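(* Let $n\ge 2$, let $\Omega\subset\mathbb R^n$ be an open set, and let $A$ be a Young function. Assume that either $n=2$, or $n\ge 3$ and $$\int^\infty\Big(\frac{t}{A(t)}\Big)^{\frac1{n-2}}\,dt<\infty .$$ Let $A_{n-1}$ be the Young function associated with $A$ and $n$ (defined in the context). Let $h:[0,\infty)\to[0,\infty)$ be a continuous, increasing function with $h(0)=0$. Let $\sigma:[0,\infty)\to[0,\infty)$ be a continuous function such that $$\int^\infty\frac{A_{n-1}(\lambda t)}{t\,\sigma(t)\,A_{n-1}(t)}\,dt=\infty\qquad\text{for every }\lambda>0 ,$$ and let $\Psi:[0,\infty)\to[0,\infty)$ be given by $\Psi(t)=\sigma(t)A_{n-1}(t)$ for $t\ge0$. Assume, in addition, that $$t\mapsto t^n\,\Psi(1/t)\quad\text{is a non-decreasing function on }(0,\infty)\text{ decaying to }0\text{ as }t\to0^+ .$$ If $$\int_0 h(s)\,d\Big(\frac{-1}{s^n\Psi(1/s)}\Big)<\infty ,$$ then every weakly monotone function $u\in W^{1,A}_{\rm loc}(\Omega)$ admits a representative whose restriction to the complement in $\Omega$ of an exceptional set of $\mathcal H^{h(\cdot)}$-measure zero is continuous.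
   Context: Young function: a convex function $A:[0,\infty)\to[0,\infty]$, non-constant in $(0,\infty)$, with $A(0)=0$. An integral $\int^\infty$ (resp. $\int_0$) with one unspecified endpoint refers only to behaviour near infinity (resp. near $0$): the missing endpoint is any sufficiently large (resp. small positive) number. The Young conjugate is $\widetilde A(t)=\sup\{st-A(s): s\ge0\}$, $t\ge0$. Function $A_{n-1}$: if $n=2$, $A_{1}=A$. If $n\ge3$, $A_{n-1}$ is the Young conjugate of the function $t\mapsto t^{\frac{n-1}{n-2}}\int_t^\infty \frac{\widetilde A(r)}{r^{1+\frac{n-1}{n-2}}}\,dr$, $t>0$ (with value $0$ at $t=0$); the integral converges exactly when $\int^\infty(t/A(t))^{1/(n-2)}dt<\infty$. It is understood that $A_{n-1}$ is finite-valued, as required for $\Psi$ to take values in $[0,\infty)$, and that $\Psi>0$ on $(0,\infty)$, so that $s\mapsto\frac{-1}{s^n\Psi(1/s)}$ is a non-decreasing function on $(0,\infty)$ and its derivative $d\big(\frac{-1}{s^n\Psi(1/s)}\big)$ is a positive (Stieltjes) measure on $(0,\infty)$. Hausdorff measure: for $E\subset\mathbb R^n$, $$\mathcal H^{h(\cdot)}(E)=\lim_{\varepsilon\to0^+}\inf\Big\{\sum_{j=1}^\infty h(\operatorname{diam}K_j):\ E\subset\bigcup_{j=1}^\infty K_j,\ \operatorname{diam}K_j\le\varepsilon\Big\}.$$ Orlicz and Orlicz–Sobolev spaces: for measurable $E\subset\mathbb R^n$, $L^A(E)$ is the space of measurable real-valued $u$ on $E$ with finite Luxemburg norm $\|u\|_{L^A(E)}=\inf\{\lambda>0:\int_E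 A(|u|/\lambda)\,dx\le1\}$. $W^{1,A}(\Omega)$ is the set of weakly differentiable $u\in L^A(\Omega)$ with $|\nabla u|\in L^A(\Omega)$; $W^{1,A}_{\rm loc}(\Omega)$ is the set of measurable $u$ with $u\in W^{1,A}(\Omega')$ for every bounded open $\Omega'\subset\subset\Omega$. Weakly monotone: $u\in W^{1,1}_{\rm loc}(\Omega)$ is weakly monotone if for every open $\Omega'\subset\subset\Omega$ and every $m,M\in\mathbb R$ with $m\le M$ and $(u-M)_+-(m-u)_+\in W^{1,1}_0(\Omega')$, one has $m\le u\le M$ a.e. in $\Omega'$ (here $_+$ denotes positive part). *)

theory Defs
  imports "HOL-Analysis.Analysis"
begin

text \<open>
  Functions on \<open>[0,\<infinity>)\<close> with values in \<open>[0,\<infinity>]\<close> have type \<^typ>\<open>real \<Rightarrow> ennreal\<close>; their values at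
  negative arguments are irrelevant and never used.
\<close>

definition young_function :: "(real \<Rightarrow> ennreal) \<Rightarrow> bool" where
  "young_function A \<longleftrightarrow>
     A 0 = 0 \<and>
     (\<forall>x\<ge>0. \<forall>y\<ge>0. \<forall>\<theta>\<in>{0..1}.
        A ((1 - \<theta>) * x + \<theta> * y) \<le> ennreal (1 - \<theta>) * A x + ennreal \<theta> * A y) \<and>
     \<not> (\<exists>c. \<forall>t>0. A t = c)"

text \<open>
  Subtraction on \<^typ>\<open>ennreal\<close> truncates at \<open>0\<close>. This does not change the supremum when \<open>A 0 = 0\<close>,
  since \<open>s = 0\<close> then contributes the value \<open>0\<close>. If \<open>A s = \<infinity>\<close> the contribution is \<open>0\<close>.
\<close>

definition young_conjugate :: "(real \<Rightarrow> ennreal) \<Rightarrow> real \<Rightarrow> ennreal" where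
  "young_conjugate A t = (SUP s\<in>{0..}. ennreal (s * t) - A s)"

text \<open>\<open>young_sub n A\<close> is the function \<open>A\<^bsub>n-1\<^esub>\<close> associated with \<open>A\<close>; only meaningful for \<open>n \<ge> 2\<close>.\<close>

definition young_sub :: "nat \<Rightarrow> (real \<Rightarrow> ennreal) \<Rightarrow> real \<Rightarrow> ennreal" where
  "young_sub n A =
     (if n = 2 then A
      else let p = (real n - 1) / (real n - 2) in
        young_conjugate (\<lambda>t. if t = 0 then 0
          else ennreal (t powr p) *
               (\<integral>\<^sup>+r\<in>{t..}. young_conjugate A r / ennreal (r powr (1 + p)) \<partial>lborel)))"

text \<open>Real powers on \<open>[0,\<infinity>]\<close>, for positive exponents.\<close>

definition ennreal_powr :: "ennreal \<Rightarrow> real \<Rightarrow> ennreal" where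
  "ennreal_powr x p = (if x = \<infinity> then \<infinity> else ennreal (enn2real x powr p))"

text \<open>
  The analogue of \<^const>\<open>interval_measure\<close> on the half-line \<open>(0,\<infinity>)\<close>; the function \<open>F\<close> may be
  unbounded near \<open>0\<close>.
\<close>

definition stieltjes_pos :: "(real \<Rightarrow> real) \<Rightarrow> real measure" where
  "stieltjes_pos F =
     extend_measure {0<..} {(a, b). 0 < a \<and> a \<le> b} (\<lambda>(a, b). {a<..b})
       (\<lambda>(a, b). ennreal (F b - F a))"

lemma emeasure_stieltjes_pos_Ioc:
  fixes F :: "real \<Rightarrow> real"
  assumes mono: "mono_on {0<..} F"
    and right: "\<And>a. 0 < a \<Longrightarrow> continuous (at_right a) F"
    and ab: "0 < a" "a \<le> b"
  shows "emeasure (stieltjes_pos F) {a<..b} = ennreal (F b - F a)"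
proof -
  define \<nu> where "\<nu> = distr (interval_measure (\<lambda>x. F (exp x))) borel exp"
  have mono': "F (exp x) \<le> F (exp y)" if "x \<le> y" for x y
    using mono that by (auto simp: mono_on_def)
  have right': "continuous (at_right x) (\<lambda>x. F (exp x))" for x
  proof -
    have "(F \<longlongrightarrow> F (exp x)) (at_right (exp x))"
      using right[of "exp x"] by (simp add: continuous_within)
    moreover have "filterlim exp (at_right (exp x)) (at_right x)"
      unfolding filterlim_at
      by (auto simp: eventually_at_filter intro!: tendsto_intros)
    ultimately show ?thesis
      unfolding continuous_within by (rule filterlim_compose)
  qed
  have \<nu>: "emeasure \<nu> {c<..d} = ennreal (F d - F c)" if "0 < c" "c \<le> d" for c d
  proof -
    have "exp -` {c<..d} = {ln c<..ln d}"
    proof (rule set_eqI)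
      fix x
      have "c < exp x \<longleftrightarrow> ln c < x"
        using that exp_less_cancel_iff[of "ln c" x] by simp
      moreover have "exp x \<le> d \<longleftrightarrow> x \<le> ln d"
        using that exp_le_cancel_iff[of x "ln d"] by simp
      ultimately show "x \<in> exp -` {c<..d} \<longleftrightarrow> x \<in> {ln c<..ln d}"
        by simp
    qed
    moreover have "emeasure (interval_measure (\<lambda>x. F (exp x))) {ln c<..ln d}
        = F (exp (ln d)) - F (exp (ln c))"
      using that by (intro emeasure_interval_measure_Ioc mono' right') auto
    ultimately show ?thesis
      using that unfolding \<nu>_def by (subst emeasure_distr) auto
  qed
  have sets: "sets (stieltjes_pos F) \<subseteq> sets \<nu>"
  proof -
    have "sets (stieltjes_pos F)
        = sigma_sets {0<..} ((\<lambda>(a, b). {a<..b}) ` {(a::real, b). 0 < a \<and> a \<le> b})"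
      unfolding stieltjes_pos_def by (subst sets_extend_measure) auto
    also have "\<dots> \<subseteq> sets borel"
      by (rule sets.sigma_sets_subset') auto
    finally show ?thesis by (simp add: \<nu>_def)
  qed
  have "countably_additive (sets (stieltjes_pos F)) (emeasure \<nu>)"
    unfolding countably_additive_def
  proof (intro allI impI)
    fix B :: "nat \<Rightarrow> real set"
    assume "range B \<subseteq> sets (stieltjes_pos F)" "disjoint_family B"
    then show "(\<Sum>i. emeasure \<nu> (B i)) = emeasure \<nu> (\<Union>i. B i)"
      using sets by (intro suminf_emeasure) auto
  qed
  then show ?thesis
    using ab
    by (intro emeasure_extend_measure_Pair[OF stieltjes_pos_def, where \<mu>' = "emeasure \<nu>"])
      (auto simp: positive_def intro: \<nu>)
qed

text \<open>
  Boundedness of the covering sets is required explicitly because \<^const>\<open>diameter\<close> is unspecified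
  for unbounded sets.
\<close>

definition hausdorff_content :: "(real \<Rightarrow> real) \<Rightarrow> real \<Rightarrow> 'a::metric_space set \<Rightarrow> ennreal" where
  "hausdorff_content h \<epsilon> E =
     (INF K\<in>{K :: nat \<Rightarrow> 'a set. E \<subseteq> (\<Union>j. K j) \<and> (\<forall>j. bounded (K j) \<and> diameter (K j) \<le> \<epsilon>)}.
        \<Sum>j. ennreal (h (diameter (K j))))"

definition hausdorff_measure :: "(real \<Rightarrow> real) \<Rightarrow> 'a::metric_space set \<Rightarrow> ennreal" where
  "hausdorff_measure h E = Lim (at_right 0) (\<lambda>\<epsilon>. hausdorff_content h \<epsilon> E)"

definition luxemburg_norm ::
    "(real \<Rightarrow> ennreal) \<Rightarrow> 'a::euclidean_space set \<Rightarrow> ('a \<Rightarrow> real) \<Rightarrow> ennreal" where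
  "luxemburg_norm A E u =
     Inf {ennreal c |c. 0 < c \<and> (\<integral>\<^sup>+x. A (\<bar>u x\<bar> / c) \<partial>lebesgue_on E) \<le> 1}"

definition orlicz :: "(real \<Rightarrow> ennreal) \<Rightarrow> 'a::euclidean_space set \<Rightarrow> ('a \<Rightarrow> real) set" where
  "orlicz A E = {u \<in> borel_measurable (lebesgue_on E). luxemburg_norm A E u < \<infinity>}"

definition partial_deriv :: "'n \<Rightarrow> (real^'n \<Rightarrow> real) \<Rightarrow> real^'n \<Rightarrow> real" where
  "partial_deriv i f x = frechet_derivative f (at x) (axis i 1)"

definition gradient :: "(real^'n \<Rightarrow> real) \<Rightarrow> real^'n \<Rightarrow> real^'n" where
  "gradient f x = (\<chi> i. partial_deriv i f x)"

primrec C_k :: "nat \<Rightarrow> (real^'n \<Rightarrow> real) \<Rightarrow> bool" where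
  "C_k 0 f \<longleftrightarrow> continuous_on UNIV f"
| "C_k (Suc k) f \<longleftrightarrow> f differentiable_on UNIV \<and> (\<forall>i. C_k k (partial_deriv i f))"

definition compactly_contained :: "'a::topological_space set \<Rightarrow> 'a set \<Rightarrow> bool" where
  "compactly_contained U \<Omega> \<longleftrightarrow> compact (closure U) \<and> closure U \<subseteq> \<Omega>"

definition test_functions :: "(real^'n) set \<Rightarrow> (real^'n \<Rightarrow> real) set" where
  "test_functions \<Omega> = {\<phi>. (\<forall>k. C_k k \<phi>) \<and> compactly_contained {x. \<phi> x \<noteq> 0} \<Omega>}"

definition locally_integrable ::
    "'a::euclidean_space set \<Rightarrow> ('a \<Rightarrow> 'b::euclidean_space) \<Rightarrow> bool" where
  "locally_integrable \<Omega> f \<longleftrightarrow> (\<forall>K. compact K \<and> K \<subseteq> \<Omega> \<longrightarrow> f absolutely_integrable_on K)"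

definition has_weak_gradient ::
    "(real^'n \<Rightarrow> real) \<Rightarrow> (real^'n \<Rightarrow> real^'n) \<Rightarrow> (real^'n) set \<Rightarrow> bool" where
  "has_weak_gradient u g \<Omega> \<longleftrightarrow>
     locally_integrable \<Omega> u \<and> locally_integrable \<Omega> g \<and>
     (\<forall>\<phi>\<in>test_functions \<Omega>. \<forall>i.
        (LINT x:\<Omega>|lebesgue. u x * partial_deriv i \<phi> x) = - (LINT x:\<Omega>|lebesgue. g x $ i * \<phi> x))"

definition orlicz_sobolev :: "(real \<Rightarrow> ennreal) \<Rightarrow> (real^'n) set \<Rightarrow> (real^'n \<Rightarrow> real) set" where
  "orlicz_sobolev A \<Omega> =
     {u \<in> orlicz A \<Omega>. \<exists>g. has_weak_gradient u g \<Omega> \<and> (\<lambda>x. norm (g x)) \<in> orlicz A \<Omega>}"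

definition orlicz_sobolev_loc :: "(real \<Rightarrow> ennreal) \<Rightarrow> (real^'n) set \<Rightarrow> (real^'n \<Rightarrow> real) set" where
  "orlicz_sobolev_loc A \<Omega> =
     {u \<in> borel_measurable (lebesgue_on \<Omega>).
        \<forall>U. open U \<and> compactly_contained U \<Omega> \<longrightarrow> u \<in> orlicz_sobolev A U}"

text \<open>
  The classical spaces \<open>W\<^sup>1\<^sup>,\<^sup>1\<close> are those given by the Young function \<open>A(t) = t\<close>, i.e. by the coercion
  \<^const>\<open>ennreal\<close>. The space \<open>W\<^sub>0\<^sup>1\<^sup>,\<^sup>1\<close> is the closure of the test functions in \<open>W\<^sup>1\<^sup>,\<^sup>1\<close>.
\<close>

definition sobolev_11_loc :: "(real^'n) set \<Rightarrow> (real^'n \<Rightarrow> real) set" where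
  "sobolev_11_loc \<Omega> = orlicz_sobolev_loc ennreal \<Omega>"

definition sobolev_11_zero :: "(real^'n) set \<Rightarrow> (real^'n \<Rightarrow> real) set" where
  "sobolev_11_zero \<Omega> =
     {w \<in> orlicz_sobolev ennreal \<Omega>. \<exists>g \<phi>.
        has_weak_gradient w g \<Omega> \<and> (\<forall>k. \<phi> k \<in> test_functions \<Omega>) \<and>
        (\<lambda>k :: nat. \<integral>\<^sup>+x. ennreal (\<bar>w x - \<phi> k x\<bar> + norm (g x - gradient (\<phi> k) x)) \<partial>lebesgue_on \<Omega>)
          \<longlonglongrightarrow> 0}"

definition weakly_monotone :: "(real^'n) set \<Rightarrow> (real^'n \<Rightarrow> real) \<Rightarrow> bool" where
  "weakly_monotone \<Omega> u \<longleftrightarrow>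
     u \<in> sobolev_11_loc \<Omega> \<and>
     (\<forall>U m M. open U \<and> compactly_contained U \<Omega> \<and> m \<le> M \<and>
        (\<lambda>x. max (u x - M) 0 - max (m - u x) 0) \<in> sobolev_11_zero U \<longrightarrow>
        (AE x in lebesgue_on U. m \<le> u x \<and> u x \<le> M))"

end

(*
  Weak monotonicity bounds the oscillation of u on a cube by its oscillation on the boundary.
  On each face, which has dimension n - 1, averaging the mean value inequality over segments and
  applying Young's inequality under the integral gives
      A_{n-1} (osc u / (K r)) <= mean of A (|grad u| / L) over the boundary of the cube;
  this passes from mollifications of u to u itself for almost every radius r.  Multiply by
  r^{n-1} eta(r) with eta(r) = 1 / (r^n Psi(1/r)) and integrate over r: if the essential
  oscillation of u at x stays above some c > 0, the left-hand side becomes the divergent integral of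
  A_{n-1}(lambda t) / (t sigma(t) A_{n-1}(t)), so the potential
      integral of A (|grad u| / L) (y) eta(|y - x|) dy
  is infinite at x.  As eta decreases, this potential is a superposition of energies of balls
  centred at x with respect to d(-eta), and comparison with the integral of h shows that an infinite
  potential forces the energy of the ball of radius comparable to s around x to exceed any multiple
  of h(s) at arbitrarily small dyadic scales s.  Since the total energy is finite, Vitali's covering
  lemma shows that such points x form a set of vanishing H^h-measure.
*)
theory Submission
  imports Defs "HOL-Computational_Algebra.Polynomial"
begin

section \<open>Young functions\<close>

text \<open>No doubling condition is available for \<open>A\<close> or \<open>h\<close>, and this
  shapes the argument. The energy enters only through Young's inequality
  \<open>t * norm g \<le> f + young_conjugate A (L * t)\<close> for all \<open>t\<close>. It is
  linear in \<open>g\<close> and \<open>f\<close>, so it survives mollification without composing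
  \<open>A\<close> with averages. On a face of dimension d = n - 1 >= 2 the averaged mean value
  inequality has a kernel of size |w - p|^(1 - d). Using Young's inequality with a parameter
  comparable to l 2^(k (d - 1)) in the k-th dyadic shell around p leaves a sum of terms 2^(-k d)
  \<open>young_conjugate A\<close> (l 2^(k (d - 1))). This is a Riemann sum for l^p times the
  integral of \<open>young_conjugate A\<close> r / r^(1 + p) over r > l, with p = d / (d - 1), and
  the conjugate of that function of l is A_{n-1}. The mollified functions have errors 2^(-k), whose
  sum is finite, so their boundary integrals converge for almost every radius. \<open>h\<close> is
  evaluated at half the dyadic scale both in the Stieltjes sum and in the coverings, so its values
  at different scales are compared by monotonicity only.\<close>

lemma borel_measurable_mono_ennreal:
  fixes f :: "real \<Rightarrow> ennreal"
  assumes "mono f"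
  shows "f \<in> borel_measurable borel"
proof (rule borel_measurableI_less)
  fix y
  have "is_interval {x \<in> space borel. f x < y}"
    using assms by (auto simp: is_interval_1 mono_def intro: le_less_trans)
  then show "{x \<in> space borel. f x < y} \<in> sets borel"
    by (rule real_interval_borel_measurable)
qed

lemma young_function_mono:
  assumes A: "young_function A" and "0 \<le> x" "x \<le> y"
  shows "A x \<le> A y"
proof (cases "y = 0")
  case True
  then show ?thesis using assms by simp
next
  case False
  then have y: "y > 0" using assms by simp
  define \<theta> where "\<theta> = x / y"
  have \<theta>: "\<theta> \<in> {0..1}" using assms y by (simp add: \<theta>_def)
  have "A ((1 - \<theta>) * 0 + \<theta> * y) \<le> ennreal (1 - \<theta>) * A 0 + ennreal \<theta> * A y"
    using A \<theta> y unfolding young_function_def by (meson less_imp_le order_refl)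
  also have "\<dots> = ennreal \<theta> * A y"
    using A by (simp add: young_function_def)
  also have "\<dots> \<le> 1 * A y"
    using \<theta> by (intro mult_right_mono) (auto simp: ennreal_le_1)
  finally show ?thesis using y by (simp add: \<theta>_def)
qed

lemma young_function_measurable:
  assumes "young_function A"
  shows "(\<lambda>x. A (max 0 x)) \<in> borel_measurable borel"
  using young_function_mono[OF assms] by (intro borel_measurable_mono_ennreal monoI) auto

lemma young_conjugate_mono: "t \<le> t' \<Longrightarrow> young_conjugate A t \<le> young_conjugate A t'"
  unfolding young_conjugate_def
  by (intro SUP_mono) (auto intro!: ennreal_minus_mono ennreal_leI mult_left_mono)

lemma young_conjugate_measurable [measurable]: "young_conjugate A \<in> borel_measurable borel"
  by (intro borel_measurable_mono_ennreal monoI young_conjugate_mono)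

lemma young_ineq:
  assumes "0 \<le> s"
  shows "ennreal (s * t) \<le> A s + young_conjugate A t"
proof -
  have "ennreal (s * t) - A s \<le> young_conjugate A t"
    unfolding young_conjugate_def using assms by (intro SUP_upper) auto
  then show ?thesis by (auto simp: ennreal_minus_le_iff)
qed

text \<open>Fenchel-Moreau for finite Young functions. It serves n = 2, where A_{n-1} is
  \<open>A\<close> itself and not by definition a conjugate, whereas all oscillation estimates are
  obtained as upper bounds for conjugates.\<close>

lemma young_biconjugate:
  assumes A: "young_function A" and fin: "\<And>t. 0 \<le> t \<Longrightarrow> A t < \<infinity>" and t: "0 \<le> t"
  shows "young_conjugate (young_conjugate A) t = A t"
proof (rule antisym)
  show "young_conjugate (young_conjugate A) t \<le> A t"
    unfolding young_conjugate_def[of "young_conjugate A"]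
    using young_ineq[OF t, where A = A]
    by (intro SUP_least) (auto simp: ennreal_minus_le_iff mult.commute add.commute)
next
  define a where "a = (\<lambda>t. enn2real (A t))"
  have Aa: "A s = ennreal (a s)" if "0 \<le> s" for s
    using fin[OF that] by (simp add: a_def)
  have a0: "0 \<le> a s" for s by (simp add: a_def)
  have a00: "a 0 = 0" using A by (simp add: a_def young_function_def)
  show "A t \<le> young_conjugate (young_conjugate A) t"
  proof (cases "t = 0")
    case True
    then show ?thesis using A by (simp add: young_function_def)
  next
    case False
    then have t: "t > 0" using t by simp
    have "convex_on {0..} a"
    proof (rule convex_onI)
      fix \<theta> x y :: real assume \<theta>: "0 < \<theta>" "\<theta> < 1" and xy: "x \<in> {0..}" "y \<in> {0..}"
      have p: "0 \<le> (1 - \<theta>) * x + \<theta> * y" using \<theta> xy by auto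
      have "A ((1 - \<theta>) * x + \<theta> * y) \<le> ennreal (1 - \<theta>) * A x + ennreal \<theta> * A y"
        using A \<theta> xy unfolding young_function_def by auto
      then have "ennreal (a ((1 - \<theta>) * x + \<theta> * y)) \<le> ennreal ((1 - \<theta>) * a x + \<theta> * a y)"
        using \<theta> xy p a0 by (simp add: Aa ennreal_mult' ennreal_plus)
      moreover have "0 \<le> (1 - \<theta>) * a x + \<theta> * a y" using \<theta> a0 by simp
      ultimately show "a ((1 - \<theta>) *\<^sub>R x + \<theta> *\<^sub>R y) \<le> (1 - \<theta>) * a x + \<theta> * a y"
        by (simp add: ennreal_le_iff)
    qed simp
    \<comment> \<open>\<open>l\<close> is the slope of a supporting line of \<open>a\<close> at the
      interior point \<open>t\<close>. The supremum defining \<open>young_conjugate A l\<close> is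
      attained at \<open>t\<close>, so testing the biconjugate with \<open>l\<close> recovers
      \<open>A t\<close>.\<close>
    then obtain l where l: "\<And>s. s \<in> {0..} \<Longrightarrow> a s \<ge> a t + l * (s - t)"
      using convex_le_Inf_differential[of "{0..}" a t] t by (auto simp: interior_real_atLeast)
    have lt: "l * t \<ge> a t" using l[of 0] a00 by simp
    then have l0: "l \<ge> 0" using t a0[of t] by (metis order_trans zero_le_mult_iff not_le order.strict_iff_order)
    have "young_conjugate A l \<le> ennreal (l * t - a t)"
      unfolding young_conjugate_def
    proof (rule SUP_least)
      fix s :: real assume s: "s \<in> {0..}"
      have "ennreal (s * l) - A s = ennreal (s * l - a s)"
        using s a0 l0 by (simp add: Aa ennreal_minus)
      also have "\<dots> \<le> ennreal (l * t - a t)"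
        using l[OF s] by (intro ennreal_leI) (simp add: algebra_simps)
      finally show "ennreal (s * l) - A s \<le> ennreal (l * t - a t)" .
    qed
    then have "ennreal (l * t) - ennreal (l * t - a t) \<le> ennreal (l * t) - young_conjugate A l"
      by (intro ennreal_minus_mono) auto
    moreover have "ennreal (l * t) - ennreal (l * t - a t) = A t"
      using lt a0 t by (simp add: ennreal_minus Aa)
    ultimately show ?thesis
      using l0 unfolding young_conjugate_def[of "young_conjugate A"]
      by (auto intro!: SUP_upper2[of l])
  qed
qed

text \<open>A supremum of functions affine in \<open>t\<close> is convex. The truncated difference
  lies above the real one, and this is all that the bound \<open>le\<close> takes from it.\<close>

lemma convex_on_young_conjugate:
  assumes fin: "\<And>t. 0 < t \<Longrightarrow> young_conjugate B t < \<infinity>"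
  shows "convex_on {0<..} (\<lambda>t. enn2real (young_conjugate B t))"
proof (rule convex_onI)
  fix \<theta> x y :: real assume \<theta>: "0 < \<theta>" "\<theta> < 1" and xy: "x \<in> {0<..}" "y \<in> {0<..}"
  define z where "z = (1 - \<theta>) * x + \<theta> * y"
  have zpos: "0 < z" using \<theta> xy by (auto simp: z_def intro!: add_pos_pos)
  define N where "N = (\<lambda>t. enn2real (young_conjugate B t))"
  have N: "young_conjugate B t = ennreal (N t)" if "0 < t" for t
    using fin[OF that] by (simp add: N_def)
  have N0: "0 \<le> N t" for t by (simp add: N_def)
  have "young_conjugate B z \<le> ennreal ((1 - \<theta>) * N x + \<theta> * N y)"
    unfolding young_conjugate_def[of B z]
  proof (rule SUP_least)
    fix s :: real assume "s \<in> {0..}"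
    then have s: "0 \<le> s" by simp
    show "ennreal (s * z) - B s \<le> ennreal ((1 - \<theta>) * N x + \<theta> * N y)"
    proof (cases "B s")
      case top
      then show ?thesis by simp
    next
      case (real b)
      have le: "s * t - b \<le> N t" if "0 < t" for t
      proof -
        have "ennreal (s * t) - B s \<le> ennreal (N t)"
          unfolding N[OF that, symmetric] young_conjugate_def using s by (intro SUP_upper) auto
        then show ?thesis using real N0[of t] s that
          by (auto simp: ennreal_minus ennreal_le_iff2)
      qed
      have "s * z - b = (1 - \<theta>) * (s * x - b) + \<theta> * (s * y - b)"
        by (simp add: z_def algebra_simps)
      also have "\<dots> \<le> (1 - \<theta>) * N x + \<theta> * N y"
        using \<theta> xy le by (intro add_mono mult_left_mono) auto
      finally show ?thesis using real by (simp add: ennreal_minus ennreal_leI)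
    qed
  qed
  then have "N z \<le> (1 - \<theta>) * N x + \<theta> * N y"
    unfolding N[OF zpos] using \<theta> N0 by (subst (asm) ennreal_le_iff) auto
  then show "enn2real (young_conjugate B ((1 - \<theta>) *\<^sub>R x + \<theta> *\<^sub>R y))
      \<le> (1 - \<theta>) * enn2real (young_conjugate B x) + \<theta> * enn2real (young_conjugate B y)"
    by (simp add: N_def z_def)
qed simp

text \<open>Continuity of A_{n-1} on the open half-line makes \<Psi> and the weight 1 / (r^n
  \<Psi>(1/r)) continuous. This gives the right-continuity behind the Stieltjes measure and the
  measurability used in the substitution t = 1/r.\<close>

lemma continuous_on_young_conjugate:
  assumes "\<And>t. 0 < t \<Longrightarrow> young_conjugate B t < \<infinity>"
  shows "continuous_on {0<..} (\<lambda>t. enn2real (young_conjugate B t))"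
  using convex_on_young_conjugate[OF assms] by (intro convex_on_continuous) auto

text \<open>The function whose Young conjugate is \<open>A\<^bsub>n-1\<^esub>\<close>, also in the case \<open>n = 2\<close>.\<close>

definition young_pre :: "nat \<Rightarrow> (real \<Rightarrow> ennreal) \<Rightarrow> real \<Rightarrow> ennreal" where
  "young_pre n A =
     (if n = 2 then young_conjugate A
      else let p = (real n - 1) / (real n - 2) in
        (\<lambda>t. if t = 0 then 0
          else ennreal (t powr p) *
               (\<integral>\<^sup>+r\<in>{t..}. young_conjugate A r / ennreal (r powr (1 + p)) \<partial>lborel)))"

lemma young_sub_eq_conjugate:
  assumes "young_function A" and "\<And>t. 0 \<le> t \<Longrightarrow> young_sub n A t < \<infinity>" and "0 \<le> t"
  shows "young_sub n A t = young_conjugate (young_pre n A) t"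
proof (cases "n = 2")
  case True
  then show ?thesis
    using young_biconjugate[of A t] assms by (simp add: young_sub_def young_pre_def)
next
  case False
  then show ?thesis by (simp add: young_sub_def young_pre_def Let_def)
qed

text \<open>Dividing the hypothesis by \<open>c\<close> and taking the supremum over
  \<open>l\<close> moves a constant in front of \<open>B\<close> into the argument of its conjugate;
  \<open>c \<ge> 1\<close> lets \<open>X\<close> absorb the factor 1/c.\<close>

lemma young_conjugate_leI:
  assumes c: "c \<ge> 1" and le: "\<And>l. 0 < l \<Longrightarrow> ennreal (l * s) \<le> X + ennreal c * B l" and s: "0 \<le> s"
  shows "young_conjugate B (s / c) \<le> X"
  unfolding young_conjugate_def
proof (rule SUP_least)
  fix l :: real assume "l \<in> {0..}"
  show "ennreal (l * (s / c)) - B l \<le> X"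
  proof (cases "l = 0 \<or> B l = top")
    case True
    then show ?thesis by auto
  next
    case False
    then have l: "0 < l" using \<open>l \<in> {0..}\<close> by auto
    have "ennreal (l * (s / c)) = ennreal (1 / c) * ennreal (l * s)"
      using c l s by (simp add: ennreal_mult[symmetric] field_simps)
    also have "\<dots> \<le> ennreal (1 / c) * (X + ennreal c * B l)"
      by (intro mult_left_mono le l) auto
    also have "\<dots> = ennreal (1 / c) * X + B l"
    proof -
      have "ennreal (1 / c) * (ennreal c * B l) = B l"
        using c by (simp add: mult.assoc[symmetric] ennreal_mult[symmetric])
      then show ?thesis by (simp add: distrib_left)
    qed
    also have "\<dots> \<le> 1 * X + B l"
      using c by (intro add_right_mono mult_right_mono) (auto simp: ennreal_le_1)
    finally show ?thesis using False by (simp add: ennreal_minus_le_iff add.commute)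
  qed
qed

text \<open>Compare with the integral block by block, from \<open>a (Suc k)\<close> to
  \<open>a (Suc (Suc k))\<close>: there \<open>young_conjugate A\<close> is at least its left value,
  the weight 1 / r^(1 + p) is at least its right value, and the length is at least half of the right
  end. Since (d - 1) p = d, the ratio 2^(d - 1) of consecutive blocks turns into the weight 2^(-k
  d).\<close>

lemma dyadic_sum_le_young_pre:
  assumes d: "2 \<le> d" and n: "n = Suc d" and l: "0 < l"
  shows "(\<Sum>k. ennreal ((2 * (1/2) ^ k) ^ d) * young_conjugate A (l * 2 ^ ((k + 1) * (d - 1))))
    \<le> ennreal (2 ^ (4 * d)) * young_pre n A l"
proof -
  define p where "p = real d / (real d - 1)"
  have p: "p > 0" "(real d - 1) * p = real d" using d by (auto simp: p_def)
  have pre: "young_pre n A l = ennreal (l powr p) *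
      (\<integral>\<^sup>+r\<in>{l..}. young_conjugate A r / ennreal (r powr (1 + p)) \<partial>lborel)"
    using d n l by (simp add: young_pre_def p_def Let_def)
  define a where "a = (\<lambda>k::nat. l * 2 ^ (k * (d - 1)))"
  have a0: "a k > 0" for k using l by (simp add: a_def)
  have aSuc: "a (Suc k) = 2 ^ (d - 1) * a k" for k by (simp add: a_def power_add)
  have d1: "(2::real) \<le> 2 ^ (d - 1)"
    using d power_increasing[of 1 "d - 1" "2::real"] by simp
  have amono: "a k \<le> a m" if "k \<le> m" for k m
    using l that by (simp add: a_def power_increasing)
  define I where "I = (\<lambda>k. {a (Suc k)..<a (Suc (Suc k))})"
  have "disjoint_family I"
    unfolding disjoint_family_on_def
  proof (intro ballI impI)
    fix m k :: nat assume "m \<noteq> k"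
    then have "Suc m \<le> k \<or> Suc k \<le> m" by auto
    then show "I m \<inter> I k = {}"
      using amono[of "Suc (Suc m)" "Suc k"] amono[of "Suc (Suc k)" "Suc m"] by (auto simp: I_def)
  qed
  define f where "f = (\<lambda>r. young_conjugate A r / ennreal (r powr (1 + p)))"
  have [measurable]: "f \<in> borel_measurable borel" unfolding f_def by measurable
  have [measurable]: "I k \<in> sets borel" for k by (simp add: I_def)
  have sub: "(\<Union>k. I k) \<subseteq> {l..}"
  proof (intro UN_least subsetI)
    fix k x assume "x \<in> I k"
    then show "x \<in> {l..}"
      using amono[of 0 "Suc k"] by (auto simp: I_def) (simp add: a_def)
  qed
  have piece: "ennreal ((2 * (1/2) ^ k) ^ d) * young_conjugate A (a (Suc k))
      \<le> ennreal (2 ^ (4 * d)) * (ennreal (l powr p) * (\<integral>\<^sup>+r\<in>I k. f r \<partial>lborel))" for k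
  proof -
    define b where "b = a (Suc (Suc k))"
    have b: "b > 0" using a0 by (simp add: b_def)
    have len: "b - a (Suc k) \<ge> b / 2"
      using d1 a0[of "Suc k"] mult_right_mono[OF d1, of "a (Suc k)"] by (simp add: b_def aSuc[of "Suc k"])
    have ab: "a (Suc k) \<le> b" using amono by (simp add: b_def)
    have bp: "b powr p = l powr p * 2 ^ ((k + 2) * d)"
    proof -
      have "b = l * 2 powr (real (k + 2) * (real d - 1))"
        using d by (simp add: b_def a_def powr_realpow[symmetric] of_nat_diff algebra_simps)
      then have "b powr p = l powr p * 2 powr (real (k + 2) * ((real d - 1) * p))"
        using l by (simp add: powr_mult powr_powr mult.assoc)
      also have "2 powr (real (k + 2) * ((real d - 1) * p)) = 2 powr real ((k + 2) * d)"
        using p by (simp add: distrib_right)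
      also have "\<dots> = 2 ^ ((k + 2) * d)" by (rule powr_realpow) simp
      finally show ?thesis .
    qed
    have "ennreal (1 / (b powr (1 + p))) * ennreal (b - a (Suc k)) * young_conjugate A (a (Suc k))
       = (\<integral>\<^sup>+r. young_conjugate A (a (Suc k)) * ennreal (1 / (b powr (1 + p))) * indicator (I k) r \<partial>lborel)"
      using ab by (subst nn_integral_cmult_indicator) (auto simp: I_def b_def[symmetric] mult_ac)
    also have "\<dots> \<le> (\<integral>\<^sup>+r\<in>I k. f r \<partial>lborel)"
    proof (intro nn_integral_mono)
      fix r
      show "young_conjugate A (a (Suc k)) * ennreal (1 / (b powr (1 + p))) * indicator (I k) r
          \<le> f r * indicator (I k) r"
      proof (cases "r \<in> I k")
        case True
        then have r: "a (Suc k) \<le> r" "r \<le> b" by (auto simp: I_def b_def)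
        then have r0: "0 < r" using a0[of "Suc k"] by linarith
        have "1 / (b powr (1 + p)) \<le> 1 / (r powr (1 + p))"
          using r r0 b p by (intro divide_left_mono powr_mono2) auto
        then have "ennreal (1 / (b powr (1 + p))) \<le> inverse (ennreal (r powr (1 + p)))"
          using r0 by (subst inverse_ennreal) (auto simp: inverse_eq_divide intro: ennreal_leI)
        then show ?thesis
          using True young_conjugate_mono[OF r(1), of A]
          by (auto simp: f_def divide_ennreal_def intro!: mult_mono)
      qed simp
    qed
    finally have le: "ennreal (1 / (b powr (1 + p))) * ennreal (b - a (Suc k)) * young_conjugate A (a (Suc k))
       \<le> (\<integral>\<^sup>+r\<in>I k. f r \<partial>lborel)" .
    have "2 ^ (4 * d) * (l powr p) * (1 / (b powr (1 + p)) * (b - a (Suc k)))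
        \<ge> 2 ^ (4 * d) * (l powr p) * (1 / (b powr (1 + p)) * (b / 2))"
      using len l b by (intro mult_left_mono) auto
    also have "2 ^ (4 * d) * (l powr p) * (1 / (b powr (1 + p)) * (b / 2)) = 2 ^ (4 * d) * (l powr p) / (2 * b powr p)"
      using b by (simp add: powr_add field_simps)
    also have "\<dots> = 2 ^ (4 * d) / (2 * 2 ^ ((k + 2) * d))"
      using l by (simp add: bp)
    \<comment> \<open>The factors of 2 multiply to 2^(3 d + 1): 2^d from the weight, 2 from the
      length being only half of \<open>b\<close>, and 2^(2 d) from the shift by two blocks in
      \<open>bp\<close>. This is at most 2^(4 d).\<close>
    also have "\<dots> \<ge> (2 * (1/2) ^ k) ^ d"
    proof -
      have "(2::real) ^ 1 \<le> 2 ^ d" using d by (intro power_increasing) auto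
      then have "2 * (2 ^ d * 2 ^ (2 * d)) \<le> 2 ^ d * (2 ^ d * 2 ^ (2 * d) :: real)"
        by (intro mult_right_mono) auto
      also have "\<dots> = 2 ^ (d + (d + 2 * d))" by (simp only: power_add)
      also have "d + (d + 2 * d) = 4 * d" by simp
      finally have le: "2 * (2 ^ d * 2 ^ (2 * d)) \<le> (2::real) ^ (4 * d)" .
      have one: "((1/2) ^ k) ^ d * 2 ^ (k * d) = (1::real)"
        by (simp add: power_mult power_mult_distrib[symmetric])
      have "(2 * (1/2) ^ k) ^ d * (2 * 2 ^ ((k + 2) * d))
          = 2 * (2 ^ d * 2 ^ (2 * d)) * (((1/2) ^ k) ^ d * 2 ^ (k * d) :: real)"
        unfolding add_mult_distrib power_mult_distrib power_add by (simp only: mult_ac)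
      then have "(2 * (1/2) ^ k) ^ d * (2 * 2 ^ ((k + 2) * d)) \<le> (2::real) ^ (4 * d)"
        using le by (simp only: one mult_1_right)
      then show ?thesis by (simp add: field_simps)
    qed
    finally have "(2 * (1/2) ^ k) ^ d \<le> 2 ^ (4 * d) * (l powr p) * (1 / (b powr (1 + p)) * (b - a (Suc k)))" .
    then have "ennreal ((2 * (1/2) ^ k) ^ d) * young_conjugate A (a (Suc k))
        \<le> ennreal (2 ^ (4 * d) * (l powr p) * (1 / (b powr (1 + p)) * (b - a (Suc k)))) * young_conjugate A (a (Suc k))"
      by (intro mult_right_mono ennreal_leI) auto
    also have "\<dots> = ennreal (2 ^ (4 * d)) * (ennreal (l powr p) * (ennreal (1 / (b powr (1 + p))) * ennreal (b - a (Suc k)) * young_conjugate A (a (Suc k))))"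
    proof -
      have e: "ennreal (x1 * x2 * (x3 * x4)) = ennreal x1 * ennreal x2 * (ennreal x3 * ennreal x4)"
        if "0 \<le> x1" "0 \<le> x2" "0 \<le> x3" "0 \<le> x4" for x1 x2 x3 x4 :: real
        using that by (simp add: ennreal_mult)
      show ?thesis using ab by (subst e) (auto simp: mult_ac)
    qed
    also have "\<dots> \<le> ennreal (2 ^ (4 * d)) * (ennreal (l powr p) * (\<integral>\<^sup>+r\<in>I k. f r \<partial>lborel))"
      by (intro mult_left_mono le) auto
    finally show ?thesis .
  qed
  have "(\<Sum>k. ennreal ((2 * (1/2) ^ k) ^ d) * young_conjugate A (l * 2 ^ ((k + 1) * (d - 1))))
      \<le> (\<Sum>k. ennreal (2 ^ (4 * d)) * (ennreal (l powr p) * (\<integral>\<^sup>+r\<in>I k. f r \<partial>lborel)))"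
    using piece by (intro suminf_le) (auto simp: a_def)
  also have "\<dots> = ennreal (2 ^ (4 * d)) * (ennreal (l powr p) * (\<Sum>k. \<integral>\<^sup>+r\<in>I k. f r \<partial>lborel))"
    by simp
  also have "(\<Sum>k. \<integral>\<^sup>+r\<in>I k. f r \<partial>lborel) = (\<integral>\<^sup>+r\<in>(\<Union>k. I k). f r \<partial>lborel)"
    using \<open>disjoint_family I\<close> by (intro nn_integral_disjoint_family[symmetric]) auto
  also have "\<dots> \<le> (\<integral>\<^sup>+r\<in>{l..}. f r \<partial>lborel)"
    using sub by (intro nn_integral_mono) (auto split: split_indicator)
  finally show ?thesis by (simp add: pre f_def mult_left_mono)
qed

section \<open>Sets of vanishing Hausdorff measure\<close>

lemma hausdorff_measure_eq_0I:
  assumes "\<And>\<epsilon>. 0 < \<epsilon> \<Longrightarrow> hausdorff_content h \<epsilon> N = 0"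
  shows "hausdorff_measure h N = 0"
proof -
  have "((\<lambda>\<epsilon>. hausdorff_content h \<epsilon> N) \<longlongrightarrow> 0) (at_right 0)"
    by (rule tendsto_eventually) (auto simp: eventually_at_right_less eventually_at_filter assms)
  then show ?thesis
    unfolding hausdorff_measure_def by (intro tendsto_Lim) auto
qed

lemma hausdorff_content_le_countable:
  fixes K :: "'i \<Rightarrow> 'a::metric_space set"
  assumes I: "countable I" and cov: "E \<subseteq> (\<Union>i\<in>I. K i)"
    and K: "\<And>i. i \<in> I \<Longrightarrow> bounded (K i)" "\<And>i. i \<in> I \<Longrightarrow> diameter (K i) \<le> \<epsilon>"
    and h0: "h 0 = 0" and \<epsilon>: "0 \<le> \<epsilon>"
  shows "hausdorff_content h \<epsilon> E \<le> (\<integral>\<^sup>+i. ennreal (h (diameter (K i))) \<partial>count_space I)"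
proof -
  define g where "g = to_nat_on I"
  have g: "inj_on g I" using I by (simp add: g_def inj_on_to_nat_on)
  \<comment> \<open>Indices outside the range of \<open>g\<close> receive the empty set; its
    diameter is 0, so \<open>h 0 = 0\<close> makes the padding cost nothing.\<close>
  define L where "L = (\<lambda>j. if j \<in> g ` I then K (inv_into I g j) else {})"
  have Lg: "L (g i) = K i" if "i \<in> I" for i
    using that g by (simp add: L_def)
  have "E \<subseteq> (\<Union>j. L j)" using cov Lg by blast
  moreover have "bounded (L j) \<and> diameter (L j) \<le> \<epsilon>" for j
    using K \<epsilon> inv_into_into[of j g I] by (auto simp: L_def diameter_empty)
  ultimately have "hausdorff_content h \<epsilon> E \<le> (\<Sum>j. ennreal (h (diameter (L j))))"
    unfolding hausdorff_content_def by (intro INF_lower) auto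
  also have "\<dots> = (\<integral>\<^sup>+j. ennreal (h (diameter (L j))) \<partial>count_space UNIV)"
    by (simp add: nn_integral_count_space_nat)
  also have "\<dots> = (\<integral>\<^sup>+j. ennreal (h (diameter (L j))) * indicator (g ` I) j \<partial>count_space UNIV)"
    by (intro nn_integral_cong) (auto simp: L_def h0 split: split_indicator)
  also have "\<dots> = (\<integral>\<^sup>+j. ennreal (h (diameter (L j))) \<partial>count_space (g ` I))"
    by (simp add: nn_integral_count_space_indicator)
  also have "\<dots> = (\<integral>\<^sup>+i. ennreal (h (diameter (L (g i)))) \<partial>count_space I)"
    using g by (intro nn_integral_bij_count_space[symmetric] inj_on_imp_bij_betw)
  also have "\<dots> = (\<integral>\<^sup>+i. ennreal (h (diameter (K i))) \<partial>count_space I)"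
    by (intro nn_integral_cong) (simp add: Lg)
  finally show ?thesis .
qed

text \<open>Near-optimal covers of cost below e / 2^(i + 1) are merged through the pairing
  bijection. The scale \<epsilon> stays fixed throughout.\<close>

lemma hausdorff_content_UN_eq_0:
  fixes N :: "nat \<Rightarrow> 'a::metric_space set"
  assumes zero: "\<And>i. hausdorff_content h \<epsilon> (N i) = 0"
  shows "hausdorff_content h \<epsilon> (\<Union>i. N i) = 0"
proof -
  have "hausdorff_content h \<epsilon> (\<Union>i. N i) \<le> 0 + ennreal e" if e: "0 < e" for e
  proof -
    have "\<exists>K. (N i \<subseteq> (\<Union>j. K j) \<and> (\<forall>j. bounded (K j) \<and> diameter (K j) \<le> \<epsilon>)) \<and>
        (\<Sum>j::nat. ennreal (h (diameter (K j)))) < ennreal (e * (1/2) ^ Suc i)" for i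
    proof -
      have "hausdorff_content h \<epsilon> (N i) < ennreal (e * (1/2) ^ Suc i)"
        using e zero by simp
      then show ?thesis unfolding hausdorff_content_def INF_less_iff by auto
    qed
    then obtain K where K: "\<And>i. N i \<subseteq> (\<Union>j. K i j)"
        "\<And>i j. bounded (K i j)" "\<And>i j. diameter (K i j) \<le> \<epsilon>"
        "\<And>i. (\<Sum>j::nat. ennreal (h (diameter (K i j)))) < ennreal (e * (1/2) ^ Suc i)"
      by metis
    define L where "L = (\<lambda>m. case prod_decode m of (i, j) \<Rightarrow> K i j)"
    have "(\<Union>i. N i) \<subseteq> (\<Union>m. L m)"
    proof
      fix x assume "x \<in> (\<Union>i. N i)"
      then obtain i j where "x \<in> K i j" using K(1) by blast
      then have "x \<in> L (prod_encode (i, j))" by (simp add: L_def)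
      then show "x \<in> (\<Union>m. L m)" by blast
    qed
    then have "hausdorff_content h \<epsilon> (\<Union>i. N i) \<le> (\<Sum>m. ennreal (h (diameter (L m))))"
      unfolding hausdorff_content_def using K
      by (intro INF_lower) (auto simp: L_def split: prod.split)
    also have "\<dots> = (\<integral>\<^sup>+m. ennreal (h (diameter (L m))) \<partial>count_space UNIV)"
      by (simp add: nn_integral_count_space_nat)
    also have "\<dots> = (\<integral>\<^sup>+m. (\<lambda>(i, j). ennreal (h (diameter (K i j)))) (prod_decode m) \<partial>count_space UNIV)"
      by (intro nn_integral_cong) (simp add: L_def split: prod.split)
    also have "\<dots> = (\<integral>\<^sup>+q. (\<lambda>(i, j). ennreal (h (diameter (K i j)))) q \<partial>count_space UNIV)"
      by (intro nn_integral_bij_count_space bij_prod_decode)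
    also have "\<dots> = (\<integral>\<^sup>+i. \<integral>\<^sup>+j. ennreal (h (diameter (K i j))) \<partial>count_space UNIV \<partial>count_space UNIV)"
      by (simp add: nn_integral_fst_count_space[symmetric])
    also have "\<dots> = (\<Sum>i. \<Sum>j. ennreal (h (diameter (K i j))))"
      by (simp add: nn_integral_count_space_nat)
    also have "\<dots> \<le> (\<Sum>i. ennreal (e * (1/2) ^ Suc i))"
      using K(4) by (intro suminf_le less_imp_le) auto
    also have "\<dots> = ennreal e"
    proof -
      have "(\<lambda>i. e * (1/2) ^ Suc i) sums (e * 1)"
        by (intro sums_mult power_half_series)
      moreover have "0 \<le> e * (1/2) ^ Suc i" for i using e by (intro mult_nonneg_nonneg) simp_all
      ultimately show ?thesis unfolding mult_1_right by (rule suminf_ennreal_eq[rotated])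
    qed
    finally show ?thesis by simp
  qed
  then have "hausdorff_content h \<epsilon> (\<Union>i. N i) \<le> 0"
    by (rule ennreal_le_epsilon)
  then show ?thesis by simp
qed

text \<open>
  The balls of the Vitali cover are subdivided into a fixed number of sets of diameter
  at most half the dyadic scale, so that no doubling property of \<open>h\<close> is needed.
\<close>

lemma hausdorff_content_eq_0_of_density:
  fixes \<mu> :: "'a::euclidean_space measure" and a :: real
  assumes sets: "sets \<mu> = sets borel" and fin: "emeasure \<mu> UNIV < \<infinity>" and a: "0 < a"
    and h0: "h 0 = 0" and \<epsilon>: "0 < \<epsilon>"
    and dens: "\<And>x C J. x \<in> N \<Longrightarrow>
      \<exists>j\<ge>J. ennreal (C * h ((1/2) ^ Suc j)) < emeasure \<mu> (cball x (a * (1/2) ^ j))"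
  shows "hausdorff_content h \<epsilon> N = 0"
proof -
  \<comment> \<open>In units of the local scale, \<open>5 * a\<close> is the radius of the enlarged
    balls in Vitali's lemma. Balls of radius 1/4 become sets of diameter half a dyadic scale after
    rescaling, and their number does not depend on the point or on the scale.\<close>
  obtain T :: "'a set" where T: "finite T" "cball 0 (5 * a) \<subseteq> (\<Union>t\<in>T. ball t (1/4))"
  proof (rule compactE_image[of "cball (0::'a) (5 * a)" "cball 0 (5 * a)" "\<lambda>t. ball t (1/4)"])
    show "cball 0 (5 * a) \<subseteq> (\<Union>t\<in>cball (0::'a) (5 * a). ball t (1/4))"
    proof
      fix x :: 'a assume "x \<in> cball 0 (5 * a)"
      moreover have "x \<in> ball x (1/4)" by simp
      ultimately show "x \<in> (\<Union>t\<in>cball (0::'a) (5 * a). ball t (1/4))" by (rule UN_I)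
    qed
  qed (use that in auto)
  obtain J :: nat where J: "(1/2) ^ J < \<epsilon>"
    using real_arch_pow_inv[OF \<epsilon>, of "1/2"] by auto
  have bound: "hausdorff_content h \<epsilon> N \<le> ennreal (real (card T) / C) * emeasure \<mu> UNIV" if C: "0 < C" for C
  proof -
    obtain jf where jf: "\<And>x. x \<in> N \<Longrightarrow> J \<le> jf x"
        "\<And>x. x \<in> N \<Longrightarrow> ennreal (C * h ((1/2) ^ Suc (jf x))) < emeasure \<mu> (cball x (a * (1/2) ^ (jf x)))"
      using dens[of _ J C] by metis
    define s where "s = (\<lambda>x. (1/2::real) ^ jf x)"
    have s: "0 < s x" "s x \<le> 1" for x by (auto simp: s_def power_le_one)
    obtain D where D: "countable D" "D \<subseteq> N"
        "pairwise (\<lambda>i j. disjnt (cball i (a * s i)) (cball j (a * s j))) D"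
        "N \<subseteq> (\<Union>i\<in>D. cball i (5 * (a * s i)))"
    proof (rule Vitali_covering_lemma_cballs[where S = N and K = N and a = "\<lambda>x. x" and r = "\<lambda>x. a * s x" and B = a])
      show "N \<subseteq> (\<Union>i\<in>N. cball i (a * s i))"
      proof
        fix x assume "x \<in> N"
        moreover have "x \<in> cball x (a * s x)" using s[of x] a by (simp add: less_imp_le)
        ultimately show "x \<in> (\<Union>i\<in>N. cball i (a * s i))" by (rule UN_I)
      qed
      show "0 < a * s i \<and> a * s i \<le> a" if "i \<in> N" for i
        using s a by (simp add: mult_left_le)
    qed (use that in auto)
    define K where "K = (\<lambda>(x, t). cball (x + s x *\<^sub>R t) (s x / 4))"
    have cov: "N \<subseteq> (\<Union>q\<in>D \<times> T. K q)"
    proof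
      fix y assume "y \<in> N"
      then obtain x where x: "x \<in> D" "y \<in> cball x (5 * (a * s x))" using D(4) by blast
      have "(y - x) /\<^sub>R s x \<in> cball 0 (5 * a)"
      proof -
        have "norm ((y - x) /\<^sub>R s x) = norm (y - x) / s x"
          using s[of x] by (simp only: norm_scaleR) (simp add: divide_inverse mult.commute)
        also have "\<dots> \<le> 5 * a"
          using x(2) s[of x] by (simp add: dist_norm norm_minus_commute pos_divide_le_eq mult_ac)
        finally show ?thesis by simp
      qed
      then obtain t where t: "t \<in> T" "(y - x) /\<^sub>R s x \<in> ball t (1/4)" using T by blast
      have "norm (y - (x + s x *\<^sub>R t)) = s x * norm ((y - x) /\<^sub>R s x - t)"
      proof -
        have "y - (x + s x *\<^sub>R t) = s x *\<^sub>R ((y - x) /\<^sub>R s x - t)"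
          using s[of x] by (simp add: scaleR_diff_right)
        then show ?thesis using s[of x] by (metis abs_of_pos norm_scaleR)
      qed
      also have "\<dots> \<le> s x * (1/4)"
        using t(2) s[of x] by (intro mult_left_mono) (auto simp: dist_norm norm_minus_commute)
      finally have "y \<in> K (x, t)" by (simp add: K_def dist_norm norm_minus_commute)
      then show "y \<in> (\<Union>q\<in>D \<times> T. K q)" using x t by blast
    qed
    have diam: "diameter (K (x, t)) = (1/2) ^ Suc (jf x)" for x t
      using s[of x] by (simp add: K_def s_def)
    have jle: "(1/2) ^ Suc (jf x) \<le> \<epsilon>" if "x \<in> N" for x
    proof -
      have "(1/2::real) ^ Suc (jf x) \<le> (1/2) ^ J"
        using jf(1)[OF that] by (intro power_decreasing) auto
      then show ?thesis using J by simp
    qed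
    have Kle: "diameter (K q) \<le> \<epsilon>" if qDT: "q \<in> D \<times> T" for q
    proof -
      obtain x t where q: "q = (x, t)" "x \<in> D" using qDT by auto
      show ?thesis unfolding q(1) diam using jle q(2) D(2) by blast
    qed
    have "hausdorff_content h \<epsilon> N \<le> (\<integral>\<^sup>+q. ennreal (h (diameter (K q))) \<partial>count_space (D \<times> T))"
    proof (rule hausdorff_content_le_countable)
      show "countable (D \<times> T)" using D(1) T(1) by (simp add: countable_finite)
    qed (use cov Kle h0 \<epsilon> in \<open>auto simp: K_def\<close>)
    also have "\<dots> = (\<integral>\<^sup>+q. ennreal (h (diameter (K q))) * indicator (D \<times> T) q \<partial>count_space UNIV)"
      by (simp add: nn_integral_count_space_indicator)
    also have "\<dots> = (\<integral>\<^sup>+q. (\<lambda>(x, t). ennreal (h ((1/2) ^ Suc (jf x))) * indicator D x * indicator T t) q \<partial>count_space UNIV)"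
      by (intro nn_integral_cong) (auto simp: diam indicator_def split: prod.split)
    also have "\<dots> = (\<integral>\<^sup>+x. \<integral>\<^sup>+t. ennreal (h ((1/2) ^ Suc (jf x))) * indicator D x * indicator T t
        \<partial>count_space UNIV \<partial>count_space UNIV)"
      by (simp add: nn_integral_fst_count_space[symmetric])
    also have "\<dots> = (\<integral>\<^sup>+x. ennreal (h ((1/2) ^ Suc (jf x))) * indicator D x * of_nat (card T) \<partial>count_space UNIV)"
      using T(1) by (intro nn_integral_cong) (simp add: nn_integral_cmult)
    \<comment> \<open>For each selected ball the density hypothesis bounds \<open>h\<close> by 1/C
      times the mass of that ball. The selected balls are disjoint, so the whole cover costs at most
      \<open>card T\<close> / C times the total mass, with C arbitrary.\<close>
    also have "\<dots> \<le> (\<integral>\<^sup>+x. ennreal (real (card T) / C) * (emeasure \<mu> (cball x (a * s x)) * indicator D x) \<partial>count_space UNIV)"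
    proof (intro nn_integral_mono)
      fix x
      show "ennreal (h ((1/2) ^ Suc (jf x))) * indicator D x * of_nat (card T)
          \<le> ennreal (real (card T) / C) * (emeasure \<mu> (cball x (a * s x)) * indicator D x)"
      proof (cases "x \<in> D")
        case True
        have "ennreal (h ((1/2) ^ Suc (jf x))) * of_nat (card T)
            = ennreal (real (card T) / C) * ennreal (C * h ((1/2) ^ Suc (jf x)))"
          using C by (cases "0 \<le> h ((1/2) ^ Suc (jf x))")
            (auto simp: ennreal_of_nat_eq_real_of_nat ennreal_mult[symmetric] ennreal_neg mult_nonneg_nonpos field_simps
               simp del: power_Suc)
        also have "\<dots> \<le> ennreal (real (card T) / C) * emeasure \<mu> (cball x (a * s x))"
          using jf(2)[of x] True D(2) by (intro mult_left_mono) (auto simp: s_def intro: less_imp_le)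
        finally show ?thesis using True by simp
      qed simp
    qed
    also have "\<dots> = ennreal (real (card T) / C) * (\<integral>\<^sup>+x. emeasure \<mu> (cball x (a * s x)) \<partial>count_space D)"
      by (simp add: nn_integral_cmult nn_integral_count_space_indicator)
    also have "(\<integral>\<^sup>+x. emeasure \<mu> (cball x (a * s x)) \<partial>count_space D) = emeasure \<mu> (\<Union>x\<in>D. cball x (a * s x))"
      using D(1,3) by (intro emeasure_UN_countable[symmetric])
        (auto simp: sets disjoint_family_on_def pairwise_def disjnt_def)
    also have "ennreal (real (card T) / C) * \<dots> \<le> ennreal (real (card T) / C) * emeasure \<mu> UNIV"
      by (intro mult_left_mono emeasure_mono) (auto simp: sets)
    finally show ?thesis .
  qed
  define m where "m = enn2real (emeasure \<mu> UNIV)"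
  have m: "emeasure \<mu> UNIV = ennreal m" "0 \<le> m" using fin by (auto simp: m_def)
  have "hausdorff_content h \<epsilon> N \<le> 0 + ennreal e" if "0 < e" for e
  proof -
    \<comment> \<open>Makes \<open>card T\<close> * m / C at most e; the added 1 keeps
      \<open>C\<close> positive when the total mass vanishes.\<close>
    define C where "C = (real (card T) * m + 1) / e"
    have C: "0 < C" using that m by (simp add: C_def add_nonneg_pos)
    have "hausdorff_content h \<epsilon> N \<le> ennreal (real (card T) / C * m)"
      using bound[OF C] m C by (simp add: ennreal_mult[symmetric])
    also have "real (card T) / C * m \<le> e"
    proof -
      have "real (card T) * m * e \<le> e * (real (card T) * m + 1)" using that by (simp add: algebra_simps)
      moreover have "0 < real (card T) * m + 1" using m by (simp add: add_nonneg_pos)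
      ultimately show ?thesis by (simp add: C_def field_simps)
    qed
    finally show ?thesis by (simp add: ennreal_leI)
  qed
  then have "hausdorff_content h \<epsilon> N \<le> 0"
    by (rule ennreal_le_epsilon)
  then show ?thesis by simp
qed

section \<open>Integration over hyperplane slices\<close>

lemma borel_measurable_vec_nth' [measurable (raw)]:
  fixes f :: "'a \<Rightarrow> real^'n"
  assumes "f \<in> borel_measurable M"
  shows "(\<lambda>x. f x $ i) \<in> borel_measurable M"
proof -
  have "(\<lambda>x. f x \<bullet> axis i 1) \<in> borel_measurable M" using assms by measurable
  then show ?thesis by (simp add: inner_axis)
qed

lemma borel_measurable_vec_lambda' [measurable (raw)]:
  fixes f :: "'n::finite \<Rightarrow> 'a \<Rightarrow> real"
  assumes "\<And>i. f i \<in> borel_measurable M"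
  shows "(\<lambda>x. \<chi> i. f i x) \<in> borel_measurable M"
  unfolding borel_measurable_euclidean_space[where f = "\<lambda>x. \<chi> i. f i x"]
  using assms by (auto simp: Basis_vec_def inner_axis)

lemma Basis_cart: "(Basis :: (real^'n) set) = range (\<lambda>j. axis j 1)"
  by (auto simp: Basis_vec_def)

lemma prod_Basis_cart:
  fixes f :: "real^'n \<Rightarrow> 'b::comm_monoid_mult"
  shows "(\<Prod>b\<in>Basis. f b) = (\<Prod>j\<in>UNIV. f (axis j 1))"
  unfolding Basis_cart by (subst prod.reindex) (auto simp: inj_on_def axis_eq_axis)

lemma emeasure_lborel_box_cart:
  fixes l u :: "real^'n"
  assumes "\<And>j. l $ j \<le> u $ j"
  shows "emeasure lborel (box l u) = ennreal (\<Prod>j\<in>UNIV. u $ j - l $ j)"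
proof -
  have "\<And>b. b \<in> Basis \<Longrightarrow> l \<bullet> b \<le> u \<bullet> b" using assms by (auto simp: Basis_cart inner_axis)
  then show ?thesis by (simp add: prod_Basis_cart inner_axis)
qed

definition upd :: "real^'n \<Rightarrow> 'n \<Rightarrow> real \<Rightarrow> real^'n" where
  "upd y i t = (\<chi> j. if j = i then t else y $ j)"

lemma upd_nth [simp]: "upd y i t $ j = (if j = i then t else y $ j)"
  by (simp add: upd_def)

lemma measurable_upd [measurable (raw)]:
  fixes f :: "'a \<Rightarrow> real^'n"
  assumes [measurable]: "f \<in> borel_measurable M" "g \<in> borel_measurable M"
  shows "(\<lambda>x. upd (f x) i (g x)) \<in> borel_measurable M"
  unfolding upd_def
proof (rule borel_measurable_vec_lambda')
  show "(\<lambda>x. if j = i then g x else f x $ j) \<in> borel_measurable M" for j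
    by (cases "j = i") simp_all
qed

text \<open>
  The \<open>i\<close>-th coordinate of \<open>y\<close> is a dummy variable ranging over the unit interval, which replaces
  integration over the hyperplane \<open>{z. z $ i = t}\<close>.
\<close>

lemma nn_integral_slice:
  fixes H :: "real^'n \<Rightarrow> ennreal"
  assumes [measurable]: "H \<in> borel_measurable borel"
  shows "(\<integral>\<^sup>+t. \<integral>\<^sup>+y. H (upd y i t) * indicator {0<..<1} (y $ i) \<partial>lborel \<partial>lborel) = (\<integral>\<^sup>+y. H y \<partial>lborel)"
proof -
  define S where "S = {q :: real \<times> (real^'n). 0 < snd q $ i \<and> snd q $ i < 1}"
  define P where "P = (lborel :: real measure) \<Otimes>\<^sub>M (lborel :: (real^'n) measure)"
  have "{q \<in> space P. 0 < snd q $ i \<and> snd q $ i < 1} \<in> sets P" unfolding P_def by measurable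
  then have [measurable]: "S \<in> sets P" by (simp add: S_def P_def space_pair_measure)
  have [measurable]: "(\<lambda>q. upd (snd q) i (fst q)) \<in> borel_measurable P" unfolding P_def by measurable
  define \<nu> where "\<nu> = distr (density P (indicator S)) borel (\<lambda>q. upd (snd q) i (fst q))"
  \<comment> \<open>Lebesgue measure is determined by its values on boxes. The preimage of a box is
    a product whose first factor is the i-th side and whose second factor is the box with that side
    replaced by the unit interval, so the product of the side lengths is unchanged.\<close>
  have "lborel = \<nu>"
  proof (rule lborel_eqI)
    fix l u :: "real^'n" assume le: "\<And>b. b \<in> Basis \<Longrightarrow> l \<bullet> b \<le> u \<bullet> b"
    have lu: "l $ j \<le> u $ j" for j using le[of "axis j 1"] by (simp add: Basis_cart inner_axis)
    define X where "X = (\<lambda>q. upd (snd q) i (fst q)) -` box l u \<inter> space P"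
    have [measurable]: "X \<in> sets P" unfolding X_def by measurable
    have "emeasure \<nu> (box l u) = emeasure (density P (indicator S)) X"
      unfolding \<nu>_def X_def by (subst emeasure_distr) auto
    also have "\<dots> = (\<integral>\<^sup>+q. indicator S q * indicator X q \<partial>P)"
      by (intro emeasure_density) auto
    also have "\<dots> = (\<integral>\<^sup>+q. indicator (S \<inter> X) q \<partial>P)"
      by (simp add: indicator_inter_arith)
    also have "\<dots> = emeasure P (S \<inter> X)" by (intro nn_integral_indicator) measurable
    also have "S \<inter> X = {l $ i<..<u $ i} \<times> box (upd l i 0) (upd u i 1)"
      by (auto simp: S_def X_def P_def space_pair_measure mem_box_cart split: if_splits)
    also have "emeasure P \<dots> = emeasure lborel {l $ i<..<u $ i} * emeasure lborel (box (upd l i 0) (upd u i 1))"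
      unfolding P_def by (intro lborel.emeasure_pair_measure_Times) auto
    also have "\<dots> = ennreal (u $ i - l $ i) * ennreal (\<Prod>j\<in>UNIV. upd u i 1 $ j - upd l i 0 $ j)"
      using lu by (subst emeasure_lborel_box_cart) auto
    also have "(\<Prod>j\<in>UNIV. upd u i 1 $ j - upd l i 0 $ j) = (\<Prod>j\<in>UNIV - {i}. u $ j - l $ j)"
      by (subst prod.remove[of _ i]) auto
    also have "ennreal (u $ i - l $ i) * ennreal \<dots> = ennreal (\<Prod>j\<in>UNIV. u $ j - l $ j)"
      using lu by (subst ennreal_mult[symmetric]) (auto intro!: prod_nonneg simp: prod.remove[of _ i])
    also have "\<dots> = (\<Prod>b\<in>Basis. (u - l) \<bullet> b)"
      by (simp add: prod_Basis_cart inner_axis)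
    finally show "emeasure \<nu> (box l u) = (\<Prod>b\<in>Basis. (u - l) \<bullet> b)" .
  qed (simp add: \<nu>_def)
  then have "(\<integral>\<^sup>+y. H y \<partial>lborel) = (\<integral>\<^sup>+y. H y \<partial>\<nu>)" by simp
  also have "\<dots> = (\<integral>\<^sup>+q. indicator S q * H (upd (snd q) i (fst q)) \<partial>P)"
    unfolding \<nu>_def by (subst nn_integral_distr) (auto simp: nn_integral_density)
  also have "\<dots> = (\<integral>\<^sup>+t. \<integral>\<^sup>+y. indicator S (t, y) * H (upd y i t) \<partial>lborel \<partial>lborel)"
    unfolding P_def by (subst lborel.nn_integral_fst[symmetric]) (auto simp flip: P_def)
  also have "\<dots> = (\<integral>\<^sup>+t. \<integral>\<^sup>+y. H (upd y i t) * indicator {0<..<1} (y $ i) \<partial>lborel \<partial>lborel)"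
    by (intro nn_integral_cong) (auto simp: S_def split: split_indicator)
  finally show ?thesis by simp
qed

text \<open>A face of half side \<open>r\<close> times the unit interval in the dummy coordinate
  \<open>i\<close>; its n-dimensional measure is therefore the (n - 1)-dimensional measure of the
  face.\<close>

definition slab :: "'n \<Rightarrow> real^'n \<Rightarrow> real \<Rightarrow> (real^'n) set" where
  "slab i x r = {y. 0 < y $ i \<and> y $ i < 1 \<and> (\<forall>j. j \<noteq> i \<longrightarrow> \<bar>y $ j - x $ j\<bar> < r)}"

lemma slab_eq_box: "slab i x r = box (\<chi> j. if j = i then 0 else x $ j - r) (\<chi> j. if j = i then 1 else x $ j + r)"
  by (auto simp: slab_def mem_box_cart abs_less_iff split: if_splits) (smt (verit))+

lemma slab_borel [measurable]: "slab i x r \<in> sets borel"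
  by (simp add: slab_eq_box)

lemma emeasure_slab:
  fixes x :: "real^'n"
  assumes "0 \<le> r"
  shows "emeasure lborel (slab i x r) = ennreal ((2 * r) ^ (CARD('n) - 1))"
proof -
  have "(\<Prod>j\<in>UNIV. (if j = i then 1 else x $ j + r) - (if j = i then 0 else x $ j - r))
      = (\<Prod>j\<in>UNIV - {i}. 2 * r)"
    by (subst prod.remove[of _ i]) auto
  then show ?thesis
    unfolding slab_eq_box using assms by (subst emeasure_lborel_box_cart) (auto simp: card_Diff_singleton)
qed

text \<open>The (n - 1)-dimensional integral of \<open>F\<close> over the face centred at
  \<open>x\<close> in the hyperplane where coordinate \<open>i\<close> equals \<open>c\<close>; the
  dummy coordinate integrates to 1.\<close>

definition face_int :: "(real^'n \<Rightarrow> ennreal) \<Rightarrow> 'n \<Rightarrow> real^'n \<Rightarrow> real \<Rightarrow> real \<Rightarrow> ennreal" where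
  "face_int F i x r c = (\<integral>\<^sup>+y. F (upd y i c) * indicator (slab i x r) y \<partial>lborel)"

text \<open>Polar coordinates for the sup norm. The faces in direction \<open>s\<close> of axis
  \<open>i\<close> sweep out the pyramid where the i-th coordinate of y - x dominates and has sign
  \<open>s\<close>; the radius is \<open>\<bar>y $ i - x $ i\<bar>\<close>.\<close>

lemma nn_integral_face_int:
  fixes F :: "real^'n \<Rightarrow> ennreal"
  assumes [measurable]: "F \<in> borel_measurable borel" "\<eta> \<in> borel_measurable borel" and s: "\<bar>s\<bar> = 1"
  shows "(\<integral>\<^sup>+t. \<eta> t * indicator {0<..<R} t * face_int F i x t (x $ i + s * t) \<partial>lborel)
    = (\<integral>\<^sup>+y. F y * \<eta> \<bar>y $ i - x $ i\<bar> * indicator {y. 0 < s * (y $ i - x $ i) \<and> \<bar>y $ i - x $ i\<bar> < R \<and>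
        (\<forall>j. j \<noteq> i \<longrightarrow> \<bar>y $ j - x $ j\<bar> < \<bar>y $ i - x $ i\<bar>)} y \<partial>lborel)"
proof -
  define E where "E = {y. 0 < s * (y $ i - x $ i) \<and> \<bar>y $ i - x $ i\<bar> < R \<and>
        (\<forall>j. j \<noteq> i \<longrightarrow> \<bar>y $ j - x $ j\<bar> < \<bar>y $ i - x $ i\<bar>)}"
  have [measurable]: "E \<in> sets borel" unfolding E_def by measurable
  define H where "H = (\<lambda>y. F y * \<eta> \<bar>y $ i - x $ i\<bar> * indicator E y)"
  have [measurable]: "H \<in> borel_measurable borel" unfolding H_def by measurable
  have "(\<integral>\<^sup>+y. H y \<partial>lborel) = (\<integral>\<^sup>+t. \<integral>\<^sup>+y. H (upd y i t) * indicator {0<..<1} (y $ i) \<partial>lborel \<partial>lborel)"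
    by (rule nn_integral_slice[symmetric]) measurable
  \<comment> \<open>Affine substitution centred at \<open>x $ i\<close> with Jacobian
    \<open>\<bar>s\<bar> = 1\<close>; the sign of \<open>s\<close> selects one of two opposite
    faces.\<close>
  also have "\<dots> = (\<integral>\<^sup>+t. \<integral>\<^sup>+y. H (upd y i (x $ i + s * t)) * indicator {0<..<1} (y $ i) \<partial>lborel \<partial>lborel)"
  proof (subst nn_integral_real_affine[of _ s "x $ i"])
    show "(\<lambda>t. \<integral>\<^sup>+ y. H (upd y i t) * indicator {0<..<1} (y $ i) \<partial>lborel) \<in> borel_measurable borel"
      by measurable
  qed (use s in auto)
  also have "\<dots> = (\<integral>\<^sup>+t. \<eta> t * indicator {0<..<R} t * face_int F i x t (x $ i + s * t) \<partial>lborel)"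
  proof (intro nn_integral_cong)
    fix t
    have "(\<integral>\<^sup>+y. H (upd y i (x $ i + s * t)) * indicator {0<..<1} (y $ i) \<partial>lborel)
       = (\<integral>\<^sup>+y. \<eta> t * indicator {0<..<R} t * (F (upd y i (x $ i + s * t)) * indicator (slab i x t) y) \<partial>lborel)"
    proof (intro nn_integral_cong)
      fix y :: "real^'n"
      have "s = 1 \<or> s = - 1" using s by auto
      then show "H (upd y i (x $ i + s * t)) * indicator {0<..<1} (y $ i)
         = \<eta> t * indicator {0<..<R} t * (F (upd y i (x $ i + s * t)) * indicator (slab i x t) y)"
        by (auto simp: H_def E_def slab_def mult_ac split: split_indicator)
    qed
    also have "\<dots> = \<eta> t * indicator {0<..<R} t * face_int F i x t (x $ i + s * t)"
      unfolding face_int_def by (rule nn_integral_cmult) measurable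
    finally show "(\<integral>\<^sup>+y. H (upd y i (x $ i + s * t)) * indicator {0<..<1} (y $ i) \<partial>lborel)
       = \<eta> t * indicator {0<..<R} t * face_int F i x t (x $ i + s * t)" .
  qed
  finally show ?thesis by (simp add: H_def E_def)
qed

lemma measurable_face_int [measurable]:
  fixes F :: "real^'n \<Rightarrow> ennreal"
  assumes [measurable]: "F \<in> borel_measurable borel"
  shows "(\<lambda>t. face_int F i x t (x $ i + s * t)) \<in> borel_measurable borel"
proof -
  have [measurable]: "Measurable.pred (borel \<Otimes>\<^sub>M borel) (\<lambda>q. snd q \<in> slab i x (fst q))"
    unfolding slab_def mem_Collect_eq by measurable
  have "(\<lambda>t. \<integral>\<^sup>+y. (if y \<in> slab i x t then F (upd y i (x $ i + s * t)) else 0) \<partial>lborel) \<in> borel_measurable borel"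
    by measurable
  also have "(\<lambda>t. \<integral>\<^sup>+y. (if y \<in> slab i x t then F (upd y i (x $ i + s * t)) else 0) \<partial>lborel)
     = (\<lambda>t. face_int F i x t (x $ i + s * t))"
    unfolding face_int_def by (intro ext nn_integral_cong) (auto split: split_indicator)
  finally show ?thesis .
qed

section \<open>Oscillation on the faces of a cube\<close>

lemma measurable_ennreal_norm_comp:
  assumes "continuous_on UNIV G" "f \<in> borel_measurable M"
  shows "(\<lambda>x. ennreal (norm (G (f x)))) \<in> borel_measurable M"
proof -
  have "(\<lambda>y. ennreal (norm (G y))) \<in> borel_measurable borel"
    using assms(1) by (intro measurable_compose[OF borel_measurable_continuous_onI measurable_ennreal] continuous_on_norm)
  then show ?thesis using assms(2) by (rule measurable_compose_rev)
qed

text \<open>Fundamental theorem of calculus along the segment from \<open>p\<close> to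
  \<open>z\<close>. The parameter interval is made open at the end because the parameter later
  appears in a denominator.\<close>

lemma ftc_norm_bound:
  fixes v :: "'a::euclidean_space \<Rightarrow> real" and G :: "'a \<Rightarrow> 'a"
  assumes v: "\<And>w. (v has_derivative (\<lambda>h. G w \<bullet> h)) (at w)" and G: "continuous_on UNIV G"
  shows "ennreal \<bar>v z - v p\<bar> \<le> ennreal (norm (z - p)) *
    (\<integral>\<^sup>+t. ennreal (norm (G (p + t *\<^sub>R (z - p)))) * indicator {0<..<1} t \<partial>lborel)"
proof -
  define f where "f = (\<lambda>t. G (p + t *\<^sub>R (z - p)) \<bullet> (z - p))"
  have contG: "continuous_on UNIV (\<lambda>t. G (p + t *\<^sub>R (z - p)))"
    by (rule continuous_on_compose2[OF G]) (auto intro!: continuous_intros)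
  have cont: "continuous_on UNIV f" unfolding f_def
    using contG by (intro continuous_intros)
  have deriv: "((\<lambda>t. v (p + t *\<^sub>R (z - p))) has_real_derivative f t) (at t)" for t
  proof -
    have "((\<lambda>t. v (p + t *\<^sub>R (z - p))) has_derivative (\<lambda>h. G (p + t *\<^sub>R (z - p)) \<bullet> (h *\<^sub>R (z - p)))) (at t)"
      by (rule has_derivative_compose[OF _ v]) (auto intro!: derivative_eq_intros)
    then show ?thesis
      unfolding has_field_derivative_def f_def by (rule has_derivative_eq_rhs) (simp add: fun_eq_iff)
  qed
  have cf: "isCont f t" for t using cont by (simp add: continuous_on_eq_continuous_at)
  have "has_bochner_integral lborel (\<lambda>t. f t * indicator {0 .. 1} t)
      (v (p + 1 *\<^sub>R (z - p)) - v (p + 0 *\<^sub>R (z - p)))"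
    by (intro has_bochner_integral_FTC_Icc_real deriv cf) auto
  then have hb: "has_bochner_integral lborel (\<lambda>t. f t * indicator {0 .. 1} t) (v z - v p)"
    by simp
  have "ennreal \<bar>v z - v p\<bar> \<le> (\<integral>\<^sup>+t. norm (f t * indicator {0 .. 1} t) \<partial>lborel)"
    using has_bochner_integral_norm_bound[OF hb] by simp
  also have "\<dots> \<le> (\<integral>\<^sup>+t. ennreal (norm (z - p)) * (ennreal (norm (G (p + t *\<^sub>R (z - p)))) * indicator {0 .. 1} t) \<partial>lborel)"
  proof (intro nn_integral_mono)
    fix t
    have "\<bar>f t\<bar> \<le> norm (z - p) * norm (G (p + t *\<^sub>R (z - p)))"
      unfolding f_def by (metis Cauchy_Schwarz_ineq2 mult.commute)
    then show "ennreal (norm (f t * indicator {0 .. 1} t))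
        \<le> ennreal (norm (z - p)) * (ennreal (norm (G (p + t *\<^sub>R (z - p)))) * indicator {0 .. 1} t)"
      by (auto simp: ennreal_mult[symmetric] split: split_indicator intro: ennreal_leI)
  qed
  also have "\<dots> = ennreal (norm (z - p)) * (\<integral>\<^sup>+t. ennreal (norm (G (p + t *\<^sub>R (z - p)))) * indicator {0 .. 1} t \<partial>lborel)"
    by (intro nn_integral_cmult borel_measurable_times_ennreal measurable_ennreal_norm_comp[OF G]) measurable
  also have "(\<integral>\<^sup>+t. ennreal (norm (G (p + t *\<^sub>R (z - p)))) * indicator {0 .. 1} t \<partial>lborel)
     = (\<integral>\<^sup>+t. ennreal (norm (G (p + t *\<^sub>R (z - p)))) * indicator {0<..<1} t \<partial>lborel)"
  proof (intro nn_integral_cong_AE)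
    have "AE t in lborel. t \<noteq> (0::real)" "AE t in lborel. t \<noteq> (1::real)"
      by (rule AE_lborel_singleton)+
    then show "AE t in lborel. ennreal (norm (G (p + t *\<^sub>R (z - p)))) * indicator {0 .. 1} t
        = ennreal (norm (G (p + t *\<^sub>R (z - p)))) * indicator {0<..<1} t"
      by eventually_elim (auto split: split_indicator)
  qed
  finally show ?thesis .
qed

text \<open>The map dilates about \<open>p\<close> in the face coordinates only and fixes the dummy
  coordinate \<open>i\<close>, so its Jacobian has exponent n - 1 instead of n.\<close>

lemma nn_integral_scale_slice:
  fixes f :: "real^'n \<Rightarrow> ennreal"
  assumes [measurable]: "f \<in> borel_measurable borel" and t: "0 < t"
  shows "(\<integral>\<^sup>+w. f w \<partial>lborel) = ennreal (t ^ (CARD('n) - 1)) *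
    (\<integral>\<^sup>+z. f (\<chi> j. if j = i then z $ j else p $ j + t * (z $ j - p $ j)) \<partial>lborel)"
proof -
  define c where "c = (\<lambda>b::real^'n. if b = axis i 1 then 1 else t)"
  define a :: "real^'n" where "a = (\<chi> j. if j = i then 0 else (1 - t) * p $ j)"
  have T: "a + (\<Sum>b\<in>Basis. (c b * (z \<bullet> b)) *\<^sub>R b) = (\<chi> j. if j = i then z $ j else p $ j + t * (z $ j - p $ j))" for z
  proof -
    have "(\<Sum>b\<in>Basis. (c b * (z \<bullet> b)) *\<^sub>R b) $ j = c (axis j 1) * z $ j" for j
    proof -
      have "(\<Sum>b\<in>Basis. (c b * (z \<bullet> b)) *\<^sub>R b) $ j = (\<Sum>b\<in>Basis. (c b * (z \<bullet> b)) *\<^sub>R b) \<bullet> axis j 1"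
        by (simp add: inner_axis)
      also have "\<dots> = c (axis j 1) * (z \<bullet> axis j 1)"
        by (rule inner_sum_left_Basis) (simp add: Basis_cart)
      finally show ?thesis by (simp add: inner_axis)
    qed
    moreover have "c (axis j 1) = (if j = i then 1 else t)" for j
      by (simp add: c_def axis_eq_axis)
    ultimately show ?thesis
      by (simp add: vec_eq_iff a_def algebra_simps)
  qed
  have "(\<Prod>b\<in>Basis. \<bar>c b\<bar>) = (\<Prod>j\<in>UNIV. if j = i then 1 else t)"
    unfolding prod_Basis_cart using t by (intro prod.cong) (auto simp: c_def axis_eq_axis)
  also have "\<dots> = t ^ (CARD('n) - 1)"
    by (subst prod.remove[of _ i]) (auto simp: card_Diff_singleton)
  finally have P: "(\<Prod>b\<in>Basis. \<bar>c b\<bar>) = t ^ (CARD('n) - 1)" .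
  have [measurable]: "(\<lambda>z. a + (\<Sum>b\<in>Basis. (c b * (z \<bullet> b)) *\<^sub>R b)) \<in> borel_measurable borel" by measurable
  have "(\<integral>\<^sup>+w. f w \<partial>lborel) = (\<integral>\<^sup>+w. f w \<partial>density (distr lborel borel (\<lambda>z. a + (\<Sum>b\<in>Basis. (c b * (z \<bullet> b)) *\<^sub>R b)))
      (\<lambda>_. ennreal (\<Prod>b\<in>Basis. \<bar>c b\<bar>)))"
    using t by (subst lborel_affine_euclidean[of c a]) (auto simp: c_def)
  also have "\<dots> = ennreal (\<Prod>b\<in>Basis. \<bar>c b\<bar>) * (\<integral>\<^sup>+z. f (a + (\<Sum>b\<in>Basis. (c b * (z \<bullet> b)) *\<^sub>R b)) \<partial>lborel)"
    by (subst nn_integral_density) (auto simp: nn_integral_cmult nn_integral_distr)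
  finally show ?thesis unfolding P T .
qed

text \<open>With \<open>a\<close> proportional to the distance from \<open>p\<close>, this is where
  the singularity of order d - 1 of the face potential comes from.\<close>

lemma nn_integral_inverse_power_le:
  assumes d: "2 \<le> d" and a: "0 < a" "a \<le> 1"
  shows "(\<integral>\<^sup>+t. ennreal (1 / t ^ d) * indicator {a..1} t \<partial>lborel) \<le> ennreal ((1 / a) ^ (d - 1))"
proof -
  obtain e where e: "d = Suc (Suc e)" using d by (metis add_2_eq_Suc le_Suc_ex)
  define \<Phi> where "\<Phi> = (\<lambda>t::real. - (inverse t ^ Suc e) / real (Suc e))"
  have "(\<integral>\<^sup>+t. ennreal (1 / t ^ d) * indicator {a..1} t \<partial>lborel) = ennreal (\<Phi> 1 - \<Phi> a)"
  proof (rule nn_integral_FTC_Icc)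
    fix t assume "t \<in> {a..1}"
    then have t: "0 < t" using a by auto
    show "0 \<le> 1 / t ^ d" using t by simp
    have "(\<Phi> has_real_derivative - ((1 + real e) * (- (inverse t ^ Suc (Suc 0)) * inverse t ^ e)) / real (Suc e)) (at t)"
      unfolding \<Phi>_def using t by (intro DERIV_cdivide DERIV_minus DERIV_power_Suc DERIV_inverse) auto
    also have "- ((1 + real e) * (- (inverse t ^ Suc (Suc 0)) * inverse t ^ e)) / real (Suc e) = inverse t ^ d"
      by (simp add: e add.commute)
    also have "\<dots> = 1 / t ^ d" by (simp add: inverse_eq_divide power_divide)
    finally show "(\<Phi> has_real_derivative 1 / t ^ d) (at t)" .
  qed (use a in auto)
  also have "\<Phi> 1 - \<Phi> a \<le> (1 / a) ^ (d - 1)"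
  proof -
    have "\<Phi> 1 - \<Phi> a \<le> inverse a ^ Suc e / real (Suc e)" by (simp add: \<Phi>_def)
    also have "\<dots> \<le> inverse a ^ Suc e / 1" using a by (intro divide_left_mono) auto
    finally show ?thesis by (simp add: e inverse_eq_divide)
  qed
  finally show ?thesis by (simp add: ennreal_leI)
qed

lemma upd_segment:
  assumes "p $ i = c"
  shows "p + t *\<^sub>R (upd z i c - p) = upd (\<chi> j. if j = i then z $ j else p $ j + t * (z $ j - p $ j)) i c"
  using assms by (simp add: vec_eq_iff)

text \<open>Average the mean value inequality along segments from \<open>p\<close> over all end points in the face.\<close>

lemma face_potential:
  fixes v :: "real^'n \<Rightarrow> real" and G :: "real^'n \<Rightarrow> real^'n"
  assumes v: "\<And>w. (v has_derivative (\<lambda>h. G w \<bullet> h)) (at w)" and G: "continuous_on UNIV G"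
    and p: "p $ i = c" "\<And>j. j \<noteq> i \<Longrightarrow> \<bar>p $ j - x $ j\<bar> \<le> r" and d: "CARD('n) = Suc d" and r: "0 \<le> r"
  shows "(\<integral>\<^sup>+z. ennreal \<bar>v (upd z i c) - v p\<bar> * indicator (slab i x r) z \<partial>lborel)
    \<le> ennreal (2 * r * real CARD('n)) * (\<integral>\<^sup>+w. ennreal (norm (G (upd w i c))) * indicator (slab i x r) w *
      (\<integral>\<^sup>+t. ennreal (1 / t ^ d) * indicator {0<..<1} t * indicator {t. \<forall>j. j \<noteq> i \<longrightarrow> \<bar>w $ j - p $ j\<bar> < 2 * r * t} t \<partial>lborel) \<partial>lborel)"
proof -
  define g where "g = (\<lambda>w. ennreal (norm (G (upd w i c))))"
  have g[measurable]: "g \<in> borel_measurable borel"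
    unfolding g_def by (rule measurable_ennreal_norm_comp[OF G]) measurable
  \<comment> \<open>\<open>T t z\<close> is the point at parameter \<open>t\<close> on the segment
    from \<open>p\<close> to \<open>z\<close>, apart from the dummy coordinate, which is
    kept.\<close>
  define T where "T = (\<lambda>t z. (\<chi> j. if j = i then z $ j else p $ j + t * (z $ j - p $ j)) :: real^'n)"
  have [measurable]: "(\<lambda>q. T (snd q) (fst q)) \<in> borel_measurable (lborel \<Otimes>\<^sub>M lborel)"
    unfolding T_def
  proof (rule borel_measurable_vec_lambda')
    show "(\<lambda>q. if j = i then fst q $ j else p $ j + snd q * (fst q $ j - p $ j)) \<in> borel_measurable (lborel \<Otimes>\<^sub>M lborel)" for j
      by (cases "j = i") simp_all
  qed
  have [measurable]: "(\<lambda>q. T (fst q) (snd q)) \<in> borel_measurable (lborel \<Otimes>\<^sub>M lborel)"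
    unfolding T_def
  proof (rule borel_measurable_vec_lambda')
    show "(\<lambda>q. if j = i then snd q $ j else p $ j + fst q * (snd q $ j - p $ j)) \<in> borel_measurable (lborel \<Otimes>\<^sub>M lborel)" for j
      by (cases "j = i") simp_all
  qed
  have [measurable]: "T t \<in> borel_measurable borel" for t
    unfolding T_def
  proof (rule borel_measurable_vec_lambda')
    show "(\<lambda>z. if j = i then z $ j else p $ j + t * (z $ j - p $ j)) \<in> borel_measurable borel" for j
      by (cases "j = i") simp_all
  qed
  \<comment> \<open>\<open>T t\<close> maps the face into this neighbourhood of \<open>p\<close>.
    After the substitution w = \<open>T t z\<close> the constraint excludes small \<open>t\<close>
    when w is far from \<open>p\<close>, which tames the factor 1 / t^d of the Jacobian.\<close>
  define N where "N = (\<lambda>(t::real) w. \<forall>j. j \<noteq> i \<longrightarrow> \<bar>w $ j - p $ j\<bar> < 2 * r * t)"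
  have [measurable]: "Measurable.pred (borel \<Otimes>\<^sub>M borel) (\<lambda>q. N (fst q) (snd q))"
    unfolding N_def by measurable
  have [measurable]: "Measurable.pred (borel \<Otimes>\<^sub>M borel) (\<lambda>q. N (snd q) (fst q))"
    unfolding N_def by measurable
  have [measurable]: "Measurable.pred borel (N t)" for t
    unfolding N_def by measurable
  have [measurable]: "Measurable.pred borel (\<lambda>t. N t w)" for w
    unfolding N_def by measurable
  have step1: "ennreal \<bar>v (upd z i c) - v p\<bar> * indicator (slab i x r) z
     \<le> ennreal (2 * r * real CARD('n)) * (\<integral>\<^sup>+t. g (T t z) * indicator {0<..<1} t * indicator (slab i x r) z \<partial>lborel)" for z
  proof (cases "z \<in> slab i x r")
    case True
    have "\<bar>(upd z i c - p) $ j\<bar> \<le> 2 * r" for j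
    proof (cases "j = i")
      case True
      then show ?thesis using p(1) r by simp
    next
      case False
      then show ?thesis using p(2)[OF False] True by (auto simp: slab_def dest!: spec[of _ j])
    qed
    then have "norm (upd z i c - p) \<le> (\<Sum>j\<in>(UNIV::'n set). 2 * r)"
      by (intro order_trans[OF norm_le_l1_cart] sum_mono) auto
    then have nrm: "norm (upd z i c - p) \<le> 2 * r * real CARD('n)" by (simp add: mult.commute)
    have "ennreal \<bar>v (upd z i c) - v p\<bar> \<le> ennreal (norm (upd z i c - p)) *
       (\<integral>\<^sup>+t. ennreal (norm (G (p + t *\<^sub>R (upd z i c - p)))) * indicator {0<..<1} t \<partial>lborel)"
      by (rule ftc_norm_bound[OF v G])
    also have "\<dots> \<le> ennreal (2 * r * real CARD('n)) *
       (\<integral>\<^sup>+t. ennreal (norm (G (p + t *\<^sub>R (upd z i c - p)))) * indicator {0<..<1} t \<partial>lborel)"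
      using nrm by (intro mult_right_mono ennreal_leI) auto
    finally show ?thesis using True by (simp add: upd_segment[OF p(1)] g_def T_def)
  qed simp
  have "(\<integral>\<^sup>+z. ennreal \<bar>v (upd z i c) - v p\<bar> * indicator (slab i x r) z \<partial>lborel)
     \<le> (\<integral>\<^sup>+z. ennreal (2 * r * real CARD('n)) * (\<integral>\<^sup>+t. g (T t z) * indicator {0<..<1} t * indicator (slab i x r) z \<partial>lborel) \<partial>lborel)"
    by (intro nn_integral_mono step1)
  also have "\<dots> = ennreal (2 * r * real CARD('n)) * (\<integral>\<^sup>+z. (\<integral>\<^sup>+t. g (T t z) * indicator {0<..<1} t * indicator (slab i x r) z \<partial>lborel) \<partial>lborel)"
    by (rule nn_integral_cmult) measurable
  also have "(\<integral>\<^sup>+z. (\<integral>\<^sup>+t. g (T t z) * indicator {0<..<1} t * indicator (slab i x r) z \<partial>lborel) \<partial>lborel)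
     = (\<integral>\<^sup>+t. (\<integral>\<^sup>+z. g (T t z) * indicator {0<..<1} t * indicator (slab i x r) z \<partial>lborel) \<partial>lborel)"
    by (rule lborel_pair.Fubini') measurable
  \<comment> \<open>For fixed \<open>t\<close>, substitute w = \<open>T t z\<close>: convexity keeps
    segments inside the face, and the inverse Jacobian is 1 / t^d. A second exchange of integrals
    then isolates the kernel in w.\<close>
  also have "\<dots> \<le> (\<integral>\<^sup>+t. (\<integral>\<^sup>+w. ennreal (1 / t ^ d) * indicator {0<..<1} t * (g w * indicator (slab i x r) w * indicator {w. N t w} w) \<partial>lborel) \<partial>lborel)"
  proof (rule nn_integral_mono)
    fix t :: real
    show "(\<integral>\<^sup>+z. g (T t z) * indicator {0<..<1} t * indicator (slab i x r) z \<partial>lborel)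
      \<le> (\<integral>\<^sup>+w. ennreal (1 / t ^ d) * indicator {0<..<1} t * (g w * indicator (slab i x r) w * indicator {w. N t w} w) \<partial>lborel)"
    proof (cases "t \<in> {0<..<1}")
      case True
      then have t: "0 < t" "t < 1" by auto
      define \<phi> where "\<phi> = (\<lambda>w. g w * indicator (slab i x r) w * indicator {w. N t w} w)"
      have [measurable]: "\<phi> \<in> borel_measurable borel" unfolding \<phi>_def by measurable
      have in_slab: "T t z \<in> slab i x r \<and> N t (T t z)" if z: "z \<in> slab i x r" for z
      proof -
        have "\<bar>T t z $ j - x $ j\<bar> < r \<and> \<bar>T t z $ j - p $ j\<bar> < 2 * r * t" if j: "j \<noteq> i" for j
        proof
          have zj: "\<bar>z $ j - x $ j\<bar> < r" using z j by (auto simp: slab_def)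
          have "T t z $ j - x $ j = (1 - t) * (p $ j - x $ j) + t * (z $ j - x $ j)"
            using j by (simp add: T_def algebra_simps)
          then have "\<bar>T t z $ j - x $ j\<bar> \<le> (1 - t) * \<bar>p $ j - x $ j\<bar> + t * \<bar>z $ j - x $ j\<bar>"
            using t by (metis abs_mult abs_of_pos abs_triangle_ineq diff_gt_0_iff_gt)
          also have "\<dots> < (1 - t) * r + t * r"
            using p(2)[OF j] zj t by (intro add_le_less_mono mult_left_mono mult_strict_left_mono) auto
          finally show "\<bar>T t z $ j - x $ j\<bar> < r" by (simp add: algebra_simps)
          have "\<bar>z $ j - p $ j\<bar> < 2 * r" using p(2)[OF j] zj by linarith
          then have "t * \<bar>z $ j - p $ j\<bar> < t * (2 * r)" using t by simp
          then show "\<bar>T t z $ j - p $ j\<bar> < 2 * r * t" using j t by (simp add: T_def abs_mult mult_ac)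
        qed
        then show ?thesis using z by (auto simp: slab_def N_def) (auto simp: T_def)
      qed
      have "(\<integral>\<^sup>+z. g (T t z) * indicator {0<..<1} t * indicator (slab i x r) z \<partial>lborel) \<le> (\<integral>\<^sup>+z. \<phi> (T t z) \<partial>lborel)"
        using in_slab by (intro nn_integral_mono) (auto simp: \<phi>_def split: split_indicator)
      also have "\<dots> = ennreal (1 / t ^ d) * (ennreal (t ^ d) * (\<integral>\<^sup>+z. \<phi> (T t z) \<partial>lborel))"
        using t by (simp add: mult.assoc[symmetric] ennreal_mult[symmetric])
      also have "ennreal (t ^ d) * (\<integral>\<^sup>+z. \<phi> (T t z) \<partial>lborel) = (\<integral>\<^sup>+w. \<phi> w \<partial>lborel)"
        using nn_integral_scale_slice[of \<phi> t i p] t d by (simp add: T_def)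
      also have "ennreal (1 / t ^ d) * \<dots> = (\<integral>\<^sup>+w. ennreal (1 / t ^ d) * \<phi> w \<partial>lborel)"
        by (rule nn_integral_cmult[symmetric]) measurable
      finally show ?thesis using True by (simp add: \<phi>_def)
    qed simp
  qed
  also have "\<dots> = (\<integral>\<^sup>+w. (\<integral>\<^sup>+t. ennreal (1 / t ^ d) * indicator {0<..<1} t * (g w * indicator (slab i x r) w * indicator {w. N t w} w) \<partial>lborel) \<partial>lborel)"
    by (rule lborel_pair.Fubini') measurable
  also have "\<dots> = (\<integral>\<^sup>+w. g w * indicator (slab i x r) w * (\<integral>\<^sup>+t. ennreal (1 / t ^ d) * indicator {0<..<1} t * indicator {t. N t w} t \<partial>lborel) \<partial>lborel)"
  proof (intro nn_integral_cong)
    fix w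
    have "(\<integral>\<^sup>+t. ennreal (1 / t ^ d) * indicator {0<..<1} t * (g w * indicator (slab i x r) w * indicator {w. N t w} w) \<partial>lborel)
      = (\<integral>\<^sup>+t. g w * indicator (slab i x r) w * (ennreal (1 / t ^ d) * indicator {0<..<1} t * indicator {t. N t w} t) \<partial>lborel)"
      by (intro nn_integral_cong) (auto simp: mult_ac split: split_indicator)
    also have "\<dots> = g w * indicator (slab i x r) w * (\<integral>\<^sup>+t. ennreal (1 / t ^ d) * indicator {0<..<1} t * indicator {t. N t w} t \<partial>lborel)"
      by (rule nn_integral_cmult) measurable
    finally show "(\<integral>\<^sup>+t. ennreal (1 / t ^ d) * indicator {0<..<1} t * (g w * indicator (slab i x r) w * indicator {w. N t w} w) \<partial>lborel)
      = g w * indicator (slab i x r) w * (\<integral>\<^sup>+t. ennreal (1 / t ^ d) * indicator {0<..<1} t * indicator {t. N t w} t \<partial>lborel)" .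
  qed
  finally show ?thesis by (simp add: g_def N_def mult_left_mono)
qed


lemma AE_nth_neq: "AE w in lborel. w $ j \<noteq> (a::real)" for j :: "'n::finite"
proof -
  have "{w::real^'n. w $ j = a} \<in> null_sets lebesgue"
    using negligible_standard_hyperplane[of "axis j 1 :: real^'n" a]
    by (simp add: Basis_cart inner_axis flip: negligible_iff_null_sets)
  moreover have "{w::real^'n. w $ j = a} \<in> sets lborel" by measurable
  ultimately have "{w::real^'n. w $ j = a} \<in> null_sets lborel"
    by (simp add: null_sets_completion_iff)
  then show ?thesis by (rule AE_I') auto
qed

text \<open>The kernel \<open>\<kappa>\<close> integrates 1 / t^d over t > |w - p| / (2 r) in the
  sup norm of the face. In the shell where this quotient lies between 2^(-k-1) and 2^(-k),
  \<open>l * \<kappa> w\<close> is at most \<open>a k\<close>, and Young's inequality is applied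
  with the parameter \<open>a k\<close>. Integrating \<open>young_conjugate A (a k)\<close> over the
  cube containing the k-th shell produces the terms of
  \<open>dyadic_sum_le_young_pre\<close>.\<close>

lemma face_potential_le_young:
  fixes v :: "real^'n \<Rightarrow> real" and G :: "real^'n \<Rightarrow> real^'n" and F :: "real^'n \<Rightarrow> ennreal"
  assumes v: "\<And>w. (v has_derivative (\<lambda>h. G w \<bullet> h)) (at w)" and G: "continuous_on UNIV G"
    and [measurable]: "F \<in> borel_measurable borel"
    and p: "p $ i = c" "\<And>j. j \<noteq> i \<Longrightarrow> \<bar>p $ j - x $ j\<bar> \<le> r"
    and d: "CARD('n) = Suc d" "2 \<le> d" and r: "0 < r" and l: "0 < l"
    and young: "\<And>w \<tau>. w $ i = c \<Longrightarrow> (\<And>j. j \<noteq> i \<Longrightarrow> \<bar>w $ j - x $ j\<bar> \<le> r) \<Longrightarrow> 0 < \<tau> \<Longrightarrow>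
      ennreal (\<tau> * norm (G w)) \<le> F w + young_conjugate A \<tau>"
  shows "ennreal l * (\<integral>\<^sup>+z. ennreal \<bar>v (upd z i c) - v p\<bar> * indicator (slab i x r) z \<partial>lborel)
    \<le> ennreal (2 * r * real CARD('n)) * (face_int F i x r c +
        ennreal ((2 * r) ^ d) * (ennreal (2 ^ (4 * d)) * young_pre CARD('n) A l))"
proof -
  define g where "g = (\<lambda>w. ennreal (norm (G (upd w i c))))"
  have g[measurable]: "g \<in> borel_measurable borel"
    unfolding g_def by (rule measurable_ennreal_norm_comp[OF G]) measurable
  define N where "N = (\<lambda>(t::real) w. \<forall>j. j \<noteq> i \<longrightarrow> \<bar>w $ j - p $ j\<bar> < 2 * r * t)"
  have [measurable]: "Measurable.pred (borel \<Otimes>\<^sub>M borel) (\<lambda>q. N (snd q) (fst q))"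
    unfolding N_def by measurable
  have [measurable]: "Measurable.pred borel (\<lambda>t. N t w)" for w
    unfolding N_def by measurable
  define \<kappa> where "\<kappa> = (\<lambda>w. \<integral>\<^sup>+t. ennreal (1 / t ^ d) * indicator {0<..<1} t * indicator {t. N t w} t \<partial>lborel)"
  have [measurable]: "\<kappa> \<in> borel_measurable borel" unfolding \<kappa>_def by measurable
  define a where "a = (\<lambda>k::nat. l * 2 ^ ((k + 1) * (d - 1)))"
  have \<kappa>_le: "ennreal l * \<kappa> w \<le> ennreal (a k)" if w: "\<not> N ((1/2) ^ Suc k) w" for k w
  proof -
    obtain j where j: "j \<noteq> i" "2 * r * (1/2) ^ Suc k \<le> \<bar>w $ j - p $ j\<bar>"
      using w unfolding N_def by (auto simp: not_less)
    have "\<kappa> w \<le> (\<integral>\<^sup>+t. ennreal (1 / t ^ d) * indicator {(1/2) ^ Suc k..1} t \<partial>lborel)"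
      unfolding \<kappa>_def
    proof (intro nn_integral_mono)
      fix t :: real
      have "(1/2) ^ Suc k \<le> t" if "N t w"
      proof -
        have "2 * r * (1/2) ^ Suc k < 2 * r * t" using that j unfolding N_def by (meson le_less_trans)
        then show ?thesis using r by (simp del: power_Suc)
      qed
      then show "ennreal (1 / t ^ d) * indicator {0<..<1} t * indicator {t. N t w} t
          \<le> ennreal (1 / t ^ d) * indicator {(1/2) ^ Suc k..1} t"
        by (auto split: split_indicator simp del: power_Suc)
    qed
    also have "\<dots> \<le> ennreal ((1 / (1/2) ^ Suc k) ^ (d - 1))"
      using d by (intro nn_integral_inverse_power_le) (auto intro!: power_le_one simp del: power_Suc)
    also have "(1 / (1/2) ^ Suc k) ^ (d - 1) = (2::real) ^ ((k + 1) * (d - 1))"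
    proof -
      have "1 / (1/2) ^ Suc k = (2::real) ^ Suc k" by (simp add: power_one_over)
      then show ?thesis by (simp only: power_mult[symmetric] Suc_eq_plus1)
    qed
    finally have "ennreal l * \<kappa> w \<le> ennreal l * ennreal (2 ^ ((k + 1) * (d - 1)))"
      by (rule mult_left_mono) simp
    also have "\<dots> = ennreal (a k)" using l by (simp add: a_def ennreal_mult)
    finally show ?thesis .
  qed
  \<comment> \<open>Every point of the face that differs from \<open>p\<close> in coordinate
    \<open>j0\<close> lies in some dyadic shell; the remaining points form a null set.\<close>
  obtain j0 where j0: "j0 \<noteq> i"
  proof -
    have "\<exists>j. j \<noteq> i"
    proof (rule ccontr)
      assume "\<not> (\<exists>j. j \<noteq> i)"
      then have "(UNIV :: 'n set) = {i}" by auto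
      then have "CARD('n) = card {i}" by (rule arg_cong)
      then show False using d by simp
    qed
    then show ?thesis using that by blast
  qed
  have pointwise: "ennreal l * (g w * indicator (slab i x r) w * \<kappa> w)
      \<le> F (upd w i c) * indicator (slab i x r) w +
        (\<Sum>k. young_conjugate A (a k) * indicator (slab i p (2 * r * (1/2) ^ k)) w)"
    if w0: "w $ j0 \<noteq> p $ j0" for w
  proof (cases "w \<in> slab i x r")
    case True
    define S where "S = {k. \<not> N ((1/2) ^ k) w}"
    have "\<exists>k. k \<in> S"
    proof -
      have "0 < \<bar>w $ j0 - p $ j0\<bar> / (2 * r)" using w0 r by simp
      then obtain k where "(1/2) ^ k < \<bar>w $ j0 - p $ j0\<bar> / (2 * r)"
        using real_arch_pow_inv[of "\<bar>w $ j0 - p $ j0\<bar> / (2 * r)" "1/2"] by auto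
      then have "2 * r * (1/2) ^ k < \<bar>w $ j0 - p $ j0\<bar>" using r by (simp add: field_simps)
      then show ?thesis using j0 by (auto simp: S_def N_def intro!: exI[of _ k])
    qed
    define m where "m = (LEAST k. k \<in> S)"
    have mS: "m \<in> S" unfolding m_def using \<open>\<exists>k. k \<in> S\<close> by (rule LeastI_ex)
    \<comment> \<open>A point of the open face and a point of the closed one differ by less than 2 r
      in each face coordinate. Hence the first index \<open>m\<close> in \<open>S\<close> is a
      successor and the shell index \<open>k\<close> exists.\<close>
    have "0 \<notin> S"
      using True p(2) by (force simp: S_def N_def slab_def)
    then obtain k where k: "m = Suc k" using mS by (cases m) auto
    have "k \<notin> S" using not_less_Least[of k "\<lambda>k. k \<in> S"] k unfolding m_def by auto
    then have Nk: "N ((1/2) ^ k) w" by (simp add: S_def)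
    have nNk: "\<not> N ((1/2) ^ Suc k) w" using mS k by (simp add: S_def)
    have "ennreal l * (g w * \<kappa> w) = g w * (ennreal l * \<kappa> w)" by (simp add: mult_ac)
    also have "\<dots> \<le> g w * ennreal (a k)" by (intro mult_left_mono \<kappa>_le nNk) simp
    also have "\<dots> = ennreal (a k * norm (G (upd w i c)))"
      using l by (simp add: g_def a_def ennreal_mult mult.commute)
    also have "\<dots> \<le> F (upd w i c) + young_conjugate A (a k)"
      using True l by (intro young) (auto simp: slab_def a_def)
    also have "\<dots> \<le> F (upd w i c) + (\<Sum>k. young_conjugate A (a k) * indicator (slab i p (2 * r * (1/2) ^ k)) w)"
    proof (intro add_left_mono)
      have "w \<in> slab i p (2 * r * (1/2) ^ k)" using Nk True by (auto simp: N_def slab_def)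
      then have "young_conjugate A (a k) = (\<Sum>k\<in>{k}. young_conjugate A (a k) * indicator (slab i p (2 * r * (1/2) ^ k)) w)"
        by simp
      also have "\<dots> \<le> (\<Sum>k. young_conjugate A (a k) * indicator (slab i p (2 * r * (1/2) ^ k)) w)"
        by (rule sum_le_suminf) auto
      finally show "young_conjugate A (a k) \<le> \<dots>" .
    qed
    finally show ?thesis using True by simp
  qed simp
  have "ennreal l * (\<integral>\<^sup>+w. g w * indicator (slab i x r) w * \<kappa> w \<partial>lborel)
     = (\<integral>\<^sup>+w. ennreal l * (g w * indicator (slab i x r) w * \<kappa> w) \<partial>lborel)"
    by (rule nn_integral_cmult[symmetric]) measurable
  also have "\<dots> \<le> (\<integral>\<^sup>+w. F (upd w i c) * indicator (slab i x r) w +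
        (\<Sum>k. young_conjugate A (a k) * indicator (slab i p (2 * r * (1/2) ^ k)) w) \<partial>lborel)"
    using AE_nth_neq[of j0 "p $ j0"] pointwise by (intro nn_integral_mono_AE) auto
  also have "\<dots> = (\<integral>\<^sup>+w. F (upd w i c) * indicator (slab i x r) w \<partial>lborel) +
        (\<integral>\<^sup>+w. (\<Sum>k. young_conjugate A (a k) * indicator (slab i p (2 * r * (1/2) ^ k)) w) \<partial>lborel)"
    by (rule nn_integral_add) measurable
  also have "(\<integral>\<^sup>+w. (\<Sum>k. young_conjugate A (a k) * indicator (slab i p (2 * r * (1/2) ^ k)) w) \<partial>lborel)
      = (\<Sum>k. \<integral>\<^sup>+w. young_conjugate A (a k) * indicator (slab i p (2 * r * (1/2) ^ k)) w \<partial>lborel)"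
    by (rule nn_integral_suminf) measurable
  also have "\<dots> = (\<Sum>k. ennreal ((2 * r) ^ d) * (ennreal ((2 * (1/2) ^ k) ^ d) * young_conjugate A (a k)))"
  proof (intro suminf_cong)
    fix k
    have "(\<integral>\<^sup>+w. young_conjugate A (a k) * indicator (slab i p (2 * r * (1/2) ^ k)) w \<partial>lborel)
       = young_conjugate A (a k) * emeasure lborel (slab i p (2 * r * (1/2) ^ k))"
      by (rule nn_integral_cmult_indicator) measurable
    also have "emeasure lborel (slab i p (2 * r * (1/2) ^ k)) = ennreal ((2 * (2 * r * (1/2) ^ k)) ^ d)"
      using r d by (subst emeasure_slab) auto
    also have "(2 * (2 * r * (1/2) ^ k)) ^ d = (2 * r) ^ d * (2 * (1/2) ^ k) ^ d"
      by (simp only: power_mult_distrib[symmetric] mult_ac)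
    finally show "(\<integral>\<^sup>+w. young_conjugate A (a k) * indicator (slab i p (2 * r * (1/2) ^ k)) w \<partial>lborel)
       = ennreal ((2 * r) ^ d) * (ennreal ((2 * (1/2) ^ k) ^ d) * young_conjugate A (a k))"
      using r by (simp add: ennreal_mult mult_ac)
  qed
  also have "\<dots> = ennreal ((2 * r) ^ d) * (\<Sum>k. ennreal ((2 * (1/2) ^ k) ^ d) * young_conjugate A (a k))"
    by (rule ennreal_suminf_cmult)
  also have "\<dots> \<le> ennreal ((2 * r) ^ d) * (ennreal (2 ^ (4 * d)) * young_pre CARD('n) A l)"
    using dyadic_sum_le_young_pre[OF d(2,1) l, of A] unfolding a_def by (intro mult_left_mono) auto
  finally have main: "ennreal l * (\<integral>\<^sup>+w. g w * indicator (slab i x r) w * \<kappa> w \<partial>lborel)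
     \<le> face_int F i x r c + ennreal ((2 * r) ^ d) * (ennreal (2 ^ (4 * d)) * young_pre CARD('n) A l)"
    by (simp add: face_int_def add_left_mono)
  have "(\<integral>\<^sup>+z. ennreal \<bar>v (upd z i c) - v p\<bar> * indicator (slab i x r) z \<partial>lborel)
     \<le> ennreal (2 * r * real CARD('n)) * (\<integral>\<^sup>+w. g w * indicator (slab i x r) w * \<kappa> w \<partial>lborel)"
    unfolding g_def \<kappa>_def N_def using r by (intro face_potential[OF v G p d(1)]) auto
  then have "ennreal l * (\<integral>\<^sup>+z. ennreal \<bar>v (upd z i c) - v p\<bar> * indicator (slab i x r) z \<partial>lborel)
     \<le> ennreal l * (ennreal (2 * r * real CARD('n)) * (\<integral>\<^sup>+w. g w * indicator (slab i x r) w * \<kappa> w \<partial>lborel))"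
    by (rule mult_left_mono) simp
  also have "\<dots> = ennreal (2 * r * real CARD('n)) * (ennreal l * (\<integral>\<^sup>+w. g w * indicator (slab i x r) w * \<kappa> w \<partial>lborel))"
    by (simp add: mult_ac)
  also have "\<dots> \<le> ennreal (2 * r * real CARD('n)) * (face_int F i x r c +
        ennreal ((2 * r) ^ d) * (ennreal (2 ^ (4 * d)) * young_pre CARD('n) A l))"
    by (rule mult_left_mono[OF main]) simp
  finally show ?thesis .
qed

text \<open>Averaging the triangle inequality through a variable point z of the face bounds the
  increment by two potentials, based at \<open>p\<close> and at \<open>q\<close>. The result holds
  for every \<open>l\<close>, so \<open>young_conjugate_leI\<close> with c = 2^(4 d) converts it
  into a bound on A_{n-1}.\<close>

lemma face_osc_ge3:
  fixes v :: "real^'n \<Rightarrow> real" and G :: "real^'n \<Rightarrow> real^'n" and F :: "real^'n \<Rightarrow> ennreal"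
  assumes v: "\<And>w. (v has_derivative (\<lambda>h. G w \<bullet> h)) (at w)" and G: "continuous_on UNIV G"
    and F[measurable]: "F \<in> borel_measurable borel"
    and p: "p $ i = c" "\<And>j. j \<noteq> i \<Longrightarrow> \<bar>p $ j - x $ j\<bar> \<le> r"
    and q: "q $ i = c" "\<And>j. j \<noteq> i \<Longrightarrow> \<bar>q $ j - x $ j\<bar> \<le> r"
    and d: "CARD('n) = Suc d" "2 \<le> d" and r: "0 < r"
    and young: "\<And>w \<tau>. w $ i = c \<Longrightarrow> (\<And>j. j \<noteq> i \<Longrightarrow> \<bar>w $ j - x $ j\<bar> \<le> r) \<Longrightarrow> 0 < \<tau> \<Longrightarrow>
      ennreal (\<tau> * norm (G w)) \<le> F w + young_conjugate A \<tau>"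
  shows "young_conjugate (young_pre CARD('n) A) (\<bar>v p - v q\<bar> / (4 * r * real CARD('n)) / 2 ^ (4 * d))
    \<le> ennreal (1 / (2 * r) ^ d) * face_int F i x r c"
proof (rule young_conjugate_leI)
  fix l :: real assume l: "0 < l"
  define J where "J = face_int F i x r c"
  define B where "B = young_pre CARD('n) A l"
  define n where "n = real CARD('n)"
  have n: "n > 0" by (simp add: n_def)
  define R where "R = (2 * r) ^ d"
  have R: "R > 0" using r by (simp add: R_def)
  have [measurable]: "v \<in> borel_measurable borel"
    using v by (intro borel_measurable_continuous_onI)
      (auto simp: continuous_on_eq_continuous_within intro!: has_derivative_continuous)
  define I where "I = (\<lambda>p. \<integral>\<^sup>+z. ennreal \<bar>v (upd z i c) - v p\<bar> * indicator (slab i x r) z \<partial>lborel)"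
  have Ip: "ennreal l * I p \<le> ennreal (2 * r * n) * (J + ennreal R * (ennreal (2 ^ (4 * d)) * B))"
    unfolding I_def n_def J_def R_def B_def
    by (rule face_potential_le_young[OF v G F p d r l young])
  have Iq: "ennreal l * I q \<le> ennreal (2 * r * n) * (J + ennreal R * (ennreal (2 ^ (4 * d)) * B))"
    unfolding I_def n_def J_def R_def B_def
    by (rule face_potential_le_young[OF v G F q d r l young])
  have "ennreal \<bar>v p - v q\<bar> * ennreal R = (\<integral>\<^sup>+z. ennreal \<bar>v p - v q\<bar> * indicator (slab i x r) z \<partial>lborel)"
    using r d by (subst nn_integral_cmult_indicator) (auto simp: emeasure_slab R_def)
  also have "\<dots> \<le> (\<integral>\<^sup>+z. ennreal \<bar>v (upd z i c) - v p\<bar> * indicator (slab i x r) z + ennreal \<bar>v (upd z i c) - v q\<bar> * indicator (slab i x r) z \<partial>lborel)"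
    by (intro nn_integral_mono) (auto simp: ennreal_plus[symmetric] simp del: ennreal_plus intro!: ennreal_leI split: split_indicator)
  also have "\<dots> = I p + I q"
    unfolding I_def by (rule nn_integral_add) measurable
  finally have osc: "ennreal \<bar>v p - v q\<bar> * ennreal R \<le> I p + I q" .
  \<comment> \<open>The factor 4 r n is twice 2 r n: two end points, each contributing the bound 2 r
    n on the length of the segments. Division by \<open>R\<close>, the measure of the face, makes
    the energy a mean up to a constant.\<close>
  have "ennreal (l * (\<bar>v p - v q\<bar> / (4 * r * n))) = ennreal (1 / (4 * r * n * R)) * (ennreal l * (ennreal \<bar>v p - v q\<bar> * ennreal R))"
    using l r n R by (simp add: ennreal_mult[symmetric] field_simps)
  also have "\<dots> \<le> ennreal (1 / (4 * r * n * R)) * (ennreal l * (I p + I q))"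
    by (intro mult_left_mono osc) auto
  also have "\<dots> \<le> ennreal (1 / (4 * r * n * R)) * (2 * (ennreal (2 * r * n) * (J + ennreal R * (ennreal (2 ^ (4 * d)) * B))))"
    using add_mono[OF Ip Iq] unfolding distrib_left[symmetric, of "ennreal l"] mult_2[symmetric]
    by (rule mult_left_mono) simp
  also have "\<dots> = (ennreal (1 / (4 * r * n * R)) * 2 * ennreal (2 * r * n)) * (J + ennreal R * (ennreal (2 ^ (4 * d)) * B))"
    by (simp only: mult.assoc)
  also have "ennreal (1 / (4 * r * n * R)) * 2 * ennreal (2 * r * n) = ennreal (1 / R)"
  proof -
    have e: "ennreal a * ennreal 2 * ennreal b = ennreal (a * 2 * b)" if "0 \<le> a" "0 \<le> b" for a b :: real
      using that by (simp add: ennreal_mult)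
    have "ennreal (1 / (4 * r * n * R)) * ennreal 2 * ennreal (2 * r * n) = ennreal (1 / (4 * r * n * R) * 2 * (2 * r * n))"
      using r n R by (intro e) auto
    also have "1 / (4 * r * n * R) * 2 * (2 * r * n) = 1 / R" using r n R by (simp add: field_simps)
    finally show ?thesis by simp
  qed
  also have "ennreal (1 / R) * (J + ennreal R * (ennreal (2 ^ (4 * d)) * B)) = ennreal (1 / R) * J + (ennreal (1 / R) * ennreal R) * (ennreal (2 ^ (4 * d)) * B)"
    by (simp only: distrib_left mult.assoc)
  also have "ennreal (1 / R) * ennreal R = 1"
    using R by (simp add: ennreal_mult[symmetric])
  finally show "ennreal (l * (\<bar>v p - v q\<bar> / (4 * r * real CARD('n))))
      \<le> ennreal (1 / (2 * r) ^ d) * face_int F i x r c + ennreal (2 ^ (4 * d)) * young_pre CARD('n) A l"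
    by (simp add: n_def R_def J_def B_def)
qed (use r in auto)

text \<open>A face is now a segment, so there is no singular kernel: integrating the gradient along
  the face itself replaces the average over end points, and \<open>young_pre\<close> is just the
  conjugate of \<open>A\<close>.\<close>

lemma face_osc_eq2:
  fixes v :: "real^'n \<Rightarrow> real" and G :: "real^'n \<Rightarrow> real^'n" and F :: "real^'n \<Rightarrow> ennreal"
  assumes v: "\<And>w. (v has_derivative (\<lambda>h. G w \<bullet> h)) (at w)" and G: "continuous_on UNIV G"
    and F[measurable]: "F \<in> borel_measurable borel"
    and p: "p $ i = c" "\<And>j. j \<noteq> i \<Longrightarrow> \<bar>p $ j - x $ j\<bar> \<le> r"
    and q: "q $ i = c" "\<And>j. j \<noteq> i \<Longrightarrow> \<bar>q $ j - x $ j\<bar> \<le> r"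
    and d: "CARD('n) = 2" and r: "0 < r"
    and young: "\<And>w \<tau>. w $ i = c \<Longrightarrow> (\<And>j. j \<noteq> i \<Longrightarrow> \<bar>w $ j - x $ j\<bar> \<le> r) \<Longrightarrow> 0 < \<tau> \<Longrightarrow>
      ennreal (\<tau> * norm (G w)) \<le> F w + young_conjugate A \<tau>"
  shows "young_conjugate (young_pre CARD('n) A) (\<bar>v p - v q\<bar> / (2 * r))
    \<le> ennreal (1 / (2 * r)) * face_int F i x r c"
proof -
  obtain k where k: "k \<noteq> i" "UNIV = {i, k}"
  proof -
    obtain a b :: 'n where ab: "UNIV = {a, b}" "a \<noteq> b" using d by (auto simp: card_2_iff)
    have "i \<in> {a, b}" using ab(1) by blast
    then consider "i = a" | "i = b" by blast
    then show ?thesis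
    proof cases
      case 1
      then show ?thesis using that[of b] ab by simp
    next
      case 2
      then show ?thesis using that[of a] ab by (simp add: insert_commute)
    qed
  qed
  have eq_upd: "w = upd p k (w $ k)" if "w $ i = c" for w
  proof -
    have "w $ j = upd p k (w $ k) $ j" for j
    proof -
      have "j \<in> {i, k}" using k(2) by blast
      then show ?thesis using that p(1) k(1) by auto
    qed
    then show ?thesis unfolding vec_eq_iff by blast
  qed
  define g where "g = (\<lambda>s. ennreal (norm (G (upd p k s))))"
  have [measurable]: "g \<in> borel_measurable borel"
    unfolding g_def by (rule measurable_ennreal_norm_comp[OF G]) measurable
  define a where "a = p $ k" define b where "b = q $ k"
  have ab: "\<bar>a - x $ k\<bar> \<le> r" "\<bar>b - x $ k\<bar> \<le> r" using p(2)[OF k(1)] q(2)[OF k(1)] by (auto simp: a_def b_def)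
  have le1: "ennreal \<bar>v p - v q\<bar> \<le> (\<integral>\<^sup>+s. g s * indicator {s. \<bar>s - x $ k\<bar> < r} s \<partial>lborel)"
  proof (cases "a = b")
    case True
    then have "p = q" using eq_upd[OF p(1)] eq_upd[OF q(1)] by (simp add: a_def b_def)
    then show ?thesis by simp
  next
    case False
    have seg: "p + t *\<^sub>R (q - p) = upd p k (a + (b - a) * t)" for t
    proof -
      have "(p + t *\<^sub>R (q - p)) $ i = c" using p(1) q(1) by simp
      from eq_upd[OF this] show ?thesis by (simp add: a_def b_def mult.commute)
    qed
    have "norm (q - p) \<le> (\<Sum>j\<in>UNIV. \<bar>(q - p) $ j\<bar>)" by (rule norm_le_l1_cart)
    also have "\<dots> = \<bar>b - a\<bar>"
      unfolding k(2) using k(1) p(1) q(1) by (simp add: a_def b_def)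
    finally have nrm: "norm (q - p) \<le> \<bar>b - a\<bar>" .
    have "ennreal \<bar>v p - v q\<bar> = ennreal \<bar>v q - v p\<bar>" by (simp add: abs_minus_commute)
    also have "\<dots> \<le> ennreal (norm (q - p)) * (\<integral>\<^sup>+t. g (a + (b - a) * t) * indicator {0<..<1} t \<partial>lborel)"
      using ftc_norm_bound[OF v G, of q p] by (simp add: seg g_def)
    also have "\<dots> \<le> ennreal \<bar>b - a\<bar> * (\<integral>\<^sup>+t. g (a + (b - a) * t) * indicator {0<..<1} t \<partial>lborel)"
      by (intro mult_right_mono ennreal_leI nrm) auto
    also have "\<dots> \<le> ennreal \<bar>b - a\<bar> * (\<integral>\<^sup>+t. g (a + (b - a) * t) * indicator {s. \<bar>s - x $ k\<bar> < r} (a + (b - a) * t) \<partial>lborel)"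
    proof (rule mult_left_mono, rule nn_integral_mono)
      fix t
      have "\<bar>a + (b - a) * t - x $ k\<bar> < r" if t: "0 < t" "t < 1"
      proof -
        have e: "a + (b - a) * t - x $ k = (1 - t) * (a - x $ k) + t * (b - x $ k)" by (simp add: algebra_simps)
        \<comment> \<open>As the end points differ, the smaller one is below the upper end of the
          face and the larger one above its lower end. Proper convex combinations are therefore
          strictly inside.\<close>
        have "a - x $ k \<noteq> b - x $ k" using False by simp
        then consider "a - x $ k < r" "- r < b - x $ k" "b - x $ k < r \<or> a - x $ k < r" | "b - x $ k < r" "- r < a - x $ k"
          using ab by linarith
        then have "(1 - t) * (a - x $ k) + t * (b - x $ k) < r \<and> - r < (1 - t) * (a - x $ k) + t * (b - x $ k)"
        proof cases
          case 1
          have "(1 - t) * (a - x $ k) + t * (b - x $ k) < (1 - t) * r + t * r"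
            using 1 ab t by (intro add_less_le_mono mult_strict_left_mono mult_left_mono) auto
          moreover have "(1 - t) * (- r) + t * (- r) < (1 - t) * (a - x $ k) + t * (b - x $ k)"
            using 1 ab t by (intro add_le_less_mono mult_strict_left_mono mult_left_mono) auto
          ultimately show ?thesis by (simp add: algebra_simps)
        next
          case 2
          have "(1 - t) * (a - x $ k) + t * (b - x $ k) < (1 - t) * r + t * r"
            using 2 ab t by (intro add_le_less_mono mult_strict_left_mono mult_left_mono) auto
          moreover have "(1 - t) * (- r) + t * (- r) < (1 - t) * (a - x $ k) + t * (b - x $ k)"
            using 2 ab t by (intro add_less_le_mono mult_strict_left_mono mult_left_mono) auto
          ultimately show ?thesis by (simp add: algebra_simps)
        qed
        then show ?thesis unfolding e by (simp add: abs_less_iff)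
      qed
      then show "g (a + (b - a) * t) * indicator {0<..<1} t
          \<le> g (a + (b - a) * t) * indicator {s. \<bar>s - x $ k\<bar> < r} (a + (b - a) * t)"
        by (auto split: split_indicator)
    qed simp
    also have "\<dots> = (\<integral>\<^sup>+s. g s * indicator {s. \<bar>s - x $ k\<bar> < r} s \<partial>lborel)"
      using False by (subst nn_integral_real_affine[of "\<lambda>s. g s * indicator {s. \<bar>s - x $ k\<bar> < r} s" "b - a" a]) auto
    finally show ?thesis .
  qed
  have le2: "(\<integral>\<^sup>+s. g s * indicator {s. \<bar>s - x $ k\<bar> < r} s \<partial>lborel)
      = (\<integral>\<^sup>+y. ennreal (norm (G (upd y i c))) * indicator (slab i x r) y \<partial>lborel)"
  proof -
    have [measurable]: "(\<lambda>y. ennreal (norm (G (upd y i c)))) \<in> borel_measurable borel"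
      by (rule measurable_ennreal_norm_comp[OF G]) measurable
    have "(\<integral>\<^sup>+y. ennreal (norm (G (upd y i c))) * indicator (slab i x r) y \<partial>lborel)
      = (\<integral>\<^sup>+s. \<integral>\<^sup>+y. (ennreal (norm (G (upd (upd y k s) i c))) * indicator (slab i x r) (upd y k s))
           * indicator {0<..<1} (y $ k) \<partial>lborel \<partial>lborel)"
      by (rule nn_integral_slice[symmetric]) measurable
    \<comment> \<open>Slicing in direction \<open>k\<close> makes \<open>y $ k\<close> a second
      dummy variable. Together the two dummies range over the unit square, written as a slab of half
      side 1/2 about the point with all coordinates 1/2; its measure is 1.\<close>
    also have "\<dots> = (\<integral>\<^sup>+s. \<integral>\<^sup>+y. g s * indicator {s. \<bar>s - x $ k\<bar> < r} s * indicator (slab i (\<chi> j. 1/2) (1/2)) y \<partial>lborel \<partial>lborel)"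
    proof (intro nn_integral_cong)
      fix s and y :: "real^'n"
      have u: "upd (upd y k s) i c = upd p k s"
        using eq_upd[of "upd (upd y k s) i c"] k(1) by simp
      have ball: "(\<forall>j. j \<noteq> i \<longrightarrow> P j) \<longleftrightarrow> P k" for P
        using k by (metis UNIV_I insertE singletonD)
      have "upd y k s \<in> slab i x r \<and> y $ k \<in> {0<..<1} \<longleftrightarrow> \<bar>s - x $ k\<bar> < r \<and> y \<in> slab i (\<chi> j. 1/2) (1/2)"
      proof -
        have "\<bar>y $ k - 1/2\<bar> < 1/2 \<longleftrightarrow> 0 < y $ k \<and> y $ k < 1"
          unfolding abs_less_iff by (intro iffI conjI; linarith)
        then show ?thesis
          unfolding slab_def mem_Collect_eq ball using k(1) by auto
      qed
      then show "(ennreal (norm (G (upd (upd y k s) i c))) * indicator (slab i x r) (upd y k s)) * indicator {0<..<1} (y $ k)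
          = g s * indicator {s. \<bar>s - x $ k\<bar> < r} s * indicator (slab i (\<chi> j. 1/2) (1/2)) y"
        unfolding u g_def by (auto simp: indicator_def)
    qed
    also have "\<dots> = (\<integral>\<^sup>+s. g s * indicator {s. \<bar>s - x $ k\<bar> < r} s * emeasure lborel (slab i ((\<chi> j. 1/2) :: real^'n) (1/2)) \<partial>lborel)"
      by (rule nn_integral_cong, rule nn_integral_cmult_indicator) simp
    also have "\<dots> = (\<integral>\<^sup>+s. g s * indicator {s. \<bar>s - x $ k\<bar> < r} s \<partial>lborel)"
      by (simp add: emeasure_slab)
    finally show ?thesis by simp
  qed
  have "young_conjugate (young_pre CARD('n) A) (\<bar>v p - v q\<bar> / (2 * r) / 1)
    \<le> ennreal (1 / (2 * r)) * face_int F i x r c"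
  proof (rule young_conjugate_leI)
    fix l :: real assume l: "0 < l"
    have [measurable]: "(\<lambda>y. ennreal (norm (G (upd y i c)))) \<in> borel_measurable borel"
      by (rule measurable_ennreal_norm_comp[OF G]) measurable
    have "ennreal (l * \<bar>v p - v q\<bar>) = ennreal l * ennreal \<bar>v p - v q\<bar>" using l by (simp add: ennreal_mult)
    also have "\<dots> \<le> ennreal l * (\<integral>\<^sup>+y. ennreal (norm (G (upd y i c))) * indicator (slab i x r) y \<partial>lborel)"
      using le1 unfolding le2 by (rule mult_left_mono) simp
    also have "\<dots> = (\<integral>\<^sup>+y. ennreal l * (ennreal (norm (G (upd y i c))) * indicator (slab i x r) y) \<partial>lborel)"
      by (rule nn_integral_cmult[symmetric]) measurable
    also have "\<dots> \<le> (\<integral>\<^sup>+y. F (upd y i c) * indicator (slab i x r) y + young_conjugate A l * indicator (slab i x r) y \<partial>lborel)"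
    proof (intro nn_integral_mono)
      fix y
      have "ennreal (l * norm (G (upd y i c))) \<le> F (upd y i c) + young_conjugate A l" if "y \<in> slab i x r"
        using that l by (intro young) (auto simp: slab_def)
      then show "ennreal l * (ennreal (norm (G (upd y i c))) * indicator (slab i x r) y)
          \<le> F (upd y i c) * indicator (slab i x r) y + young_conjugate A l * indicator (slab i x r) y"
        using l by (auto simp: ennreal_mult split: split_indicator)
    qed
    also have "\<dots> = face_int F i x r c + (\<integral>\<^sup>+y. young_conjugate A l * indicator (slab i x r) y \<partial>lborel)"
      unfolding face_int_def by (rule nn_integral_add) measurable
    also have "(\<integral>\<^sup>+y. young_conjugate A l * indicator (slab i x r) y \<partial>lborel) = young_conjugate A l * ennreal (2 * r)"
      using r d by (subst nn_integral_cmult_indicator) (auto simp: emeasure_slab)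
    finally have *: "ennreal (l * \<bar>v p - v q\<bar>) \<le> face_int F i x r c + young_conjugate A l * ennreal (2 * r)" .
    have "ennreal (l * (\<bar>v p - v q\<bar> / (2 * r))) = ennreal (1 / (2 * r)) * ennreal (l * \<bar>v p - v q\<bar>)"
      using l r by (simp add: ennreal_mult[symmetric])
    also have "\<dots> \<le> ennreal (1 / (2 * r)) * (face_int F i x r c + young_conjugate A l * ennreal (2 * r))"
      by (rule mult_left_mono[OF *]) simp
    also have "\<dots> = ennreal (1 / (2 * r)) * face_int F i x r c + (ennreal (1 / (2 * r)) * ennreal (2 * r)) * young_conjugate A l"
      by (simp only: distrib_left mult_ac)
    also have "ennreal (1 / (2 * r)) * ennreal (2 * r) = 1"
      using r by (simp add: ennreal_mult[symmetric])
    finally show "ennreal (l * (\<bar>v p - v q\<bar> / (2 * r)))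
        \<le> ennreal (1 / (2 * r)) * face_int F i x r c + ennreal 1 * young_pre CARD('n) A l"
      using d by (simp add: young_pre_def)
  qed (use r in auto)
  then show ?thesis by simp
qed

text \<open>Large enough for both cases: 2 is needed when n = 2, and 4 n 2^(4 (n - 1)) when n >=
  3.\<close>

definition osc_const :: "nat \<Rightarrow> real" where
  "osc_const n = 4 * real n * 2 ^ (4 * n)"

lemma face_osc:
  fixes v :: "real^'n \<Rightarrow> real" and G :: "real^'n \<Rightarrow> real^'n" and F :: "real^'n \<Rightarrow> ennreal"
  assumes v: "\<And>w. (v has_derivative (\<lambda>h. G w \<bullet> h)) (at w)" and G: "continuous_on UNIV G"
    and F[measurable]: "F \<in> borel_measurable borel"
    and p: "p $ i = c" "\<And>j. j \<noteq> i \<Longrightarrow> \<bar>p $ j - x $ j\<bar> \<le> r"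
    and q: "q $ i = c" "\<And>j. j \<noteq> i \<Longrightarrow> \<bar>q $ j - x $ j\<bar> \<le> r"
    and n: "2 \<le> CARD('n)" and r: "0 < r"
    and young: "\<And>w \<tau>. w $ i = c \<Longrightarrow> (\<And>j. j \<noteq> i \<Longrightarrow> \<bar>w $ j - x $ j\<bar> \<le> r) \<Longrightarrow> 0 < \<tau> \<Longrightarrow>
      ennreal (\<tau> * norm (G w)) \<le> F w + young_conjugate A \<tau>"
  shows "young_conjugate (young_pre CARD('n) A) (\<bar>v p - v q\<bar> / (osc_const CARD('n) * r))
    \<le> ennreal (1 / (2 * r) ^ (CARD('n) - 1)) * face_int F i x r c"
proof (cases "CARD('n) = 2")
  case True
  have "\<bar>v p - v q\<bar> / (osc_const CARD('n) * r) \<le> \<bar>v p - v q\<bar> / (2 * r)"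
    using r True by (intro divide_left_mono mult_right_mono) (auto simp: osc_const_def)
  then have "young_conjugate (young_pre CARD('n) A) (\<bar>v p - v q\<bar> / (osc_const CARD('n) * r))
     \<le> young_conjugate (young_pre CARD('n) A) (\<bar>v p - v q\<bar> / (2 * r))"
    by (rule young_conjugate_mono)
  also have "\<dots> \<le> ennreal (1 / (2 * r)) * face_int F i x r c"
    by (rule face_osc_eq2[OF v G F p q True r young])
  finally show ?thesis using True by simp
next
  case False
  then obtain d where d: "CARD('n) = Suc d" "2 \<le> d"
    using n that[of "CARD('n) - 1"] by simp
  have "\<bar>v p - v q\<bar> / (osc_const CARD('n) * r) \<le> \<bar>v p - v q\<bar> / (4 * r * real CARD('n) * 2 ^ (4 * d))"
  proof -
    have "(2::real) ^ (4 * d) \<le> 2 ^ (4 * CARD('n))" using d by (intro power_increasing) auto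
    then have "4 * r * real CARD('n) * 2 ^ (4 * d) \<le> 4 * r * real CARD('n) * 2 ^ (4 * CARD('n))"
      using r by (intro mult_left_mono) auto
    also have "\<dots> = osc_const CARD('n) * r" by (simp add: osc_const_def)
    finally show ?thesis using r by (intro divide_left_mono) (auto simp: osc_const_def)
  qed
  then have "young_conjugate (young_pre CARD('n) A) (\<bar>v p - v q\<bar> / (osc_const CARD('n) * r))
     \<le> young_conjugate (young_pre CARD('n) A) (\<bar>v p - v q\<bar> / (4 * r * real CARD('n)) / 2 ^ (4 * d))"
    by (intro young_conjugate_mono) simp
  also have "\<dots> \<le> ennreal (1 / (2 * r) ^ d) * face_int F i x r c"
    by (rule face_osc_ge3[OF v G F p q d r young])
  finally show ?thesis using d by simp
qed

section \<open>From one face to the whole boundary\<close>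

definition on_face :: "real^'n \<Rightarrow> real \<Rightarrow> 'n \<Rightarrow> real \<Rightarrow> (real^'n) set" where
  "on_face x r i s = {p. p $ i = x $ i + s * r \<and> (\<forall>j. \<bar>p $ j - x $ j\<bar> \<le> r)}"

definition bd_int :: "(real^'n \<Rightarrow> ennreal) \<Rightarrow> real^'n \<Rightarrow> real \<Rightarrow> ennreal" where
  "bd_int F x r = (\<Sum>i\<in>UNIV. \<Sum>s\<in>{1, -1}. face_int F i x r (x $ i + s * r))"

text \<open>Two boundary points are joined through at most three faces, hence the factor 3. Faces of
  different axes meet, so one common point suffices; for equal axes the path passes through a face
  orthogonal to another axis.\<close>

lemma boundary_osc:
  fixes v :: "real^'n \<Rightarrow> real" and G :: "real^'n \<Rightarrow> real^'n" and F :: "real^'n \<Rightarrow> ennreal"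
  assumes v: "\<And>w. (v has_derivative (\<lambda>h. G w \<bullet> h)) (at w)" and G: "continuous_on UNIV G"
    and F[measurable]: "F \<in> borel_measurable borel"
    and p: "p \<in> on_face x r i s" "s \<in> {1, -1}" and q: "q \<in> on_face x r j s'" "s' \<in> {1, -1}"
    and n: "2 \<le> CARD('n)" and r: "0 < r"
    and young: "\<And>w \<tau>. (\<And>j. \<bar>w $ j - x $ j\<bar> \<le> r) \<Longrightarrow> 0 < \<tau> \<Longrightarrow>
      ennreal (\<tau> * norm (G w)) \<le> F w + young_conjugate A \<tau>"
  shows "young_conjugate (young_pre CARD('n) A) (\<bar>v p - v q\<bar> / (3 * osc_const CARD('n) * r))
    \<le> ennreal (1 / (2 * r) ^ (CARD('n) - 1)) * bd_int F x r"
proof -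
  define K where "K = osc_const CARD('n)"
  have K: "K > 0" by (simp add: K_def osc_const_def)
  define X where "X = ennreal (1 / (2 * r) ^ (CARD('n) - 1)) * bd_int F x r"
  have one: "young_conjugate (young_pre CARD('n) A) (\<bar>v a - v b\<bar> / (K * r)) \<le> X"
    if a: "a \<in> on_face x r i s" and b: "b \<in> on_face x r i s" and s: "s \<in> {1, -1}" for a b i s
  proof -
    have "young_conjugate (young_pre CARD('n) A) (\<bar>v a - v b\<bar> / (K * r))
      \<le> ennreal (1 / (2 * r) ^ (CARD('n) - 1)) * face_int F i x r (x $ i + s * r)"
      unfolding K_def
    proof (rule face_osc[OF v G F _ _ _ _ n r])
      show "ennreal (\<tau> * norm (G w)) \<le> F w + young_conjugate A \<tau>"
        if "w $ i = x $ i + s * r" "\<And>j. j \<noteq> i \<Longrightarrow> \<bar>w $ j - x $ j\<bar> \<le> r" "0 < \<tau>" for w \<tau>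
      proof (rule young[OF _ that(3)])
        show "\<bar>w $ j - x $ j\<bar> \<le> r" for j
          using that(1,2) s r by (cases "j = i") (auto simp: abs_mult)
      qed
    qed (use a b in \<open>auto simp: on_face_def\<close>)
    also have "\<dots> \<le> X"
      unfolding X_def bd_int_def
    proof (intro mult_left_mono)
      have "face_int F i x r (x $ i + s * r) \<le> (\<Sum>s\<in>{1, -1}. face_int F i x r (x $ i + s * r))"
        by (rule member_le_sum[OF s]) auto
      also have "\<dots> \<le> (\<Sum>i\<in>UNIV. \<Sum>s\<in>{1, -1}. face_int F i x r (x $ i + s * r))"
        by (rule member_le_sum[where f = "\<lambda>i. \<Sum>s\<in>{1, -1}. face_int F i x r (x $ i + s * r)"]) auto
      finally show "face_int F i x r (x $ i + s * r) \<le> \<dots>" .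
    qed simp
    finally show ?thesis .
  qed
  obtain a b k t where ab: "a \<in> on_face x r i s" "a \<in> on_face x r k t" "b \<in> on_face x r k t" "b \<in> on_face x r j s'" "t \<in> {1, -1}"
  proof (cases "i = j")
    case False
    have "upd p j (q $ j) \<in> on_face x r i s" "upd p j (q $ j) \<in> on_face x r j s'"
      using p q False by (auto simp: on_face_def)
    then show ?thesis using that[of "upd p j (q $ j)" j s' "upd p j (q $ j)"] q(2) by blast
  next
    case True
    obtain k where k: "k \<noteq> i"
    proof -
      have "\<exists>j. j \<noteq> i"
      proof (rule ccontr)
        assume "\<not> (\<exists>j. j \<noteq> i)"
        then have "(UNIV :: 'n set) = {i}" by auto
        then have "CARD('n) = card {i}" by (rule arg_cong)
        then show False using n by simp
      qed
      then show ?thesis using that by blast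
    qed
    have "upd p k (x $ k + r) \<in> on_face x r i s" "upd p k (x $ k + r) \<in> on_face x r k 1"
      "upd q k (x $ k + r) \<in> on_face x r k 1" "upd q k (x $ k + r) \<in> on_face x r j s'"
      using p q True k r by (auto simp: on_face_def)
    then show ?thesis using that[of "upd p k (x $ k + r)" k 1 "upd q k (x $ k + r)"] by blast
  qed
  \<comment> \<open>The conjugate bound is known for each of the three increments, hence for the
    largest one, and that is at least a third of the total increment.\<close>
  define m where "m = max \<bar>v p - v a\<bar> (max \<bar>v a - v b\<bar> \<bar>v b - v q\<bar>)"
  have "young_conjugate (young_pre CARD('n) A) (m / (K * r)) \<le> X"
    unfolding m_def max_def
    using one[OF p(1) ab(1) p(2)] one[OF ab(2,3,5)] one[OF ab(4) q(1) q(2)] by auto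
  moreover have "\<bar>v p - v q\<bar> / (3 * K * r) \<le> m / (K * r)"
  proof -
    have "\<bar>v p - v a\<bar> \<le> m" "\<bar>v a - v b\<bar> \<le> m" "\<bar>v b - v q\<bar> \<le> m" by (simp_all add: m_def)
    then have "\<bar>v p - v q\<bar> \<le> 3 * m" by linarith
    then have "\<bar>v p - v q\<bar> / (3 * K * r) \<le> (3 * m) / (3 * K * r)"
      using K r by (intro divide_right_mono) auto
    then show ?thesis by simp
  qed
  ultimately show ?thesis
    unfolding X_def K_def by (meson order_trans young_conjugate_mono)
qed

section \<open>Smooth functions\<close>

lemma partial_deriv_eq:
  assumes "(f has_derivative D) (at x)"
  shows "partial_deriv i f x = D (axis i 1)"
  using frechet_derivative_at[OF assms] by (simp add: partial_deriv_def)

lemma linear_axis_sum: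
  fixes D :: "real^'n \<Rightarrow> real"
  assumes "linear D"
  shows "D h = (\<chi> i. D (axis i 1)) \<bullet> h"
proof -
  have "D h = D (\<Sum>i\<in>UNIV. (h $ i) *\<^sub>R axis i 1)"
    by (subst basis_expansion[of h, symmetric]) (simp add: scalar_mult_eq_scaleR)
  also have "\<dots> = (\<Sum>i\<in>UNIV. (h $ i) * D (axis i 1))"
    using assms by (simp add: linear_sum linear_cmul)
  finally show ?thesis by (simp add: inner_vec_def mult.commute)
qed

lemma has_derivative_gradient:
  assumes "f differentiable (at x)"
  shows "(f has_derivative (\<lambda>h. gradient f x \<bullet> h)) (at x)"
proof -
  have D: "(f has_derivative frechet_derivative f (at x)) (at x)"
    using assms by (simp add: frechet_derivative_works)
  then have "linear (frechet_derivative f (at x))" by (rule has_derivative_linear)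
  then have "frechet_derivative f (at x) = (\<lambda>h. gradient f x \<bullet> h)"
    unfolding gradient_def partial_deriv_def using linear_axis_sum by blast
  then show ?thesis using D by simp
qed

lemma partial_deriv_of_gradient:
  assumes "(f has_derivative (\<lambda>h. G \<bullet> h)) (at x)"
  shows "partial_deriv i f x = G $ i"
  by (simp add: partial_deriv_eq[OF assms] inner_axis)

lemma differentiable_on_UNIV_D: "f differentiable_on UNIV \<Longrightarrow> f differentiable (at x)"
  by (simp add: differentiable_on_def)

lemma C_k_continuous: "C_k k f \<Longrightarrow> continuous_on UNIV f"
  by (cases k) (auto intro: differentiable_imp_continuous_on)

lemma C_k_SucD: "C_k (Suc k) f \<Longrightarrow> C_k k f"
proof (induction k arbitrary: f)
  case 0
  then show ?case by (auto intro: differentiable_imp_continuous_on)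
qed auto

lemma C_k_const: "C_k k (\<lambda>x. c)"
proof (induction k arbitrary: c)
  case (Suc k)
  have "partial_deriv i (\<lambda>x. c) = (\<lambda>x. 0)" for i :: 'a
    by (auto simp: fun_eq_iff partial_deriv_eq[OF has_derivative_const])
  then show ?case using Suc by (simp add: differentiable_on_const)
qed simp

lemma C_k_nth: "C_k k (\<lambda>x :: real^'n. x $ j)"
proof (cases k)
  case (Suc m)
  have D: "((\<lambda>x. x $ j) has_derivative (\<lambda>h. h $ j)) (at x)" for x :: "real^'n"
    by (rule bounded_linear.has_derivative[OF bounded_linear_vec_nth has_derivative_ident])
  then have "partial_deriv i (\<lambda>x. x $ j) = (\<lambda>x. axis i 1 $ j)" for i :: 'n
    by (auto simp: fun_eq_iff partial_deriv_eq[OF D])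
  moreover have "(\<lambda>x :: real^'n. x $ j) differentiable_on UNIV"
    unfolding differentiable_on_def differentiable_def using D by blast
  ultimately show ?thesis by (simp add: Suc C_k_const)
qed (simp add: continuous_on_component continuous_on_id)

lemma C_k_add: "C_k k f \<Longrightarrow> C_k k g \<Longrightarrow> C_k k (\<lambda>x. f x + g x)"
proof (induction k arbitrary: f g)
  case (Suc k)
  have "partial_deriv i (\<lambda>x. f x + g x) = (\<lambda>x. partial_deriv i f x + partial_deriv i g x)" for i
  proof
    fix x
    have "((\<lambda>x. f x + g x) has_derivative (\<lambda>h. (gradient f x + gradient g x) \<bullet> h)) (at x)"
      unfolding inner_add_left using Suc.prems
      by (intro has_derivative_add has_derivative_gradient differentiable_on_UNIV_D) auto
    then show "partial_deriv i (\<lambda>x. f x + g x) x = partial_deriv i f x + partial_deriv i g x"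
      by (simp add: partial_deriv_of_gradient gradient_def)
  qed
  then show ?case using Suc by (auto intro: differentiable_on_add)
qed (auto intro: continuous_on_add)

lemma partial_deriv_mult:
  assumes "f differentiable_on UNIV" "g differentiable_on UNIV"
  shows "partial_deriv i (\<lambda>x. f x * g x) = (\<lambda>x. f x * partial_deriv i g x + partial_deriv i f x * g x)"
proof
  fix x
  have "((\<lambda>x. f x * g x) has_derivative (\<lambda>h. f x * (gradient g x \<bullet> h) + (gradient f x \<bullet> h) * g x)) (at x)"
    using assms by (intro has_derivative_mult has_derivative_gradient differentiable_on_UNIV_D)
  then show "partial_deriv i (\<lambda>x. f x * g x) x = f x * partial_deriv i g x + partial_deriv i f x * g x"
    by (simp add: partial_deriv_eq gradient_def inner_axis)
qed

lemma C_k_mult: "C_k k f \<Longrightarrow> C_k k g \<Longrightarrow> C_k k (\<lambda>x. f x * g x)"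
proof (induction k arbitrary: f g)
  case (Suc k)
  then have "C_k k f" "C_k k g" by (blast intro: C_k_SucD)+
  then show ?case using Suc
    by (auto simp: partial_deriv_mult intro!: differentiable_on_mult C_k_add Suc.IH)
qed (auto intro: continuous_on_mult)

lemma C_k_sum: "finite I \<Longrightarrow> (\<And>j. j \<in> I \<Longrightarrow> C_k k (f j)) \<Longrightarrow> C_k k (\<lambda>x. \<Sum>j\<in>I. f j x)"
  by (induction I rule: finite_induct) (auto intro: C_k_const C_k_add)

lemma C_k_diff: "C_k k f \<Longrightarrow> C_k k g \<Longrightarrow> C_k k (\<lambda>x. f x - g x)"
  using C_k_add[of k f "\<lambda>x. (- 1) * g x"] C_k_mult[OF C_k_const[of k "- 1"], of g] by simp

lemma partial_deriv_compose:
  assumes \<phi>: "\<And>s. (\<phi> has_real_derivative \<phi>' s) (at s)" and f: "f differentiable (at x)"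
  shows "partial_deriv i (\<lambda>x. \<phi> (f x)) x = \<phi>' (f x) * partial_deriv i f x"
proof -
  have "((\<lambda>x. \<phi> (f x)) has_derivative (\<lambda>h. \<phi>' (f x) * (gradient f x \<bullet> h))) (at x)"
    using has_derivative_compose[OF has_derivative_gradient[OF f] has_field_derivative_imp_has_derivative[OF \<phi>]]
    by simp
  then show ?thesis by (simp add: partial_deriv_eq gradient_def inner_axis)
qed

text \<open>Stated for a whole sequence of successive derivatives, so that the chain rule leads back
  to the induction hypothesis with \<phi> shifted by one.\<close>

lemma C_k_compose:
  assumes \<phi>: "\<And>m s. (\<phi> m has_real_derivative \<phi> (Suc m) s) (at s)"
  shows "C_k k f \<Longrightarrow> C_k k (\<lambda>x. \<phi> m (f x))"
proof (induction k arbitrary: m)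
  case 0
  have "continuous_on UNIV (\<phi> m)"
    using \<phi> by (auto simp: continuous_on_eq_continuous_at intro: DERIV_isCont)
  then show ?case using 0 by (auto intro: continuous_on_compose2)
next
  case (Suc k)
  have df: "f differentiable (at x)" for x using Suc.prems by (auto intro: differentiable_on_UNIV_D)
  have "partial_deriv i (\<lambda>x. \<phi> m (f x)) = (\<lambda>x. \<phi> (Suc m) (f x) * partial_deriv i f x)" for i
    using partial_deriv_compose[OF \<phi> df] by blast
  moreover have "(\<lambda>x. \<phi> m (f x)) differentiable_on UNIV"
    unfolding differentiable_on_def differentiable_def
    using has_derivative_compose[OF has_derivative_gradient[OF df] has_field_derivative_imp_has_derivative[OF \<phi>]] by auto
  moreover have "C_k k (\<lambda>x. \<phi> (Suc m) (f x))" using Suc by (blast intro: C_k_SucD)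
  ultimately show ?case using Suc.prems by (auto intro!: C_k_mult)
qed

text \<open>The open sets \<open>Q\<close> and \<open>- L\<close> cover the space; on the first the
  extension is \<open>f\<close>, on the second it is 0. The derivative of \<open>f\<close> also
  vanishes on \<open>Q - L\<close>, so the induction applies to the partial derivatives.\<close>

lemma C_k_cutoff:
  fixes f :: "real^'n \<Rightarrow> real"
  assumes Q: "open Q" and L: "closed L" "L \<subseteq> Q"
  shows "(\<And>x. x \<in> Q - L \<Longrightarrow> f x = 0) \<Longrightarrow> C_k k f \<Longrightarrow> C_k k (\<lambda>x. if x \<in> Q then f x else 0)"
proof (induction k arbitrary: f)
  case 0
  have "continuous_on Q (\<lambda>x. if x \<in> Q then f x else 0)"
    using 0 by (subst continuous_on_cong[OF refl, of _ _ f]) (auto intro: continuous_on_subset)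
  moreover have "continuous_on (- L) (\<lambda>x. if x \<in> Q then f x else 0)"
    using 0 by (subst continuous_on_cong[OF refl, of _ _ "\<lambda>x. 0"]) auto
  moreover have "Q \<union> - L = UNIV" using L by blast
  ultimately show ?case
    using continuous_on_open_Un[OF Q open_Compl[OF L(1)]] by (metis C_k.simps(1))
next
  case (Suc k)
  define F where "F = (\<lambda>x. if x \<in> Q then f x else 0)"
  have df: "f differentiable (at x)" for x using Suc.prems by (auto intro: differentiable_on_UNIV_D)
  have D: "(F has_derivative (\<lambda>h. (if x \<in> Q then gradient f x else 0) \<bullet> h)) (at x)" for x
  proof (cases "x \<in> Q")
    case True
    show ?thesis
      by (rule has_derivative_transform_within_open[OF _ Q True, of f])
        (use True has_derivative_gradient[OF df] in \<open>auto simp: F_def\<close>)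
  next
    case False
    then have "x \<in> - L" using L by auto
    show ?thesis
      by (rule has_derivative_transform_within_open[OF _ _ \<open>x \<in> - L\<close>, of "\<lambda>x. 0"])
        (use False Suc.prems(1) L in \<open>auto simp: F_def open_Compl\<close>)
  qed
  have "partial_deriv i F = (\<lambda>x. if x \<in> Q then partial_deriv i f x else 0)" for i
    by (auto simp: fun_eq_iff partial_deriv_of_gradient[OF D] gradient_def)
  moreover have "C_k k (\<lambda>x. if x \<in> Q then partial_deriv i f x else 0)" for i
  proof (rule Suc.IH)
    fix x assume x: "x \<in> Q - L"
    have "(f has_derivative (\<lambda>h. 0)) (at x)"
      by (rule has_derivative_transform_within_open[OF _ _ x, of "\<lambda>x. 0"])
        (use Suc.prems(1) Q L in \<open>auto simp: open_Diff\<close>)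
    then show "partial_deriv i f x = 0" by (simp add: partial_deriv_eq)
  qed (use Suc.prems in auto)
  moreover have "F differentiable_on UNIV"
    using D unfolding differentiable_on_def differentiable_def by auto
  ultimately show ?case by (simp add: F_def)
qed

lemma gradient_cutoff:
  fixes f :: "real^'n \<Rightarrow> real"
  assumes "open Q" "x \<in> Q" "f differentiable (at x)"
  shows "gradient (\<lambda>x. if x \<in> Q then f x else 0) x = gradient f x"
proof -
  have "((\<lambda>x. if x \<in> Q then f x else 0) has_derivative (\<lambda>h. gradient f x \<bullet> h)) (at x)"
    by (rule has_derivative_transform_within_open[OF has_derivative_gradient[OF assms(3)] assms(1,2)]) auto
  then show ?thesis by (simp add: gradient_def vec_eq_iff partial_deriv_of_gradient)
qed

subsection \<open>The function \<open>exp (-1/x)\<close>\<close>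

text \<open>If a function equals P(1/x) exp(-1/x), its derivative is (1/x^2) (P - P')(1/x)
  exp(-1/x), which is the recursion for P. Thus \<open>flat m\<close> is the m-th derivative of
  exp(-1/x) extended by 0.\<close>

primrec flat_poly :: "nat \<Rightarrow> real poly" where
  "flat_poly 0 = 1"
| "flat_poly (Suc m) = [:0, 0, 1:] * (flat_poly m - pderiv (flat_poly m))"

definition flat :: "nat \<Rightarrow> real \<Rightarrow> real" where
  "flat m x = (if 0 < x then poly (flat_poly m) (1 / x) * exp (- 1 / x) else 0)"

lemma poly_mult_exp_tendsto_0:
  "((\<lambda>y. poly q y * exp (- y)) \<longlongrightarrow> (0::real)) at_top"
proof -
  have "((\<lambda>y. \<Sum>i\<le>degree q. coeff q i * (y ^ i / exp y)) \<longlongrightarrow> (\<Sum>i\<le>degree q. coeff q i * 0)) at_top"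
    by (intro tendsto_sum tendsto_mult tendsto_const tendsto_power_div_exp_0)
  then show ?thesis
    by (simp add: poly_altdef sum_distrib_right exp_minus divide_inverse mult.assoc)
qed

lemma flat_deriv: "(flat m has_real_derivative flat (Suc m) x) (at x)"
proof -
  consider "0 < x" | "x < 0" | "x = 0" by linarith
  then show ?thesis
  proof cases
    case 1
    have "((\<lambda>x. poly (flat_poly m) (1 / x) * exp (- 1 / x)) has_real_derivative
        poly (flat_poly m) (1 / x) * (exp (- 1 / x) * (1 / x ^ 2)) + (poly (pderiv (flat_poly m)) (1 / x) * (- 1 / x ^ 2)) * exp (- 1 / x)) (at x)"
    proof -
      have i1: "((\<lambda>x. 1 / x) has_real_derivative (- 1 / x ^ 2)) (at x)"
        using 1 by (auto intro!: derivative_eq_intros simp: power2_eq_square)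
      have i2: "((\<lambda>x. - 1 / x) has_real_derivative (1 / x ^ 2)) (at x)"
        using 1 by (auto intro!: derivative_eq_intros simp: power2_eq_square)
      show ?thesis
        by (rule DERIV_cong[OF DERIV_mult[OF DERIV_chain2[OF poly_DERIV i1] DERIV_chain2[OF DERIV_exp i2]]])
          (simp add: algebra_simps)
    qed
    also have "poly (flat_poly m) (1 / x) * (exp (- 1 / x) * (1 / x ^ 2)) + (poly (pderiv (flat_poly m)) (1 / x) * (- 1 / x ^ 2)) * exp (- 1 / x)
       = flat (Suc m) x"
      using 1 by (simp add: flat_def power2_eq_square algebra_simps)
    finally show ?thesis
      by (rule has_field_derivative_transform_within_open[where S = "{0<..}"]) (use 1 in \<open>auto simp: flat_def\<close>)
  next
    case 2
    have "((\<lambda>x. 0::real) has_real_derivative flat (Suc m) x) (at x)"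
      using 2 by (simp add: flat_def)
    then show ?thesis
      by (rule has_field_derivative_transform_within_open[where S = "{..<0}"]) (use 2 in \<open>auto simp: flat_def\<close>)
  next
    case 3
    have "((\<lambda>h. flat m h / h) \<longlongrightarrow> 0) (at_right 0)"
    proof -
      have "filterlim (\<lambda>h::real. 1 / h) at_top (at_right 0)"
        using filterlim_inverse_at_top_right by (simp add: inverse_eq_divide)
      \<comment> \<open>The extra factor \<open>[:0, 1:]\<close>, evaluated at 1/h, is the 1/h of
        the difference quotient at 0.\<close>
      then have "((\<lambda>h. poly ([:0, 1:] * flat_poly m) (1 / h) * exp (- (1 / h))) \<longlongrightarrow> 0) (at_right (0::real))"
        by (rule filterlim_compose[OF poly_mult_exp_tendsto_0])
      then show ?thesis
        by (rule Lim_transform_eventually)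
          (auto simp: flat_def eventually_at_filter)
    qed
    moreover have "((\<lambda>h. flat m h / h) \<longlongrightarrow> 0) (at_left 0)"
      by (rule tendsto_eventually) (auto simp: flat_def eventually_at_filter)
    ultimately have "((\<lambda>h. flat m h / h) \<longlongrightarrow> 0) (at 0)"
      by (simp add: filterlim_at_split)
    then show ?thesis
      using 3 by (simp add: has_field_derivative_iff flat_def)
  qed
qed

lemma flat_0_eq: "flat 0 x = (if 0 < x then exp (- 1 / x) else 0)"
  by (simp add: flat_def)

lemma flat_1_eq: "flat (Suc 0) x = (if 0 < x then exp (- 1 / x) / x\<^sup>2 else 0)"
  by (simp add: flat_def power2_eq_square pderiv_1)

section \<open>Mollification\<close>

lemma nn_integral_lborel_translate:
  fixes f :: "'a::euclidean_space \<Rightarrow> ennreal"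
  assumes [measurable]: "f \<in> borel_measurable borel"
  shows "(\<integral>\<^sup>+x. f (x + c) \<partial>lborel) = (\<integral>\<^sup>+x. f x \<partial>lborel)"
proof -
  have "(\<integral>\<^sup>+x. f x \<partial>lborel) = (\<integral>\<^sup>+x. f x \<partial>distr lborel borel ((+) c))"
    by (simp add: lborel_distr_plus)
  also have "\<dots> = (\<integral>\<^sup>+x. f (c + x) \<partial>lborel)"
    by (intro nn_integral_distr) auto
  finally show ?thesis by (simp add: add.commute)
qed

lemma nn_integral_lborel_reflect:
  fixes f :: "'a::euclidean_space \<Rightarrow> ennreal"
  assumes [measurable]: "f \<in> borel_measurable borel"
  shows "(\<integral>\<^sup>+x. f (c - x) \<partial>lborel) = (\<integral>\<^sup>+x. f x \<partial>lborel)"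
proof -
  have "lborel = distr lborel borel (\<lambda>x. c - x :: 'a)"
    using lborel_affine[of "-1" c] by (simp add: density_1)
  then have "(\<integral>\<^sup>+x. f x \<partial>lborel) = (\<integral>\<^sup>+x. f x \<partial>distr lborel borel (\<lambda>x. c - x))"
    by simp
  also have "\<dots> = (\<integral>\<^sup>+x. f (c - x) \<partial>lborel)"
    by (intro nn_integral_distr) auto
  finally show ?thesis by simp
qed

text \<open>Squeeze \<open>A\<close> between a compact \<open>K\<close> and an open \<open>U\<close>
  with small difference. A translation shorter than the distance from \<open>K\<close> to the
  complement of \<open>U\<close> keeps \<open>K\<close> inside \<open>U\<close>, and where the
  indicators of \<open>A\<close> and of its translate differ, one of the two points is in
  \<open>U\<close> and the other outside \<open>K\<close>.\<close>

lemma indicator_translation: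
  fixes A :: "'a::euclidean_space set"
  assumes A[measurable]: "A \<in> sets borel" and fin: "emeasure lborel A < \<infinity>" and e: "0 < e"
  shows "\<exists>\<delta>>0. \<forall>h. norm h < \<delta> \<longrightarrow>
    (\<integral>\<^sup>+x. ennreal \<bar>indicator A (x - h) - indicator A x\<bar> \<partial>lborel) \<le> ennreal e"
proof -
  obtain U where U: "open U" "A \<subseteq> U" "emeasure lborel (U - A) < ennreal (e / 4)"
    using outer_regular_lborel[OF A, of "e / 4"] e by auto
  obtain K where K: "compact K" "K \<subseteq> A" "emeasure lborel (A - K) \<le> ennreal (e / 4)"
  proof -
    \<comment> \<open>Lebesgue measure restricted to \<open>A\<close> is finite, so inner regularity
      is available for it.\<close>
    define M where "M = density lborel (indicator A :: 'a \<Rightarrow> ennreal)"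
    have M: "emeasure M B = emeasure lborel (A \<inter> B)" if [measurable]: "B \<in> sets borel" for B
      unfolding M_def by (subst emeasure_density) (auto simp: indicator_inter_arith[symmetric])
    have "emeasure M A = (SUP K \<in> {K. K \<subseteq> A \<and> compact K}. emeasure M K)"
      by (rule inner_regular) (use fin in \<open>auto simp: M M_def[symmetric]\<close>, auto simp: M_def M[unfolded M_def])
    then have sup: "emeasure lborel A = (SUP K \<in> {K. K \<subseteq> A \<and> compact K}. emeasure M K)"
      by (simp add: M)
    have "\<exists>K\<in>{K. K \<subseteq> A \<and> compact K}. emeasure lborel A < emeasure M K + ennreal (e / 4)"
      using e fin by (intro SUP_approx_ennreal[OF _ _ sup]) auto
    then obtain K where K: "K \<subseteq> A" "compact K" "emeasure lborel A < emeasure M K + ennreal (e / 4)" by auto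
    have [measurable]: "K \<in> sets borel" using K(2) by (simp add: borel_compact)
    have "emeasure M K = emeasure lborel K" using K(1) by (simp add: M Int_absorb1)
    moreover have "emeasure lborel (A - K) = emeasure lborel A - emeasure lborel K"
      using K fin emeasure_compact_finite[OF K(2)] by (intro emeasure_Diff) auto
    ultimately have "emeasure lborel (A - K) \<le> ennreal (e / 4)"
      using K(3) by (auto simp: ennreal_minus_le_iff)
    then show ?thesis using that K by blast
  qed
  have [measurable]: "U \<in> sets borel" "K \<in> sets borel" using U K by (auto simp: borel_compact)
  obtain \<delta> where \<delta>: "0 < \<delta>" "\<And>x y. x \<in> K \<Longrightarrow> y \<in> - U \<Longrightarrow> \<delta> \<le> dist x y"
  proof -
    have "\<exists>\<delta>>0. \<forall>x\<in>K. \<forall>y\<in>- U. \<delta> \<le> dist x y"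
      using K U by (intro separate_compact_closed) (auto simp: closed_Compl)
    then show ?thesis using that by blast
  qed
  have UK: "emeasure lborel (U - K) \<le> ennreal (e / 2)"
  proof -
    have "U - K = (U - A) \<union> (A - K)" using U K by blast
    then have "emeasure lborel (U - K) \<le> emeasure lborel (U - A) + emeasure lborel (A - K)"
      by (auto intro!: emeasure_subadditive)
    also have "\<dots> \<le> ennreal (e / 4) + ennreal (e / 4)" using U K by (intro add_mono) auto
    finally show ?thesis using e by (simp add: ennreal_plus[symmetric] del: ennreal_plus)
  qed
  have finK: "emeasure lborel K < \<infinity>" using K(1) by (rule emeasure_compact_finite)
  \<comment> \<open>As the translate of \<open>K\<close> lies in \<open>U\<close>, the integral is
    the measure of \<open>U\<close> minus that of \<open>K\<close>; \<open>finK\<close> permits the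
    cancellation.\<close>
  have diff: "(\<integral>\<^sup>+x. indicator U x * indicator (- K) (x - h) \<partial>lborel) \<le> ennreal (e / 2)" if h: "norm h < \<delta>" for h
  proof -
    have sub: "x + h \<in> U" if "x \<in> K" for x
    proof (rule ccontr)
      assume "x + h \<notin> U"
      then have "\<delta> \<le> dist x (x + h)" using \<delta>(2)[of x "x + h"] that by simp
      then show False using h by (simp add: dist_norm)
    qed
    have split: "indicator U x = indicator U x * indicator (- K) (x - h) + (indicator K (x - h) :: ennreal)" for x
      using sub[of "x - h"] by (auto split: split_indicator)
    have "(\<integral>\<^sup>+x. indicator K (x - h) \<partial>lborel) = emeasure lborel K"
      using nn_integral_lborel_translate[of "indicator K" "- h"] by simp
    moreover have "emeasure lborel U = (\<integral>\<^sup>+x. indicator U x * indicator (- K) (x - h) + indicator K (x - h) \<partial>lborel)"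
      by (subst split[symmetric]) simp
    then have "emeasure lborel U = (\<integral>\<^sup>+x. indicator U x * indicator (- K) (x - h) \<partial>lborel) + (\<integral>\<^sup>+x. indicator K (x - h) \<partial>lborel)"
      by (subst (asm) nn_integral_add) auto
    moreover have "emeasure lborel U = emeasure lborel (U - K) + emeasure lborel K"
    proof -
      have "U = (U - K) \<union> K" using U K by blast
      then show ?thesis by (subst plus_emeasure) auto
    qed
    ultimately show ?thesis using UK finK
      by (metis add.commute ennreal_add_left_cancel infinity_ennreal_def less_irrefl)
  qed
  show ?thesis
  proof (intro exI conjI allI impI)
    fix h :: 'a assume h: "norm h < \<delta>"
    have "(\<integral>\<^sup>+x. ennreal \<bar>indicator A (x - h) - indicator A x\<bar> \<partial>lborel)
      \<le> (\<integral>\<^sup>+x. indicator U x * indicator (- K) (x - h) + indicator U (x - h) * indicator (- K) x \<partial>lborel)"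
      using U(2) K(2) by (intro nn_integral_mono) (auto split: split_indicator)
    also have "\<dots> = (\<integral>\<^sup>+x. indicator U x * indicator (- K) (x - h) \<partial>lborel)
        + (\<integral>\<^sup>+x. indicator U (x - h) * indicator (- K) x \<partial>lborel)"
      by (rule nn_integral_add) measurable
    also have "(\<integral>\<^sup>+x. indicator U (x - h) * indicator (- K) x \<partial>lborel) = (\<integral>\<^sup>+x. indicator U x * indicator (- K) (x - (- h)) \<partial>lborel)"
      using nn_integral_lborel_translate[of "\<lambda>x. indicator U (x - h) * indicator (- K) x" h] by simp
    also have "(\<integral>\<^sup>+x. indicator U x * indicator (- K) (x - h) \<partial>lborel) + \<dots> \<le> ennreal (e / 2) + ennreal (e / 2)"
      using h by (intro add_mono diff) auto
    also have "\<dots> = ennreal e" using e by (simp add: ennreal_plus[symmetric] del: ennreal_plus)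
    finally show "(\<integral>\<^sup>+x. ennreal \<bar>indicator A (x - h) - indicator A x\<bar> \<partial>lborel) \<le> ennreal e" .
  qed (rule \<delta>)
qed

text \<open>Indicators, sums, and limits in the mean. In the limit case the two outer terms of the
  triangle inequality coincide by translation invariance, which explains the thirds of
  \<open>e\<close>.\<close>

lemma L1_translation:
  fixes f :: "'a::euclidean_space \<Rightarrow> real"
  assumes "integrable lborel f"
  shows "\<forall>e>0. \<exists>\<delta>>0. \<forall>h. norm h < \<delta> \<longrightarrow>
    (\<integral>\<^sup>+x. ennreal \<bar>f (x - h) - f x\<bar> \<partial>lborel) \<le> ennreal e"
  using assms
proof (induction rule: integrable_induct)
  case (base A c)
  then have [measurable]: "A \<in> sets borel" by simp
  show ?case
  proof (intro allI impI)
    fix e :: real assume e: "0 < e"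
    define e' where "e' = e / (\<bar>c\<bar> + 1)"
    have e': "0 < e'" using e by (simp add: e'_def add_nonneg_pos)
    obtain \<delta> where \<delta>: "0 < \<delta>" "\<And>h. norm h < \<delta> \<Longrightarrow>
        (\<integral>\<^sup>+x. ennreal \<bar>indicator A (x - h) - indicator A x\<bar> \<partial>lborel) \<le> ennreal e'"
      using indicator_translation[of A e'] base e' by auto
    show "\<exists>\<delta>>0. \<forall>h. norm h < \<delta> \<longrightarrow>
      (\<integral>\<^sup>+x. ennreal \<bar>indicator A (x - h) *\<^sub>R c - indicator A x *\<^sub>R c\<bar> \<partial>lborel) \<le> ennreal e"
    proof (intro exI conjI allI impI)
      fix h :: 'a assume h: "norm h < \<delta>"
      have "(\<integral>\<^sup>+x. ennreal \<bar>indicator A (x - h) *\<^sub>R c - indicator A x *\<^sub>R c\<bar> \<partial>lborel)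
         = (\<integral>\<^sup>+x. ennreal \<bar>c\<bar> * ennreal \<bar>indicator A (x - h) - indicator A x\<bar> \<partial>lborel)"
        by (intro nn_integral_cong) (simp add: ennreal_mult[symmetric] abs_mult[symmetric] algebra_simps)
      also have "\<dots> = ennreal \<bar>c\<bar> * (\<integral>\<^sup>+x. ennreal \<bar>indicator A (x - h) - indicator A x\<bar> \<partial>lborel)"
        by (rule nn_integral_cmult) measurable
      also have "\<dots> \<le> ennreal \<bar>c\<bar> * ennreal e'" by (intro mult_left_mono \<delta> h) simp
      also have "\<dots> = ennreal (\<bar>c\<bar> * e')" using e' by (simp add: ennreal_mult)
      also have "\<bar>c\<bar> * e' \<le> e" using e by (simp add: e'_def field_simps)
      finally show "(\<integral>\<^sup>+x. ennreal \<bar>indicator A (x - h) *\<^sub>R c - indicator A x *\<^sub>R c\<bar> \<partial>lborel) \<le> ennreal e"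
        by (simp add: ennreal_leI)
    qed (rule \<delta>)
  qed
next
  case (add f g)
  have [measurable]: "f \<in> borel_measurable borel" "g \<in> borel_measurable borel"
    using add.hyps[THEN borel_measurable_integrable] by simp_all
  show ?case
  proof (intro allI impI)
    fix e :: real assume e: "0 < e"
    obtain d1 where d1: "0 < d1" "\<And>h. norm h < d1 \<Longrightarrow> (\<integral>\<^sup>+x. ennreal \<bar>f (x - h) - f x\<bar> \<partial>lborel) \<le> ennreal (e/2)"
      using add.IH(1) e by (meson half_gt_zero)
    obtain d2 where d2: "0 < d2" "\<And>h. norm h < d2 \<Longrightarrow> (\<integral>\<^sup>+x. ennreal \<bar>g (x - h) - g x\<bar> \<partial>lborel) \<le> ennreal (e/2)"
      using add.IH(2) e by (meson half_gt_zero)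
    show "\<exists>\<delta>>0. \<forall>h. norm h < \<delta> \<longrightarrow> (\<integral>\<^sup>+x. ennreal \<bar>f (x - h) + g (x - h) - (f x + g x)\<bar> \<partial>lborel) \<le> ennreal e"
    proof (intro exI conjI allI impI)
      fix h :: 'a assume h: "norm h < min d1 d2"
      have "(\<integral>\<^sup>+x. ennreal \<bar>f (x - h) + g (x - h) - (f x + g x)\<bar> \<partial>lborel)
         \<le> (\<integral>\<^sup>+x. ennreal \<bar>f (x - h) - f x\<bar> + ennreal \<bar>g (x - h) - g x\<bar> \<partial>lborel)"
        by (intro nn_integral_mono) (auto simp: ennreal_plus[symmetric] simp del: ennreal_plus intro!: ennreal_leI)
      also have "\<dots> = (\<integral>\<^sup>+x. ennreal \<bar>f (x - h) - f x\<bar> \<partial>lborel) + (\<integral>\<^sup>+x. ennreal \<bar>g (x - h) - g x\<bar> \<partial>lborel)"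
        by (rule nn_integral_add) measurable
      also have "\<dots> \<le> ennreal (e/2) + ennreal (e/2)" using h by (intro add_mono d1 d2) auto
      also have "\<dots> = ennreal e" using e by (simp add: ennreal_plus[symmetric] del: ennreal_plus)
      finally show "(\<integral>\<^sup>+x. ennreal \<bar>f (x - h) + g (x - h) - (f x + g x)\<bar> \<partial>lborel) \<le> ennreal e" .
    qed (use d1 d2 in auto)
  qed
next
  case (lim f s)
  have [measurable]: "f \<in> borel_measurable borel" "\<And>i. s i \<in> borel_measurable borel"
    using lim.hyps(1,4)[THEN borel_measurable_integrable] by simp_all
  have conv: "(\<lambda>i. \<integral>\<^sup>+x. norm (f x - s i x) \<partial>lborel) \<longlonglongrightarrow> 0"
  proof (rule nn_integral_dominated_convergence_norm[where w = "\<lambda>x. 2 * norm (f x)"])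
    show "(\<integral>\<^sup>+x. ennreal (2 * norm (f x)) \<partial>lborel) < \<infinity>"
      using lim.hyps(4) by (auto simp: integrable_iff_bounded ennreal_mult nn_integral_cmult ennreal_mult_less_top)
  qed (use lim.hyps in auto)
  show ?case
  proof (intro allI impI)
    fix e :: real assume e: "0 < e"
    have "eventually (\<lambda>i. (\<integral>\<^sup>+x. norm (f x - s i x) \<partial>lborel) < ennreal (e/3)) sequentially"
      using order_tendstoD(2)[OF conv, of "ennreal (e/3)"] e by simp
    then obtain i where i: "(\<integral>\<^sup>+x. norm (f x - s i x) \<partial>lborel) < ennreal (e/3)"
      by (auto simp: eventually_sequentially)
    obtain \<delta> where \<delta>: "0 < \<delta>" "\<And>h. norm h < \<delta> \<Longrightarrow> (\<integral>\<^sup>+x. ennreal \<bar>s i (x - h) - s i x\<bar> \<partial>lborel) \<le> ennreal (e/3)"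
      using lim.IH[of i] e by (metis divide_pos_pos zero_less_numeral)
    show "\<exists>\<delta>>0. \<forall>h. norm h < \<delta> \<longrightarrow> (\<integral>\<^sup>+x. ennreal \<bar>f (x - h) - f x\<bar> \<partial>lborel) \<le> ennreal e"
    proof (intro exI conjI allI impI)
      fix h :: 'a assume h: "norm h < \<delta>"
      have "(\<integral>\<^sup>+x. ennreal \<bar>f (x - h) - f x\<bar> \<partial>lborel)
         \<le> (\<integral>\<^sup>+x. (ennreal (norm (f (x - h) - s i (x - h))) + ennreal \<bar>s i (x - h) - s i x\<bar>) + ennreal (norm (f x - s i x)) \<partial>lborel)"
        by (intro nn_integral_mono) (auto simp: ennreal_plus[symmetric] simp del: ennreal_plus intro!: ennreal_leI)
      also have "\<dots> = (\<integral>\<^sup>+x. (ennreal (norm (f (x - h) - s i (x - h))) + ennreal \<bar>s i (x - h) - s i x\<bar>) \<partial>lborel) + (\<integral>\<^sup>+x. ennreal (norm (f x - s i x)) \<partial>lborel)"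
        by (rule nn_integral_add) measurable
      also have "(\<integral>\<^sup>+x. (ennreal (norm (f (x - h) - s i (x - h))) + ennreal \<bar>s i (x - h) - s i x\<bar>) \<partial>lborel)
         = (\<integral>\<^sup>+x. ennreal (norm (f (x - h) - s i (x - h))) \<partial>lborel) + (\<integral>\<^sup>+x. ennreal \<bar>s i (x - h) - s i x\<bar> \<partial>lborel)"
        by (rule nn_integral_add) measurable
      also have "(\<integral>\<^sup>+x. ennreal (norm (f (x - h) - s i (x - h))) \<partial>lborel) = (\<integral>\<^sup>+x. ennreal (norm (f x - s i x)) \<partial>lborel)"
        using nn_integral_lborel_translate[of "\<lambda>x. ennreal (norm (f x - s i x))" "- h"] by simp
      also have "(\<integral>\<^sup>+x. ennreal (norm (f x - s i x)) \<partial>lborel) + (\<integral>\<^sup>+x. ennreal \<bar>s i (x - h) - s i x\<bar> \<partial>lborel) + (\<integral>\<^sup>+x. ennreal (norm (f x - s i x)) \<partial>lborel)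
         \<le> ennreal (e/3) + ennreal (e/3) + ennreal (e/3)"
        using i by (intro add_mono \<delta> h) auto
      also have "\<dots> = ennreal e" using e by (simp add: ennreal_plus[symmetric] del: ennreal_plus)
      finally show "(\<integral>\<^sup>+x. ennreal \<bar>f (x - h) - f x\<bar> \<partial>lborel) \<le> ennreal e" .
    qed (rule \<delta>)
  qed
qed

section \<open>Convolution with smooth kernels\<close>

definition conv :: "('a::euclidean_space \<Rightarrow> real) \<Rightarrow> ('a \<Rightarrow> real) \<Rightarrow> 'a \<Rightarrow> real" where
  "conv \<psi> u x = (\<integral>y. u y * \<psi> (x - y) \<partial>lborel)"

lemma integrable_mult_translate:
  fixes u \<psi> :: "'a::euclidean_space \<Rightarrow> real"
  assumes u: "integrable lborel u" and \<psi>: "continuous_on UNIV \<psi>" and bdd: "\<And>x. \<bar>\<psi> x\<bar> \<le> b"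
  shows "integrable lborel (\<lambda>y. u y * \<psi> (x - y))"
proof (rule Bochner_Integration.integrable_bound)
  have [measurable]: "u \<in> borel_measurable borel" using u[THEN borel_measurable_integrable] by simp
  have [measurable]: "\<psi> \<in> borel_measurable borel" using \<psi> by (rule borel_measurable_continuous_onI)
  show "(\<lambda>y. u y * \<psi> (x - y)) \<in> borel_measurable lborel" by measurable
  show "integrable lborel (\<lambda>y. b * \<bar>u y\<bar>)" using u by auto
  show "AE y in lborel. norm (u y * \<psi> (x - y)) \<le> norm (b * \<bar>u y\<bar>)"
  proof (rule AE_I2)
    fix y
    have "\<bar>u y\<bar> * \<bar>\<psi> (x - y)\<bar> \<le> \<bar>u y\<bar> * \<bar>b\<bar>"
      using bdd[of "x - y"] by (intro mult_left_mono) auto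
    then show "norm (u y * \<psi> (x - y)) \<le> norm (b * \<bar>u y\<bar>)"
      by (simp add: abs_mult mult.commute)
  qed
qed

text \<open>A kernel of mass 1 makes the error an average of the increments u(x - h) - u(x) over
  shifts in its support; after exchanging integrals each shift contributes at most
  \<open>e\<close>.\<close>

lemma conv_L1:
  fixes u \<psi> :: "'a::euclidean_space \<Rightarrow> real"
  assumes u: "integrable lborel u" and \<psi>: "continuous_on UNIV \<psi>" and bdd: "\<And>x. \<bar>\<psi> x\<bar> \<le> b"
    and nonneg: "\<And>x. 0 \<le> \<psi> x" and supp: "\<And>x. \<delta> \<le> norm x \<Longrightarrow> \<psi> x = 0" and int: "(\<integral>\<^sup>+x. \<psi> x \<partial>lborel) = 1"
    and transl: "\<And>h. norm h < \<delta> \<Longrightarrow> (\<integral>\<^sup>+x. ennreal \<bar>u (x - h) - u x\<bar> \<partial>lborel) \<le> ennreal e"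
  shows "(\<integral>\<^sup>+x. ennreal \<bar>conv \<psi> u x - u x\<bar> \<partial>lborel) \<le> ennreal e"
proof -
  have [measurable]: "u \<in> borel_measurable borel" using u[THEN borel_measurable_integrable] by simp
  have [measurable]: "\<psi> \<in> borel_measurable borel" using \<psi> by (rule borel_measurable_continuous_onI)
  have nn\<psi>: "(\<integral>\<^sup>+y. ennreal (\<psi> (x - y)) \<partial>lborel) = 1" for x
    using nn_integral_lborel_reflect[of "\<lambda>y. ennreal (\<psi> y)" x] int by simp
  have int\<psi>: "integrable lborel (\<lambda>y. \<psi> (x - y))" for x
    using nonneg nn\<psi>[of x] by (auto simp: integrable_iff_bounded)
  have one: "(\<integral>y. \<psi> (x - y) \<partial>lborel) = 1" for x
    using nn_integral_eq_integral[OF int\<psi>[of x]] nonneg nn\<psi>[of x]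
    by (simp add: ennreal_eq_1)
  have "ennreal \<bar>conv \<psi> u x - u x\<bar> \<le> (\<integral>\<^sup>+h. ennreal (\<psi> h) * ennreal \<bar>u (x - h) - u x\<bar> \<partial>lborel)" for x
  proof -
    have i1: "integrable lborel (\<lambda>y. u y * \<psi> (x - y))" by (rule integrable_mult_translate[OF u \<psi> bdd])
    have i2: "integrable lborel (\<lambda>y. u x * \<psi> (x - y))" using int\<psi> by simp
    have "conv \<psi> u x - u x = (\<integral>y. u y * \<psi> (x - y) - u x * \<psi> (x - y) \<partial>lborel)"
      unfolding conv_def using i1 i2 one by (subst Bochner_Integration.integral_diff) auto
    then have "ennreal \<bar>conv \<psi> u x - u x\<bar> \<le> (\<integral>\<^sup>+y. norm (u y * \<psi> (x - y) - u x * \<psi> (x - y)) \<partial>lborel)"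
      using integral_norm_bound_ennreal[OF Bochner_Integration.integrable_diff[OF i1 i2]] by simp
    also have "\<dots> = (\<integral>\<^sup>+y. ennreal (\<psi> (x - y)) * ennreal \<bar>u (x - (x - y)) - u x\<bar> \<partial>lborel)"
      using nonneg by (intro nn_integral_cong)
        (simp add: ennreal_mult[symmetric] left_diff_distrib[symmetric] abs_mult mult.commute)
    also have "\<dots> = (\<integral>\<^sup>+h. ennreal (\<psi> h) * ennreal \<bar>u (x - h) - u x\<bar> \<partial>lborel)"
      by (rule nn_integral_lborel_reflect[where f = "\<lambda>h. ennreal (\<psi> h) * ennreal \<bar>u (x - h) - u x\<bar>"]) measurable
    finally show ?thesis .
  qed
  then have "(\<integral>\<^sup>+x. ennreal \<bar>conv \<psi> u x - u x\<bar> \<partial>lborel)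
      \<le> (\<integral>\<^sup>+x. \<integral>\<^sup>+h. ennreal (\<psi> h) * ennreal \<bar>u (x - h) - u x\<bar> \<partial>lborel \<partial>lborel)"
    by (intro nn_integral_mono)
  also have "\<dots> = (\<integral>\<^sup>+h. \<integral>\<^sup>+x. ennreal (\<psi> h) * ennreal \<bar>u (x - h) - u x\<bar> \<partial>lborel \<partial>lborel)"
    by (rule lborel_pair.Fubini') measurable
  also have "\<dots> = (\<integral>\<^sup>+h. ennreal (\<psi> h) * (\<integral>\<^sup>+x. ennreal \<bar>u (x - h) - u x\<bar> \<partial>lborel) \<partial>lborel)"
    by (rule nn_integral_cong, rule nn_integral_cmult) measurable
  also have "\<dots> \<le> (\<integral>\<^sup>+h. ennreal (\<psi> h) * ennreal e \<partial>lborel)"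
  proof (rule nn_integral_mono)
    fix h :: 'a
    show "ennreal (\<psi> h) * (\<integral>\<^sup>+x. ennreal \<bar>u (x - h) - u x\<bar> \<partial>lborel) \<le> ennreal (\<psi> h) * ennreal e"
      using transl[of h] supp[of h] by (cases "norm h < \<delta>") (auto intro: mult_left_mono)
  qed
  also have "\<dots> = ennreal e"
    by (subst nn_integral_multc) (auto simp: int)
  finally show ?thesis .
qed

lemma uniformly_continuous_on_support:
  fixes \<psi> :: "'a::euclidean_space \<Rightarrow> real"
  assumes \<psi>: "continuous_on UNIV \<psi>" and supp: "\<And>x. R < norm x \<Longrightarrow> \<psi> x = 0" and e: "0 < e"
  shows "\<exists>d>0. \<forall>x y. dist x y < d \<longrightarrow> \<bar>\<psi> x - \<psi> y\<bar> < e"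
proof -
  have "uniformly_continuous_on (cball 0 (R + 1)) \<psi>"
    by (rule compact_uniformly_continuous) (auto intro: continuous_on_subset[OF \<psi>])
  then obtain d where d: "0 < d" "\<And>x y. x \<in> cball 0 (R + 1) \<Longrightarrow> y \<in> cball 0 (R + 1) \<Longrightarrow> dist y x < d \<Longrightarrow> dist (\<psi> y) (\<psi> x) < e"
    using e unfolding uniformly_continuous_on_def by meson
  have "\<bar>\<psi> x - \<psi> y\<bar> < e" if xy: "dist x y < min d 1" for x y
  proof (cases "x \<in> cball 0 (R + 1) \<and> y \<in> cball 0 (R + 1)")
    case True
    then show ?thesis using d(2)[of y x] xy by (simp add: dist_real_def)
  next
    case False
    moreover have "norm x \<le> norm y + dist x y" "norm y \<le> norm x + dist x y"
      by (simp_all add: dist_norm) (metis add.commute norm_triangle_sub, metis add.commute norm_minus_commute norm_triangle_sub)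
    ultimately have "R < norm x" "R < norm y" using xy by auto
    then show ?thesis using supp e by simp
  qed
  then show ?thesis using d(1) by (intro exI[of _ "min d 1"]) auto
qed

lemma bounded_on_support:
  fixes \<psi> :: "'a::euclidean_space \<Rightarrow> real"
  assumes \<psi>: "continuous_on UNIV \<psi>" and supp: "\<And>x. R < norm x \<Longrightarrow> \<psi> x = 0"
  obtains b where "\<And>x. \<bar>\<psi> x\<bar> \<le> b"
proof -
  have "bounded (\<psi> ` cball 0 R)"
    by (intro compact_imp_bounded compact_continuous_image) (auto intro: continuous_on_subset[OF \<psi>])
  then obtain b where "\<forall>y\<in>\<psi> ` cball 0 R. norm y \<le> b" unfolding bounded_iff by blast
  then have b: "\<bar>\<psi> x\<bar> \<le> b" if "x \<in> cball 0 R" for x using that by auto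
  have "\<bar>\<psi> x\<bar> \<le> max b 0" for x
    using b[of x] supp[of x] by (cases "norm x \<le> R") auto
  then show ?thesis using that by blast
qed

definition kernel :: "real \<Rightarrow> (real^'n \<Rightarrow> real) \<Rightarrow> bool" where
  "kernel R \<psi> \<longleftrightarrow> (\<forall>k. C_k k \<psi>) \<and> (\<forall>x. R < norm x \<longrightarrow> \<psi> x = 0)"

lemma kernel_continuous: "kernel R \<psi> \<Longrightarrow> continuous_on UNIV \<psi>"
  unfolding kernel_def using C_k_continuous by blast

lemma kernel_differentiable: "kernel R \<psi> \<Longrightarrow> \<psi> differentiable (at x)"
  unfolding kernel_def by (metis C_k.simps(2) differentiable_on_UNIV_D)

lemma kernel_partial_deriv: "kernel R \<psi> \<Longrightarrow> kernel R (partial_deriv i \<psi>)"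
  unfolding kernel_def
proof (intro conjI allI impI)
  assume \<psi>: "(\<forall>k. C_k k \<psi>) \<and> (\<forall>x. R < norm x \<longrightarrow> \<psi> x = 0)"
  show "C_k k (partial_deriv i \<psi>)" for k using \<psi> by (metis C_k.simps(2))
  fix x :: "real^'a" assume x: "R < norm x"
  have "(\<psi> has_derivative (\<lambda>h. 0)) (at x)"
  proof (rule has_derivative_transform_within_open[OF has_derivative_const])
    show "open {x :: real^'a. R < norm x}"
      by (intro open_Collect_less continuous_intros)
  qed (use \<psi> x in auto)
  then show "partial_deriv i \<psi> x = 0" by (simp add: partial_deriv_eq)
qed

lemma kernel_integrable:
  assumes "integrable lborel u" "kernel R \<psi>"
  shows "integrable lborel (\<lambda>y. u y * \<psi> (x - y))"
proof -
  obtain b where "\<And>x. \<bar>\<psi> x\<bar> \<le> b"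
    using bounded_on_support[OF kernel_continuous[OF assms(2)], of R] assms(2) unfolding kernel_def by metis
  then show ?thesis using integrable_mult_translate[OF assms(1) kernel_continuous[OF assms(2)]] by blast
qed

lemma linearization_bound:
  fixes \<psi> :: "real^'n \<Rightarrow> real"
  assumes \<psi>: "\<And>x. \<psi> differentiable (at x)" and h: "norm h < \<delta>"
    and d: "\<And>i w. dist w z < \<delta> \<Longrightarrow> \<bar>partial_deriv i \<psi> w - partial_deriv i \<psi> z\<bar> \<le> e'"
  shows "\<bar>\<psi> (z + h) - \<psi> z - gradient \<psi> z \<bullet> h\<bar> \<le> norm h * (real CARD('n) * e')"
proof -
  have on: "onorm ((\<lambda>k. gradient \<psi> w \<bullet> k) - (\<lambda>k. gradient \<psi> z \<bullet> k)) \<le> real CARD('n) * e'"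
    if w: "w \<in> ball z \<delta>" for w
  proof (rule onorm_le)
    fix k
    have "norm (gradient \<psi> w - gradient \<psi> z) \<le> (\<Sum>i\<in>UNIV. \<bar>(gradient \<psi> w - gradient \<psi> z) $ i\<bar>)"
      by (rule norm_le_l1_cart)
    also have "\<dots> \<le> (\<Sum>i\<in>(UNIV::'n set). e')"
      using d[of w] w by (intro sum_mono) (simp add: gradient_def dist_commute)
    finally have g: "norm (gradient \<psi> w - gradient \<psi> z) \<le> real CARD('n) * e'" by simp
    have "norm (((\<lambda>k. gradient \<psi> w \<bullet> k) - (\<lambda>k. gradient \<psi> z \<bullet> k)) k) = \<bar>(gradient \<psi> w - gradient \<psi> z) \<bullet> k\<bar>"
      by (simp add: inner_diff_left)
    also have "\<dots> \<le> norm (gradient \<psi> w - gradient \<psi> z) * norm k" by (rule Cauchy_Schwarz_ineq2)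
    also have "\<dots> \<le> real CARD('n) * e' * norm k" using g by (rule mult_right_mono) simp
    finally show "norm (((\<lambda>k. gradient \<psi> w \<bullet> k) - (\<lambda>k. gradient \<psi> z \<bullet> k)) k) \<le> real CARD('n) * e' * norm k" .
  qed
  have seg: "z + t *\<^sub>R (z + h - z) \<in> ball z \<delta>" if t: "t \<in> {0..1}" for t
  proof -
    have "\<bar>t\<bar> * norm h \<le> 1 * norm h" using t by (intro mult_right_mono) auto
    then show ?thesis using h by (simp add: dist_norm)
  qed
  have der: "(\<psi> has_derivative (\<lambda>k. gradient \<psi> x \<bullet> k)) (at x within ball z \<delta>)" for x
    using has_derivative_gradient[OF \<psi>] by (rule has_derivative_at_withinI)
  have "0 < \<delta>" using h norm_ge_zero[of h] by linarith
  then have zb: "z \<in> ball z \<delta>" by simp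
  show ?thesis
    using differentiable_bound_linearization[where f = \<psi> and f' = "\<lambda>x k. gradient \<psi> x \<bullet> k" and S = "ball z \<delta>"
        and a = z and b = "z + h" and ?x0.0 = z, OF seg der on zb]
    by simp
qed

text \<open>The partial derivatives of a compactly supported kernel are uniformly continuous, so the
  linearization error of \<psi> is o(|h|) uniformly in the base point and can be integrated against
  |u|.\<close>

lemma conv_has_derivative:
  fixes u \<psi> :: "real^'n \<Rightarrow> real"
  assumes u: "integrable lborel u" and \<psi>: "kernel R \<psi>"
  shows "(conv \<psi> u has_derivative (\<lambda>h. (\<chi> i. conv (partial_deriv i \<psi>) u x) \<bullet> h)) (at x)"
  unfolding has_derivative_at_alt
proof (intro conjI allI impI)
  show "bounded_linear (\<lambda>h. (\<chi> i. conv (partial_deriv i \<psi>) u x) \<bullet> h)"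
    by (rule bounded_linear_inner_right)
  fix e :: real assume e: "0 < e"
  define N where "N = (\<integral>y. \<bar>u y\<bar> \<partial>lborel)"
  have N: "0 \<le> N" by (simp add: N_def)
  \<comment> \<open>\<open>linearization_bound\<close> costs a factor n and the integration a factor
    \<open>N\<close>; \<open>N + 1\<close> avoids division by 0.\<close>
  define e' where "e' = e / (real CARD('n) * (N + 1))"
  have e': "0 < e'" using e N by (simp add: e'_def add_nonneg_pos)
  have "\<exists>d>0. \<forall>x y. dist x y < d \<longrightarrow> \<bar>partial_deriv i \<psi> x - partial_deriv i \<psi> y\<bar> < e'" for i
    using kernel_partial_deriv[OF \<psi>, of i] e'
    by (intro uniformly_continuous_on_support[where R = R] kernel_continuous) (auto simp: kernel_def)
  then obtain d where d: "\<And>i. 0 < d i" "\<And>i x y. dist x y < d i \<Longrightarrow> \<bar>partial_deriv i \<psi> x - partial_deriv i \<psi> y\<bar> < e'"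
    by metis
  define \<delta> where "\<delta> = Min (range d)"
  have \<delta>: "0 < \<delta>" "\<delta> \<le> d i" for i using d(1) by (auto simp: \<delta>_def)
  have lin: "\<bar>\<psi> (z + h) - \<psi> z - gradient \<psi> z \<bullet> h\<bar> \<le> norm h * (real CARD('n) * e')" if h: "norm h < \<delta>" for z h
  proof (rule linearization_bound[OF kernel_differentiable[OF \<psi>] h])
    show "\<bar>partial_deriv i \<psi> w - partial_deriv i \<psi> z\<bar> \<le> e'" if "dist w z < \<delta>" for i w
      using d(2)[of w z i] \<delta>(2)[of i] that by simp
  qed
  show "\<exists>d>0. \<forall>y. norm (y - x) < d \<longrightarrow>
      norm (conv \<psi> u y - conv \<psi> u x - (\<chi> i. conv (partial_deriv i \<psi>) u x) \<bullet> (y - x)) \<le> e * norm (y - x)"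
  proof (intro exI conjI allI impI)
    fix y assume y: "norm (y - x) < \<delta>"
    define h where "h = y - x"
    have i1: "integrable lborel (\<lambda>z. u z * \<psi> (y - z))" "integrable lborel (\<lambda>z. u z * \<psi> (x - z))"
      using kernel_integrable[OF u \<psi>] by blast+
    have i2: "integrable lborel (\<lambda>z. u z * partial_deriv i \<psi> (x - z))" for i
      using kernel_integrable[OF u kernel_partial_deriv[OF \<psi>]] by blast
    have i3: "integrable lborel (\<lambda>z. u z * (gradient \<psi> (x - z) \<bullet> h))"
    proof -
      have "integrable lborel (\<lambda>z. \<Sum>i\<in>UNIV. u z * partial_deriv i \<psi> (x - z) * h $ i)"
        using i2 by (intro Bochner_Integration.integrable_sum integrable_mult_left)
      then show ?thesis by (simp add: gradient_def inner_vec_def sum_distrib_left mult.assoc)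
    qed
    have "(\<chi> i. conv (partial_deriv i \<psi>) u x) \<bullet> h = (\<Sum>i\<in>UNIV. (\<integral>z. u z * partial_deriv i \<psi> (x - z) * h $ i \<partial>lborel))"
      by (simp add: inner_vec_def conv_def)
    also have "\<dots> = (\<integral>z. (\<Sum>i\<in>UNIV. u z * partial_deriv i \<psi> (x - z) * h $ i) \<partial>lborel)"
      using i2 by (subst Bochner_Integration.integral_sum) auto
    also have "\<dots> = (\<integral>z. u z * (gradient \<psi> (x - z) \<bullet> h) \<partial>lborel)"
      by (simp add: gradient_def inner_vec_def sum_distrib_left mult.assoc)
    finally have "conv \<psi> u y - conv \<psi> u x - (\<chi> i. conv (partial_deriv i \<psi>) u x) \<bullet> h
        = (\<integral>z. u z * \<psi> (y - z) - u z * \<psi> (x - z) - u z * (gradient \<psi> (x - z) \<bullet> h) \<partial>lborel)"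
      using i1 i3 by (simp add: conv_def Bochner_Integration.integral_diff)
    also have "norm \<dots> \<le> (\<integral>z. \<bar>u z\<bar> * (norm h * (real CARD('n) * e')) \<partial>lborel)"
    proof (rule order_trans[OF integral_norm_bound integral_mono])
      show "integrable lborel (\<lambda>z. norm (u z * \<psi> (y - z) - u z * \<psi> (x - z) - u z * (gradient \<psi> (x - z) \<bullet> h)))"
        using i1 i3 by (intro integrable_norm Bochner_Integration.integrable_diff)
      show "integrable lborel (\<lambda>z. \<bar>u z\<bar> * (norm h * (real CARD('n) * e')))"
        using u by auto
      fix z
      have "norm (u z * \<psi> (y - z) - u z * \<psi> (x - z) - u z * (gradient \<psi> (x - z) \<bullet> h))
         = \<bar>u z\<bar> * \<bar>\<psi> ((x - z) + h) - \<psi> (x - z) - gradient \<psi> (x - z) \<bullet> h\<bar>"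
      proof -
        have hz: "(x - z) + h = y - z" by (simp add: h_def)
        show ?thesis unfolding hz right_diff_distrib[symmetric] real_norm_def abs_mult ..
      qed
      also have "\<dots> \<le> \<bar>u z\<bar> * (norm h * (real CARD('n) * e'))"
        using y by (intro mult_left_mono lin) (auto simp: h_def)
      finally show "norm (u z * \<psi> (y - z) - u z * \<psi> (x - z) - u z * (gradient \<psi> (x - z) \<bullet> h))
         \<le> \<bar>u z\<bar> * (norm h * (real CARD('n) * e'))" .
    qed
    also have "\<dots> = N * (real CARD('n) * e') * norm h" by (simp add: N_def)
    also have "\<dots> \<le> e * norm h"
    proof (rule mult_right_mono)
      have "N * (real CARD('n) * e') = e * (N / (N + 1))" using N by (simp add: e'_def)
      also have "\<dots> \<le> e * 1" using N e by (intro mult_left_mono) auto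
      finally show "N * (real CARD('n) * e') \<le> e" by simp
    qed simp
    finally show "norm (conv \<psi> u y - conv \<psi> u x - (\<chi> i. conv (partial_deriv i \<psi>) u x) \<bullet> (y - x)) \<le> e * norm (y - x)"
      by (simp add: h_def)
  qed (rule \<delta>)
qed

lemma partial_deriv_conv:
  assumes "integrable lborel u" "kernel R \<psi>"
  shows "partial_deriv i (conv \<psi> u) = conv (partial_deriv i \<psi>) u"
  by (rule ext) (simp add: partial_deriv_of_gradient[OF conv_has_derivative[OF assms]])

lemma C_k_conv:
  assumes u: "integrable lborel u"
  shows "kernel R \<psi> \<Longrightarrow> C_k k (conv \<psi> u)"
proof (induction k arbitrary: \<psi>)
  case 0
  have "conv \<psi> u differentiable_on UNIV"
    unfolding differentiable_on_def differentiable_def using conv_has_derivative[OF u 0] by blast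
  then show ?case by (simp add: differentiable_imp_continuous_on)
next
  case (Suc k)
  have "conv \<psi> u differentiable_on UNIV"
    unfolding differentiable_on_def differentiable_def using conv_has_derivative[OF u Suc.prems] by blast
  then show ?case
    using Suc.IH[OF kernel_partial_deriv[OF Suc.prems]] by (simp add: partial_deriv_conv[OF u Suc.prems])
qed

text \<open>The standard bump exp(-1 / (1 - |x|^2 / e^2)). Writing the squared norm as a polynomial
  in the coordinates makes smoothness a consequence of the closure properties of
  \<open>C_k\<close>.\<close>

definition bump :: "real \<Rightarrow> real^'n \<Rightarrow> real" where
  "bump e x = flat 0 (1 - (\<Sum>j\<in>UNIV. x $ j * x $ j) / e\<^sup>2)"

definition mol :: "real \<Rightarrow> real^'n \<Rightarrow> real" where
  "mol e x = bump e x / (\<integral>x. bump e (x :: real^'n) \<partial>lborel)"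

lemma bump_eq: "bump e x = flat 0 (1 - (norm x)\<^sup>2 / e\<^sup>2)"
  unfolding bump_def power2_norm_eq_inner by (simp add: inner_vec_def)

lemma bump_bounds: "0 \<le> bump e x" "bump e x \<le> 1"
  by (simp_all add: bump_eq flat_0_eq)

lemma bump_pos_iff: "0 < e \<Longrightarrow> bump e x \<noteq> 0 \<longleftrightarrow> norm x < e"
proof -
  assume e: "0 < e"
  have "0 < 1 - (norm x)\<^sup>2 / e\<^sup>2 \<longleftrightarrow> (norm x)\<^sup>2 < e\<^sup>2" using e by (simp add: field_simps)
  also have "\<dots> \<longleftrightarrow> norm x < e" using e
    by (auto intro: power2_less_imp_less[of "norm x" e] power_strict_mono)
  finally show ?thesis by (auto simp: bump_eq flat_0_eq)
qed

lemma bump_minus: "bump e (- x) = bump e x"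
  by (simp add: bump_eq)

lemma C_k_bump: "C_k k (\<lambda>y. bump e (y - x))" for x :: "real^'n"
proof -
  have "C_k k (\<lambda>y :: real^'n. 1 - (\<Sum>j\<in>UNIV. (y $ j - x $ j) * (y $ j - x $ j)) * (1 / e\<^sup>2))"
    by (intro C_k_diff C_k_mult C_k_sum C_k_const C_k_nth finite)
  then have "C_k k (\<lambda>y :: real^'n. flat 0 (1 - (\<Sum>j\<in>UNIV. (y $ j - x $ j) * (y $ j - x $ j)) * (1 / e\<^sup>2)))"
    by (rule C_k_compose[where \<phi> = flat, OF flat_deriv])
  then show ?thesis by (simp add: bump_def)
qed

lemma integrable_bump:
  assumes "0 < e"
  shows "integrable lborel (bump e :: real^'n \<Rightarrow> real)" "0 < (\<integral>x. bump e (x :: real^'n) \<partial>lborel)"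
proof -
  have "continuous_on UNIV (bump e :: real^'n \<Rightarrow> real)"
    using C_k_continuous[OF C_k_bump[of 0 e 0]] by simp
  then have [measurable]: "(bump e :: real^'n \<Rightarrow> real) \<in> borel_measurable borel"
    by (rule borel_measurable_continuous_onI)
  show int: "integrable lborel (bump e :: real^'n \<Rightarrow> real)"
  proof (rule Bochner_Integration.integrable_bound[where f = "indicator (cball (0::real^'n) e) :: _ \<Rightarrow> real"])
    show "integrable lborel (indicator (cball (0::real^'n) e) :: _ \<Rightarrow> real)"
      using emeasure_lborel_cball_finite[of "0::real^'n" e] by (intro integrable_real_indicator) auto
    show "AE x in lborel. norm (bump e x) \<le> norm (indicator (cball (0::real^'n) e) x :: real)"
    proof (rule AE_I2)
      fix x :: "real^'n"
      show "norm (bump e x) \<le> norm (indicator (cball (0::real^'n) e) x :: real)"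
        using bump_bounds[of e x] bump_pos_iff[OF assms, of x] by (cases "norm x < e") auto
    qed
  qed measurable
  have "(\<integral>x. bump e (x :: real^'n) \<partial>lborel) \<noteq> 0"
  proof
    assume "(\<integral>x. bump e (x :: real^'n) \<partial>lborel) = 0"
    then have "AE x::real^'n in lborel. bump e x = 0"
      using integral_nonneg_eq_0_iff_AE[OF int] bump_bounds(1) by auto
    then have "AE x::real^'n in lborel. x \<notin> ball 0 e"
      by eventually_elim (use bump_pos_iff[OF assms] in auto)
    then have "AE x::real^'n in lborel. \<not> x \<in> ball 0 e" by simp
    then have "ball (0::real^'n) e \<in> null_sets lborel"
      by (subst AE_iff_null_sets) auto
    then have "emeasure lborel (ball (0::real^'n) e) = 0" by auto
    then show False using content_ball_pos[OF assms, of "0::real^'n"] by (simp add: measure_def)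
  qed
  moreover have "0 \<le> (\<integral>x. bump e (x :: real^'n) \<partial>lborel)"
    using bump_bounds(1) by (intro Bochner_Integration.integral_nonneg) auto
  ultimately show "0 < (\<integral>x. bump e (x :: real^'n) \<partial>lborel)" by simp
qed

lemma C_k_mol: "C_k k (\<lambda>y. mol e (y - x))"
  unfolding mol_def divide_inverse by (intro C_k_mult C_k_bump C_k_const)

lemma mol_nonneg: "0 \<le> mol e x"
  unfolding mol_def using bump_bounds(1) by (intro divide_nonneg_nonneg Bochner_Integration.integral_nonneg) auto

lemma mol_eq_0: "0 < e \<Longrightarrow> e \<le> norm x \<Longrightarrow> mol e x = 0"
  using bump_pos_iff[of e x] by (auto simp: mol_def)

lemma mol_minus: "mol e (- x) = mol e x"
  by (simp add: mol_def bump_minus)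

lemma kernel_mol: "0 < e \<Longrightarrow> kernel e (mol e)"
  using C_k_mol[of _ e 0] by (auto simp: kernel_def intro!: mol_eq_0)

lemma nn_integral_mol:
  assumes "0 < e"
  shows "(\<integral>\<^sup>+x. mol e (x :: real^'n) \<partial>lborel) = 1"
proof -
  have "(\<integral>\<^sup>+x. mol e (x :: real^'n) \<partial>lborel) = ennreal (\<integral>x. mol e (x :: real^'n) \<partial>lborel)"
    using integrable_bump[OF assms, where 'n = 'n] mol_nonneg
    by (intro nn_integral_eq_integral) (auto simp: mol_def[abs_def])
  also have "(\<integral>x. mol e (x :: real^'n) \<partial>lborel) = 1"
    using integrable_bump[OF assms, where 'n = 'n] by (simp add: mol_def)
  finally show ?thesis by simp
qed

lemma mol_test_function:
  assumes e: "0 < e" and V: "cball x e \<subseteq> V"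
  shows "(\<lambda>y. mol e (y - x)) \<in> test_functions V"
proof -
  have sub: "{y. mol e (y - x) \<noteq> 0} \<subseteq> cball x e"
    using mol_eq_0[OF e] by (force simp: dist_norm norm_minus_commute)
  then have "closure {y. mol e (y - x) \<noteq> 0} \<subseteq> cball x e"
    by (rule closure_minimal) simp
  moreover from this have "compact (closure {y. mol e (y - x) \<noteq> 0})"
    by (meson bounded_cball bounded_subset closed_closure compact_eq_bounded_closed)
  ultimately show ?thesis
    using V C_k_mol by (auto simp: test_functions_def compactly_contained_def)
qed

text \<open>The weak identity is tested with the translate of the mollifier to \<open>x\<close>,
  whose derivative in y is minus the derivative of \<open>mol e\<close> at x - y. The ball around
  \<open>x\<close> must lie in \<open>V\<close> for this translate to be admissible.\<close>

lemma conv_mol_weak_gradient: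
  fixes u :: "real^'n \<Rightarrow> real" and g :: "real^'n \<Rightarrow> real^'n"
  assumes u: "integrable lborel u" and e: "0 < e" and V: "cball x e \<subseteq> V"
    and weak: "\<And>\<phi>. \<phi> \<in> test_functions V \<Longrightarrow>
      (\<integral>y. u y * partial_deriv i \<phi> y \<partial>lborel) = - (\<integral>y. g y $ i * \<phi> y \<partial>lborel)"
  shows "partial_deriv i (conv (mol e) u) x = conv (mol e) (\<lambda>y. g y $ i) x"
proof -
  have D: "partial_deriv i (\<lambda>y. mol e (y - x)) y = - partial_deriv i (mol e) (x - y)" for y
  proof -
    have d: "(mol e has_derivative (\<lambda>h. gradient (mol e) (x - y) \<bullet> h)) (at (x - y))"
      by (intro has_derivative_gradient kernel_differentiable[OF kernel_mol[OF e]])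
    have "((\<lambda>y. x - y) has_derivative (\<lambda>h. - h)) (at y)"
      by (auto intro!: derivative_eq_intros)
    then have "((\<lambda>y. mol e (x - y)) has_derivative (\<lambda>h. gradient (mol e) (x - y) \<bullet> (- h))) (at y)"
      using d by (rule has_derivative_compose)
    moreover have "(\<lambda>y. mol e (x - y)) = (\<lambda>y. mol e (y - x))"
      using mol_minus[of e] by (metis minus_diff_eq)
    ultimately have "((\<lambda>y. mol e (y - x)) has_derivative (\<lambda>h. gradient (mol e) (x - y) \<bullet> (- h))) (at y)"
      by (simp only:)
    from partial_deriv_eq[OF this, of i] show ?thesis by (simp add: gradient_def inner_axis)
  qed
  have "partial_deriv i (conv (mol e) u) x = (\<integral>y. u y * partial_deriv i (mol e) (x - y) \<partial>lborel)"
    by (simp add: partial_deriv_conv[OF u kernel_mol[OF e]] conv_def)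
  also have "\<dots> = - (\<integral>y. u y * partial_deriv i (\<lambda>y. mol e (y - x)) y \<partial>lborel)"
    by (simp add: D)
  also have "\<dots> = (\<integral>y. g y $ i * mol e (y - x) \<partial>lborel)"
    using weak[OF mol_test_function[OF e V]] by simp
  also have "\<dots> = conv (mol e) (\<lambda>y. g y $ i) x"
    unfolding conv_def using mol_minus[of e] by (metis minus_diff_eq)
  finally show ?thesis .
qed

text \<open>For fixed \<open>t\<close> the hypothesis is linear in f and convex in g, so it is
  inherited by averages against a probability density. This takes the place of Jensen's inequality
  for \<open>A\<close>; the additive term \<open>a\<close> is reproduced because the kernel has mass
  1.\<close>

lemma conv_mol_young:
  fixes f :: "real^'n \<Rightarrow> real" and g :: "real^'n \<Rightarrow> real^'n"
  assumes g: "integrable lborel g" and f: "integrable lborel f" and e: "0 < e" and t: "0 \<le> t"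
    and young: "\<And>y. ennreal (t * norm (g y)) \<le> ennreal (f y) + a" and f0: "\<And>y. 0 \<le> f y"
  shows "ennreal (t * norm (\<chi> i. conv (mol e) (\<lambda>y. g y $ i) x)) \<le> ennreal (conv (mol e) f x) + a"
proof (cases a)
  case (real b)
  have le: "t * norm (g y) \<le> f y + b" for y
    using young[of y] real f0[of y] by (simp add: ennreal_plus[symmetric] del: ennreal_plus)
  have ker: "kernel e (mol e :: real^'n \<Rightarrow> real)" by (rule kernel_mol[OF e])
  have [measurable]: "(mol e :: real^'n \<Rightarrow> real) \<in> borel_measurable borel"
    using kernel_continuous[OF ker] by (rule borel_measurable_continuous_onI)
  have gi: "integrable lborel (\<lambda>y. g y $ i)" for i
    using integrable_inner_left[OF g, of "axis i 1"] by (simp add: inner_axis)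
  have gm: "integrable lborel (\<lambda>y. mol e (x - y) *\<^sub>R g y)"
  proof (rule Bochner_Integration.integrable_bound)
    show "integrable lborel (\<lambda>y. norm (g y) * mol e (x - y))"
      using g by (intro kernel_integrable[OF _ ker]) auto
    show "(\<lambda>y. mol e (x - y) *\<^sub>R g y) \<in> borel_measurable lborel"
      using g[THEN borel_measurable_integrable] by measurable
  qed (auto simp: mult.commute)
  have vec: "(\<chi> i. conv (mol e) (\<lambda>y. g y $ i) x) = (\<integral>y. mol e (x - y) *\<^sub>R g y \<partial>lborel)"
  proof -
    have "(\<integral>y. mol e (x - y) *\<^sub>R g y \<partial>lborel) $ i = (\<integral>y. g y $ i * mol e (x - y) \<partial>lborel)" for i
    proof -
      have "(\<integral>y. mol e (x - y) *\<^sub>R g y \<partial>lborel) \<bullet> axis i 1 = (\<integral>y. (mol e (x - y) *\<^sub>R g y) \<bullet> axis i 1 \<partial>lborel)"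
        using integral_inner_left[OF gm, of "axis i 1"] by simp
      then show ?thesis by (simp add: inner_axis mult.commute)
    qed
    then show ?thesis by (simp add: vec_eq_iff conv_def)
  qed
  have "t * norm (\<chi> i. conv (mol e) (\<lambda>y. g y $ i) x) \<le> t * (\<integral>y. norm (mol e (x - y) *\<^sub>R g y) \<partial>lborel)"
    unfolding vec by (rule mult_left_mono[OF integral_norm_bound t])
  also have "\<dots> = (\<integral>y. mol e (x - y) * (t * norm (g y)) \<partial>lborel)"
  proof -
    have "t * (\<integral>y. norm (mol e (x - y) *\<^sub>R g y) \<partial>lborel) = (\<integral>y. t * norm (mol e (x - y) *\<^sub>R g y) \<partial>lborel)"
      by (rule integral_mult_right_zero[symmetric])
    also have "(\<lambda>y. t * norm (mol e (x - y) *\<^sub>R g y)) = (\<lambda>y. mol e (x - y) * (t * norm (g y)))"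
      by (rule ext) (simp only: norm_scaleR abs_of_nonneg[OF mol_nonneg] mult.left_commute)
    finally show ?thesis .
  qed
  also have "\<dots> \<le> (\<integral>y. f y * mol e (x - y) + b * mol e (x - y) \<partial>lborel)"
  proof (rule integral_mono)
    show "integrable lborel (\<lambda>y. mol e (x - y) * (t * norm (g y)))"
    proof -
      have "(\<lambda>y. mol e (x - y) * (t * norm (g y))) = (\<lambda>y. t * norm (mol e (x - y) *\<^sub>R g y))"
        by (rule ext) (simp only: norm_scaleR abs_of_nonneg[OF mol_nonneg] mult.left_commute)
      then show ?thesis using integrable_norm[OF gm] by simp
    qed
    have i1: "integrable lborel (\<lambda>y. mol e (x - y))"
      using nn_integral_lborel_reflect[of "\<lambda>y. ennreal (mol e y)" x] nn_integral_mol[OF e, where 'n = 'n]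
      by (auto simp: integrable_iff_bounded abs_of_nonneg mol_nonneg)
    then show "integrable lborel (\<lambda>y. f y * mol e (x - y) + b * mol e (x - y))"
      by (intro Bochner_Integration.integrable_add kernel_integrable[OF f ker] integrable_mult_right)
    show "mol e (x - y) * (t * norm (g y)) \<le> f y * mol e (x - y) + b * mol e (x - y)" for y
      using mult_left_mono[OF le[of y] mol_nonneg[of e "x - y"]] by (simp add: algebra_simps)
  qed
  also have "\<dots> = conv (mol e) f x + b"
  proof -
    have i1: "integrable lborel (\<lambda>y. mol e (x - y))"
      using nn_integral_lborel_reflect[of "\<lambda>y. ennreal (mol e y)" x] nn_integral_mol[OF e, where 'n = 'n]
      by (auto simp: integrable_iff_bounded abs_of_nonneg mol_nonneg)
    have "(\<integral>\<^sup>+y. ennreal (mol e (x - y)) \<partial>lborel) = ennreal (\<integral>y. mol e (x - y) \<partial>lborel)"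
      using mol_nonneg[of e] by (intro nn_integral_eq_integral i1) auto
    then have "(\<integral>y. mol e (x - y) \<partial>lborel) = 1"
      using nn_integral_lborel_reflect[of "\<lambda>y. ennreal (mol e y)" x] nn_integral_mol[OF e, where 'n = 'n]
      by (simp add: ennreal_eq_1)
    then show ?thesis
      unfolding conv_def using i1 by (subst Bochner_Integration.integral_add) (auto intro: kernel_integrable[OF f ker])
  qed
  finally have "t * norm (\<chi> i. conv (mol e) (\<lambda>y. g y $ i) x) \<le> conv (mol e) f x + b" .
  moreover have "0 \<le> conv (mol e) f x"
    unfolding conv_def by (intro Bochner_Integration.integral_nonneg mult_nonneg_nonneg f0 mol_nonneg)
  ultimately show ?thesis using real by (simp add: ennreal_plus[symmetric] ennreal_leI del: ennreal_plus)
qed simp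

lemma conv_mol_L1_small:
  fixes u :: "real^'n \<Rightarrow> real"
  assumes u: "integrable lborel u" and \<eta>: "0 < \<eta>"
  shows "\<exists>\<delta>>0. \<forall>e. 0 < e \<and> e < \<delta> \<longrightarrow> (\<integral>\<^sup>+x. ennreal \<bar>conv (mol e) u x - u x\<bar> \<partial>lborel) \<le> ennreal \<eta>"
proof -
  obtain \<delta> where \<delta>: "0 < \<delta>" "\<And>h. norm h < \<delta> \<Longrightarrow> (\<integral>\<^sup>+x. ennreal \<bar>u (x - h) - u x\<bar> \<partial>lborel) \<le> ennreal \<eta>"
    using L1_translation[OF u] \<eta> by blast
  show ?thesis
  proof (intro exI conjI allI impI)
    fix e :: real assume e: "0 < e \<and> e < \<delta>"
    obtain b where b: "\<And>x. \<bar>mol e (x::real^'n)\<bar> \<le> b"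
      using bounded_on_support[OF kernel_continuous[OF kernel_mol], of e e] mol_eq_0[of e] e
      by (metis less_imp_le)
    have supp: "mol e x = 0" if "\<delta> \<le> norm x" for x :: "real^'n"
      using e that by (intro mol_eq_0) auto
    show "(\<integral>\<^sup>+x. ennreal \<bar>conv (mol e) u x - u x\<bar> \<partial>lborel) \<le> ennreal \<eta>"
      by (rule conv_L1[OF u kernel_continuous[OF kernel_mol] b mol_nonneg supp nn_integral_mol \<delta>(2)])
        (use e in auto)
  qed (rule \<delta>)
qed

lemma conv_mol_L1_family:
  fixes u :: "'i \<Rightarrow> real^'n \<Rightarrow> real"
  assumes I: "finite I" and u: "\<And>i. i \<in> I \<Longrightarrow> integrable lborel (u i)" and \<eta>: "0 < \<eta>" and b: "0 < b"
  shows "\<exists>e. 0 < e \<and> e < b \<and> (\<forall>i\<in>I. (\<integral>\<^sup>+x. ennreal \<bar>conv (mol e) (u i) x - u i x\<bar> \<partial>lborel) \<le> ennreal \<eta>)"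
proof -
  have "\<forall>i\<in>I. \<exists>\<delta>>0. \<forall>e. 0 < e \<and> e < \<delta> \<longrightarrow> (\<integral>\<^sup>+x. ennreal \<bar>conv (mol e) (u i) x - u i x\<bar> \<partial>lborel) \<le> ennreal \<eta>"
    using conv_mol_L1_small[OF u \<eta>] by blast
  then obtain \<delta> where \<delta>: "\<And>i. i \<in> I \<Longrightarrow> 0 < \<delta> i"
      "\<And>i e. i \<in> I \<Longrightarrow> 0 < e \<Longrightarrow> e < \<delta> i \<Longrightarrow> (\<integral>\<^sup>+x. ennreal \<bar>conv (mol e) (u i) x - u i x\<bar> \<partial>lborel) \<le> ennreal \<eta>"
    by metis
  define d where "d = Min (insert b (\<delta> ` I))"
  have d: "0 < d" "d \<le> b" "\<And>i. i \<in> I \<Longrightarrow> d \<le> \<delta> i" using I b \<delta>(1) by (auto simp: d_def)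
  show ?thesis
  proof (intro exI[of _ "d / 2"] conjI ballI)
    fix i assume i: "i \<in> I"
    show "(\<integral>\<^sup>+x. ennreal \<bar>conv (mol (d / 2)) (u i) x - u i x\<bar> \<partial>lborel) \<le> ennreal \<eta>"
      using \<delta>(2)[OF i, of "d / 2"] d(1) d(3)[OF i] by simp
  qed (use d in auto)
qed

text \<open>One radius \<open>e k\<close> serves \<open>u\<close>, the energy density
  \<open>f\<close> and all components of \<open>g\<close>, so that Young's inequality links the
  mollified functions. The rate 2^(-k) makes the errors summable; the gradient identity needs the
  points of \<open>W\<close> to keep a positive distance from the complement of
  \<open>V\<close>.\<close>

lemma smooth_approximation:
  fixes u f :: "real^'n \<Rightarrow> real" and g :: "real^'n \<Rightarrow> real^'n"
  assumes u: "integrable lborel u" and g: "integrable lborel g" and f: "integrable lborel f"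
    and f0: "\<And>y. 0 \<le> f y" and V: "open V" and W: "compact W" "W \<subseteq> V"
    and weak: "\<And>\<phi> i. \<phi> \<in> test_functions V \<Longrightarrow>
      (\<integral>y. u y * partial_deriv i \<phi> y \<partial>lborel) = - (\<integral>y. g y $ i * \<phi> y \<partial>lborel)"
    and young: "\<And>y t. 0 \<le> t \<Longrightarrow> ennreal (t * norm (g y)) \<le> ennreal (f y) + a t"
  obtains uk fk where
    "\<And>k m. C_k m (uk k)" "\<And>k. continuous_on UNIV (fk k)"
    "\<And>k. (\<integral>\<^sup>+x. ennreal \<bar>uk k x - u x\<bar> \<partial>lborel) \<le> ennreal ((1/2) ^ k)"
    "\<And>k. (\<integral>\<^sup>+x. ennreal \<bar>fk k x - f x\<bar> \<partial>lborel) \<le> ennreal ((1/2) ^ k)"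
    "\<And>k. (\<integral>\<^sup>+x. ennreal (norm (gradient (uk k) x - g x)) * indicator W x \<partial>lborel) \<le> ennreal (real CARD('n) * (1/2) ^ k)"
    "\<And>k x t. x \<in> W \<Longrightarrow> 0 \<le> t \<Longrightarrow> ennreal (t * norm (gradient (uk k) x)) \<le> ennreal (fk k x) + a t"
proof -
  obtain b where b: "0 < b" "\<And>x. x \<in> W \<Longrightarrow> cball x b \<subseteq> V"
  proof (cases "W = {}")
    case False
    obtain \<delta> where \<delta>: "0 < \<delta>" "\<And>x y. x \<in> W \<Longrightarrow> y \<in> - V \<Longrightarrow> \<delta> \<le> dist x y"
    proof -
      have "\<exists>\<delta>>0. \<forall>x\<in>W. \<forall>y\<in>- V. \<delta> \<le> dist x y"
        using V W by (intro separate_compact_closed) (auto simp: closed_Compl)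
      then show ?thesis using that by blast
    qed
    have "cball x (\<delta> / 2) \<subseteq> V" if "x \<in> W" for x
      using \<delta>(1) \<delta>(2)[OF that] by force
    then show ?thesis using that[of "\<delta> / 2"] \<delta>(1) by auto
  qed (use that[of 1] in auto)
  \<comment> \<open>A finite index set collecting \<open>u\<close>, \<open>f\<close> and the
    components of \<open>g\<close>, to which the common choice of a radius applies.\<close>
  define w where "w = (\<lambda>s :: 'n option option. case s of None \<Rightarrow> u | Some None \<Rightarrow> f | Some (Some i) \<Rightarrow> (\<lambda>y. g y $ i))"
  have gi: "integrable lborel (\<lambda>y. g y $ i)" for i
    using integrable_inner_left[OF g, of "axis i 1"] by (simp add: inner_axis)
  have w: "integrable lborel (w s)" for s
    using u f gi by (auto simp: w_def split: option.split)
  have "\<exists>e. 0 < e \<and> e < b \<and> (\<forall>s\<in>UNIV. (\<integral>\<^sup>+x. ennreal \<bar>conv (mol e) (w s) x - w s x\<bar> \<partial>lborel) \<le> ennreal ((1/2) ^ k))" for k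
    using b w by (intro conv_mol_L1_family) auto
  then obtain e where e: "\<And>k. 0 < e k" "\<And>k. e k < b"
      "\<And>k s. (\<integral>\<^sup>+x. ennreal \<bar>conv (mol (e k)) (w s) x - w s x\<bar> \<partial>lborel) \<le> ennreal ((1/2) ^ k)"
    by (metis UNIV_I)
  have grad: "gradient (conv (mol (e k)) u) x = (\<chi> i. conv (mol (e k)) (\<lambda>y. g y $ i) x)" if "x \<in> W" for k x
  proof -
    have "cball x (e k) \<subseteq> V" using b(2)[OF that] e(2)[of k] by (meson less_imp_le order_trans subset_cball)
    then show ?thesis
      using conv_mol_weak_gradient[OF u e(1) _ weak] by (simp add: gradient_def)
  qed
  show ?thesis
  proof (rule that[of "\<lambda>k. conv (mol (e k)) u" "\<lambda>k. conv (mol (e k)) f"])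
    show "C_k m (conv (mol (e k)) u)" for k m by (rule C_k_conv[OF u kernel_mol[OF e(1)]])
    show "continuous_on UNIV (conv (mol (e k)) f)" for k
      by (rule C_k_continuous[of 0, OF C_k_conv[OF f kernel_mol[OF e(1)]]])
    show "(\<integral>\<^sup>+x. ennreal \<bar>conv (mol (e k)) u x - u x\<bar> \<partial>lborel) \<le> ennreal ((1/2) ^ k)" for k
      using e(3)[of k None] by (simp add: w_def)
    show "(\<integral>\<^sup>+x. ennreal \<bar>conv (mol (e k)) f x - f x\<bar> \<partial>lborel) \<le> ennreal ((1/2) ^ k)" for k
      using e(3)[of k "Some None"] by (simp add: w_def)
    show "ennreal (t * norm (gradient (conv (mol (e k)) u) x)) \<le> ennreal (conv (mol (e k)) f x) + a t"
      if "x \<in> W" "0 \<le> t" for k x t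
      unfolding grad[OF that(1)] by (rule conv_mol_young[OF g f e(1) that(2) young[OF that(2)] f0])
    fix k
    have m: "(\<lambda>x. ennreal \<bar>conv (mol (e k)) (\<lambda>y. g y $ i) x - g x $ i\<bar>) \<in> borel_measurable borel" for i
    proof -
      have "continuous_on UNIV (conv (mol (e k)) (\<lambda>y. g y $ i))"
        by (rule C_k_continuous[of 0, OF C_k_conv[OF gi kernel_mol[OF e(1)]]])
      then have [measurable]: "conv (mol (e k)) (\<lambda>y. g y $ i) \<in> borel_measurable borel"
        by (rule borel_measurable_continuous_onI)
      have [measurable]: "g \<in> borel_measurable borel" using g[THEN borel_measurable_integrable] by simp
      show ?thesis by measurable
    qed
    have "(\<integral>\<^sup>+x. ennreal (norm (gradient (conv (mol (e k)) u) x - g x)) * indicator W x \<partial>lborel)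
      \<le> (\<integral>\<^sup>+x. (\<Sum>i\<in>UNIV. ennreal \<bar>conv (mol (e k)) (\<lambda>y. g y $ i) x - g x $ i\<bar>) \<partial>lborel)"
    proof (rule nn_integral_mono)
      fix x
      show "ennreal (norm (gradient (conv (mol (e k)) u) x - g x)) * indicator W x
         \<le> (\<Sum>i\<in>UNIV. ennreal \<bar>conv (mol (e k)) (\<lambda>y. g y $ i) x - g x $ i\<bar>)"
      proof (cases "x \<in> W")
        case True
        have "norm (gradient (conv (mol (e k)) u) x - g x) \<le> (\<Sum>i\<in>UNIV. \<bar>(gradient (conv (mol (e k)) u) x - g x) $ i\<bar>)"
          by (rule norm_le_l1_cart)
        then show ?thesis using True by (simp add: grad sum_ennreal ennreal_leI)
      qed simp
    qed
    also have "\<dots> = (\<Sum>i\<in>UNIV. \<integral>\<^sup>+x. ennreal \<bar>conv (mol (e k)) (\<lambda>y. g y $ i) x - g x $ i\<bar> \<partial>lborel)"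
      using m by (intro nn_integral_sum) simp
    also have "\<dots> \<le> (\<Sum>i\<in>(UNIV::'n set). ennreal ((1/2) ^ k))"
    proof (rule sum_mono)
      fix i
      show "(\<integral>\<^sup>+x. ennreal \<bar>conv (mol (e k)) (\<lambda>y. g y $ i) x - g x $ i\<bar> \<partial>lborel) \<le> ennreal ((1/2) ^ k)"
        using e(3)[of k "Some (Some i)"] by (simp add: w_def)
    qed
    also have "\<dots> = ennreal (real CARD('n) * (1/2) ^ k)"
      by (simp add: ennreal_mult ennreal_of_nat_eq_real_of_nat)
    finally show "(\<integral>\<^sup>+x. ennreal (norm (gradient (conv (mol (e k)) u) x - g x)) * indicator W x \<partial>lborel)
       \<le> ennreal (real CARD('n) * (1/2) ^ k)" .
  qed
qed

section \<open>Truncations with zero boundary values\<close>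

lemma test_function_kernel:
  assumes "\<phi> \<in> test_functions V"
  obtains R where "kernel R \<phi>"
proof -
  have "bounded (closure {x. \<phi> x \<noteq> 0})"
    using assms by (auto simp: test_functions_def compactly_contained_def compact_imp_bounded)
  then have "bounded {x. \<phi> x \<noteq> 0}" by (rule bounded_subset[OF _ closure_subset])
  then obtain R where R: "\<forall>x\<in>{x. \<phi> x \<noteq> 0}. norm x \<le> R" unfolding bounded_iff by blast
  have "\<phi> x = 0" if "R < norm x" for x
    using R that by (meson leD mem_Collect_eq)
  then have "kernel R \<phi>"
    using assms by (simp add: kernel_def test_functions_def)
  then show ?thesis by (rule that)
qed

lemma integrable_kernel:
  fixes \<psi> :: "real^'n \<Rightarrow> real"
  assumes "kernel R \<psi>"
  shows "integrable lborel \<psi>"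
proof -
  obtain b where b: "\<And>x. \<bar>\<psi> x\<bar> \<le> b"
    using bounded_on_support[OF kernel_continuous[OF assms], of R] assms unfolding kernel_def by metis
  show ?thesis
  proof (rule Bochner_Integration.integrable_bound[where f = "\<lambda>x. b * indicator (cball (0::real^'n) R) x"])
    show "integrable lborel (\<lambda>x. b * indicator (cball (0::real^'n) R) x)"
      using emeasure_lborel_cball_finite[of "0::real^'n" R]
      by (intro integrable_mult_right integrable_real_indicator) auto
    show "\<psi> \<in> borel_measurable lborel"
      using kernel_continuous[OF assms] borel_measurable_continuous_onI by auto
    show "AE x in lborel. norm (\<psi> x) \<le> norm (b * indicator (cball (0::real^'n) R) x)"
    proof (rule AE_I2)
      fix x :: "real^'n"
      show "norm (\<psi> x) \<le> norm (b * indicator (cball (0::real^'n) R) x)"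
        using b[of x] assms unfolding kernel_def by (cases "norm x \<le> R") auto
    qed
  qed
qed

lemma integral_lborel_reflect:
  fixes f :: "'a::euclidean_space \<Rightarrow> real"
  assumes [measurable]: "f \<in> borel_measurable borel"
  shows "(\<integral>x. f (c - x) \<partial>lborel) = (\<integral>x. f x \<partial>lborel)"
proof -
  have "lborel = distr lborel borel (\<lambda>x. c - x :: 'a)"
    using lborel_affine[of "-1" c] by (simp add: density_1)
  then have "(\<integral>x. f x \<partial>lborel) = (\<integral>x. f x \<partial>distr lborel borel (\<lambda>x. c - x))"
    by simp
  also have "\<dots> = (\<integral>x. f (c - x) \<partial>lborel)"
    by (intro integral_distr) auto
  finally show ?thesis by simp
qed

text \<open>Near 0 the ball contains every point at which the shifted kernel can be nonzero: the
  radius exceeds |R| plus the norm of \<open>x\<close>.\<close>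

lemma conv_indicator_ball:
  fixes \<psi> :: "real^'n \<Rightarrow> real"
  assumes \<psi>: "kernel R \<psi>" and x: "norm x < 1"
  shows "conv \<psi> (indicator (ball 0 (\<bar>R\<bar> + 2))) x = (\<integral>y. \<psi> y \<partial>lborel)"
proof -
  have "indicator (ball 0 (\<bar>R\<bar> + 2)) y * \<psi> (x - y) = \<psi> (x - y)" for y
  proof (cases "norm y < \<bar>R\<bar> + 2")
    case False
    have "norm y \<le> norm (x - y) + norm x" by (metis norm_minus_commute norm_triangle_sub add.commute)
    then have "R < norm (x - y)" using False x by linarith
    then show ?thesis using \<psi> by (simp add: kernel_def)
  qed simp
  then have "conv \<psi> (indicator (ball 0 (\<bar>R\<bar> + 2))) x = (\<integral>y. \<psi> (x - y) \<partial>lborel)"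
    by (simp only: conv_def)
  also have "\<dots> = (\<integral>y. \<psi> y \<partial>lborel)"
    by (intro integral_lborel_reflect borel_measurable_continuous_onI kernel_continuous[OF \<psi>])
  finally show ?thesis .
qed

text \<open>Convolving \<psi> with the indicator of a large ball gives a function that is constant
  near 0. Its derivative there vanishes, and it is also the convolution with the derivative of
  \<psi>, that is, the integral in question.\<close>

lemma integral_partial_deriv_kernel:
  fixes \<psi> :: "real^'n \<Rightarrow> real"
  assumes \<psi>: "kernel R \<psi>"
  shows "(\<integral>y. partial_deriv i \<psi> y \<partial>lborel) = 0"
proof -
  define u :: "real^'n \<Rightarrow> real" where "u = indicator (ball 0 (\<bar>R\<bar> + 2))"
  have u: "integrable lborel u"
    unfolding u_def using emeasure_lborel_ball_finite[of "0::real^'n" "\<bar>R\<bar> + 2"]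
    by (intro integrable_real_indicator) auto
  have "(conv \<psi> u has_derivative (\<lambda>h. 0)) (at 0)"
  proof (rule has_derivative_transform_within_open[OF has_derivative_const])
    show "(\<integral>y. \<psi> y \<partial>lborel) = conv \<psi> u x" if "x \<in> ball 0 1" for x
      using conv_indicator_ball[OF \<psi>, of x] that by (simp add: u_def)
  qed auto
  then have "partial_deriv i (conv \<psi> u) 0 = 0" by (simp add: partial_deriv_eq)
  then have "conv (partial_deriv i \<psi>) u 0 = 0" by (simp add: partial_deriv_conv[OF u \<psi>])
  then show ?thesis
    using conv_indicator_ball[OF kernel_partial_deriv[OF \<psi>], of 0 i] by (simp add: u_def)
qed

lemma kernel_mult:
  assumes "kernel R \<phi>" "\<And>k. C_k k \<psi>"
  shows "kernel R (\<lambda>x. \<phi> x * \<psi> x)"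
  using assms by (auto simp: kernel_def intro: C_k_mult)

lemma kernel_C_k: "kernel R \<phi> \<Longrightarrow> C_k k \<phi>"
  by (simp add: kernel_def)

lemma integration_by_parts:
  assumes \<phi>: "kernel R \<phi>" and \<psi>: "kernel R' \<psi>"
  shows "(\<integral>x. \<phi> x * partial_deriv i \<psi> x + partial_deriv i \<phi> x * \<psi> x \<partial>lborel) = 0"
proof -
  have "\<phi> differentiable_on UNIV" "\<psi> differentiable_on UNIV"
    using kernel_C_k[OF \<phi>, of 1] kernel_C_k[OF \<psi>, of 1] by auto
  then show ?thesis
    using integral_partial_deriv_kernel[OF kernel_mult[OF \<phi> kernel_C_k[OF \<psi>]], of i]
    by (simp add: partial_deriv_mult)
qed

lemma borel_measurable_lebesgue_onI:
  assumes "f \<in> borel_measurable borel"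
  shows "f \<in> borel_measurable (lebesgue_on Q)"
  using assms by (intro measurable_restrict_space1 measurable_completion) simp

lemma nn_integral_lebesgue_on:
  fixes f :: "'a::euclidean_space \<Rightarrow> ennreal"
  assumes Q: "Q \<in> sets borel" and [measurable]: "f \<in> borel_measurable borel"
  shows "(\<integral>\<^sup>+x. f x \<partial>lebesgue_on Q) = (\<integral>\<^sup>+x. f x * indicator Q x \<partial>lborel)"
  using Q by (subst nn_integral_restrict_space) (auto simp: nn_integral_completion)

lemma orlicz_ennrealI:
  assumes w: "w \<in> borel_measurable (lebesgue_on Q)" and fin: "(\<integral>\<^sup>+x. ennreal \<bar>w x\<bar> \<partial>lebesgue_on Q) < \<infinity>"
  shows "w \<in> orlicz ennreal Q"
proof -
  define c where "c = enn2real (\<integral>\<^sup>+x. ennreal \<bar>w x\<bar> \<partial>lebesgue_on Q) + 1"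
  have c: "0 < c" by (simp add: c_def add_nonneg_pos)
  have le: "(\<integral>\<^sup>+x. ennreal \<bar>w x\<bar> \<partial>lebesgue_on Q) \<le> ennreal c"
  proof -
    have "(\<integral>\<^sup>+x. ennreal \<bar>w x\<bar> \<partial>lebesgue_on Q) = ennreal (enn2real (\<integral>\<^sup>+x. ennreal \<bar>w x\<bar> \<partial>lebesgue_on Q))"
      using fin by simp
    also have "\<dots> \<le> ennreal c" unfolding c_def by (rule ennreal_leI) simp
    finally show ?thesis .
  qed
  have "(\<integral>\<^sup>+x. ennreal (\<bar>w x\<bar> / c) \<partial>lebesgue_on Q) = (\<integral>\<^sup>+x. ennreal (1 / c) * ennreal \<bar>w x\<bar> \<partial>lebesgue_on Q)"
    using c by (intro nn_integral_cong) (simp add: ennreal_mult[symmetric])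
  also have "\<dots> = ennreal (1 / c) * (\<integral>\<^sup>+x. ennreal \<bar>w x\<bar> \<partial>lebesgue_on Q)"
    using w by (intro nn_integral_cmult) auto
  also have "\<dots> \<le> ennreal (1 / c) * ennreal c" by (intro mult_left_mono le) auto
  also have "\<dots> = 1" using c by (simp add: ennreal_mult[symmetric])
  finally have "luxemburg_norm ennreal Q w \<le> ennreal c"
    unfolding luxemburg_norm_def using c by (intro Inf_lower) auto
  then show ?thesis using w by (auto simp: orlicz_def intro: le_less_trans)
qed

text \<open>Convergence of test functions in the norm already forces \<open>gw\<close> to be the
  weak gradient of \<open>w\<close>, because integration by parts for the approximants passes to the
  limit. \<open>w'\<close> is a Borel representative, with which integrals can be taken in
  \<open>lborel\<close>.\<close>

lemma sobolev_11_zeroI: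
  fixes w w' :: "real^'n \<Rightarrow> real" and gw :: "real^'n \<Rightarrow> real^'n"
  assumes Q: "open Q"
    and w'[measurable]: "w' \<in> borel_measurable borel" and gw[measurable]: "gw \<in> borel_measurable borel"
    and iw: "integrable lborel (\<lambda>x. indicator Q x * w' x)" and ig: "integrable lborel (\<lambda>x. indicator Q x *\<^sub>R gw x)"
    and w: "w \<in> borel_measurable (lebesgue_on Q)" and eq: "AE x in lebesgue_on Q. w x = w' x"
    and \<phi>: "\<And>k. \<phi> k \<in> test_functions Q"
    and lim: "(\<lambda>k. \<integral>\<^sup>+x. ennreal (\<bar>w' x - \<phi> k x\<bar> + norm (gw x - gradient (\<phi> k) x)) * indicator Q x \<partial>lborel) \<longlonglongrightarrow> 0"
  shows "w \<in> sobolev_11_zero Q"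
proof -
  have Qb[measurable]: "Q \<in> sets borel" using Q by simp
  have Ql: "Q \<in> sets lebesgue" using Q by auto
  have siw: "set_integrable lebesgue Q w'"
    using iw unfolding set_integrable_def by (simp add: integrable_completion)
  have sig: "set_integrable lebesgue Q gw"
    using ig unfolding set_integrable_def by (simp add: integrable_completion)
  have w'l: "w' \<in> borel_measurable (lebesgue_on Q)" and gwl: "gw \<in> borel_measurable (lebesgue_on Q)"
    using w' gw by (auto intro: borel_measurable_lebesgue_onI)
  have "integrable (lebesgue_on Q) w'" "integrable (lebesgue_on Q) gw"
    using siw sig Ql by (auto simp: set_integrable_def integrable_restrict_space)
  note int' = this
  have int: "integrable (lebesgue_on Q) w"
    by (rule integrable_cong_AE_imp[OF int'(1) w]) (use eq in auto)
  have siw0: "set_integrable lebesgue Q w"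
    using int Ql by (auto simp: set_integrable_def integrable_restrict_space)
  have ow: "w \<in> orlicz ennreal Q"
    using int by (intro orlicz_ennrealI w) (auto simp: integrable_iff_bounded)
  have og: "(\<lambda>x. norm (gw x)) \<in> orlicz ennreal Q"
    using int'(2) gwl by (intro orlicz_ennrealI) (auto simp: integrable_iff_bounded)
  have LQ: "(LINT x:Q|lebesgue. F x) = (\<integral>x. indicator Q x * F x \<partial>lborel)"
    if [measurable]: "F \<in> borel_measurable borel" for F :: "real^'n \<Rightarrow> real"
    unfolding set_lebesgue_integral_def by (simp add: integral_completion)
  have weak: "(LINT x:Q|lebesgue. w x * partial_deriv i \<psi> x) = - (LINT x:Q|lebesgue. gw x $ i * \<psi> x)"
    if \<psi>: "\<psi> \<in> test_functions Q" for \<psi> i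
  proof -
    obtain R where k\<psi>: "kernel R \<psi>" using test_function_kernel[OF \<psi>] .
    note kd = kernel_partial_deriv[OF k\<psi>, of i]
    have [measurable]: "\<psi> \<in> borel_measurable borel" "partial_deriv i \<psi> \<in> borel_measurable borel"
      using kernel_continuous[OF k\<psi>] kernel_continuous[OF kd] borel_measurable_continuous_onI by auto
    obtain b1 where b1: "\<And>x. \<bar>\<psi> x\<bar> \<le> b1"
      using bounded_on_support[OF kernel_continuous[OF k\<psi>], of R] k\<psi> unfolding kernel_def by metis
    obtain b2 where b2: "\<And>x. \<bar>partial_deriv i \<psi> x\<bar> \<le> b2"
      using bounded_on_support[OF kernel_continuous[OF kd], of R] kd unfolding kernel_def by metis
    define b where "b = max b1 b2"
    have b: "\<bar>\<psi> x\<bar> \<le> b" "\<bar>partial_deriv i \<psi> x\<bar> \<le> b" "0 \<le> b" for x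
      using b1[of x] b2[of x] abs_ge_zero[of "\<psi> x"] by (auto simp: b_def simp del: abs_ge_zero)
    have bounded_int: "integrable lborel (\<lambda>x. F x * G x)"
      if F: "integrable lborel F" and [measurable]: "G \<in> borel_measurable borel" and G: "\<And>x. \<bar>G x\<bar> \<le> b"
      for F G :: "real^'n \<Rightarrow> real"
    proof (rule Bochner_Integration.integrable_bound)
      show "integrable lborel (\<lambda>x. b * F x)" using F by simp
      show "(\<lambda>x. F x * G x) \<in> borel_measurable lborel" using F[THEN borel_measurable_integrable] by measurable
      show "AE x in lborel. norm (F x * G x) \<le> norm (b * F x)"
        using G b(3) by (intro AE_I2) (auto simp: abs_mult mult.commute[of "\<bar>F _\<bar>"] intro!: mult_right_mono)
    qed
    have igi: "integrable lborel (\<lambda>x. indicator Q x * gw x $ i)"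
      using integrable_inner_left[OF ig, of "axis i 1"] by (simp add: inner_axis)
    have int1: "integrable lborel (\<lambda>x. (indicator Q x * w' x) * partial_deriv i \<psi> x)"
      by (rule bounded_int[OF iw]) (use b in auto)
    have int2: "integrable lborel (\<lambda>x. (indicator Q x * gw x $ i) * \<psi> x)"
      by (rule bounded_int[OF igi]) (use b in auto)
    \<comment> \<open>The defect of the weak identity. Subtracting the same expression for the k-th
      test function, which is 0, shows that it is at most \<open>b\<close> times the norm error
      \<open>X k\<close>.\<close>
    define a where "a = (\<integral>x. (indicator Q x * w' x) * partial_deriv i \<psi> x + (indicator Q x * gw x $ i) * \<psi> x \<partial>lborel)"
    define X where "X = (\<lambda>k. \<integral>\<^sup>+x. ennreal (\<bar>w' x - \<phi> k x\<bar> + norm (gw x - gradient (\<phi> k) x)) * indicator Q x \<partial>lborel)"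
    have "ennreal \<bar>a\<bar> \<le> ennreal b * X k" for k
    proof -
      obtain R' where k\<phi>: "kernel R' (\<phi> k)" using test_function_kernel[OF \<phi>] .
      have ibp: "(\<integral>x. \<phi> k x * partial_deriv i \<psi> x + partial_deriv i (\<phi> k) x * \<psi> x \<partial>lborel) = 0"
        by (rule integration_by_parts[OF k\<phi> k\<psi>])
      have j1: "integrable lborel (\<lambda>x. \<phi> k x * partial_deriv i \<psi> x)"
        by (rule bounded_int[OF integrable_kernel[OF k\<phi>]]) (use b in auto)
      have j2: "integrable lborel (\<lambda>x. partial_deriv i (\<phi> k) x * \<psi> x)"
        by (rule bounded_int[OF integrable_kernel[OF kernel_partial_deriv[OF k\<phi>]]]) (use b in auto)
      have [measurable]: "\<phi> k \<in> borel_measurable borel" "\<And>i. partial_deriv i (\<phi> k) \<in> borel_measurable borel"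
        using kernel_continuous[OF k\<phi>] kernel_continuous[OF kernel_partial_deriv[OF k\<phi>]] borel_measurable_continuous_onI by auto
      have [measurable]: "gradient (\<phi> k) \<in> borel_measurable borel"
        unfolding gradient_def[abs_def] by measurable
      have zero: "\<psi> x = 0 \<and> partial_deriv i \<psi> x = 0" if "x \<notin> Q" for x
      proof -
        have cl: "closure {x. \<psi> x \<noteq> 0} \<subseteq> Q" using \<psi> by (simp add: test_functions_def compactly_contained_def)
        have "x \<in> - closure {x. \<psi> x \<noteq> 0}" using cl that by blast
        moreover have "(\<psi> has_derivative (\<lambda>h. 0)) (at x)"
        proof (rule has_derivative_transform_within_open[OF has_derivative_const])
          show "x \<in> - closure {x. \<psi> x \<noteq> 0}" by fact
          show "open (- closure {x. \<psi> x \<noteq> 0})" by (simp add: open_Compl)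
          show "0 = \<psi> y" if "y \<in> - closure {x. \<psi> x \<noteq> 0}" for y
            using that closure_subset[of "{x. \<psi> x \<noteq> 0}"] by auto
        qed
        ultimately show ?thesis
          using closure_subset[of "{x. \<psi> x \<noteq> 0}"] by (auto simp: partial_deriv_eq)
      qed
      have "a = a - (\<integral>x. \<phi> k x * partial_deriv i \<psi> x + partial_deriv i (\<phi> k) x * \<psi> x \<partial>lborel)"
        using ibp by simp
      also have "\<dots> = (\<integral>x. ((indicator Q x * w' x) * partial_deriv i \<psi> x + (indicator Q x * gw x $ i) * \<psi> x)
           - (\<phi> k x * partial_deriv i \<psi> x + partial_deriv i (\<phi> k) x * \<psi> x) \<partial>lborel)"
        unfolding a_def using int1 int2 j1 j2 by (intro Bochner_Integration.integral_diff[symmetric]) auto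
      also have "\<dots> = (\<integral>x. indicator Q x * ((w' x - \<phi> k x) * partial_deriv i \<psi> x + (gw x $ i - partial_deriv i (\<phi> k) x) * \<psi> x) \<partial>lborel)"
        by (intro Bochner_Integration.integral_cong refl) (use zero in \<open>auto simp: algebra_simps split: split_indicator\<close>)
      finally have a_eq: "a = (\<integral>x. indicator Q x * ((w' x - \<phi> k x) * partial_deriv i \<psi> x + (gw x $ i - partial_deriv i (\<phi> k) x) * \<psi> x) \<partial>lborel)" .
      have "ennreal \<bar>a\<bar> \<le> (\<integral>\<^sup>+x. norm (indicator Q x * ((w' x - \<phi> k x) * partial_deriv i \<psi> x + (gw x $ i - partial_deriv i (\<phi> k) x) * \<psi> x)) \<partial>lborel)"
      \<comment> \<open>The integral of a non-integrable function is 0 by convention, so the bound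
        is trivial in that case.\<close>
      proof (cases "integrable lborel (\<lambda>x. indicator Q x * ((w' x - \<phi> k x) * partial_deriv i \<psi> x + (gw x $ i - partial_deriv i (\<phi> k) x) * \<psi> x))")
        case True
        from integral_norm_bound_ennreal[OF True] show ?thesis by (simp add: a_eq)
      next
        case False
        then show ?thesis by (simp add: a_eq not_integrable_integral_eq)
      qed
      also have "\<dots> \<le> (\<integral>\<^sup>+x. ennreal b * (ennreal (\<bar>w' x - \<phi> k x\<bar> + norm (gw x - gradient (\<phi> k) x)) * indicator Q x) \<partial>lborel)"
      proof (intro nn_integral_mono)
        fix x
        have "\<bar>(w' x - \<phi> k x) * partial_deriv i \<psi> x + (gw x $ i - partial_deriv i (\<phi> k) x) * \<psi> x\<bar>
           \<le> \<bar>w' x - \<phi> k x\<bar> * \<bar>partial_deriv i \<psi> x\<bar> + \<bar>gw x $ i - partial_deriv i (\<phi> k) x\<bar> * \<bar>\<psi> x\<bar>"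
          using abs_triangle_ineq by (metis abs_mult)
        also have "\<dots> \<le> \<bar>w' x - \<phi> k x\<bar> * b + norm (gw x - gradient (\<phi> k) x) * b"
        proof (intro add_mono mult_mono)
          show "\<bar>gw x $ i - partial_deriv i (\<phi> k) x\<bar> \<le> norm (gw x - gradient (\<phi> k) x)"
            using component_le_norm_cart[of "gw x - gradient (\<phi> k) x" i] by (simp add: gradient_def)
        qed (use b in auto)
        finally have "\<bar>(w' x - \<phi> k x) * partial_deriv i \<psi> x + (gw x $ i - partial_deriv i (\<phi> k) x) * \<psi> x\<bar>
           \<le> b * (\<bar>w' x - \<phi> k x\<bar> + norm (gw x - gradient (\<phi> k) x))" by (simp add: algebra_simps)
        then show "ennreal (norm (indicator Q x * ((w' x - \<phi> k x) * partial_deriv i \<psi> x + (gw x $ i - partial_deriv i (\<phi> k) x) * \<psi> x)))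
            \<le> ennreal b * (ennreal (\<bar>w' x - \<phi> k x\<bar> + norm (gw x - gradient (\<phi> k) x)) * indicator Q x)"
          using b(3) by (cases "x \<in> Q") (simp_all add: ennreal_mult[symmetric] ennreal_leI del: ennreal_plus)
      qed
      also have "\<dots> = ennreal b * X k"
        unfolding X_def by (rule nn_integral_cmult) measurable
      finally show ?thesis .
    qed
    moreover have "(\<lambda>k. ennreal b * X k) \<longlonglongrightarrow> ennreal b * 0"
      using lim unfolding X_def by (intro ennreal_tendsto_cmult) auto
    ultimately have "ennreal \<bar>a\<bar> \<le> ennreal b * 0"
      by (intro LIMSEQ_le_const[of "\<lambda>k. ennreal b * X k"]) auto
    then have "a = 0" by simp
    then have "(\<integral>x. (indicator Q x * w' x) * partial_deriv i \<psi> x \<partial>lborel) = - (\<integral>x. (indicator Q x * gw x $ i) * \<psi> x \<partial>lborel)"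
      unfolding a_def using int1 int2 by simp
    moreover have "(LINT x:Q|lebesgue. w x * partial_deriv i \<psi> x) = (LINT x:Q|lebesgue. w' x * partial_deriv i \<psi> x)"
    proof -
      have [measurable]: "partial_deriv i \<psi> \<in> borel_measurable (lebesgue_on Q)"
        by (rule borel_measurable_lebesgue_onI) measurable
      have "(\<integral>x. w x * partial_deriv i \<psi> x \<partial>lebesgue_on Q) = (\<integral>x. w' x * partial_deriv i \<psi> x \<partial>lebesgue_on Q)"
        using w w'l eq by (intro integral_cong_AE) auto
      then show ?thesis using Ql by (simp add: integral_restrict_space set_lebesgue_integral_def)
    qed
    ultimately show ?thesis
      by (simp add: LQ mult.assoc)
  qed
  have loc: "locally_integrable Q w" "locally_integrable Q gw"
    unfolding locally_integrable_def
    using set_integrable_subset[OF siw0] set_integrable_subset[OF sig] by (auto simp: lmeasurable_compact fmeasurableD)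
  have wg: "has_weak_gradient w gw Q"
    unfolding has_weak_gradient_def using loc weak by blast
  have conv: "(\<lambda>k. \<integral>\<^sup>+x. ennreal (\<bar>w x - \<phi> k x\<bar> + norm (gw x - gradient (\<phi> k) x)) \<partial>lebesgue_on Q) \<longlonglongrightarrow> 0"
  proof -
    have "(\<integral>\<^sup>+x. ennreal (\<bar>w x - \<phi> k x\<bar> + norm (gw x - gradient (\<phi> k) x)) \<partial>lebesgue_on Q)
      = (\<integral>\<^sup>+x. ennreal (\<bar>w' x - \<phi> k x\<bar> + norm (gw x - gradient (\<phi> k) x)) * indicator Q x \<partial>lborel)" for k
    proof -
      obtain R' where k\<phi>: "kernel R' (\<phi> k)" using test_function_kernel[OF \<phi>] .
      have [measurable]: "\<phi> k \<in> borel_measurable borel" "\<And>i. partial_deriv i (\<phi> k) \<in> borel_measurable borel"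
        using kernel_continuous[OF k\<phi>] kernel_continuous[OF kernel_partial_deriv[OF k\<phi>]] borel_measurable_continuous_onI by auto
      have [measurable]: "gradient (\<phi> k) \<in> borel_measurable borel"
        unfolding gradient_def[abs_def] by measurable
      have "(\<integral>\<^sup>+x. ennreal (\<bar>w x - \<phi> k x\<bar> + norm (gw x - gradient (\<phi> k) x)) \<partial>lebesgue_on Q)
        = (\<integral>\<^sup>+x. ennreal (\<bar>w' x - \<phi> k x\<bar> + norm (gw x - gradient (\<phi> k) x)) \<partial>lebesgue_on Q)"
        using eq by (intro nn_integral_cong_AE) auto
      also have "\<dots> = (\<integral>\<^sup>+x. ennreal (\<bar>w' x - \<phi> k x\<bar> + norm (gw x - gradient (\<phi> k) x)) * indicator Q x \<partial>lborel)"
        by (rule nn_integral_lebesgue_on[OF Qb]) measurable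
      finally show ?thesis .
    qed
    then show ?thesis using lim by simp
  qed
  show ?thesis
    unfolding sobolev_11_zero_def orlicz_sobolev_def using ow og wg conv \<phi> by blast
qed

text \<open>The sum of the functions has finite integral, so almost everywhere the series converges
  and its terms tend to 0. With errors of size 2^(-k) the full sequence converges almost
  everywhere.\<close>

lemma AE_tendsto_0_of_summable:
  fixes F :: "nat \<Rightarrow> 'a \<Rightarrow> ennreal"
  assumes [measurable]: "\<And>k. F k \<in> borel_measurable M" and fin: "(\<Sum>k. \<integral>\<^sup>+x. F k x \<partial>M) < \<infinity>"
  shows "AE x in M. (\<lambda>k. F k x) \<longlonglongrightarrow> 0"
proof -
  have "(\<integral>\<^sup>+x. (\<Sum>k. F k x) \<partial>M) = (\<Sum>k. \<integral>\<^sup>+x. F k x \<partial>M)"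
    by (rule nn_integral_suminf) measurable
  then have "AE x in M. (\<Sum>k. F k x) \<noteq> \<infinity>"
    using fin by (intro nn_integral_noteq_infinite) auto
  then show ?thesis
  proof eventually_elim
    case (elim x)
    have "F k x \<noteq> top" for k
    proof
      assume "F k x = top"
      have "F k x \<le> (\<Sum>k. F k x)" using sum_le_suminf[of "\<lambda>k. F k x" "{k}"] by simp
      then show False using elim \<open>F k x = top\<close> by (simp add: top_unique)
    qed
    then have F: "F k x = ennreal (enn2real (F k x))" for k by (simp add: less_top)
    have "summable (\<lambda>k. enn2real (F k x))"
      using elim F by (intro summable_suminf_not_top) (auto simp flip: F)
    then have "(\<lambda>k. enn2real (F k x)) \<longlonglongrightarrow> 0" by (rule summable_LIMSEQ_zero)
    then have "(\<lambda>k. ennreal (enn2real (F k x))) \<longlonglongrightarrow> ennreal 0" by (rule tendsto_ennrealI)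
    then show ?case by (simp flip: F)
  qed
qed

text \<open>A smooth substitute for the positive part, s exp(-1 / (N s)) for s > 0. It vanishes
  exactly for s <= 0, which lets the truncations be cut off to test functions, differs from the
  positive part by at most 1/N, and has slope between 0 and 1.\<close>

definition soft_pos :: "real \<Rightarrow> real \<Rightarrow> real" where
  "soft_pos N s = s * flat 0 (N * s)"

definition soft_step :: "real \<Rightarrow> real \<Rightarrow> real" where
  "soft_step N s = flat 0 (N * s) + N * s * flat (Suc 0) (N * s)"

lemma soft_pos_deriv: "(soft_pos N has_real_derivative soft_step N s) (at s)"
proof -
  have "((\<lambda>s. flat 0 (N * s)) has_real_derivative flat (Suc 0) (N * s) * N) (at s)"
    by (rule DERIV_chain2[OF flat_deriv]) (auto intro!: derivative_eq_intros)
  then have "((\<lambda>s. s * flat 0 (N * s)) has_real_derivative 1 * flat 0 (N * s) + (flat (Suc 0) (N * s) * N) * s) (at s)"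
    by (rule DERIV_mult[OF DERIV_ident])
  then show ?thesis
    unfolding soft_pos_def[abs_def] soft_step_def by (simp add: mult_ac)
qed

lemma C_k_soft_pos: "C_k k f \<Longrightarrow> C_k k (\<lambda>x. soft_pos N (f x))"
  unfolding soft_pos_def by (intro C_k_mult C_k_compose[where \<phi> = flat, OF flat_deriv] C_k_const)

lemma soft_pos_nonpos: "0 < N \<Longrightarrow> s \<le> 0 \<Longrightarrow> soft_pos N s = 0"
  by (simp add: soft_pos_def flat_0_eq mult_le_0_iff not_less[symmetric] zero_less_mult_iff)

lemma soft_step_nonpos: "0 < N \<Longrightarrow> s \<le> 0 \<Longrightarrow> soft_step N s = 0"
  by (auto simp: soft_step_def flat_0_eq flat_1_eq zero_less_mult_iff)

lemma soft_step_pos: "0 < N \<Longrightarrow> 0 < s \<Longrightarrow> soft_step N s = (1 + inverse (N * s)) * exp (- inverse (N * s))"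
  by (simp add: soft_step_def flat_0_eq flat_1_eq field_simps power2_eq_square)

lemma soft_step_bounds:
  assumes "0 < N"
  shows "0 \<le> soft_step N s" "soft_step N s \<le> 1"
proof -
  have "0 \<le> soft_step N s \<and> soft_step N s \<le> 1"
  proof (cases "s \<le> 0")
    case False
    define z where "z = inverse (N * s)"
    have z: "0 < z" using False assms by (simp add: z_def)
    have "(1 + z) * exp (- z) \<le> exp z * exp (- z)"
      using exp_ge_add_one_self[of z] by (intro mult_right_mono) auto
    then have "(1 + z) * exp (- z) \<le> 1" by (simp add: exp_minus)
    moreover have "soft_step N s = (1 + z) * exp (- z)"
      unfolding z_def using False assms by (intro soft_step_pos) auto
    ultimately show ?thesis using z by simp
  qed (simp add: soft_step_nonpos assms)
  then show "0 \<le> soft_step N s" "soft_step N s \<le> 1" by auto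
qed

lemma soft_pos_approx:
  assumes "0 < N"
  shows "\<bar>max s 0 - soft_pos N s\<bar> \<le> 1 / N"
proof (cases "s \<le> 0")
  case False
  define z where "z = 1 / (N * s)"
  have z: "0 < z" using False assms by (simp add: z_def)
  have e: "1 - z \<le> exp (- z)" using exp_ge_add_one_self[of "- z"] by simp
  have "max s 0 - soft_pos N s = s * (1 - exp (- z))"
    using False assms by (simp add: soft_pos_def flat_0_eq z_def algebra_simps)
  moreover have "0 \<le> s * (1 - exp (- z))" using False z by simp
  moreover have "s * (1 - exp (- z)) \<le> s * z" using e False by (intro mult_left_mono) auto
  moreover have "s * z = 1 / N" using False assms by (simp add: z_def)
  ultimately show ?thesis by linarith
qed (use assms in \<open>simp add: soft_pos_nonpos\<close>)

text \<open>With z = 1 / (N s) the slope is (1 + z) exp(-z), which tends to 1 as z tends to 0. The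
  value \<open>s0 = 0\<close> is excluded because no limit can be expected at the kink; hence the
  truncation levels are chosen with null level sets.\<close>

lemma soft_step_tendsto:
  assumes s: "s \<longlonglongrightarrow> s0" and s0: "s0 \<noteq> 0"
  shows "(\<lambda>j. soft_step (real (Suc j)) (s j)) \<longlonglongrightarrow> (if 0 < s0 then 1 else 0)"
proof (cases "0 < s0")
  case True
  have ev: "\<forall>\<^sub>F j in sequentially. 0 < s j" using order_tendstoD(1)[OF s True] .
  have "filterlim (\<lambda>j. real (Suc j)) at_top sequentially"
    by (rule filterlim_compose[OF filterlim_real_sequentially filterlim_Suc])
  then have "filterlim (\<lambda>j. s j * real (Suc j)) at_top sequentially"
    by (rule filterlim_tendsto_pos_mult_at_top[OF s True])
  then have z: "(\<lambda>j. inverse (s j * real (Suc j))) \<longlonglongrightarrow> 0"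
    by (rule tendsto_inverse_0_at_top)
  have "(\<lambda>j. (1 + inverse (s j * real (Suc j))) * exp (- inverse (s j * real (Suc j)))) \<longlonglongrightarrow> (1 + 0) * exp (- 0)"
    by (intro tendsto_intros z)
  then have "(\<lambda>j. (1 + inverse (s j * real (Suc j))) * exp (- inverse (s j * real (Suc j)))) \<longlonglongrightarrow> 1"
    by simp
  then have "(\<lambda>j. soft_step (real (Suc j)) (s j)) \<longlonglongrightarrow> 1"
  proof (rule Lim_transform_eventually)
    show "\<forall>\<^sub>F j in sequentially. (1 + inverse (s j * real (Suc j))) * exp (- inverse (s j * real (Suc j))) = soft_step (real (Suc j)) (s j)"
      using ev by eventually_elim (simp add: soft_step_pos mult.commute del: of_nat_Suc)
  qed
  then show ?thesis using True by simp
next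
  case False
  then have "s0 < 0" using s0 by simp
  from order_tendstoD(2)[OF s this]
  have "\<forall>\<^sub>F j in sequentially. soft_step (real (Suc j)) (s j) = 0"
    by eventually_elim (simp add: soft_step_nonpos del: of_nat_Suc)
  then show ?thesis using False by (simp add: tendsto_eventually)
qed

text \<open>On the frontier the approximants take values strictly between \<open>m\<close> and
  \<open>M\<close>, so their smooth truncations vanish near it and, extended by 0, are test
  functions in \<open>Q\<close>. Their gradients converge in the mean because the slopes converge
  wherever u' avoids both levels.\<close>

lemma truncation_in_sobolev_11_zero:
  fixes u u' :: "real^'n \<Rightarrow> real" and g :: "real^'n \<Rightarrow> real^'n" and uk :: "nat \<Rightarrow> real^'n \<Rightarrow> real"
  assumes Q: "open Q" "bounded Q" "closure Q \<subseteq> W" and W[measurable]: "W \<in> sets borel"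
    and u': "integrable lborel u'" and g: "integrable lborel g"
    and uk: "\<And>k m. C_k m (uk k)"
    and uk_L1: "\<And>k. (\<integral>\<^sup>+x. ennreal \<bar>uk k x - u' x\<bar> \<partial>lborel) \<le> ennreal ((1/2) ^ k)"
    and gk_L1: "\<And>k. (\<integral>\<^sup>+x. ennreal (norm (gradient (uk k) x - g x)) * indicator W x \<partial>lborel) \<le> ennreal (real CARD('n) * (1/2) ^ k)"
    and mM: "m < M" and null: "AE x in lborel. u' x \<noteq> m" "AE x in lborel. u' x \<noteq> M"
    and \<kappa>: "\<And>j. j \<le> \<kappa> j" and bd: "\<And>j y. y \<in> frontier Q \<Longrightarrow> m < uk (\<kappa> j) y \<and> uk (\<kappa> j) y < M"
    and u: "u \<in> borel_measurable (lebesgue_on Q)" and eq: "AE x in lebesgue_on Q. u x = u' x"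
  shows "(\<lambda>x. max (u x - M) 0 - max (m - u x) 0) \<in> sobolev_11_zero Q"
proof -
  have Qb[measurable]: "Q \<in> sets borel" using Q by simp
  have [measurable]: "u' \<in> borel_measurable borel" "g \<in> borel_measurable borel"
    using u' g by (auto dest: borel_measurable_integrable)
  have finQ: "emeasure lborel Q < \<infinity>" by (rule emeasure_bounded_finite[OF Q(2)])
  define v where "v = (\<lambda>j. uk (\<kappa> j))"
  have vC: "C_k k (v j)" for k j by (simp add: v_def uk)
  have dv: "v j differentiable (at x)" for j x
    using vC[of 1 j] by (auto intro: differentiable_on_UNIV_D)
  have vcont: "continuous_on UNIV (v j)" for j by (rule C_k_continuous[OF vC[of 0]])
  have [measurable]: "v j \<in> borel_measurable borel" for j
    by (rule borel_measurable_continuous_onI[OF vcont])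
  have [measurable]: "gradient (v j) \<in> borel_measurable borel" for j
  proof -
    have "C_k 0 (partial_deriv i (v j))" for i using vC[of 1 j] by simp
    then have [measurable]: "partial_deriv i (v j) \<in> borel_measurable borel" for i
      by (intro borel_measurable_continuous_onI) simp
    show ?thesis unfolding gradient_def[abs_def] by measurable
  qed
  define N where "N = (\<lambda>j::nat. real (Suc j))"
  have N: "0 < N j" for j by (simp add: N_def)
  define F where "F = (\<lambda>j x. soft_pos (N j) (v j x - M) - soft_pos (N j) (m - v j x))"
  define \<phi> where "\<phi> = (\<lambda>j x. if x \<in> Q then F j x else 0)"
  define w' where "w' = (\<lambda>x. max (u' x - M) 0 - max (m - u' x) 0)"
  \<comment> \<open>The slope of the truncation as a function of u'. Both summands are positive: the
    second positive part enters with a minus sign and decreases in u'.\<close>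
  define \<theta> where "\<theta> = (\<lambda>x. (if 0 < u' x - M then 1 else 0) + (if 0 < m - u' x then 1 else (0::real)))"
  define gw where "gw = (\<lambda>x. \<theta> x *\<^sub>R g x)"
  define \<theta>j where "\<theta>j = (\<lambda>j x. soft_step (N j) (v j x - M) + soft_step (N j) (m - v j x))"
  have [measurable]: "w' \<in> borel_measurable borel" "\<theta> \<in> borel_measurable borel" "gw \<in> borel_measurable borel"
    unfolding w'_def \<theta>_def gw_def by measurable
  have FC: "C_k k (F j)" for k j
    unfolding F_def by (intro C_k_diff C_k_soft_pos vC C_k_const)
  have [measurable]: "soft_step n \<in> borel_measurable borel" for n
  proof -
    have "continuous_on UNIV (flat m)" for m
      using flat_deriv by (auto simp: continuous_on_eq_continuous_at intro: DERIV_isCont)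
    then have [measurable]: "flat m \<in> borel_measurable borel" for m by (rule borel_measurable_continuous_onI)
    show ?thesis unfolding soft_step_def[abs_def] by measurable
  qed
  have [measurable]: "\<theta>j j \<in> borel_measurable borel" for j
    unfolding \<theta>j_def by measurable
  have test: "\<phi> j \<in> test_functions Q" for j
  proof -
    \<comment> \<open>Outside this closed set the truncation vanishes on \<open>Q\<close>; the
      frontier condition confines the set to \<open>Q\<close> itself.\<close>
    define L where "L = closure Q \<inter> ({x. M \<le> v j x} \<union> {x. v j x \<le> m})"
    have L: "closed L"
      unfolding L_def using vcont[of j] by (intro closed_Int closed_closure closed_Un closed_Collect_le continuous_intros)
    have LQ: "L \<subseteq> Q"
    proof
      fix x assume x: "x \<in> L"
      show "x \<in> Q"
      proof (rule ccontr)
        assume "x \<notin> Q"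
        then have "x \<in> frontier Q" using x Q(1) by (auto simp: L_def frontier_def interior_open)
        then have "m < v j x \<and> v j x < M" using bd unfolding v_def by blast
        then show False using x by (auto simp: L_def)
      qed
    qed
    have F0: "F j x = 0" if "x \<in> Q - L" for x
    proof -
      have "m \<le> v j x" "v j x \<le> M" using that closure_subset[of Q] by (auto simp: L_def)
      then show ?thesis using N by (simp add: F_def soft_pos_nonpos)
    qed
    have "C_k k (\<phi> j)" for k
      unfolding \<phi>_def by (rule C_k_cutoff[OF Q(1) L LQ F0 FC])
    moreover have "{x. \<phi> j x \<noteq> 0} \<subseteq> L" using F0 by (auto simp: \<phi>_def)
    then have cl: "closure {x. \<phi> j x \<noteq> 0} \<subseteq> L" using L by (rule closure_minimal)
    moreover have "compact (closure {x. \<phi> j x \<noteq> 0})"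
      using cl LQ Q(2) by (meson bounded_subset closed_closure compact_eq_bounded_closed)
    ultimately show ?thesis using LQ by (auto simp: test_functions_def compactly_contained_def)
  qed
  have grad: "gradient (\<phi> j) x = \<theta>j j x *\<^sub>R gradient (v j) x" if x: "x \<in> Q" for j x
  proof -
    have "F j differentiable (at x)" using FC[of 1 j] by (auto intro: differentiable_on_UNIV_D)
    then have "gradient (\<phi> j) x = gradient (F j) x"
      unfolding \<phi>_def by (rule gradient_cutoff[OF Q(1) x])
    also have "\<dots> = \<theta>j j x *\<^sub>R gradient (v j) x"
    proof -
      have d1: "((\<lambda>x. v j x - M) has_derivative (\<lambda>h. gradient (v j) x \<bullet> h)) (at x)"
        using has_derivative_diff[OF has_derivative_gradient[OF dv] has_derivative_const[of M]] by simp
      have d2: "((\<lambda>x. m - v j x) has_derivative (\<lambda>h. - (gradient (v j) x \<bullet> h))) (at x)"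
        using has_derivative_diff[OF has_derivative_const[of m] has_derivative_gradient[OF dv]] by simp
      have "(F j has_derivative (\<lambda>h. soft_step (N j) (v j x - M) * (gradient (v j) x \<bullet> h)
          - soft_step (N j) (m - v j x) * (- (gradient (v j) x \<bullet> h)))) (at x)"
        unfolding F_def
        by (intro has_derivative_diff
            has_derivative_compose[OF d1 has_field_derivative_imp_has_derivative[OF soft_pos_deriv]]
            has_derivative_compose[OF d2 has_field_derivative_imp_has_derivative[OF soft_pos_deriv]])
      then have D: "(F j has_derivative (\<lambda>h. (\<theta>j j x *\<^sub>R gradient (v j) x) \<bullet> h)) (at x)"
        by (simp add: \<theta>j_def algebra_simps)
      show ?thesis by (simp add: gradient_def[of "F j"] vec_eq_iff partial_deriv_of_gradient[OF D])
    qed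
    finally show ?thesis .
  qed
  have iw: "integrable lborel (\<lambda>x. indicator Q x * w' x)"
  proof (rule Bochner_Integration.integrable_bound)
    show "integrable lborel (\<lambda>x. \<bar>u' x\<bar> + (\<bar>m\<bar> + \<bar>M\<bar>) * indicator Q x)"
      using u' finQ by (intro Bochner_Integration.integrable_add integrable_mult_right integrable_real_indicator) auto
    show "AE x in lborel. norm (indicator Q x * w' x) \<le> norm (\<bar>u' x\<bar> + (\<bar>m\<bar> + \<bar>M\<bar>) * indicator Q x)"
    proof (rule AE_I2)
      fix x
      have "\<bar>w' x\<bar> \<le> \<bar>u' x\<bar> + (\<bar>m\<bar> + \<bar>M\<bar>)" using mM unfolding w'_def by (auto simp: max_def)
      then show "norm (indicator Q x * w' x) \<le> norm (\<bar>u' x\<bar> + (\<bar>m\<bar> + \<bar>M\<bar>) * indicator Q x)"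
        by (cases "x \<in> Q") auto
    qed
  qed measurable
  have \<theta>_le: "0 \<le> \<theta> x" "\<theta> x \<le> 2" for x by (auto simp: \<theta>_def)
  have \<theta>j_le: "0 \<le> \<theta>j j x" "\<theta>j j x \<le> 2" for j x
    using soft_step_bounds[OF N[of j], of "v j x - M"] soft_step_bounds[OF N[of j], of "m - v j x"] by (auto simp: \<theta>j_def)
  have ig: "integrable lborel (\<lambda>x. indicator Q x *\<^sub>R gw x)"
  proof (rule Bochner_Integration.integrable_bound)
    show "integrable lborel (\<lambda>x. 2 * norm (g x))" using g by auto
    show "AE x in lborel. norm (indicator Q x *\<^sub>R gw x) \<le> norm (2 * norm (g x))"
      using \<theta>_le by (intro AE_I2) (auto simp: gw_def split: split_indicator intro!: mult_right_mono)
  qed measurable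
  have wm: "(\<lambda>x. max (u x - M) 0 - max (m - u x) 0) \<in> borel_measurable (lebesgue_on Q)"
    using u by measurable
  have weq: "AE x in lebesgue_on Q. max (u x - M) 0 - max (m - u x) 0 = w' x"
    using eq by eventually_elim (simp add: w'_def)
  \<comment> \<open>The only error without an explicit rate: replacing the smooth slopes by
    \<theta>. It tends to 0 by dominated convergence, with majorant 4 |g|.\<close>
  define E where "E = (\<lambda>j. \<integral>\<^sup>+x. ennreal (\<bar>\<theta>j j x - \<theta> x\<bar> * norm (g x)) * indicator Q x \<partial>lborel)"
  define X where "X = (\<lambda>j. \<integral>\<^sup>+x. ennreal (\<bar>w' x - \<phi> j x\<bar> + norm (gw x - gradient (\<phi> j) x)) * indicator Q x \<partial>lborel)"
  have X_le: "X j \<le> 2 * ennreal ((1/2) ^ j) + ennreal (2 / N j) * emeasure lborel Q + 2 * ennreal (real CARD('n) * (1/2) ^ j) + E j" for j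
  proof -
    have "X j \<le> (\<integral>\<^sup>+x. ((2 * ennreal \<bar>v j x - u' x\<bar> + ennreal (2 / N j) * indicator Q x)
        + 2 * (ennreal (norm (gradient (v j) x - g x)) * indicator W x)) + ennreal (\<bar>\<theta>j j x - \<theta> x\<bar> * norm (g x)) * indicator Q x \<partial>lborel)"
      unfolding X_def
    proof (rule nn_integral_mono)
      fix x
      show "ennreal (\<bar>w' x - \<phi> j x\<bar> + norm (gw x - gradient (\<phi> j) x)) * indicator Q x
        \<le> ((2 * ennreal \<bar>v j x - u' x\<bar> + ennreal (2 / N j) * indicator Q x)
        + 2 * (ennreal (norm (gradient (v j) x - g x)) * indicator W x)) + ennreal (\<bar>\<theta>j j x - \<theta> x\<bar> * norm (g x)) * indicator Q x"
      proof (cases "x \<in> Q")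
        case True
        then have xW: "x \<in> W" using Q(3) closure_subset by blast
        have a1: "\<bar>w' x - \<phi> j x\<bar> \<le> 2 * \<bar>v j x - u' x\<bar> + 2 / N j"
        proof -
          have e: "w' x - \<phi> j x = (max (u' x - M) 0 - max (v j x - M) 0) + (max (v j x - M) 0 - soft_pos (N j) (v j x - M))
             - (max (m - u' x) 0 - max (m - v j x) 0) - (max (m - v j x) 0 - soft_pos (N j) (m - v j x))"
            using True by (simp add: w'_def \<phi>_def F_def)
          have tri: "\<bar>a + b - c - d\<bar> \<le> 2 * t + 2 / n"
            if "\<bar>a\<bar> \<le> t" "\<bar>b\<bar> \<le> 1 / n" "\<bar>c\<bar> \<le> t" "\<bar>d\<bar> \<le> 1 / n" for a b c d t n :: real
          proof -
            have "2 / n = 1 / n + 1 / n" by simp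
            then show ?thesis using that by linarith
          qed
          show ?thesis
            unfolding e by (rule tri[OF _ soft_pos_approx[OF N] _ soft_pos_approx[OF N]]) (auto simp: max_def)
        qed
        have a2: "norm (gw x - gradient (\<phi> j) x) \<le> 2 * norm (gradient (v j) x - g x) + \<bar>\<theta>j j x - \<theta> x\<bar> * norm (g x)"
        proof -
          have "gw x - gradient (\<phi> j) x = - (\<theta>j j x *\<^sub>R (gradient (v j) x - g x) + (\<theta>j j x - \<theta> x) *\<^sub>R g x)"
            by (simp add: gw_def grad[OF True] algebra_simps)
          then have "norm (gw x - gradient (\<phi> j) x) \<le> norm (\<theta>j j x *\<^sub>R (gradient (v j) x - g x)) + norm ((\<theta>j j x - \<theta> x) *\<^sub>R g x)"
            by (metis norm_minus_cancel norm_triangle_ineq)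
          also have "norm (\<theta>j j x *\<^sub>R (gradient (v j) x - g x)) \<le> 2 * norm (gradient (v j) x - g x)"
            using \<theta>j_le[of j x] by (simp add: mult_right_mono)
          finally show ?thesis by simp
        qed
        have "ennreal (\<bar>w' x - \<phi> j x\<bar> + norm (gw x - gradient (\<phi> j) x)) \<le>
           ennreal ((2 * \<bar>v j x - u' x\<bar> + 2 / N j) + 2 * norm (gradient (v j) x - g x) + \<bar>\<theta>j j x - \<theta> x\<bar> * norm (g x))"
          using a1 a2 by (intro ennreal_leI) linarith
        also have "\<dots> = 2 * ennreal \<bar>v j x - u' x\<bar> + ennreal (2 / N j) + 2 * ennreal (norm (gradient (v j) x - g x)) + ennreal (\<bar>\<theta>j j x - \<theta> x\<bar> * norm (g x))"
          using N[of j] by (simp add: ennreal_mult)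
        finally show ?thesis using True xW by simp
      qed simp
    qed
    also have "\<dots> = (\<integral>\<^sup>+x. ((2 * ennreal \<bar>v j x - u' x\<bar> + ennreal (2 / N j) * indicator Q x)
        + 2 * (ennreal (norm (gradient (v j) x - g x)) * indicator W x)) \<partial>lborel) + E j"
      unfolding E_def by (rule nn_integral_add) measurable
    also have "(\<integral>\<^sup>+x. ((2 * ennreal \<bar>v j x - u' x\<bar> + ennreal (2 / N j) * indicator Q x)
        + 2 * (ennreal (norm (gradient (v j) x - g x)) * indicator W x)) \<partial>lborel)
        = (\<integral>\<^sup>+x. (2 * ennreal \<bar>v j x - u' x\<bar> + ennreal (2 / N j) * indicator Q x) \<partial>lborel)
          + (\<integral>\<^sup>+x. 2 * (ennreal (norm (gradient (v j) x - g x)) * indicator W x) \<partial>lborel)"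
      by (rule nn_integral_add) measurable
    also have "(\<integral>\<^sup>+x. (2 * ennreal \<bar>v j x - u' x\<bar> + ennreal (2 / N j) * indicator Q x) \<partial>lborel)
        = (\<integral>\<^sup>+x. 2 * ennreal \<bar>v j x - u' x\<bar> \<partial>lborel) + (\<integral>\<^sup>+x. ennreal (2 / N j) * indicator Q x \<partial>lborel)"
      by (rule nn_integral_add) measurable
    also have "(\<integral>\<^sup>+x. 2 * ennreal \<bar>v j x - u' x\<bar> \<partial>lborel) = 2 * (\<integral>\<^sup>+x. ennreal \<bar>v j x - u' x\<bar> \<partial>lborel)"
      by (rule nn_integral_cmult) measurable
    also have "(\<integral>\<^sup>+x. ennreal (2 / N j) * indicator Q x \<partial>lborel) = ennreal (2 / N j) * emeasure lborel Q"
      by (rule nn_integral_cmult_indicator) simp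
    also have "(\<integral>\<^sup>+x. 2 * (ennreal (norm (gradient (v j) x - g x)) * indicator W x) \<partial>lborel)
        = 2 * (\<integral>\<^sup>+x. (ennreal (norm (gradient (v j) x - g x)) * indicator W x) \<partial>lborel)"
      by (rule nn_integral_cmult) measurable
    also have "2 * (\<integral>\<^sup>+x. ennreal \<bar>v j x - u' x\<bar> \<partial>lborel) + ennreal (2 / N j) * emeasure lborel Q
        + 2 * (\<integral>\<^sup>+x. (ennreal (norm (gradient (v j) x - g x)) * indicator W x) \<partial>lborel) + E j
      \<le> 2 * ennreal ((1/2) ^ j) + ennreal (2 / N j) * emeasure lborel Q + 2 * ennreal (real CARD('n) * (1/2) ^ j) + E j"
    proof -
      \<comment> \<open>Passing to the indices \<open>\<kappa> j \<ge> j\<close> only improves the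
        geometric error bounds.\<close>
      have p: "(1/2::real) ^ \<kappa> j \<le> (1/2) ^ j" using \<kappa>[of j] by (intro power_decreasing) auto
      have "(\<integral>\<^sup>+x. ennreal \<bar>v j x - u' x\<bar> \<partial>lborel) \<le> ennreal ((1/2) ^ j)"
        unfolding v_def using order_trans[OF uk_L1[of "\<kappa> j"] ennreal_leI[OF p]] .
      moreover have "(\<integral>\<^sup>+x. (ennreal (norm (gradient (v j) x - g x)) * indicator W x) \<partial>lborel) \<le> ennreal (real CARD('n) * (1/2) ^ j)"
        unfolding v_def using order_trans[OF gk_L1[of "\<kappa> j"] ennreal_leI] mult_left_mono[OF p, of "real CARD('n)"] by simp
      ultimately show ?thesis by (intro add_mono mult_left_mono) auto
    qed
    finally show ?thesis .
  qed
  have vlim: "AE x in lborel. (\<lambda>j. v j x) \<longlonglongrightarrow> u' x"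
  proof -
    have "AE x in lborel. (\<lambda>j. ennreal \<bar>v j x - u' x\<bar>) \<longlonglongrightarrow> 0"
    proof (rule AE_tendsto_0_of_summable)
      have "(\<Sum>j. \<integral>\<^sup>+x. ennreal \<bar>v j x - u' x\<bar> \<partial>lborel) \<le> (\<Sum>j. ennreal ((1/2) ^ j))"
      proof (intro suminf_le allI)
        fix j
        have p: "(1/2::real) ^ \<kappa> j \<le> (1/2) ^ j" using \<kappa>[of j] by (intro power_decreasing) auto
        show "(\<integral>\<^sup>+x. ennreal \<bar>v j x - u' x\<bar> \<partial>lborel) \<le> ennreal ((1/2) ^ j)"
          unfolding v_def using order_trans[OF uk_L1[of "\<kappa> j"] ennreal_leI[OF p]] .
      qed auto
      also have "\<dots> = ennreal (\<Sum>j. (1/2) ^ j)"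
        by (intro suminf_ennreal2 summable_geometric) auto
      finally show "(\<Sum>j. \<integral>\<^sup>+x. ennreal \<bar>v j x - u' x\<bar> \<partial>lborel) < \<infinity>"
        by (simp add: le_less_trans)
    qed measurable
    then show ?thesis
    proof eventually_elim
      case (elim x)
      then have "(\<lambda>j. enn2real (ennreal \<bar>v j x - u' x\<bar>)) \<longlonglongrightarrow> 0"
        by (intro tendsto_enn2real) simp_all
      then have "(\<lambda>j. \<bar>v j x - u' x\<bar>) \<longlonglongrightarrow> 0" by simp
      then show ?case by (simp add: tendsto_rabs_zero_iff LIM_zero_iff)
    qed
  qed
  have Elim: "E \<longlonglongrightarrow> 0"
  proof -
    have "E \<longlonglongrightarrow> (\<integral>\<^sup>+x. (0::ennreal) \<partial>(lborel :: (real^'n) measure))"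
      unfolding E_def
    proof (rule nn_integral_dominated_convergence[where w = "\<lambda>x. ennreal (4 * norm (g x))"])
      show "(\<integral>\<^sup>+x. ennreal (4 * norm (g x)) \<partial>lborel) < \<infinity>"
        using g by (auto simp: integrable_iff_bounded ennreal_mult nn_integral_cmult ennreal_mult_less_top)
      show "AE x in lborel. ennreal (\<bar>\<theta>j j x - \<theta> x\<bar> * norm (g x)) * indicator Q x \<le> ennreal (4 * norm (g x))" for j
      proof (rule AE_I2)
        fix x
        have "\<bar>\<theta>j j x - \<theta> x\<bar> \<le> 4" using \<theta>_le[of x] \<theta>j_le[of j x] by linarith
        then have "\<bar>\<theta>j j x - \<theta> x\<bar> * norm (g x) \<le> 4 * norm (g x)" by (rule mult_right_mono) simp
        then show "ennreal (\<bar>\<theta>j j x - \<theta> x\<bar> * norm (g x)) * indicator Q x \<le> ennreal (4 * norm (g x))"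
          by (auto split: split_indicator intro: ennreal_leI)
      qed
      show "AE x in lborel. (\<lambda>j. ennreal (\<bar>\<theta>j j x - \<theta> x\<bar> * norm (g x)) * indicator Q x) \<longlonglongrightarrow> 0"
        using vlim null
      proof eventually_elim
        case (elim x)
        have "(\<lambda>j. \<theta>j j x) \<longlonglongrightarrow> \<theta> x"
          unfolding \<theta>j_def \<theta>_def N_def using elim
          by (intro tendsto_add soft_step_tendsto tendsto_diff tendsto_const) auto
        then have "(\<lambda>j. \<bar>\<theta>j j x - \<theta> x\<bar> * norm (g x) * indicator Q x) \<longlonglongrightarrow> \<bar>\<theta> x - \<theta> x\<bar> * norm (g x) * indicator Q x"
          by (intro tendsto_intros)
        then have "(\<lambda>j. ennreal (\<bar>\<theta>j j x - \<theta> x\<bar> * norm (g x) * indicator Q x)) \<longlonglongrightarrow> ennreal 0"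
          by (intro tendsto_ennrealI) simp
        moreover have "ennreal (a * indicator Q x) = ennreal a * indicator Q x" for a
          by (auto split: split_indicator)
        ultimately show ?case by simp
      qed
    qed measurable
    then show ?thesis by simp
  qed
  have Xlim: "X \<longlonglongrightarrow> 0"
  proof (rule tendsto_sandwich[OF _ _ tendsto_const])
    show "\<forall>\<^sub>F j in sequentially. X j \<le> 2 * ennreal ((1/2) ^ j) + ennreal (2 / N j) * emeasure lborel Q + 2 * ennreal (real CARD('n) * (1/2) ^ j) + E j"
      using X_le by simp
    have h: "(\<lambda>j. (1/2::real) ^ j) \<longlonglongrightarrow> 0" by (rule LIMSEQ_realpow_zero) auto
    have h1: "(\<lambda>j. ennreal ((1/2) ^ j)) \<longlonglongrightarrow> ennreal 0" by (rule tendsto_ennrealI[OF h])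
    have h2: "(\<lambda>j. ennreal (real CARD('n) * (1/2) ^ j)) \<longlonglongrightarrow> ennreal 0"
      using tendsto_mult[OF tendsto_const[of "real CARD('n)"] h] by (intro tendsto_ennrealI) simp
    have h3: "(\<lambda>j. ennreal (2 / N j)) \<longlonglongrightarrow> ennreal 0"
    proof (rule tendsto_ennrealI)
      have "(\<lambda>j. 2 * inverse (real (Suc j))) \<longlonglongrightarrow> 2 * 0"
        by (intro tendsto_mult tendsto_const LIMSEQ_inverse_real_of_nat)
      then show "(\<lambda>j. 2 / N j) \<longlonglongrightarrow> 0" by (simp add: N_def divide_inverse)
    qed
    have h4: "(\<lambda>j. ennreal (2 / N j) * emeasure lborel Q) \<longlonglongrightarrow> 0"
      using ennreal_tendsto_cmult[OF _ h3, of "emeasure lborel Q"] finQ by (simp add: mult.commute)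
    have h5: "(\<lambda>j. 2 * ennreal ((1/2) ^ j)) \<longlonglongrightarrow> 2 * ennreal 0"
      by (rule ennreal_tendsto_cmult[OF _ h1]) simp
    have h6: "(\<lambda>j. 2 * ennreal (real CARD('n) * (1/2) ^ j)) \<longlonglongrightarrow> 2 * ennreal 0"
      by (rule ennreal_tendsto_cmult[OF _ h2]) simp
    show "(\<lambda>j. 2 * ennreal ((1/2) ^ j) + ennreal (2 / N j) * emeasure lborel Q + 2 * ennreal (real CARD('n) * (1/2) ^ j) + E j) \<longlonglongrightarrow> 0"
      using tendsto_add[OF tendsto_add[OF tendsto_add[OF h5 h4] h6] Elim] by simp
  qed simp
  show ?thesis
    by (rule sobolev_11_zeroI[OF Q(1) _ _ iw ig wm weq test]) (use Xlim in \<open>simp_all add: X_def\<close>)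
qed

section \<open>Oscillation on almost every cube\<close>

definition cube :: "real^'n \<Rightarrow> real \<Rightarrow> (real^'n) set" where
  "cube x r = {y. \<forall>j. \<bar>y $ j - x $ j\<bar> < r}"

definition ccube :: "real^'n \<Rightarrow> real \<Rightarrow> (real^'n) set" where
  "ccube x r = {y. \<forall>j. \<bar>y $ j - x $ j\<bar> \<le> r}"

lemma cube_eq_box: "cube x r = box (\<chi> j. x $ j - r) (\<chi> j. x $ j + r)"
  by (auto simp: cube_def mem_box_cart abs_less_iff algebra_simps)

lemma ccube_eq_cbox: "ccube x r = cbox (\<chi> j. x $ j - r) (\<chi> j. x $ j + r)"
  unfolding ccube_def mem_box_cart set_eq_iff mem_Collect_eq abs_le_iff
  by (auto simp: algebra_simps)

lemma open_cube: "open (cube x r)" and bounded_cube: "bounded (cube x r)"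
  by (simp_all add: cube_eq_box open_box bounded_box)

lemma closure_cube_subset: "closure (cube x r) \<subseteq> ccube x r"
proof (rule closure_minimal)
  show "closed (ccube x r)" unfolding ccube_eq_cbox by (rule closed_cbox)
qed (auto simp: cube_def ccube_def less_imp_le)

lemma mem_cube_self: "0 < r \<Longrightarrow> x \<in> cube x r"
  by (simp add: cube_def)

lemma compactly_contained_cube:
  assumes "ccube x r \<subseteq> \<Omega>"
  shows "compactly_contained (cube x r) \<Omega>"
proof -
  have "compact (closure (cube x r))"
    using bounded_cube[of x r] by (simp add: compact_closure)
  then show ?thesis
    using assms closure_cube_subset[of x r] by (auto simp: compactly_contained_def)
qed

definition cube_bd :: "real^'n \<Rightarrow> real \<Rightarrow> (real^'n) set" where
  "cube_bd x r = (\<Union>i. \<Union>s\<in>{1, -1}. on_face x r i s)"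

lemma frontier_cube_subset: "frontier (cube x r) \<subseteq> cube_bd x r"
proof
  fix y assume y: "y \<in> frontier (cube x r)"
  have "y \<in> ccube x r" "y \<notin> cube x r"
    using y closure_cube_subset[of x r] open_cube[of x r] by (auto simp: frontier_def interior_open)
  then have le: "\<bar>y $ j - x $ j\<bar> \<le> r" for j by (simp add: ccube_def)
  obtain i where "\<not> \<bar>y $ i - x $ i\<bar> < r" using \<open>y \<notin> cube x r\<close> unfolding cube_def by blast
  then have i: "\<bar>y $ i - x $ i\<bar> = r" using le[of i] by linarith
  define s where "s = (if 0 \<le> y $ i - x $ i then 1 else - 1 :: real)"
  have "y $ i = x $ i + s * r"
  proof (cases "0 \<le> y $ i - x $ i")
    case True
    then have "s = 1" by (simp add: s_def)
    show ?thesis unfolding \<open>s = 1\<close> using i True by linarith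
  next
    case False
    then have "s = - 1" by (simp add: s_def)
    show ?thesis unfolding \<open>s = - 1\<close> using i False by linarith
  qed
  moreover have "s \<in> {1, -1}" by (simp add: s_def)
  ultimately show "y \<in> cube_bd x r"
    unfolding cube_bd_def on_face_def using le by blast
qed

section \<open>Integrals over cube boundaries\<close>

lemma face_int_mono: "(\<And>y. F y \<le> G y) \<Longrightarrow> face_int F i x r c \<le> face_int G i x r c"
  unfolding face_int_def by (intro nn_integral_mono mult_right_mono) auto

lemma bd_int_mono: "(\<And>y. F y \<le> G y) \<Longrightarrow> bd_int F x r \<le> bd_int G x r"
  unfolding bd_int_def by (intro sum_mono face_int_mono)

lemma face_int_add:
  assumes [measurable]: "F \<in> borel_measurable borel" "G \<in> borel_measurable borel"
  shows "face_int (\<lambda>y. F y + G y) i x r c = face_int F i x r c + face_int G i x r c"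
  unfolding face_int_def distrib_right by (rule nn_integral_add) measurable

lemma bd_int_add:
  assumes "F \<in> borel_measurable borel" "G \<in> borel_measurable borel"
  shows "bd_int (\<lambda>y. F y + G y) x r = bd_int F x r + bd_int G x r"
  unfolding bd_int_def by (simp only: face_int_add[OF assms] sum.distrib)

lemma face_int_le_bd_int:
  assumes "s \<in> {1, -1}"
  shows "face_int F i x r (x $ i + s * r) \<le> bd_int F x r"
proof -
  have "face_int F i x r (x $ i + s * r) \<le> (\<Sum>s\<in>{1, -1}. face_int F i x r (x $ i + s * r))"
    by (rule member_le_sum[OF assms]) auto
  also have "\<dots> \<le> bd_int F x r"
    unfolding bd_int_def
    by (rule member_le_sum[where f = "\<lambda>i. \<Sum>s\<in>{1, -1}. face_int F i x r (x $ i + s * r)"]) auto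
  finally show ?thesis .
qed

lemma measurable_bd_int [measurable]:
  fixes F :: "real^'n \<Rightarrow> ennreal"
  assumes "F \<in> borel_measurable borel"
  shows "bd_int F x \<in> borel_measurable borel"
  unfolding bd_int_def[abs_def] by (intro borel_measurable_sum measurable_face_int assms)

text \<open>The boundary integral splits into 2 n faces, and polar coordinates turn each of them
  into an integral over a pyramid. The pyramid is enlarged by admitting ties between coordinates,
  which makes the region independent of the sign.\<close>

lemma nn_integral_bd_int_le:
  fixes F :: "real^'n \<Rightarrow> ennreal"
  assumes F[measurable]: "F \<in> borel_measurable borel" and \<eta>[measurable]: "\<eta> \<in> borel_measurable borel"
    and b: "\<And>i. (\<integral>\<^sup>+y. F y * \<eta> \<bar>y $ i - x $ i\<bar> * indicator {y. 0 < \<bar>y $ i - x $ i\<bar> \<and> \<bar>y $ i - x $ i\<bar> < R \<and>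
        (\<forall>j. \<bar>y $ j - x $ j\<bar> \<le> \<bar>y $ i - x $ i\<bar>)} y \<partial>lborel) \<le> b"
  shows "(\<integral>\<^sup>+r. \<eta> r * indicator {0<..<R} r * bd_int F x r \<partial>lborel) \<le> of_nat (2 * CARD('n)) * b"
proof -
  have "(\<integral>\<^sup>+r. \<eta> r * indicator {0<..<R} r * bd_int F x r \<partial>lborel)
     = (\<integral>\<^sup>+r. (\<Sum>i\<in>UNIV. \<Sum>s\<in>{1, -1}. \<eta> r * indicator {0<..<R} r * face_int F i x r (x $ i + s * r)) \<partial>lborel)"
    unfolding bd_int_def by (simp only: sum_distrib_left)
  also have "\<dots> = (\<Sum>i\<in>UNIV. \<integral>\<^sup>+r. (\<Sum>s\<in>{1, -1}. \<eta> r * indicator {0<..<R} r * face_int F i x r (x $ i + s * r)) \<partial>lborel)"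
    by (rule nn_integral_sum) measurable
  also have "\<dots> = (\<Sum>i\<in>UNIV. \<Sum>s\<in>{1, -1}. \<integral>\<^sup>+r. \<eta> r * indicator {0<..<R} r * face_int F i x r (x $ i + s * r) \<partial>lborel)"
    by (intro sum.cong refl nn_integral_sum) measurable
  also have "\<dots> \<le> (\<Sum>i\<in>(UNIV::'n set). \<Sum>s\<in>{1, -1::real}. b)"
  proof (intro sum_mono)
    fix i :: 'n and s :: real assume "s \<in> {1, -1}"
    then have s: "\<bar>s\<bar> = 1" by auto
    show "(\<integral>\<^sup>+r. \<eta> r * indicator {0<..<R} r * face_int F i x r (x $ i + s * r) \<partial>lborel) \<le> b"
      unfolding nn_integral_face_int[OF F \<eta> s]
    proof (rule order_trans[OF nn_integral_mono b[of i]])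
      fix y
      have "j = i \<or> \<bar>y $ j - x $ j\<bar> < \<bar>y $ i - x $ i\<bar> \<Longrightarrow> \<bar>y $ j - x $ j\<bar> \<le> \<bar>y $ i - x $ i\<bar>" for j by auto
      then show "F y * \<eta> \<bar>y $ i - x $ i\<bar> * indicator {y. 0 < s * (y $ i - x $ i) \<and> \<bar>y $ i - x $ i\<bar> < R \<and>
          (\<forall>j. j \<noteq> i \<longrightarrow> \<bar>y $ j - x $ j\<bar> < \<bar>y $ i - x $ i\<bar>)} y
        \<le> F y * \<eta> \<bar>y $ i - x $ i\<bar> * indicator {y. 0 < \<bar>y $ i - x $ i\<bar> \<and> \<bar>y $ i - x $ i\<bar> < R \<and>
          (\<forall>j. \<bar>y $ j - x $ j\<bar> \<le> \<bar>y $ i - x $ i\<bar>)} y"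
        by (intro mult_left_mono) (auto split: split_indicator)
    qed
  qed
  also have "\<dots> = of_nat (2 * CARD('n)) * b"
    by (simp add: mult.commute mult.left_commute)
  finally show ?thesis .
qed

lemma nn_integral_bd_int_le':
  fixes F :: "real^'n \<Rightarrow> ennreal"
  assumes F[measurable]: "F \<in> borel_measurable borel"
  shows "(\<integral>\<^sup>+r. indicator {0<..<R} r * bd_int F x r \<partial>lborel) \<le> of_nat (2 * CARD('n)) * (\<integral>\<^sup>+y. F y \<partial>lborel)"
  using nn_integral_bd_int_le[OF F borel_measurable_const[of 1], of x R "\<integral>\<^sup>+y. F y \<partial>lborel"]
  by (simp add: nn_integral_mono indicator_def)

text \<open>Provides traces: summable errors in the volume give convergence on the boundary of
  almost every cube centred at \<open>x\<close>.\<close>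

lemma AE_bd_int_tendsto_0:
  fixes F :: "nat \<Rightarrow> real^'n \<Rightarrow> ennreal"
  assumes [measurable]: "\<And>k. F k \<in> borel_measurable borel" and fin: "(\<Sum>k. \<integral>\<^sup>+y. F k y \<partial>lborel) < \<infinity>"
  shows "AE r in lborel. 0 < r \<and> r < R \<longrightarrow> (\<lambda>k. bd_int (F k) x r) \<longlonglongrightarrow> 0"
proof -
  have "AE r in lborel. (\<lambda>k. indicator {0<..<R} r * bd_int (F k) x r) \<longlonglongrightarrow> 0"
  proof (rule AE_tendsto_0_of_summable)
    have "(\<Sum>k. \<integral>\<^sup>+r. indicator {0<..<R} r * bd_int (F k) x r \<partial>lborel)
      \<le> (\<Sum>k. of_nat (2 * CARD('n)) * (\<integral>\<^sup>+y. F k y \<partial>lborel))"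
      by (intro suminf_le allI nn_integral_bd_int_le') auto
    also have "\<dots> = of_nat (2 * CARD('n)) * (\<Sum>k. \<integral>\<^sup>+y. F k y \<partial>lborel)"
      by (rule ennreal_suminf_cmult)
    also have "\<dots> < \<infinity>" using fin by (simp add: ennreal_mult_less_top of_nat_less_top)
    finally show "(\<Sum>k. \<integral>\<^sup>+r. indicator {0<..<R} r * bd_int (F k) x r \<partial>lborel) < \<infinity>" .
  qed measurable
  then show ?thesis by eventually_elim auto
qed

lemma AE_bd_int_finite:
  fixes F :: "real^'n \<Rightarrow> ennreal"
  assumes [measurable]: "F \<in> borel_measurable borel" and fin: "(\<integral>\<^sup>+y. F y \<partial>lborel) < \<infinity>"
  shows "AE r in lborel. 0 < r \<and> r < R \<longrightarrow> bd_int F x r < \<infinity>"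
proof -
  have "(\<integral>\<^sup>+r. indicator {0<..<R} r * bd_int F x r \<partial>lborel) \<noteq> \<infinity>"
  proof -
    have "of_nat (2 * CARD('n)) * (\<integral>\<^sup>+y. F y \<partial>lborel) < \<infinity>" using fin by (simp add: ennreal_mult_less_top of_nat_less_top)
    then show ?thesis using nn_integral_bd_int_le'[of F R x] by (auto simp: top_unique)
  qed
  then have "AE r in lborel. indicator {0<..<R} r * bd_int F x r \<noteq> \<infinity>"
    by (intro nn_integral_noteq_infinite) measurable
  then show ?thesis by eventually_elim (auto simp: less_top)
qed

text \<open>By Tonelli the graph of \<open>u\<close> has measure 0 in the product, so almost every
  level set is null and some such level lies in any given interval.\<close>

lemma exists_null_level:
  fixes u :: "'a::euclidean_space \<Rightarrow> real"
  assumes [measurable]: "u \<in> borel_measurable borel" and ab: "a < b"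
  obtains M where "a < M" "M < b" "AE x in lborel. u x \<noteq> M"
proof -
  have [measurable]: "Measurable.pred (borel \<Otimes>\<^sub>M borel) (\<lambda>q. u (snd q) = fst q)" by measurable
  have "(\<integral>\<^sup>+M. \<integral>\<^sup>+x. indicator {x. u x = M} x \<partial>lborel \<partial>lborel) = (\<integral>\<^sup>+x. \<integral>\<^sup>+M. indicator {x. u x = M} x \<partial>lborel \<partial>lborel)"
    by (rule lborel_pair.Fubini') measurable
  also have "\<dots> = (\<integral>\<^sup>+x. \<integral>\<^sup>+M. indicator {u x} M \<partial>lborel \<partial>lborel)"
    by (intro nn_integral_cong) (auto split: split_indicator)
  also have "\<dots> = 0" by simp
  finally have "AE M in lborel. (\<integral>\<^sup>+x. indicator {x. u x = M} x \<partial>lborel) = 0"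
    by (subst (asm) nn_integral_0_iff_AE) auto
  then have ae: "AE M in lborel. AE x in lborel. u x \<noteq> M"
  proof eventually_elim
    case (elim M)
    then have "AE x in lborel. (indicator {x. u x = M} x :: ennreal) = 0"
      by (subst (asm) nn_integral_0_iff_AE) auto
    then show ?case by eventually_elim (auto split: split_indicator)
  qed
  have "\<exists>M. a < M \<and> M < b \<and> (AE x in lborel. u x \<noteq> M)"
  proof (rule ccontr)
    assume neg: "\<not> (\<exists>M. a < M \<and> M < b \<and> (AE x in lborel. u x \<noteq> M))"
    have "AE M in lborel. M \<notin> {a<..<b}" using ae by eventually_elim (use neg in auto)
    then have "{a<..<b} \<in> null_sets lborel" by (subst AE_iff_null_sets) auto
    then show False using ab by auto
  qed
  then show ?thesis using that by blast
qed

text \<open>Dividing by \<open>L\<close> removes the Luxemburg constant from Young's inequality, so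
  \<open>boundary_osc\<close> applies to \<open>v\<close>.\<close>

lemma approx_boundary_osc:
  fixes uk :: "real^'n \<Rightarrow> real" and fk :: "real^'n \<Rightarrow> real"
  assumes n: "2 \<le> CARD('n)" and r: "0 < r" and L: "0 < L" and W: "ccube x r \<subseteq> W"
    and uk: "\<And>m. C_k m uk" and fk: "continuous_on UNIV fk"
    and young: "\<And>y t. y \<in> W \<Longrightarrow> 0 \<le> t \<Longrightarrow> ennreal (t * norm (gradient uk y)) \<le> ennreal (fk y) + young_conjugate A (L * t)"
    and p: "p \<in> cube_bd x r" and q: "q \<in> cube_bd x r"
  shows "young_conjugate (young_pre CARD('n) A) (\<bar>uk p - uk q\<bar> / (3 * osc_const CARD('n) * L * r))
    \<le> ennreal (1 / (2 * r) ^ (CARD('n) - 1)) * bd_int (\<lambda>y. ennreal (fk y)) x r"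
proof -
  define v where "v = (\<lambda>y. uk y / L)"
  define G where "G = (\<lambda>y. (1 / L) *\<^sub>R gradient uk y)"
  have du: "uk differentiable (at y)" for y
    using uk[of 1] by (auto intro: differentiable_on_UNIV_D)
  have v: "(v has_derivative (\<lambda>h. G w \<bullet> h)) (at w)" for w
  proof -
    have "((\<lambda>y. (1 / L) * uk y) has_derivative (\<lambda>h. (1 / L) * (gradient uk w \<bullet> h))) (at w)"
      by (intro has_derivative_mult_right has_derivative_gradient du)
    then show ?thesis by (simp add: v_def G_def)
  qed
  have contG: "continuous_on UNIV G"
  proof -
    have "C_k 0 (partial_deriv i uk)" for i using uk[of 1] by simp
    then have "continuous_on UNIV (gradient uk)"
      unfolding gradient_def[abs_def] by (intro continuous_on_vec_lambda) simp
    then show ?thesis unfolding G_def by (intro continuous_intros)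
  qed
  have fm: "(\<lambda>y. ennreal (fk y)) \<in> borel_measurable borel"
    using borel_measurable_continuous_onI[OF fk] by measurable
  have yv: "ennreal (\<tau> * norm (G w)) \<le> ennreal (fk w) + young_conjugate A \<tau>"
    if "\<And>j. \<bar>w $ j - x $ j\<bar> \<le> r" "0 < \<tau>" for w \<tau>
  proof -
    have "w \<in> W" using W that(1) by (auto simp: ccube_def)
    then show ?thesis
      using young[of w "\<tau> / L"] L that(2) by (simp add: G_def)
  qed
  obtain i s where ps: "p \<in> on_face x r i s" "s \<in> {1, -1}" using p by (auto simp: cube_bd_def)
  obtain j s' where qs: "q \<in> on_face x r j s'" "s' \<in> {1, -1}" using q by (auto simp: cube_bd_def)
  have "young_conjugate (young_pre CARD('n) A) (\<bar>v p - v q\<bar> / (3 * osc_const CARD('n) * r))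
    \<le> ennreal (1 / (2 * r) ^ (CARD('n) - 1)) * bd_int (\<lambda>y. ennreal (fk y)) x r"
    by (rule boundary_osc[OF v contG fm ps qs n r yv])
  moreover have "\<bar>v p - v q\<bar> / (3 * osc_const CARD('n) * r) = \<bar>uk p - uk q\<bar> / (3 * osc_const CARD('n) * L * r)"
    using L by (simp add: v_def diff_divide_distrib[symmetric] abs_divide mult_ac)
  ultimately show ?thesis by simp
qed

text \<open>If the bound failed, the smooth approximants would eventually oscillate by less than
  \<omega>/8 on the boundary. After fixing a limit \<open>c\<close> of their boundary values,
  truncation at levels close to \<open>c\<close> has zero boundary values, and weak monotonicity
  confines u to an interval shorter than \<omega> on the cube, contrary to
  \<open>osc\<close>.\<close>

lemma essential_osc_radius:
  fixes u u' f :: "real^'n \<Rightarrow> real" and g :: "real^'n \<Rightarrow> real^'n" and uk fk :: "nat \<Rightarrow> real^'n \<Rightarrow> real"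
  assumes n: "2 \<le> CARD('n)" and r: "0 < r" and L: "0 < L"
    and W: "ccube x r \<subseteq> W" "W \<subseteq> \<Omega>" "W \<in> sets borel"
    and u'int: "integrable lborel u'" and g: "integrable lborel g" and f[measurable]: "f \<in> borel_measurable borel"
    and uk: "\<And>k m. C_k m (uk k)" and fk: "\<And>k. continuous_on UNIV (fk k)"
    and uk_L1: "\<And>k. (\<integral>\<^sup>+x. ennreal \<bar>uk k x - u' x\<bar> \<partial>lborel) \<le> ennreal ((1/2) ^ k)"
    and gk_L1: "\<And>k. (\<integral>\<^sup>+x. ennreal (norm (gradient (uk k) x - g x)) * indicator W x \<partial>lborel) \<le> ennreal (real CARD('n) * (1/2) ^ k)"
    and young: "\<And>k y t. y \<in> W \<Longrightarrow> 0 \<le> t \<Longrightarrow>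
      ennreal (t * norm (gradient (uk k) y)) \<le> ennreal (fk k y) + young_conjugate A (L * t)"
    and u: "u \<in> borel_measurable (lebesgue_on \<Omega>)" and wm: "weakly_monotone \<Omega> u"
    and eq: "AE y in lebesgue. y \<in> W \<longrightarrow> u y = u' y"
    and f_lim: "(\<lambda>k. bd_int (\<lambda>y. ennreal \<bar>fk k y - f y\<bar>) x r) \<longlonglongrightarrow> 0"
    and u_lim: "(\<lambda>k. bd_int (\<lambda>y. ennreal \<bar>uk k y - u' y\<bar>) x r) \<longlonglongrightarrow> 0"
    and u_fin: "bd_int (\<lambda>y. ennreal \<bar>u' y\<bar>) x r < \<infinity>"
    and \<omega>: "0 < \<omega>"
    and osc: "\<And>a b. (AE y in lebesgue. y \<in> cube x r \<longrightarrow> a \<le> u y \<and> u y \<le> b) \<Longrightarrow> \<omega> \<le> b - a"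
  shows "young_conjugate (young_pre CARD('n) A) (\<omega> / 8 / (3 * osc_const CARD('n) * L * r))
    \<le> ennreal (1 / (2 * r) ^ (CARD('n) - 1)) * bd_int (\<lambda>y. ennreal (f y)) x r" (is "?Y \<le> ?c * ?b")
proof (rule ccontr)
  assume "\<not> ?Y \<le> ?c * ?b"
  then have less: "?c * ?b < ?Y" by simp
  have [measurable]: "fk k \<in> borel_measurable borel" for k by (rule borel_measurable_continuous_onI[OF fk])
  have [measurable]: "uk k \<in> borel_measurable borel" for k
    by (rule borel_measurable_continuous_onI[OF C_k_continuous[OF uk[of 0]]])
  have [measurable]: "u' \<in> borel_measurable borel" using u'int[THEN borel_measurable_integrable] by simp
  define C where "C = 3 * osc_const CARD('n) * L * r"
  have C: "0 < C" using L r by (simp add: C_def osc_const_def)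
  have "(\<lambda>k. ?c * (?b + bd_int (\<lambda>y. ennreal \<bar>fk k y - f y\<bar>) x r)) \<longlonglongrightarrow> ?c * (?b + 0)"
    by (intro ennreal_tendsto_cmult tendsto_add tendsto_const f_lim) simp
  then have "\<forall>\<^sub>F k in sequentially. ?c * (?b + bd_int (\<lambda>y. ennreal \<bar>fk k y - f y\<bar>) x r) < ?Y"
    using less by (intro order_tendstoD(2)) auto
  \<comment> \<open>The strict inequality \<open>less\<close> survives replacing \<open>f\<close> by
    \<open>fk k\<close> for large k. An increment of at least \<omega>/8 would contradict it, since
    the conjugate is monotone.\<close>
  then have ev1: "\<forall>\<^sub>F k in sequentially. \<forall>p\<in>cube_bd x r. \<forall>q\<in>cube_bd x r. \<bar>uk k p - uk k q\<bar> < \<omega> / 8"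
  proof eventually_elim
    case (elim k)
    have fkb: "bd_int (\<lambda>y. ennreal (fk k y)) x r \<le> ?b + bd_int (\<lambda>y. ennreal \<bar>fk k y - f y\<bar>) x r"
    proof -
      have "bd_int (\<lambda>y. ennreal (fk k y)) x r \<le> bd_int (\<lambda>y. ennreal (f y) + ennreal \<bar>fk k y - f y\<bar>) x r"
      proof (rule bd_int_mono)
        fix y
        show "ennreal (fk k y) \<le> ennreal (f y) + ennreal \<bar>fk k y - f y\<bar>"
        proof (cases "0 \<le> f y")
          case True
          then show ?thesis by (simp add: ennreal_plus[symmetric] ennreal_leI del: ennreal_plus)
        next
          case False
          then have "ennreal (fk k y) \<le> ennreal \<bar>fk k y - f y\<bar>" by (intro ennreal_leI) linarith
          then show ?thesis using False by (simp add: ennreal_neg)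
        qed
      qed
      also have "\<dots> = ?b + bd_int (\<lambda>y. ennreal \<bar>fk k y - f y\<bar>) x r"
        by (rule bd_int_add) measurable
      finally show ?thesis .
    qed
    show ?case
    proof (intro ballI, rule ccontr)
      fix p q assume p: "p \<in> cube_bd x r" and q: "q \<in> cube_bd x r" and "\<not> \<bar>uk k p - uk k q\<bar> < \<omega> / 8"
      then have "\<omega> / 8 / C \<le> \<bar>uk k p - uk k q\<bar> / C" using C by (intro divide_right_mono) auto
      then have "?Y \<le> young_conjugate (young_pre CARD('n) A) (\<bar>uk k p - uk k q\<bar> / C)"
        unfolding C_def by (rule young_conjugate_mono)
      also have "\<dots> \<le> ?c * bd_int (\<lambda>y. ennreal (fk k y)) x r"
        unfolding C_def by (rule approx_boundary_osc[OF n r L W(1) uk fk young p q])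
      also have "\<dots> \<le> ?c * (?b + bd_int (\<lambda>y. ennreal \<bar>fk k y - f y\<bar>) x r)"
        by (rule mult_left_mono[OF fkb]) simp
      finally show False using elim by simp
    qed
  qed
  have ev2: "\<forall>\<^sub>F k in sequentially. bd_int (\<lambda>y. ennreal \<bar>uk k y - u' y\<bar>) x r < 1"
    using order_tendstoD(2)[OF u_lim, of 1] by simp
  obtain K where K: "\<And>k p q. K \<le> k \<Longrightarrow> p \<in> cube_bd x r \<Longrightarrow> q \<in> cube_bd x r \<Longrightarrow> \<bar>uk k p - uk k q\<bar> < \<omega> / 8"
      "\<And>k. K \<le> k \<Longrightarrow> bd_int (\<lambda>y. ennreal \<bar>uk k y - u' y\<bar>) x r < 1"
    using eventually_conj[OF ev1 ev2] unfolding eventually_sequentially by blast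
  define i where "i = (SOME i :: 'n. True)"
  \<comment> \<open>A corner of the cube, serving as base point for comparing boundary
    values.\<close>
  define p0 :: "real^'n" where "p0 = (\<chi> j. x $ j + r)"
  have p0: "p0 \<in> cube_bd x r"
    unfolding cube_bd_def on_face_def p0_def using r by (auto intro!: exI[of _ i])
  define S where "S = (2 * r) ^ (CARD('n) - 1)"
  have S: "0 < S" using r by (simp add: S_def)
  have em: "emeasure lborel (slab i x r) = ennreal S"
    unfolding S_def using r by (intro emeasure_slab) simp
  define D where "D = enn2real (1 + bd_int (\<lambda>y. ennreal \<bar>u' y\<bar>) x r + ennreal (\<omega> / 8 * S))"
  have Dfin: "1 + bd_int (\<lambda>y. ennreal \<bar>u' y\<bar>) x r + ennreal (\<omega> / 8 * S) = ennreal D"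
    using u_fin by (simp add: D_def less_top)
  \<comment> \<open>Boundary oscillation below \<omega>/8 makes \<open>uk k p0\<close> comparable to
    every value on a face. Averaging over the face, where \<open>uk k\<close> is close in the mean
    to the integrable trace of u', bounds it uniformly in k.\<close>
  have bound: "\<bar>uk k p0\<bar> \<le> D / S" if k: "K \<le> k" for k
  proof -
    have "ennreal \<bar>uk k p0\<bar> * ennreal S = (\<integral>\<^sup>+y. ennreal \<bar>uk k p0\<bar> * indicator (slab i x r) y \<partial>lborel)"
      by (subst nn_integral_cmult_indicator) (auto simp: em)
    also have "\<dots> \<le> face_int (\<lambda>y. (ennreal \<bar>uk k y - u' y\<bar> + ennreal \<bar>u' y\<bar>) + ennreal (\<omega> / 8)) i x r (x $ i + 1 * r)"
      unfolding face_int_def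
    proof (rule nn_integral_mono)
      fix y
      show "ennreal \<bar>uk k p0\<bar> * indicator (slab i x r) y
        \<le> (ennreal \<bar>uk k (upd y i (x $ i + 1 * r)) - u' (upd y i (x $ i + 1 * r))\<bar> + ennreal \<bar>u' (upd y i (x $ i + 1 * r))\<bar> + ennreal (\<omega> / 8)) * indicator (slab i x r) y"
      proof (cases "y \<in> slab i x r")
        case True
        have "upd y i (x $ i + 1 * r) \<in> on_face x r i 1" using True r by (auto simp: on_face_def slab_def less_imp_le)
        then have "upd y i (x $ i + 1 * r) \<in> cube_bd x r" unfolding cube_bd_def by blast
        then have "\<bar>uk k p0\<bar> \<le> \<bar>uk k (upd y i (x $ i + 1 * r)) - u' (upd y i (x $ i + 1 * r))\<bar> + \<bar>u' (upd y i (x $ i + 1 * r))\<bar> + \<omega> / 8"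
          using K(1)[OF k p0, of "upd y i (x $ i + 1 * r)"] by linarith
        then show ?thesis using True \<omega>
          by (simp add: ennreal_plus[symmetric] ennreal_leI del: ennreal_plus)
      qed simp
    qed
    also have "\<dots> = face_int (\<lambda>y. ennreal \<bar>uk k y - u' y\<bar>) i x r (x $ i + 1 * r) + face_int (\<lambda>y. ennreal \<bar>u' y\<bar>) i x r (x $ i + 1 * r)
        + face_int (\<lambda>y. ennreal (\<omega> / 8)) i x r (x $ i + 1 * r)"
      by (subst face_int_add, measurable, subst face_int_add) measurable
    also have "face_int (\<lambda>y. ennreal (\<omega> / 8)) i x r (x $ i + 1 * r) = ennreal (\<omega> / 8 * S)"
      unfolding face_int_def using S \<omega> by (subst nn_integral_cmult_indicator) (auto simp: em ennreal_mult[symmetric])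
    also have "face_int (\<lambda>y. ennreal \<bar>uk k y - u' y\<bar>) i x r (x $ i + 1 * r) + face_int (\<lambda>y. ennreal \<bar>u' y\<bar>) i x r (x $ i + 1 * r) + ennreal (\<omega> / 8 * S)
       \<le> 1 + bd_int (\<lambda>y. ennreal \<bar>u' y\<bar>) x r + ennreal (\<omega> / 8 * S)"
      using less_imp_le[OF K(2)[OF k]] face_int_le_bd_int[of 1]
      by (intro add_mono order_refl order_trans[OF face_int_le_bd_int[of 1]]) auto
    finally have "ennreal (\<bar>uk k p0\<bar> * S) \<le> ennreal D"
      using S unfolding Dfin by (simp add: ennreal_mult)
    then have "\<bar>uk k p0\<bar> * S \<le> D" by (subst (asm) ennreal_le_iff) (auto simp: D_def)
    then show ?thesis using S by (simp add: field_simps)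
  qed
  have "bounded (range (\<lambda>k. uk (k + K) p0))"
    unfolding bounded_iff using bound by (intro exI[of _ "D / S"]) auto
  \<comment> \<open>Only the value at the corner needs a subsequence; the small boundary oscillation
    carries the limit over to the whole boundary up to \<omega>/8.\<close>
  then obtain c \<rho> where \<rho>: "strict_mono \<rho>" "((\<lambda>k. uk (k + K) p0) \<circ> \<rho>) \<longlonglongrightarrow> c"
    using bounded_imp_convergent_subsequence by blast
  have "\<forall>\<^sub>F j in sequentially. dist (((\<lambda>k. uk (k + K) p0) \<circ> \<rho>) j) c < \<omega> / 8"
    using tendstoD[OF \<rho>(2), of "\<omega> / 8"] \<omega> by simp
  then obtain J where J: "\<And>j. J \<le> j \<Longrightarrow> \<bar>uk (\<rho> j + K) p0 - c\<bar> < \<omega> / 8"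
    by (auto simp: eventually_sequentially dist_real_def)
  define \<kappa> where "\<kappa> = (\<lambda>j. \<rho> (j + J) + K)"
  have \<kappa>: "j \<le> \<kappa> j" for j
    using seq_suble[OF \<rho>(1), of "j + J"] by (simp add: \<kappa>_def)
  \<comment> \<open>Boundary values lie within \<omega>/8 + \<omega>/8 = \<omega>/4 of
    \<open>c\<close>, so levels at distance between \<omega>/4 and 3 \<omega>/8 enclose them
    strictly and still satisfy M - m < 3 \<omega>/4 < \<omega>. The room is used to choose null
    levels.\<close>
  obtain m where m: "c - 3 * \<omega> / 8 < m" "m < c - \<omega> / 4" "AE x in lborel. u' x \<noteq> m"
    using exists_null_level[of u' "c - 3 * \<omega> / 8" "c - \<omega> / 4"] \<omega> by auto
  obtain M where M: "c + \<omega> / 4 < M" "M < c + 3 * \<omega> / 8" "AE x in lborel. u' x \<noteq> M"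
    using exists_null_level[of u' "c + \<omega> / 4" "c + 3 * \<omega> / 8"] \<omega> by auto
  have mM: "m < M" using m M \<omega> by linarith
  have bd: "m < uk (\<kappa> j) y \<and> uk (\<kappa> j) y < M" if "y \<in> frontier (cube x r)" for j y
  proof -
    have y: "y \<in> cube_bd x r" using that frontier_cube_subset by blast
    have "\<bar>uk (\<kappa> j) y - uk (\<kappa> j) p0\<bar> < \<omega> / 8" using K(1)[OF _ y p0] by (simp add: \<kappa>_def)
    moreover have "\<bar>uk (\<kappa> j) p0 - c\<bar> < \<omega> / 8" using J by (simp add: \<kappa>_def)
    ultimately show ?thesis using m M by linarith
  qed
  have cub: "cube x r \<subseteq> W" using W(1) by (auto simp: cube_def ccube_def less_imp_le)
  have uQ: "u \<in> borel_measurable (lebesgue_on (cube x r))"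
    using cub W(2) by (intro measurable_restrict_mono[OF u]) auto
  have Ql: "cube x r \<in> sets lebesgue" using open_cube[of x r] by auto
  have eqQ: "AE y in lebesgue_on (cube x r). u y = u' y"
  proof -
    have "AE y in lebesgue. y \<in> cube x r \<longrightarrow> u y = u' y"
      using eq by eventually_elim (use cub in auto)
    then show ?thesis using Ql by (simp add: AE_restrict_space_iff)
  qed
  have "(\<lambda>y. max (u y - M) 0 - max (m - u y) 0) \<in> sobolev_11_zero (cube x r)"
    by (rule truncation_in_sobolev_11_zero[OF open_cube bounded_cube _ W(3) u'int g uk uk_L1 gk_L1 mM m(3) M(3) \<kappa> bd uQ eqQ])
      (use closure_cube_subset[of x r] W(1) in blast)
  moreover have "compactly_contained (cube x r) \<Omega>"
    using W by (intro compactly_contained_cube) blast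
  ultimately have "AE y in lebesgue_on (cube x r). m \<le> u y \<and> u y \<le> M"
    using wm open_cube[of x r] mM unfolding weakly_monotone_def by (meson less_imp_le)
  then have "AE y in lebesgue. y \<in> cube x r \<longrightarrow> m \<le> u y \<and> u y \<le> M"
    using Ql by (subst (asm) AE_restrict_space_iff) auto
  from osc[OF this] show False using m M \<omega> by linarith
qed

section \<open>Convergence of the potential at good points\<close>

lemma sets_stieltjes_pos_Ioc: "0 < a \<Longrightarrow> a \<le> b \<Longrightarrow> {a<..b} \<in> sets (stieltjes_pos F)"
proof -
  assume ab: "0 < a" "a \<le> b"
  have "sets (stieltjes_pos F) = sigma_sets {0<..} ((\<lambda>(a, b). {a<..b}) ` {(a::real, b). 0 < a \<and> a \<le> b})"
    unfolding stieltjes_pos_def by (subst sets_extend_measure) auto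
  then show ?thesis using ab by (auto intro!: sigma_sets.Basic)
qed

text \<open>On each half-open dyadic interval the increasing function \<open>h\<close> is at least
  its value at the left end, which is half the right end. The intervals are disjoint and lie in (0,
  \<delta>).\<close>

lemma stieltjes_dyadic_sum_le:
  fixes F h :: "real \<Rightarrow> real"
  assumes mono: "mono_on {0<..} F" and right: "\<And>a. 0 < a \<Longrightarrow> continuous (at_right a) F"
    and h: "\<And>s t. 0 \<le> s \<Longrightarrow> s \<le> t \<Longrightarrow> h s \<le> h t" and J: "(1/2) ^ J < \<delta>"
  shows "(\<Sum>l. ennreal (F ((1/2) ^ (l + J)) - F ((1/2) ^ Suc (l + J))) * ennreal (h ((1/2) ^ Suc (l + J))))
    \<le> (\<integral>\<^sup>+s\<in>{0<..<\<delta>}. ennreal (h s) \<partial>stieltjes_pos F)"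
proof -
  define s where "s = (\<lambda>l. (1/2::real) ^ (l + J))"
  have s0: "0 < s l" for l by (simp add: s_def)
  have smono: "s m \<le> s l" if "l \<le> m" for l m
    unfolding s_def using that by (intro power_decreasing) auto
  define I where "I = (\<lambda>l. {s (Suc l)<..s l})"
  have I: "I l \<in> sets (stieltjes_pos F)" for l
    unfolding I_def by (intro sets_stieltjes_pos_Ioc s0 smono) simp
  have disj: "l = m" if "x \<in> I l" "x \<in> I m" for x l m
  proof (rule ccontr)
    assume "l \<noteq> m"
    then consider "Suc l \<le> m" | "Suc m \<le> l" by linarith
    then show False
    proof cases
      case 1
      then show ?thesis using smono[OF 1] that by (auto simp: I_def)
    next
      case 2
      then show ?thesis using smono[OF 2] that by (auto simp: I_def)
    qed
  qed
  have "(\<Sum>l. ennreal (F (s l) - F (s (Suc l))) * ennreal (h (s (Suc l))))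
     = (\<Sum>l. \<integral>\<^sup>+x. ennreal (h (s (Suc l))) * indicator (I l) x \<partial>stieltjes_pos F)"
  proof (intro suminf_cong)
    fix l
    have "emeasure (stieltjes_pos F) (I l) = ennreal (F (s l) - F (s (Suc l)))"
      unfolding I_def by (rule emeasure_stieltjes_pos_Ioc[OF mono right s0 smono]) auto
    then show "ennreal (F (s l) - F (s (Suc l))) * ennreal (h (s (Suc l))) = (\<integral>\<^sup>+x. ennreal (h (s (Suc l))) * indicator (I l) x \<partial>stieltjes_pos F)"
      by (subst nn_integral_cmult_indicator[OF I]) (simp add: mult.commute)
  qed
  also have "\<dots> = (\<integral>\<^sup>+x. (\<Sum>l. ennreal (h (s (Suc l))) * indicator (I l) x) \<partial>stieltjes_pos F)"
    using I by (intro nn_integral_suminf[symmetric]) auto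
  also have "\<dots> \<le> (\<integral>\<^sup>+s\<in>{0<..<\<delta>}. ennreal (h s) \<partial>stieltjes_pos F)"
  proof (rule nn_integral_mono)
    fix x
    show "(\<Sum>l. ennreal (h (s (Suc l))) * indicator (I l) x) \<le> ennreal (h x) * indicator {0<..<\<delta>} x"
    proof (cases "\<exists>k. x \<in> I k")
      case True
      then obtain k where k: "x \<in> I k" by blast
      have "(\<Sum>l. ennreal (h (s (Suc l))) * indicator (I l) x) = (\<Sum>l\<in>{k}. ennreal (h (s (Suc l))) * indicator (I l) x)"
        by (rule suminf_finite) (use disj[OF k] in \<open>auto split: split_indicator\<close>)
      also have "\<dots> = ennreal (h (s (Suc k)))" using k by simp
      also have "\<dots> \<le> ennreal (h x)"
        using k s0[of "Suc k"] by (intro ennreal_leI h) (auto simp: I_def)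
      also have "\<dots> = ennreal (h x) * indicator {0<..<\<delta>} x"
      proof -
        have "0 < x" using k s0[of "Suc k"] by (auto simp: I_def)
        moreover have "x \<le> s 0" using k smono[of 0 k] by (auto simp: I_def)
        then have "x < \<delta>" using J by (simp add: s_def)
        ultimately show ?thesis by simp
      qed
      finally show ?thesis .
    next
      case False
      then show ?thesis by simp
    qed
  qed
  finally show ?thesis by (simp add: s_def)
qed

text \<open>Discrete layer decomposition of a decreasing weight: round \<rho> down to the first
  dyadic point \<open>s m\<close> not exceeding it and telescope the increments of \<eta>. The
  increments used are exactly those whose dyadic point exceeds \<rho>.\<close>

lemma dyadic_layer_bound:
  fixes \<eta> :: "real \<Rightarrow> real"
  assumes anti: "\<And>r s. 0 < r \<Longrightarrow> r \<le> s \<Longrightarrow> \<eta> s \<le> \<eta> r" and pos: "\<And>r. 0 < r \<Longrightarrow> 0 \<le> \<eta> r"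
    and \<rho>: "0 < \<rho>" "\<rho> < (1/2) ^ J"
  shows "ennreal (\<eta> \<rho>) \<le> ennreal (\<eta> ((1/2) ^ J)) +
    (\<Sum>l. ennreal (\<eta> ((1/2) ^ Suc (l + J)) - \<eta> ((1/2) ^ (l + J))) * indicator {..<(1/2) ^ (l + J)} \<rho>)"
proof -
  define s where "s = (\<lambda>l. (1/2::real) ^ (l + J))"
  have s0: "0 < s l" for l by (simp add: s_def)
  have smono: "s m \<le> s l" if "l \<le> m" for l m
    unfolding s_def using that by (intro power_decreasing) auto
  define d where "d = (\<lambda>l. \<eta> (s (Suc l)) - \<eta> (s l))"
  have d0: "0 \<le> d l" for l using anti[OF s0[of "Suc l"] smono[of l "Suc l"]] by (simp add: d_def)
  have ex: "\<exists>m. s m \<le> \<rho>"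
  proof -
    obtain k where "(1/2) ^ k < \<rho>" using real_arch_pow_inv[OF \<rho>(1), of "1/2"] by auto
    moreover have "s k \<le> (1/2) ^ k" unfolding s_def by (intro power_decreasing) auto
    ultimately show ?thesis by (intro exI[of _ k]) linarith
  qed
  define m where "m = (LEAST m. s m \<le> \<rho>)"
  have m: "s m \<le> \<rho>" unfolding m_def using ex by (rule LeastI_ex)
  have lt: "\<rho> < s l" if "l < m" for l
    using not_less_Least[of l "\<lambda>m. s m \<le> \<rho>"] that unfolding m_def by auto
  have "\<eta> \<rho> \<le> \<eta> (s m)" using anti[OF s0 m] .
  also have "\<eta> (s m) = \<eta> (s 0) + (\<Sum>l<m. d l)"
    unfolding d_def by (subst sum_lessThan_telescope) simp
  finally have "ennreal (\<eta> \<rho>) \<le> ennreal (\<eta> (s 0) + (\<Sum>l<m. d l))" by (rule ennreal_leI)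
  also have "\<dots> = ennreal (\<eta> (s 0)) + (\<Sum>l<m. ennreal (d l))"
    using d0 pos[OF s0] by (simp add: ennreal_plus sum_nonneg sum_ennreal)
  also have "(\<Sum>l<m. ennreal (d l)) = (\<Sum>l<m. ennreal (d l) * indicator {..<s l} \<rho>)"
    using lt by (intro sum.cong) auto
  also have "\<dots> \<le> (\<Sum>l. ennreal (d l) * indicator {..<s l} \<rho>)"
    by (rule sum_le_suminf) auto
  finally show ?thesis by (simp add: s_def d_def)
qed

text \<open>The layers of \<eta> turn the weighted boundary integral into increments of \<eta> times
  energies of balls; the factor n in the radii compares the Euclidean norm with the sup norm.
  Goodness replaces each energy by \<open>h\<close> at half the scale, which leaves the dyadic
  Stieltjes sum. \<open>\<eta>'\<close> is a Borel extension of \<eta>.\<close>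

lemma good_point_potential_finite:
  fixes f :: "real^'n \<Rightarrow> real" and \<eta> h :: "real \<Rightarrow> real"
  assumes anti: "\<And>r s. 0 < r \<Longrightarrow> r \<le> s \<Longrightarrow> \<eta> s \<le> \<eta> r" and pos: "\<And>r. 0 < r \<Longrightarrow> 0 \<le> \<eta> r"
    and f: "integrable lborel f"
    and sum: "(\<Sum>l. ennreal (\<eta> ((1/2) ^ Suc (l + J)) - \<eta> ((1/2) ^ (l + J))) * ennreal (h ((1/2) ^ Suc (l + J)))) < \<infinity>"
    and good: "\<And>l. J \<le> l \<Longrightarrow> (\<integral>\<^sup>+y. ennreal (f y) * indicator (cball x (real CARD('n) * (1/2) ^ l)) y \<partial>lborel)
      \<le> ennreal C * ennreal (h ((1/2) ^ Suc l))"
    and \<eta>'[measurable]: "\<eta>' \<in> borel_measurable borel" and \<eta>'_eq: "\<And>r. 0 < r \<Longrightarrow> \<eta>' r = ennreal (\<eta> r)"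
  shows "(\<integral>\<^sup>+r. \<eta>' r * indicator {0<..<(1/2) ^ J} r * bd_int (\<lambda>y. ennreal (f y)) x r \<partial>lborel) < \<infinity>"
proof -
  have [measurable]: "f \<in> borel_measurable borel" using f[THEN borel_measurable_integrable] by simp
  have [measurable]: "cball x c \<in> sets borel" for c by simp
  define d where "d = (\<lambda>l. \<eta> ((1/2) ^ Suc (l + J)) - \<eta> ((1/2) ^ (l + J)))"
  define b where "b = ennreal (\<eta> ((1/2) ^ J)) * (\<integral>\<^sup>+y. ennreal (f y) \<partial>lborel) +
     ennreal C * (\<Sum>l. ennreal (d l) * ennreal (h ((1/2) ^ Suc (l + J))))"
  have "(\<integral>\<^sup>+y. ennreal (f y) \<partial>lborel) \<le> (\<integral>\<^sup>+y. ennreal (norm (f y)) \<partial>lborel)"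
    by (intro nn_integral_mono ennreal_leI) simp
  also have "\<dots> < \<infinity>" using f by (simp add: integrable_iff_bounded)
  finally have b: "b < \<infinity>" using sum unfolding b_def d_def by (simp add: ennreal_mult_less_top)
  have "(\<integral>\<^sup>+r. \<eta>' r * indicator {0<..<(1/2) ^ J} r * bd_int (\<lambda>y. ennreal (f y)) x r \<partial>lborel) \<le> of_nat (2 * CARD('n)) * b"
  proof (rule nn_integral_bd_int_le)
    fix i :: 'n
    define E where "E = {y. 0 < \<bar>y $ i - x $ i\<bar> \<and> \<bar>y $ i - x $ i\<bar> < (1/2) ^ J \<and> (\<forall>j. \<bar>y $ j - x $ j\<bar> \<le> \<bar>y $ i - x $ i\<bar>)}"
    have "(\<integral>\<^sup>+y. ennreal (f y) * \<eta>' \<bar>y $ i - x $ i\<bar> * indicator E y \<partial>lborel)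
      \<le> (\<integral>\<^sup>+y. ennreal (\<eta> ((1/2) ^ J)) * ennreal (f y) +
          (\<Sum>l. ennreal (d l) * (ennreal (f y) * indicator (cball x (real CARD('n) * (1/2) ^ (l + J))) y)) \<partial>lborel)"
    proof (rule nn_integral_mono)
      fix y
      show "ennreal (f y) * \<eta>' \<bar>y $ i - x $ i\<bar> * indicator E y \<le> ennreal (\<eta> ((1/2) ^ J)) * ennreal (f y) +
          (\<Sum>l. ennreal (d l) * (ennreal (f y) * indicator (cball x (real CARD('n) * (1/2) ^ (l + J))) y))"
      proof (cases "y \<in> E")
        case True
        define \<rho> where "\<rho> = \<bar>y $ i - x $ i\<bar>"
        have \<rho>: "0 < \<rho>" "\<rho> < (1/2) ^ J" and le: "\<And>j. \<bar>y $ j - x $ j\<bar> \<le> \<rho>"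
          using True by (auto simp: E_def \<rho>_def)
        have "norm (y - x) \<le> (\<Sum>j\<in>UNIV. \<bar>(y - x) $ j\<bar>)" by (rule norm_le_l1_cart)
        also have "\<dots> \<le> (\<Sum>j\<in>(UNIV::'n set). \<rho>)" using le by (intro sum_mono) simp
        finally have nrm: "norm (y - x) \<le> real CARD('n) * \<rho>" by simp
        have ball: "y \<in> cball x (real CARD('n) * (1/2) ^ l)" if "\<rho> < (1/2) ^ l" for l
        proof -
          have "real CARD('n) * \<rho> \<le> real CARD('n) * (1/2) ^ l" using that by (intro mult_left_mono) auto
          with nrm have "norm (y - x) \<le> real CARD('n) * (1/2) ^ l" by (rule order_trans)
          then show ?thesis by (simp only: mem_cball dist_norm norm_minus_commute)
        qed
        have "ennreal (f y) * \<eta>' \<bar>y $ i - x $ i\<bar> * indicator E y = ennreal (f y) * ennreal (\<eta> \<rho>)"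
          using True \<rho> by (simp add: \<rho>_def \<eta>'_eq)
        also have "\<dots> \<le> ennreal (f y) * (ennreal (\<eta> ((1/2) ^ J)) + (\<Sum>l. ennreal (d l) * indicator {..<(1/2) ^ (l + J)} \<rho>))"
          unfolding d_def by (intro mult_left_mono dyadic_layer_bound anti pos \<rho>) auto
        also have "\<dots> = ennreal (\<eta> ((1/2) ^ J)) * ennreal (f y) + (\<Sum>l. ennreal (f y) * (ennreal (d l) * indicator {..<(1/2) ^ (l + J)} \<rho>))"
          by (simp add: distrib_left mult.commute)
        also have "\<dots> \<le> ennreal (\<eta> ((1/2) ^ J)) * ennreal (f y) +
          (\<Sum>l. ennreal (d l) * (ennreal (f y) * indicator (cball x (real CARD('n) * (1/2) ^ (l + J))) y))"
        proof (intro add_left_mono suminf_le allI)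
          fix l
          show "ennreal (f y) * (ennreal (d l) * indicator {..<(1/2) ^ (l + J)} \<rho>)
             \<le> ennreal (d l) * (ennreal (f y) * indicator (cball x (real CARD('n) * (1/2) ^ (l + J))) y)"
            using ball[of "l + J"] by (cases "\<rho> < (1/2) ^ (l + J)") (simp_all add: mult.commute)
        qed auto
        finally show ?thesis .
      qed simp
    qed
    also have "\<dots> = (\<integral>\<^sup>+y. ennreal (\<eta> ((1/2) ^ J)) * ennreal (f y) \<partial>lborel) +
        (\<integral>\<^sup>+y. (\<Sum>l. ennreal (d l) * (ennreal (f y) * indicator (cball x (real CARD('n) * (1/2) ^ (l + J))) y)) \<partial>lborel)"
      by (rule nn_integral_add) measurable
    also have "(\<integral>\<^sup>+y. ennreal (\<eta> ((1/2) ^ J)) * ennreal (f y) \<partial>lborel) = ennreal (\<eta> ((1/2) ^ J)) * (\<integral>\<^sup>+y. ennreal (f y) \<partial>lborel)"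
      by (rule nn_integral_cmult) measurable
    also have "(\<integral>\<^sup>+y. (\<Sum>l. ennreal (d l) * (ennreal (f y) * indicator (cball x (real CARD('n) * (1/2) ^ (l + J))) y)) \<partial>lborel)
       = (\<Sum>l. \<integral>\<^sup>+y. ennreal (d l) * (ennreal (f y) * indicator (cball x (real CARD('n) * (1/2) ^ (l + J))) y) \<partial>lborel)"
      by (rule nn_integral_suminf) measurable
    also have "\<dots> = (\<Sum>l. ennreal (d l) * (\<integral>\<^sup>+y. ennreal (f y) * indicator (cball x (real CARD('n) * (1/2) ^ (l + J))) y \<partial>lborel))"
      by (intro suminf_cong nn_integral_cmult) measurable
    also have "\<dots> \<le> (\<Sum>l. ennreal C * (ennreal (d l) * ennreal (h ((1/2) ^ Suc (l + J)))))"
    proof (intro suminf_le allI)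
      fix l
      have "ennreal (d l) * (\<integral>\<^sup>+y. ennreal (f y) * indicator (cball x (real CARD('n) * (1/2) ^ (l + J))) y \<partial>lborel)
         \<le> ennreal (d l) * (ennreal C * ennreal (h ((1/2) ^ Suc (l + J))))"
        by (intro mult_left_mono good) auto
      then show "ennreal (d l) * (\<integral>\<^sup>+y. ennreal (f y) * indicator (cball x (real CARD('n) * (1/2) ^ (l + J))) y \<partial>lborel)
         \<le> ennreal C * (ennreal (d l) * ennreal (h ((1/2) ^ Suc (l + J))))"
        by (simp only: mult.left_commute)
    qed auto
    also have "\<dots> = ennreal C * (\<Sum>l. ennreal (d l) * ennreal (h ((1/2) ^ Suc (l + J))))"
      by (rule ennreal_suminf_cmult)
    finally show "(\<integral>\<^sup>+y. ennreal (f y) * \<eta>' \<bar>y $ i - x $ i\<bar> * indicator {y. 0 < \<bar>y $ i - x $ i\<bar> \<and> \<bar>y $ i - x $ i\<bar> < (1/2) ^ J \<and>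
        (\<forall>j. \<bar>y $ j - x $ j\<bar> \<le> \<bar>y $ i - x $ i\<bar>)} y \<partial>lborel) \<le> b"
      by (simp add: E_def b_def add_left_mono)
  qed measurable
  also have "\<dots> < \<infinity>" using b by (simp add: ennreal_mult_less_top of_nat_less_top)
  finally show ?thesis .
qed

text \<open>Exhaust the half-line by the intervals from \<open>T\<close> to
  \<open>T + real N\<close>, substitute t = 1/r on each, and pass to the supremum by monotone
  convergence.\<close>

lemma nn_integral_inverse_substitution:
  fixes F :: "real \<Rightarrow> real"
  assumes cont: "continuous_on {0<..} F" and T: "0 < T" "1 / T < R"
    and inf: "(\<integral>\<^sup>+t\<in>{T..}. ennreal (F t) \<partial>lborel) = \<infinity>"
  shows "(\<integral>\<^sup>+r. ennreal (F (1 / r) * (1 / r\<^sup>2)) * indicator {0<..<R} r \<partial>lborel) = \<infinity>"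
proof -
  define X where "X = (\<integral>\<^sup>+r. ennreal (F (1 / r) * (1 / r\<^sup>2)) * indicator {0<..<R} r \<partial>lborel)"
  have part: "(\<integral>\<^sup>+t. ennreal (F t) * indicator {T..T + real N} t \<partial>lborel) \<le> X" for N :: nat
  proof -
    define a where "a = 1 / (T + real N)" define b where "b = 1 / T"
    have ab: "0 < a" "a \<le> b" "b < R" using T by (auto simp: a_def b_def frac_le)
    have ga: "- 1 / a = - (T + real N)" "- 1 / b = - T" using T by (auto simp: a_def b_def)
    have m: "set_borel_measurable borel {- 1 / a..- 1 / b} (\<lambda>y. F (- y))"
      unfolding set_borel_measurable_def ga
      by (intro borel_measurable_continuous_on_indicator continuous_on_compose2[OF cont])
        (use T in \<open>auto intro!: continuous_intros\<close>)
    have m2: "(\<lambda>t. ennreal (F t) * indicator {T..T + real N} t) \<in> borel_measurable borel"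
    proof -
      have "(\<lambda>t. indicator {T..T + real N} t *\<^sub>R F t) \<in> borel_measurable borel"
        by (intro borel_measurable_continuous_on_indicator continuous_on_subset[OF cont]) (use T in auto)
      then have "(\<lambda>t. ennreal (indicator {T..T + real N} t *\<^sub>R F t)) \<in> borel_measurable borel" by measurable
      moreover have "ennreal (indicator {T..T + real N} t *\<^sub>R F t) = ennreal (F t) * indicator {T..T + real N} t" for t
        by (auto split: split_indicator)
      ultimately show ?thesis by simp
    qed
    have "(\<integral>\<^sup>+t. ennreal (F t) * indicator {T..T + real N} t \<partial>lborel)
       = (\<integral>\<^sup>+y. ennreal (F (- y)) * indicator {- 1 / a..- 1 / b} y \<partial>lborel)"
      unfolding ga by (subst nn_integral_real_affine[OF m2, of "- 1" 0]) (auto intro!: nn_integral_cong split: split_indicator)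
    also have "\<dots> = (\<integral>\<^sup>+y. ennreal (F (- y) * indicator {- 1 / a..- 1 / b} y) \<partial>lborel)"
      by (intro nn_integral_cong) (auto split: split_indicator)
    also have "\<dots> = (\<integral>\<^sup>+x. ennreal (F (- (- 1 / x)) * (1 / x\<^sup>2) * indicator {a..b} x) \<partial>lborel)"
    \<comment> \<open>The substitution rule asks for an increasing map, so -1/x is used and
      \<open>F\<close> is first reflected.\<close>
    proof (rule nn_integral_substitution[where f = "\<lambda>y. F (- y)" and g = "\<lambda>x. - 1 / x" and g' = "\<lambda>x. 1 / x\<^sup>2"])
      show "set_borel_measurable borel {- 1 / a..- 1 / b} (\<lambda>y. F (- y))" by (rule m)
      fix x assume "x \<in> {a..b}"
      then have x: "0 < x" using ab by auto
      show "((\<lambda>x. - 1 / x) has_real_derivative 1 / x\<^sup>2) (at x)"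
        using x by (auto intro!: derivative_eq_intros simp: power2_eq_square)
      show "0 \<le> 1 / x\<^sup>2" by simp
    next
      show "continuous_on {a..b} (\<lambda>x. 1 / x\<^sup>2)" using ab by (intro continuous_intros) auto
    qed (use ab in auto)
    also have "\<dots> = (\<integral>\<^sup>+x. ennreal (F (1 / x) * (1 / x\<^sup>2)) * indicator {a..b} x \<partial>lborel)"
      by (intro nn_integral_cong) (auto split: split_indicator)
    also have "\<dots> \<le> X"
      unfolding X_def using ab by (intro nn_integral_mono) (auto split: split_indicator)
    finally show ?thesis .
  qed
  have m: "(\<lambda>t. ennreal (F t) * indicator {T..T + real N} t) \<in> borel_measurable lborel" for N :: nat
  proof -
    have "(\<lambda>t. indicator {T..T + real N} t *\<^sub>R F t) \<in> borel_measurable borel"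
      by (intro borel_measurable_continuous_on_indicator continuous_on_subset[OF cont]) (use T in auto)
    then have "(\<lambda>t. ennreal (indicator {T..T + real N} t *\<^sub>R F t)) \<in> borel_measurable borel" by measurable
    moreover have "ennreal (indicator {T..T + real N} t *\<^sub>R F t) = ennreal (F t) * indicator {T..T + real N} t" for t
      by (auto split: split_indicator)
    ultimately show ?thesis by simp
  qed
  have "(\<integral>\<^sup>+t\<in>{T..}. ennreal (F t) \<partial>lborel) = (\<integral>\<^sup>+t. (SUP N::nat. ennreal (F t) * indicator {T..T + real N} t) \<partial>lborel)"
  proof (rule nn_integral_cong)
    fix t
    show "ennreal (F t) * indicator {T..} t = (SUP N::nat. ennreal (F t) * indicator {T..T + real N} t)"
    proof (rule antisym)
      obtain N :: nat where N: "t \<le> T + real N" using real_arch_simple[of "t - T"] by (auto simp: algebra_simps)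
      have "ennreal (F t) * indicator {T..} t \<le> ennreal (F t) * indicator {T..T + real N} t"
        using N by (auto split: split_indicator)
      then show "ennreal (F t) * indicator {T..} t \<le> (SUP N::nat. ennreal (F t) * indicator {T..T + real N} t)"
        by (rule SUP_upper2[OF UNIV_I])
    qed (auto intro!: SUP_least split: split_indicator)
  qed
  also have "\<dots> = (SUP N::nat. \<integral>\<^sup>+t. ennreal (F t) * indicator {T..T + real N} t \<partial>lborel)"
    using m by (intro nn_integral_monotone_convergence_SUP) (auto simp: incseq_def le_fun_def split: split_indicator)
  also have "\<dots> \<le> X" by (intro SUP_least part)
  finally show ?thesis using inf unfolding X_def by (simp add: top_unique)
qed

section \<open>Local continuity outside a null set\<close>

lemma test_functions_mono: "V \<subseteq> U \<Longrightarrow> test_functions V \<subseteq> test_functions U"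
  by (auto simp: test_functions_def compactly_contained_def)

lemma test_function_zero_outside:
  assumes \<psi>: "\<psi> \<in> test_functions Q" and x: "x \<notin> Q"
  shows "\<psi> x = 0" "partial_deriv i \<psi> x = 0"
proof -
  have cl: "closure {x. \<psi> x \<noteq> 0} \<subseteq> Q" using \<psi> by (simp add: test_functions_def compactly_contained_def)
  have xc: "x \<in> - closure {x. \<psi> x \<noteq> 0}" using cl x by blast
  have "(\<psi> has_derivative (\<lambda>h. 0)) (at x)"
  proof (rule has_derivative_transform_within_open[OF has_derivative_const])
    show "0 = \<psi> y" if "y \<in> - closure {x. \<psi> x \<noteq> 0}" for y
      using that closure_subset[of "{x. \<psi> x \<noteq> 0}"] by auto
  qed (use xc in \<open>auto simp: open_Compl\<close>)
  then show "partial_deriv i \<psi> x = 0" by (simp add: partial_deriv_eq)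
  show "\<psi> x = 0" using xc closure_subset[of "{x. \<psi> x \<noteq> 0}"] by auto
qed

lemma borel_representative:
  fixes u :: "'a::euclidean_space \<Rightarrow> real"
  assumes "set_integrable lebesgue V u"
  obtains u' where "integrable lborel u'" "AE x in lebesgue. indicator V x * u x = u' x"
proof -
  have i: "integrable lebesgue (\<lambda>x. indicator V x * u x)" using assms by (simp add: set_integrable_def)
  then have "(\<lambda>x. indicator V x * u x) \<in> borel_measurable lebesgue" by (rule borel_measurable_integrable)
  then obtain u' where u': "u' \<in> borel_measurable lborel" "AE x in lborel. indicator V x * u x = u' x"
    using completion_ex_borel_measurable_real by blast
  have ae: "AE x in lebesgue. indicator V x * u x = u' x" using u'(2) by (rule AE_completion)
  have "integrable lebesgue u'"
    by (rule integrable_cong_AE_imp[OF i measurable_completion[OF u'(1)]]) (use ae in auto)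
  then have "integrable lborel u'" using u'(1) by (simp add: integrable_completion)
  then show ?thesis using ae that by blast
qed

text \<open>
  The function \<open>f\<close> stands for the energy density \<open>A (norm g / L)\<close>, used only through Young's inequality.
\<close>

lemma orlicz_sobolev_representatives:
  fixes u :: "real^'n \<Rightarrow> real"
  assumes A: "young_function A" and u: "u \<in> orlicz_sobolev A U" and U: "open U"
    and V: "open V" "compact K" "V \<subseteq> K" "K \<subseteq> U"
  obtains L u' g f where "0 < L" "integrable lborel u'" "integrable lborel g" "integrable lborel f"
    "\<And>y. 0 \<le> f y" "AE y in lebesgue. y \<in> V \<longrightarrow> u y = u' y"
    "\<And>\<phi> i. \<phi> \<in> test_functions V \<Longrightarrow>
      (\<integral>y. u' y * partial_deriv i \<phi> y \<partial>lborel) = - (\<integral>y. g y $ i * \<phi> y \<partial>lborel)"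
    "\<And>y t. 0 \<le> t \<Longrightarrow> ennreal (t * norm (g y)) \<le> ennreal (f y) + young_conjugate A (L * t)"
proof -
  obtain g0 where g0: "has_weak_gradient u g0 U" "(\<lambda>x. norm (g0 x)) \<in> orlicz A U"
    using u by (auto simp: orlicz_sobolev_def)
  have "luxemburg_norm A U (\<lambda>x. norm (g0 x)) < \<infinity>" using g0(2) by (simp add: orlicz_def)
  then have "\<exists>c>0. (\<integral>\<^sup>+x. A (\<bar>norm (g0 x)\<bar> / c) \<partial>lebesgue_on U) \<le> 1"
    unfolding luxemburg_norm_def Inf_less_iff by auto
  \<comment> \<open>Finiteness of the Luxemburg norm only provides some scale at which the modular
    of the gradient is at most 1; this \<open>L\<close> is kept throughout.\<close>
  then obtain L where L: "0 < L" "(\<integral>\<^sup>+x. A (norm (g0 x) / L) \<partial>lebesgue_on U) \<le> 1"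
    by auto
  have Vb[measurable]: "V \<in> sets borel" using V by simp
  have Ub[measurable]: "U \<in> sets borel" using U by simp
  have VU: "V \<subseteq> U" using V by blast
  have su: "set_integrable lebesgue V u" and sg: "set_integrable lebesgue V g0"
  proof -
    have "set_integrable lebesgue K u" "set_integrable lebesgue K g0"
      using g0(1) V by (auto simp: has_weak_gradient_def locally_integrable_def)
    then show "set_integrable lebesgue V u" "set_integrable lebesgue V g0"
      using V by (auto intro: set_integrable_subset)
  qed
  have sgi: "set_integrable lebesgue V (\<lambda>x. g0 x $ i)" for i
    using integrable_inner_left[OF sg[unfolded set_integrable_def], of "axis i 1"]
    by (simp add: set_integrable_def inner_axis)
  obtain u' where u': "integrable lborel u'" "AE x in lebesgue. indicator V x * u x = u' x"
    using borel_representative[OF su] .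
  have "\<exists>g'. integrable lborel g' \<and> (AE x in lebesgue. indicator V x * g0 x $ i = g' x)" for i
    using borel_representative[OF sgi[of i]] by metis
  then obtain g1 where g1: "\<And>i. integrable lborel (g1 i)" "\<And>i. AE x in lebesgue. indicator V x * g0 x $ i = g1 i x"
    by metis
  have [measurable]: "u' \<in> borel_measurable borel" "\<And>i. g1 i \<in> borel_measurable borel"
    using u'(1) g1(1) by (auto dest: borel_measurable_integrable)
  define g2 where "g2 = (\<lambda>x. \<chi> i. g1 i x)"
  have [measurable]: "g2 \<in> borel_measurable borel" unfolding g2_def by measurable
  have [measurable]: "(\<lambda>x. A (max 0 x)) \<in> borel_measurable borel" by (rule young_function_measurable[OF A])
  \<comment> \<open>The truncation \<open>max 0\<close> appears because the values of
    \<open>A\<close> at negative arguments are arbitrary.\<close>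
  define a2 where "a2 = (\<lambda>x. A (max 0 (norm (g2 x) / L)))"
  have [measurable]: "a2 \<in> borel_measurable borel"
    unfolding a2_def by (rule measurable_compose[where g = "\<lambda>x. A (max 0 x)"]) measurable
  \<comment> \<open>The energy is infinite on a null set only. Setting the gradient to 0 there makes
    \<open>f\<close> real-valued and Young's inequality valid at every point, as mollification
    requires.\<close>
  define g where "g = (\<lambda>x. if a2 x < \<infinity> then g2 x else 0)"
  have [measurable]: "g \<in> borel_measurable borel" unfolding g_def by measurable
  define f where "f = (\<lambda>x. if a2 x < \<infinity> then enn2real (a2 x) else 0)"
  have [measurable]: "f \<in> borel_measurable borel" unfolding f_def by measurable
  have A0: "A 0 = 0" using A by (simp add: young_function_def)
  have fA: "ennreal (f y) = A (norm (g y) / L)" for y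
    using L(1) A0 by (simp add: f_def g_def a2_def)
  have ae2: "AE x in lebesgue. g2 x = indicator V x *\<^sub>R g0 x"
  proof -
    have "AE x in lebesgue. \<forall>i\<in>(UNIV::'n set). indicator V x * g0 x $ i = g1 i x"
      using g1(2) by (intro AE_finite_allI) auto
    then show ?thesis by eventually_elim (simp add: g2_def vec_eq_iff)
  qed
  have inta2: "(\<integral>\<^sup>+x. a2 x \<partial>lborel) \<le> 1"
  proof -
    have "(\<integral>\<^sup>+x. a2 x \<partial>lborel) = (\<integral>\<^sup>+x. a2 x \<partial>lebesgue)" by (simp add: nn_integral_completion)
    also have "\<dots> \<le> (\<integral>\<^sup>+x. A (norm (g0 x) / L) * indicator U x \<partial>lebesgue)"
    proof (rule nn_integral_mono_AE)
      show "AE x in lebesgue. a2 x \<le> A (norm (g0 x) / L) * indicator U x"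
        using ae2 by eventually_elim
          (use L(1) VU A0 in \<open>auto simp: a2_def split: split_indicator\<close>)
    qed
    also have "\<dots> = (\<integral>\<^sup>+x. A (norm (g0 x) / L) \<partial>lebesgue_on U)"
      by (subst nn_integral_restrict_space) auto
    finally show ?thesis using L(2) by (rule order_trans)
  qed
  have "AE x in lborel. a2 x \<noteq> \<infinity>"
    using inta2 by (intro nn_integral_noteq_infinite) (auto simp: top_unique)
  then have "AE x in lebesgue. a2 x \<noteq> \<infinity>" by (rule AE_completion)
  then have aeg: "AE x in lebesgue. g x = indicator V x *\<^sub>R g0 x"
    using ae2 by eventually_elim (simp add: g_def less_top)
  have intf: "integrable lborel f"
  proof -
    have "(\<integral>\<^sup>+x. ennreal (norm (f x)) \<partial>lborel) \<le> (\<integral>\<^sup>+x. a2 x \<partial>lborel)"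
      by (intro nn_integral_mono) (auto simp: f_def)
    also have "\<dots> < \<infinity>" using inta2 by (rule le_less_trans) simp
    finally have "(\<integral>\<^sup>+x. ennreal (norm (f x)) \<partial>lborel) < \<infinity>" .
    then show ?thesis by (simp add: integrable_iff_bounded)
  qed
  have intg: "integrable lborel g"
  proof -
    have "integrable lebesgue g"
    proof (rule integrable_cong_AE_imp[OF sg[unfolded set_integrable_def]])
      show "g \<in> borel_measurable lebesgue" by (rule measurable_completion) measurable
      show "AE x in lebesgue. indicat_real V x *\<^sub>R g0 x = g x" using aeg by eventually_elim simp
    qed
    then show ?thesis by (simp add: integrable_completion)
  qed
  show ?thesis
  proof (rule that[OF L(1) u'(1) intg intf])
    show "0 \<le> f y" for y by (simp add: f_def)
    show "AE y in lebesgue. y \<in> V \<longrightarrow> u y = u' y"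
      using u'(2) by eventually_elim auto
    show "ennreal (t * norm (g y)) \<le> ennreal (f y) + young_conjugate A (L * t)" if "0 \<le> t" for y t
    proof -
      have "t * norm (g y) = (norm (g y) / L) * (L * t)" using L(1) by simp
      then show ?thesis unfolding fA using young_ineq[of "norm (g y) / L" "L * t" A] L(1) by (simp add: mult.commute)
    qed
    fix \<phi> :: "real^'n \<Rightarrow> real" and i assume \<phi>: "\<phi> \<in> test_functions V"
    obtain R where k\<phi>: "kernel R \<phi>" using test_function_kernel[OF \<phi>] .
    have [measurable]: "\<phi> \<in> borel_measurable borel" "partial_deriv i \<phi> \<in> borel_measurable borel"
      using kernel_continuous[OF k\<phi>] kernel_continuous[OF kernel_partial_deriv[OF k\<phi>]] borel_measurable_continuous_onI by auto
    have ml: "F \<in> borel_measurable lebesgue" if "F \<in> borel_measurable borel" for F :: "real^'n \<Rightarrow> real"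
      using that by (intro measurable_completion) simp
    have "\<phi> \<in> test_functions U" using \<phi> test_functions_mono[OF VU] by blast
    then have weak: "(LINT x:U|lebesgue. u x * partial_deriv i \<phi> x) = - (LINT x:U|lebesgue. g0 x $ i * \<phi> x)"
      using g0(1) by (simp add: has_weak_gradient_def)
    have "(LINT x:U|lebesgue. u x * partial_deriv i \<phi> x) = (\<integral>x. (indicator V x * u x) * partial_deriv i \<phi> x \<partial>lebesgue)"
      unfolding set_lebesgue_integral_def
      using VU test_function_zero_outside[OF \<phi>]
      by (intro Bochner_Integration.integral_cong refl) (auto split: split_indicator)
    also have "\<dots> = (\<integral>x. u' x * partial_deriv i \<phi> x \<partial>lebesgue)"
    proof (rule integral_cong_AE)
      show "(\<lambda>x. indicator V x * u x * partial_deriv i \<phi> x) \<in> borel_measurable lebesgue"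
        using su[unfolded set_integrable_def, THEN borel_measurable_integrable] ml[of "partial_deriv i \<phi>"] by auto
      show "(\<lambda>x. u' x * partial_deriv i \<phi> x) \<in> borel_measurable lebesgue" by (rule ml) measurable
      show "AE x in lebesgue. indicator V x * u x * partial_deriv i \<phi> x = u' x * partial_deriv i \<phi> x"
        using u'(2) by eventually_elim simp
    qed
    also have "\<dots> = (\<integral>x. u' x * partial_deriv i \<phi> x \<partial>lborel)" by (simp add: integral_completion)
    finally have e1: "(LINT x:U|lebesgue. u x * partial_deriv i \<phi> x) = (\<integral>x. u' x * partial_deriv i \<phi> x \<partial>lborel)" .
    have "(LINT x:U|lebesgue. g0 x $ i * \<phi> x) = (\<integral>x. (indicator V x * g0 x $ i) * \<phi> x \<partial>lebesgue)"
      unfolding set_lebesgue_integral_def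
      using VU test_function_zero_outside[OF \<phi>]
      by (intro Bochner_Integration.integral_cong refl) (auto split: split_indicator)
    also have "\<dots> = (\<integral>x. g x $ i * \<phi> x \<partial>lebesgue)"
    proof (rule integral_cong_AE)
      show "(\<lambda>x. indicator V x * g0 x $ i * \<phi> x) \<in> borel_measurable lebesgue"
        using sgi[unfolded set_integrable_def, THEN borel_measurable_integrable] ml[of \<phi>] by auto
      show "(\<lambda>x. g x $ i * \<phi> x) \<in> borel_measurable lebesgue" by (rule ml) measurable
      show "AE x in lebesgue. indicator V x * g0 x $ i * \<phi> x = g x $ i * \<phi> x"
        using aeg by eventually_elim simp
    qed
    also have "\<dots> = (\<integral>x. g x $ i * \<phi> x \<partial>lborel)" by (simp add: integral_completion)
    finally have e2: "(LINT x:U|lebesgue. g0 x $ i * \<phi> x) = (\<integral>x. g x $ i * \<phi> x \<partial>lborel)" .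
    show "(\<integral>y. u' y * partial_deriv i \<phi> y \<partial>lborel) = - (\<integral>y. g y $ i * \<phi> y \<partial>lborel)"
      using weak unfolding e1 e2 .
  qed
qed

text \<open>Expressed by essential bounds on cubes, which matches
  \<open>essential_osc_radius\<close> and depends only on the almost-everywhere class of
  \<open>u\<close>.\<close>

definition essential_osc_vanishes :: "(real^'n \<Rightarrow> real) \<Rightarrow> real^'n \<Rightarrow> bool" where
  "essential_osc_vanishes u x \<longleftrightarrow> (\<forall>\<omega>>0. \<exists>r>0. \<exists>a b. b - a < \<omega> \<and>
     (AE y in lebesgue. y \<in> cube x r \<longrightarrow> a \<le> u y \<and> u y \<le> b))"

text \<open>A point is good when the energy of balls around it is eventually at most a multiple of
  \<open>h\<close>. The others form a null set by the density lemma. At a good point a positive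
  essential oscillation would bound A_{n-1}(c/r) by boundary energies for almost every r, and the
  finite potential would dominate the divergent integral.\<close>

lemma local_continuity:
  fixes u :: "real^'n \<Rightarrow> real" and \<eta> h :: "real \<Rightarrow> real"
  assumes n: "2 \<le> CARD('n)" and A: "young_function A"
    and anti: "\<And>r s. 0 < r \<Longrightarrow> r \<le> s \<Longrightarrow> \<eta> s \<le> \<eta> r" and pos: "\<And>r. 0 < r \<Longrightarrow> 0 \<le> \<eta> r"
    and h0: "h 0 = 0" and h_nonneg: "\<And>t. 0 \<le> t \<Longrightarrow> 0 \<le> h t"
    and sum: "\<And>J. J0 \<le> J \<Longrightarrow> (\<Sum>l. ennreal (\<eta> ((1/2) ^ Suc (l + J)) - \<eta> ((1/2) ^ (l + J))) * ennreal (h ((1/2) ^ Suc (l + J)))) < \<infinity>"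
    and div: "\<And>c R. 0 < c \<Longrightarrow> 0 < R \<Longrightarrow> (\<integral>\<^sup>+r. young_conjugate (young_pre CARD('n) A) (c / r) *
        ennreal (r ^ (CARD('n) - 1) * \<eta> r) * indicator {0<..<R} r \<partial>lborel) = \<infinity>"
    and u: "u \<in> orlicz_sobolev_loc A \<Omega>" and wm: "weakly_monotone \<Omega> u"
    and \<rho>: "0 < \<rho>" "cball z (3 * \<rho>) \<subseteq> \<Omega>"
  shows "\<exists>N\<subseteq>ball z \<rho>. (\<forall>\<epsilon>>0. hausdorff_content h \<epsilon> N = 0) \<and> (\<forall>x\<in>ball z \<rho> - N. essential_osc_vanishes u x)"
proof -
  define U where "U = ball z (3 * \<rho>)"
  have "compactly_contained U \<Omega>"
    using \<rho> by (simp add: U_def compactly_contained_def)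
  then have uU: "u \<in> orlicz_sobolev A U" and um: "u \<in> borel_measurable (lebesgue_on \<Omega>)"
    using u by (auto simp: orlicz_sobolev_loc_def U_def)
  \<comment> \<open>The radii leave room twice: the representatives are formed on the ball of radius
    2 \<rho>, compactly inside \<open>U\<close>, and the approximants are used on the smaller ball
    \<open>W\<close>, where mollification does not leave that ball.\<close>
  have balls: "open U" "open (ball z (2 * \<rho>))" "compact (cball z (2 * \<rho>))" "ball z (2 * \<rho>) \<subseteq> cball z (2 * \<rho>)" "cball z (2 * \<rho>) \<subseteq> U"
    using \<rho> by (auto simp: U_def)
  obtain L u' g f where L: "0 < L" and u': "integrable lborel u'" and g: "integrable lborel g" and f: "integrable lborel f"
    and f0: "\<And>y. 0 \<le> f y" and eq: "AE y in lebesgue. y \<in> ball z (2 * \<rho>) \<longrightarrow> u y = u' y"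
    and weak: "\<And>\<phi> i. \<phi> \<in> test_functions (ball z (2 * \<rho>)) \<Longrightarrow>
      (\<integral>y. u' y * partial_deriv i \<phi> y \<partial>lborel) = - (\<integral>y. g y $ i * \<phi> y \<partial>lborel)"
    and young: "\<And>y t. 0 \<le> t \<Longrightarrow> ennreal (t * norm (g y)) \<le> ennreal (f y) + young_conjugate A (L * t)"
    by (rule orlicz_sobolev_representatives[OF A uU balls]) (rule that)
  define W where "W = cball z \<rho>"
  have W: "compact W" "W \<subseteq> ball z (2 * \<rho>)" "W \<in> sets borel" "W \<subseteq> \<Omega>"
    using \<rho> by (auto simp: W_def)
  obtain uk fk where uk: "\<And>k m. C_k m (uk k)" and fk: "\<And>k. continuous_on UNIV (fk k)"
    and uk_L1: "\<And>k. (\<integral>\<^sup>+x. ennreal \<bar>uk k x - u' x\<bar> \<partial>lborel) \<le> ennreal ((1/2) ^ k)"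
    and fk_L1: "\<And>k. (\<integral>\<^sup>+x. ennreal \<bar>fk k x - f x\<bar> \<partial>lborel) \<le> ennreal ((1/2) ^ k)"
    and gk_L1: "\<And>k. (\<integral>\<^sup>+x. ennreal (norm (gradient (uk k) x - g x)) * indicator W x \<partial>lborel) \<le> ennreal (real CARD('n) * (1/2) ^ k)"
    and youngk: "\<And>k x t. x \<in> W \<Longrightarrow> 0 \<le> t \<Longrightarrow> ennreal (t * norm (gradient (uk k) x)) \<le> ennreal (fk k x) + young_conjugate A (L * t)"
    by (rule smooth_approximation[OF u' g f f0 open_ball W(1,2), where a = "\<lambda>t. young_conjugate A (L * t)"])
      (rule weak, assumption, rule young, assumption, rule that)
  have [measurable]: "f \<in> borel_measurable borel" "u' \<in> borel_measurable borel"
    using f u' by (auto dest: borel_measurable_integrable)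
  have [measurable]: "fk k \<in> borel_measurable borel" for k by (rule borel_measurable_continuous_onI[OF fk])
  have [measurable]: "uk k \<in> borel_measurable borel" for k
    by (rule borel_measurable_continuous_onI[OF C_k_continuous[OF uk[of 0]]])
  have eqW: "AE y in lebesgue. y \<in> W \<longrightarrow> u y = u' y"
    using eq by eventually_elim (use W(2) in auto)
  define \<mu> where "\<mu> = density lborel (\<lambda>y. ennreal (f y))"
  have \<mu>: "emeasure \<mu> X = (\<integral>\<^sup>+y. ennreal (f y) * indicator X y \<partial>lborel)" if "X \<in> sets borel" for X
    unfolding \<mu>_def using that by (intro emeasure_density) auto
  have \<mu>fin: "emeasure \<mu> UNIV < \<infinity>"
  proof -
    have "(\<integral>\<^sup>+y. ennreal (f y) \<partial>lborel) \<le> (\<integral>\<^sup>+y. ennreal (norm (f y)) \<partial>lborel)"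
      by (intro nn_integral_mono ennreal_leI) simp
    also have "\<dots> < \<infinity>" using f by (simp add: integrable_iff_bounded)
    finally show ?thesis by (simp add: \<mu>)
  qed
  \<comment> \<open>The half scale inside \<open>h\<close> fits both uses: it is the diameter of the
    pieces in the covering lemma and the left end of the dyadic interval in the Stieltjes
    sum.\<close>
  define good where "good = (\<lambda>x. \<exists>C J. \<forall>l\<ge>J. emeasure \<mu> (cball x (real CARD('n) * (1/2) ^ l)) \<le> ennreal (C * h ((1/2) ^ Suc l)))"
  define N where "N = {x \<in> ball z \<rho>. \<not> good x}"
  have "hausdorff_content h \<epsilon> N = 0" if \<epsilon>: "0 < \<epsilon>" for \<epsilon>
  proof (rule hausdorff_content_eq_0_of_density[where \<mu> = \<mu> and a = "real CARD('n)"])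
    show "\<exists>j\<ge>J. ennreal (C * h ((1/2) ^ Suc j)) < emeasure \<mu> (cball x (real CARD('n) * (1/2) ^ j))"
      if "x \<in> N" for x C J
      using that unfolding N_def good_def by (auto simp: not_le)
  qed (use \<mu>fin h0 \<epsilon> in \<open>auto simp: \<mu>_def\<close>)
  moreover have "essential_osc_vanishes u x" if x: "x \<in> ball z \<rho> - N" for x
  proof (rule ccontr)
    assume "\<not> essential_osc_vanishes u x"
    then obtain \<omega> where \<omega>: "0 < \<omega>" "\<And>r a b. 0 < r \<Longrightarrow>
        (AE y in lebesgue. y \<in> cube x r \<longrightarrow> a \<le> u y \<and> u y \<le> b) \<Longrightarrow> \<omega> \<le> b - a"
      unfolding essential_osc_vanishes_def by (meson not_le)
    have "good x" using x by (auto simp: N_def)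
    then obtain C J1 where CJ: "\<And>l. J1 \<le> l \<Longrightarrow> emeasure \<mu> (cball x (real CARD('n) * (1/2) ^ l)) \<le> ennreal (C * h ((1/2) ^ Suc l))"
      unfolding good_def by blast
    define d where "d = \<rho> - dist z x"
    have d: "0 < d" using x by (simp add: d_def)
    obtain J2 where J2: "(1/2) ^ J2 < d / real CARD('n)"
      using real_arch_pow_inv[of "d / real CARD('n)" "1/2"] d by auto
    \<comment> \<open>Beyond J0 the Stieltjes sum is finite, beyond J1 the energy bound holds, and
      beyond J2 the cubes around \<open>x\<close> stay in \<open>W\<close>.\<close>
    define J where "J = max J0 (max J1 J2)"
    define R where "R = (1/2::real) ^ J"
    have R: "0 < R" "R < d / real CARD('n)"
    proof -
      have "(1/2::real) ^ J \<le> (1/2) ^ J2" by (intro power_decreasing) (auto simp: J_def)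
      then show "R < d / real CARD('n)" unfolding R_def using J2 by (rule le_less_trans)
      show "0 < R" by (simp add: R_def)
    qed
    have sub: "ccube x r \<subseteq> W" if "r < R" for r
    proof
      fix y assume y: "y \<in> ccube x r"
      have "norm (y - x) \<le> (\<Sum>j\<in>UNIV. \<bar>(y - x) $ j\<bar>)" by (rule norm_le_l1_cart)
      also have "\<dots> \<le> (\<Sum>j\<in>(UNIV::'n set). R)"
        using y that by (intro sum_mono) (auto simp: ccube_def intro: order_trans less_imp_le)
      finally have "norm (y - x) \<le> real CARD('n) * R" by simp
      also have "\<dots> \<le> d" using R(2) by (simp add: field_simps)
      finally have "dist x y \<le> d" by (simp add: dist_norm norm_minus_commute)
      then have "dist z y \<le> \<rho>" using dist_triangle[of z y x] by (simp add: d_def)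
      then show "y \<in> W" by (simp add: W_def)
    qed
    have sumk: "(\<Sum>k. \<integral>\<^sup>+y. F k y \<partial>(lborel :: (real^'n) measure)) < \<infinity>"
      if "\<And>k. (\<integral>\<^sup>+y. F k y \<partial>lborel) \<le> ennreal ((1/2) ^ k)" for F :: "nat \<Rightarrow> real^'n \<Rightarrow> ennreal"
    proof -
      have "(\<Sum>k. \<integral>\<^sup>+y. F k y \<partial>(lborel :: (real^'n) measure)) \<le> (\<Sum>k. ennreal ((1/2) ^ k))"
        using that by (intro suminf_le) auto
      also have "\<dots> = ennreal (\<Sum>k. (1/2) ^ k)"
        by (intro suminf_ennreal2 summable_geometric) auto
      finally show ?thesis by (simp add: le_less_trans)
    qed
    \<comment> \<open>Collects the constants of \<open>essential_osc_radius\<close>, so that its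
      left-hand side reads A_{n-1}(c/r).\<close>
    define c where "c = \<omega> / 8 / (3 * osc_const CARD('n) * L)"
    have c: "0 < c" using \<omega>(1) L by (simp add: c_def osc_const_def)
    have ae: "AE r in lborel. 0 < r \<and> r < R \<longrightarrow> young_conjugate (young_pre CARD('n) A) (c / r)
        \<le> ennreal (1 / (2 * r) ^ (CARD('n) - 1)) * bd_int (\<lambda>y. ennreal (f y)) x r"
    proof -
      have a1: "AE r in lborel. 0 < r \<and> r < R \<longrightarrow> (\<lambda>k. bd_int (\<lambda>y. ennreal \<bar>fk k y - f y\<bar>) x r) \<longlonglongrightarrow> 0"
        by (rule AE_bd_int_tendsto_0[OF _ sumk[OF fk_L1]]) measurable
      have a2: "AE r in lborel. 0 < r \<and> r < R \<longrightarrow> (\<lambda>k. bd_int (\<lambda>y. ennreal \<bar>uk k y - u' y\<bar>) x r) \<longlonglongrightarrow> 0"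
        by (rule AE_bd_int_tendsto_0[OF _ sumk[OF uk_L1]]) measurable
      have a3: "AE r in lborel. 0 < r \<and> r < R \<longrightarrow> bd_int (\<lambda>y. ennreal \<bar>u' y\<bar>) x r < \<infinity>"
        using u' by (intro AE_bd_int_finite) (auto simp: integrable_iff_bounded)
      show ?thesis
        using a1 a2 a3
      proof eventually_elim
        case (elim r)
        show ?case
        proof
          assume r: "0 < r \<and> r < R"
          have "young_conjugate (young_pre CARD('n) A) (\<omega> / 8 / (3 * osc_const CARD('n) * L * r))
            \<le> ennreal (1 / (2 * r) ^ (CARD('n) - 1)) * bd_int (\<lambda>y. ennreal (f y)) x r"
          proof (rule essential_osc_radius[OF n _ L sub W(4,3) u' g _ uk fk uk_L1 gk_L1 youngk um wm eqW])
            show "\<omega> \<le> b - a" if "AE y in lebesgue. y \<in> cube x r \<longrightarrow> a \<le> u y \<and> u y \<le> b" for a b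
              by (rule \<omega>(2)[OF _ that]) (use r in simp)
          qed (use r elim \<omega>(1) in auto)
          then show "young_conjugate (young_pre CARD('n) A) (c / r)
            \<le> ennreal (1 / (2 * r) ^ (CARD('n) - 1)) * bd_int (\<lambda>y. ennreal (f y)) x r"
            unfolding c_def divide_divide_eq_left by (simp only: mult.assoc)
        qed
      qed
    qed
    \<comment> \<open>Extending \<eta> by \<open>top\<close> to the left keeps it decreasing on the
      whole line, which yields Borel measurability.\<close>
    define \<eta>' where "\<eta>' = (\<lambda>r. if 0 < r then ennreal (\<eta> r) else top)"
    have [measurable]: "\<eta>' \<in> borel_measurable borel"
    proof -
      have "mono (\<lambda>r. \<eta>' (- r))"
      proof (rule monoI)
        fix r s :: real assume "r \<le> s"
        then show "\<eta>' (- r) \<le> \<eta>' (- s)"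
          using anti[of "- s" "- r"] by (auto simp: \<eta>'_def intro: ennreal_leI)
      qed
      then have "(\<lambda>r. \<eta>' (- r)) \<in> borel_measurable borel" by (rule borel_measurable_mono_ennreal)
      from measurable_compose[OF _ this, of uminus borel] show ?thesis by simp
    qed
    have fin: "(\<integral>\<^sup>+r. \<eta>' r * indicator {0<..<(1/2) ^ J} r * bd_int (\<lambda>y. ennreal (f y)) x r \<partial>lborel) < \<infinity>"
    proof (rule good_point_potential_finite[where \<eta> = \<eta> and h = h and C = "max C 0"])
      show "(\<Sum>l. ennreal (\<eta> ((1/2) ^ Suc (l + J)) - \<eta> ((1/2) ^ (l + J))) * ennreal (h ((1/2) ^ Suc (l + J)))) < \<infinity>"
        by (rule sum) (simp add: J_def)
      show "(\<integral>\<^sup>+y. ennreal (f y) * indicator (cball x (real CARD('n) * (1/2) ^ l)) y \<partial>lborel)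
         \<le> ennreal (max C 0) * ennreal (h ((1/2) ^ Suc l))" if "J \<le> l" for l
      proof -
        have hp: "0 \<le> h ((1/2) ^ Suc l)" by (rule h_nonneg) simp
        have "(\<integral>\<^sup>+y. ennreal (f y) * indicator (cball x (real CARD('n) * (1/2) ^ l)) y \<partial>lborel) \<le> ennreal (C * h ((1/2) ^ Suc l))"
          using CJ[of l] that by (simp add: J_def \<mu>)
        also have "\<dots> \<le> ennreal (max C 0 * h ((1/2) ^ Suc l))"
          using hp by (intro ennreal_leI mult_right_mono) auto
        also have "\<dots> = ennreal (max C 0) * ennreal (h ((1/2) ^ Suc l))"
          using hp by (intro ennreal_mult) auto
        finally show ?thesis .
      qed
      show "\<eta>' r = ennreal (\<eta> r)" if "0 < r" for r using that by (simp add: \<eta>'_def)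
    qed (use anti pos f in auto)
    have "(\<integral>\<^sup>+r. young_conjugate (young_pre CARD('n) A) (c / r) *
        ennreal (r ^ (CARD('n) - 1) * \<eta> r) * indicator {0<..<R} r \<partial>lborel)
      \<le> (\<integral>\<^sup>+r. \<eta>' r * indicator {0<..<(1/2) ^ J} r * bd_int (\<lambda>y. ennreal (f y)) x r \<partial>lborel)"
    proof (rule nn_integral_mono_AE)
      show "AE r in lborel. young_conjugate (young_pre CARD('n) A) (c / r) *
          ennreal (r ^ (CARD('n) - 1) * \<eta> r) * indicator {0<..<R} r
        \<le> \<eta>' r * indicator {0<..<(1/2) ^ J} r * bd_int (\<lambda>y. ennreal (f y)) x r"
        using ae
      proof eventually_elim
        case (elim r)
        show ?case
        proof (cases "0 < r \<and> r < R")
          case True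
          define k where "k = CARD('n) - 1"
          have r: "0 < r" and e: "0 \<le> \<eta> r" using True pos[of r] by auto
          have "young_conjugate (young_pre CARD('n) A) (c / r) * ennreal (r ^ k * \<eta> r)
             \<le> (ennreal (1 / (2 * r) ^ k) * bd_int (\<lambda>y. ennreal (f y)) x r) * ennreal (r ^ k * \<eta> r)"
            using elim True unfolding k_def by (intro mult_right_mono) auto
          also have "\<dots> = ennreal (1 / (2 * r) ^ k * (r ^ k * \<eta> r)) * bd_int (\<lambda>y. ennreal (f y)) x r"
            using r e by (subst ennreal_mult) (auto simp: mult_ac)
          also have "\<dots> \<le> ennreal (\<eta> r) * bd_int (\<lambda>y. ennreal (f y)) x r"
          proof (intro mult_right_mono ennreal_leI)
            \<comment> \<open>The area of the face cancels r^(n - 1) up to the harmless factor 2^(1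
              - n).\<close>
            have "1 / (2 * r) ^ k * (r ^ k * \<eta> r) = (1 / 2 ^ k) * \<eta> r"
              using r by (simp add: power_mult_distrib)
            also have "\<dots> \<le> 1 * \<eta> r" using e by (intro mult_right_mono) auto
            finally show "1 / (2 * r) ^ k * (r ^ k * \<eta> r) \<le> \<eta> r" by simp
          qed simp
          finally show ?thesis using True by (simp add: \<eta>'_def R_def k_def)
        next
          case False
          then show ?thesis by simp
        qed
      qed
    qed
    then show False using fin div[OF c R(1)] by simp
  qed
  ultimately show ?thesis by (intro exI[of _ N]) (auto simp: N_def)
qed

text \<open>
  The representative is the limit of the essential suprema of \<open>u\<close> over shrinking cubes.
\<close>

lemma continuous_representative:
  fixes u :: "real^'n \<Rightarrow> real"
  assumes \<Omega>: "open \<Omega>" and osc: "\<And>x. x \<in> \<Omega> - N \<Longrightarrow> essential_osc_vanishes u x"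
  shows "\<exists>v. (AE x in lebesgue_on \<Omega>. v x = u x) \<and> continuous_on (\<Omega> - N) v"
proof -
  define S where "S = (\<lambda>x. {b. \<exists>r>0. AE y in lebesgue. y \<in> cube x r \<longrightarrow> u y \<le> b})"
  define v where "v = (\<lambda>x. if x \<in> \<Omega> - N then Inf (S x) else u x)"
  \<comment> \<open>An essential lower bound on one cube and an essential upper bound on an
    overlapping one are compared on their intersection, which is open and nonempty, hence not
    negligible.\<close>
  have lower: "a \<le> b'" if r: "0 < r" and ae: "AE y in lebesgue. y \<in> cube x r \<longrightarrow> a \<le> u y"
    and x': "x' \<in> cube x r" and b': "b' \<in> S x'" for a b' r x x'
  proof (rule ccontr)
    assume lt: "\<not> a \<le> b'"
    obtain r' where r': "0 < r'" "AE y in lebesgue. y \<in> cube x' r' \<longrightarrow> u y \<le> b'"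
      using b' by (auto simp: S_def)
    have "open (cube x r \<inter> cube x' r')" by (intro open_Int open_cube)
    moreover have "x' \<in> cube x r \<inter> cube x' r'" using x' mem_cube_self[OF r'(1)] by blast
    ultimately have nn: "\<not> negligible (cube x r \<inter> cube x' r')" by (intro open_not_negligible) auto
    have "AE y in lebesgue. y \<notin> cube x r \<inter> cube x' r'"
      using ae r'(2) by eventually_elim (use lt in auto)
    then have "cube x r \<inter> cube x' r' \<in> null_sets lebesgue"
      using open_cube[of x r] open_cube[of x' r'] by (subst AE_iff_null_sets) auto
    then show False using nn by (simp add: negligible_iff_null_sets)
  qed
  have shrink: "\<exists>r'>0. cube x' r' \<subseteq> cube x r" if "x' \<in> cube x r" for x x' :: "real^'n" and r
  proof -
    define d where "d = Min (range (\<lambda>j. r - \<bar>x' $ j - x $ j\<bar>))"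
    have "0 < d" using that by (auto simp: d_def cube_def)
    moreover have "cube x' d \<subseteq> cube x r"
    proof
      fix y assume y: "y \<in> cube x' d"
      have "\<bar>y $ j - x $ j\<bar> < r" for j
      proof -
        have "d \<le> r - \<bar>x' $ j - x $ j\<bar>" by (simp add: d_def)
        moreover have "\<bar>y $ j - x' $ j\<bar> < d" using y by (simp add: cube_def)
        ultimately show ?thesis by linarith
      qed
      then show "y \<in> cube x r" by (simp add: cube_def)
    qed
    ultimately show ?thesis by blast
  qed
  have bounds: "a \<le> v x' \<and> v x' \<le> b"
    if r: "0 < r" and ae: "AE y in lebesgue. y \<in> cube x r \<longrightarrow> a \<le> u y \<and> u y \<le> b"
      and x': "x' \<in> cube x r" "x' \<in> \<Omega> - N" for a b r x x'
  proof -
    have aea: "AE y in lebesgue. y \<in> cube x r \<longrightarrow> a \<le> u y" using ae by eventually_elim auto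
    obtain r' where r': "0 < r'" "cube x' r' \<subseteq> cube x r" using shrink[OF x'(1)] by blast
    have "AE y in lebesgue. y \<in> cube x' r' \<longrightarrow> u y \<le> b" using ae by eventually_elim (use r' in auto)
    then have bS: "b \<in> S x'" using r'(1) by (auto simp: S_def)
    have low: "a \<le> b'" if "b' \<in> S x'" for b' by (rule lower[OF r aea x'(1) that])
    have "Inf (S x') \<le> b" using bS low by (intro cInf_lower bdd_belowI) auto
    moreover have "a \<le> Inf (S x')" using bS low by (intro cInf_greatest) auto
    ultimately show ?thesis using x'(2) by (simp add: v_def)
  qed
  have cont: "continuous_on (\<Omega> - N) v"
    unfolding continuous_on_iff
  proof (intro ballI allI impI)
    fix x and e :: real assume x: "x \<in> \<Omega> - N" and e: "0 < e"
    obtain r a b where r: "0 < r" "b - a < e" "AE y in lebesgue. y \<in> cube x r \<longrightarrow> a \<le> u y \<and> u y \<le> b"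
      using osc[OF x] e unfolding essential_osc_vanishes_def by blast
    show "\<exists>d>0. \<forall>x'\<in>\<Omega> - N. dist x' x < d \<longrightarrow> dist (v x') (v x) < e"
    proof (intro exI conjI ballI impI)
      fix x' assume x': "x' \<in> \<Omega> - N" "dist x' x < r"
      have "x' \<in> cube x r"
        using x'(2) component_le_norm_cart[of "x' - x"] by (auto simp: cube_def dist_norm intro: le_less_trans)
      then have "a \<le> v x' \<and> v x' \<le> b" using bounds[OF r(1,3) _ x'(1)] by blast
      moreover have "a \<le> v x \<and> v x \<le> b" using bounds[OF r(1,3) mem_cube_self[OF r(1)] x] .
      ultimately show "dist (v x') (v x) < e" using r(2) unfolding dist_real_def by linarith
    qed (rule r)
  qed
  \<comment> \<open>Pairs of a basic open set and a rational bound form a countable family. Off one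
    null set every essential bound from this family therefore holds pointwise, which gives v = u
    there without differentiating integrals.\<close>
  obtain \<B> :: "(real^'n) set set" where \<B>: "countable \<B>" "topological_basis \<B>"
    using ex_countable_basis by blast
  have c: "countable (\<B> \<times> \<rat> :: ((real^'n) set \<times> real) set)" using \<B>(1) countable_rat by blast
  have ae1: "AE y in lebesgue. \<forall>p\<in>\<B> \<times> \<rat>. (AE z in lebesgue. z \<in> fst p \<longrightarrow> u z \<le> snd p) \<longrightarrow> y \<in> fst p \<longrightarrow> u y \<le> snd p"
    unfolding AE_ball_countable[OF c]
  proof
    fix p :: "(real^'n) set \<times> real" assume "p \<in> \<B> \<times> \<rat>"
    show "AE y in lebesgue. (AE z in lebesgue. z \<in> fst p \<longrightarrow> u z \<le> snd p) \<longrightarrow> y \<in> fst p \<longrightarrow> u y \<le> snd p"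
      by (cases "AE z in lebesgue. z \<in> fst p \<longrightarrow> u z \<le> snd p") auto
  qed
  have ae2: "AE y in lebesgue. \<forall>p\<in>\<B> \<times> \<rat>. (AE z in lebesgue. z \<in> fst p \<longrightarrow> snd p \<le> u z) \<longrightarrow> y \<in> fst p \<longrightarrow> snd p \<le> u y"
    unfolding AE_ball_countable[OF c]
  proof
    fix p :: "(real^'n) set \<times> real" assume "p \<in> \<B> \<times> \<rat>"
    show "AE y in lebesgue. (AE z in lebesgue. z \<in> fst p \<longrightarrow> snd p \<le> u z) \<longrightarrow> y \<in> fst p \<longrightarrow> snd p \<le> u y"
      by (cases "AE z in lebesgue. z \<in> fst p \<longrightarrow> snd p \<le> u z") auto
  qed
  have "AE y in lebesgue. v y = u y"
    using ae1 ae2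
  proof eventually_elim
    case (elim y)
    show ?case
    proof (cases "y \<in> \<Omega> - N")
      case y: True
      have "\<not> v y < u y"
      proof
        assume "v y < u y"
        then obtain q where q: "q \<in> \<rat>" "v y < q" "q < u y" using Rats_dense_in_real by blast
        \<comment> \<open>A cube whose essential bounds differ by less than q - v y has its upper
          bound below q, so q is an essential upper bound on a basic neighbourhood of y.\<close>
        obtain r a b where r: "0 < r" "b - a < q - v y" "AE z in lebesgue. z \<in> cube y r \<longrightarrow> a \<le> u z \<and> u z \<le> b"
          using osc[OF y] q(2) unfolding essential_osc_vanishes_def by (meson diff_gt_0_iff_gt)
        have "a \<le> v y" using bounds[OF r(1,3) mem_cube_self[OF r(1)] y] by blast
        then have bq: "b \<le> q" using r(2) by linarith
        obtain B where B: "B \<in> \<B>" "y \<in> B" "B \<subseteq> cube y r"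
          using topological_basisE[OF \<B>(2) open_cube mem_cube_self[OF r(1)]] by blast
        have "AE z in lebesgue. z \<in> B \<longrightarrow> u z \<le> q" using r(3) by eventually_elim (use B bq in auto)
        then have "u y \<le> q" using elim(1) B q(1) by fastforce
        then show False using q by simp
      qed
      moreover have "\<not> u y < v y"
      proof
        assume "u y < v y"
        then obtain q where q: "q \<in> \<rat>" "u y < q" "q < v y" using Rats_dense_in_real by blast
        obtain r a b where r: "0 < r" "b - a < v y - q" "AE z in lebesgue. z \<in> cube y r \<longrightarrow> a \<le> u z \<and> u z \<le> b"
          using osc[OF y] q(3) unfolding essential_osc_vanishes_def by (meson diff_gt_0_iff_gt)
        have "v y \<le> b" using bounds[OF r(1,3) mem_cube_self[OF r(1)] y] by blast
        then have aq: "q \<le> a" using r(2) by linarith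
        obtain B where B: "B \<in> \<B>" "y \<in> B" "B \<subseteq> cube y r"
          using topological_basisE[OF \<B>(2) open_cube mem_cube_self[OF r(1)]] by blast
        have "AE z in lebesgue. z \<in> B \<longrightarrow> q \<le> u z" using r(3) by eventually_elim (use B aq in auto)
        then have "q \<le> u y" using elim(2) B q(1) by fastforce
        then show False using q by simp
      qed
      ultimately show ?thesis by simp
    next
      case False
      then show ?thesis unfolding v_def by (rule if_not_P)
    qed
  qed
  then have "AE x in lebesgue_on \<Omega>. v x = u x"
    using \<Omega> by (subst AE_restrict_space_iff) auto
  then show ?thesis using cont by blast
qed

section \<open>Countable unions of exceptional sets\<close>

lemma hausdorff_content_empty: "h 0 = 0 \<Longrightarrow> 0 \<le> \<epsilon> \<Longrightarrow> hausdorff_content h \<epsilon> {} = 0"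
  using hausdorff_content_le_countable[of "{} :: nat set" "{}" "\<lambda>_. {}" \<epsilon> h]
  by (simp add: nn_integral_count_space_finite)

lemma hausdorff_content_countable_UN_eq_0:
  assumes "countable I" "\<And>i. i \<in> I \<Longrightarrow> hausdorff_content h \<epsilon> (N i) = 0" "h 0 = 0" "0 \<le> \<epsilon>"
  shows "hausdorff_content h \<epsilon> (\<Union>i\<in>I. N i) = 0"
proof (cases "I = {}")
  case True
  then show ?thesis using assms by (simp add: hausdorff_content_empty)
next
  case False
  have "(\<Union>i\<in>I. N i) = (\<Union>m. N (from_nat_into I m))"
    using range_from_nat_into[OF False assms(1)] by (metis image_image)
  then show ?thesis
    using assms(2) from_nat_into[OF False] by (simp add: hausdorff_content_UN_eq_0)
qed

theorem theorem3p6: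
  fixes \<Omega> :: "(real^'n) set"
    and A :: "real \<Rightarrow> ennreal"
    and h \<sigma> \<Psi> :: "real \<Rightarrow> real"
  assumes n_ge_2: "CARD('n) \<ge> 2"
    and open_\<Omega>: "open \<Omega>"
    and young_A: "young_function A"
    and growth_A: "CARD('n) = 2 \<or> CARD('n) \<ge> 3 \<and>
      (\<forall>\<^sub>F T in at_top.
        (\<integral>\<^sup>+t\<in>{T..}. ennreal_powr (ennreal t / A t) (1 / (real CARD('n) - 2)) \<partial>lborel) < \<infinity>)"
    and finite_sub: "\<forall>t\<ge>0. young_sub CARD('n) A t < \<infinity>"
    and h_cont: "continuous_on {0..} h"
    and h_incr: "strict_mono_on {0..} h"
    and h_nonneg: "\<forall>t\<ge>0. h t \<ge> 0"
    and h_zero: "h 0 = 0"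
    and \<sigma>_cont: "continuous_on {0..} \<sigma>"
    and \<sigma>_nonneg: "\<forall>t\<ge>0. \<sigma> t \<ge> 0"
    and \<sigma>_div: "\<forall>c>0. \<forall>\<^sub>F T in at_top.
      (\<integral>\<^sup>+t\<in>{T..}. young_sub CARD('n) A (c * t) /
          (ennreal t * ennreal (\<sigma> t) * young_sub CARD('n) A t) \<partial>lborel) = \<infinity>"
    and \<Psi>_def: "\<forall>t\<ge>0. \<Psi> t = \<sigma> t * enn2real (young_sub CARD('n) A t)"
    and \<Psi>_pos: "\<forall>t>0. \<Psi> t > 0"
    and \<Psi>_mono: "mono_on {0<..} (\<lambda>t. t ^ CARD('n) * \<Psi> (1 / t))"
    and \<Psi>_decay: "((\<lambda>t. t ^ CARD('n) * \<Psi> (1 / t)) \<longlongrightarrow> 0) (at_right 0)"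
    and h_int: "\<forall>\<^sub>F \<delta> in at_right 0.
      (\<integral>\<^sup>+s\<in>{0<..<\<delta>}. ennreal (h s)
          \<partial>stieltjes_pos (\<lambda>s. - 1 / (s ^ CARD('n) * \<Psi> (1 / s)))) < \<infinity>"
  shows "\<forall>u. u \<in> orlicz_sobolev_loc A \<Omega> \<and> weakly_monotone \<Omega> u \<longrightarrow>
    (\<exists>v N. (AE x in lebesgue_on \<Omega>. v x = u x) \<and>
      N \<subseteq> \<Omega> \<and> hausdorff_measure h N = 0 \<and> continuous_on (\<Omega> - N) v)"
proof (intro allI impI, elim conjE)
  fix u :: "real^'n \<Rightarrow> real"
  assume u: "u \<in> orlicz_sobolev_loc A \<Omega>" and wm: "weakly_monotone \<Omega> u"
  define B where "B = young_pre CARD('n) A"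
  define D where "D = (\<lambda>t. enn2real (young_conjugate B t))"
  have sub_eq: "young_sub CARD('n) A t = young_conjugate B t" if "0 \<le> t" for t
    unfolding B_def using finite_sub that by (intro young_sub_eq_conjugate[OF young_A]) auto
  have B_eq: "young_conjugate B t = ennreal (D t)" if "0 \<le> t" for t
    using finite_sub[rule_format, OF that] unfolding sub_eq[OF that] by (simp add: D_def)
  have D0: "0 \<le> D t" for t by (simp add: D_def)
  have \<Psi>_eq: "\<Psi> t = \<sigma> t * D t" if "0 \<le> t" for t
    using \<Psi>_def that by (simp add: D_def sub_eq)
  have D_cont: "continuous_on {0<..} D"
    unfolding D_def
  proof (rule continuous_on_young_conjugate)
    show "young_conjugate B t < \<infinity>" if "0 < t" for t using B_eq[of t] that by simp
  qed
  have \<Psi>_cont: "continuous_on {0<..} \<Psi>"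
  proof -
    have "continuous_on {0<..} (\<lambda>t. \<sigma> t * D t)"
      by (intro continuous_on_mult D_cont continuous_on_subset[OF \<sigma>_cont]) auto
    then show ?thesis by (rule continuous_on_eq) (simp add: \<Psi>_eq)
  qed
  define \<eta> where "\<eta> = (\<lambda>r. 1 / (r ^ CARD('n) * \<Psi> (1 / r)))"
  have den_pos: "0 < r ^ CARD('n) * \<Psi> (1 / r)" if "0 < r" for r
    using that \<Psi>_pos by simp
  have anti: "\<eta> s \<le> \<eta> r" if "0 < r" "r \<le> s" for r s
    unfolding \<eta>_def using that den_pos[of r] den_pos[of s] mono_onD[OF \<Psi>_mono, of r s]
    by (intro divide_left_mono) auto
  have \<eta>_pos: "0 \<le> \<eta> r" if "0 < r" for r
    using den_pos[OF that] by (simp add: \<eta>_def)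
  have \<Phi>: "(\<lambda>s. - 1 / (s ^ CARD('n) * \<Psi> (1 / s))) = (\<lambda>s. - \<eta> s)"
    by (simp add: \<eta>_def)
  have \<eta>_cont: "continuous_on {0<..} \<eta>"
    unfolding \<eta>_def
  proof (intro continuous_intros continuous_on_compose2[OF \<Psi>_cont])
    show "\<forall>r\<in>{0<..}. r ^ CARD('n) * \<Psi> (1 / r) \<noteq> 0" using den_pos by (metis greaterThan_iff less_irrefl)
  qed auto
  \<comment> \<open>Together with monotonicity this gives the half-open intervals their Stieltjes
    mass, namely the increments of -\<eta>.\<close>
  have right: "continuous (at_right a) (\<lambda>s. - \<eta> s)" if "0 < a" for a
  proof -
    have "isCont \<eta> a" using \<eta>_cont that by (auto simp: continuous_on_eq_continuous_at)
    then have "isCont (\<lambda>s. - \<eta> s) a" by (rule continuous_minus)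
    then show ?thesis by (rule continuous_at_imp_continuous_at_within)
  qed
  have mono: "mono_on {0<..} (\<lambda>s. - \<eta> s)"
    by (rule mono_onI) (use anti in auto)
  have h_mono: "h s \<le> h t" if "0 \<le> s" "s \<le> t" for s t
    using strict_mono_onD[OF h_incr, of s t] that by (cases "s = t") auto
  obtain \<delta> where \<delta>: "0 < \<delta>" "(\<integral>\<^sup>+s\<in>{0<..<\<delta>}. ennreal (h s) \<partial>stieltjes_pos (\<lambda>s. - \<eta> s)) < \<infinity>"
  proof -
    obtain b where "0 < b" "\<And>y. 0 < y \<Longrightarrow> y < b \<Longrightarrow>
        (\<integral>\<^sup>+s\<in>{0<..<y}. ennreal (h s) \<partial>stieltjes_pos (\<lambda>s. - \<eta> s)) < \<infinity>"
      using h_int unfolding \<Phi> eventually_at_right_field by blast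
    then show ?thesis using that[of "b / 2"] by simp
  qed
  obtain J0 where J0: "(1/2) ^ J0 < \<delta>" using real_arch_pow_inv[OF \<delta>(1), of "1/2"] by auto
  have sum: "(\<Sum>l. ennreal (\<eta> ((1/2) ^ Suc (l + J)) - \<eta> ((1/2) ^ (l + J))) * ennreal (h ((1/2) ^ Suc (l + J)))) < \<infinity>"
    if "J0 \<le> J" for J
  proof -
    have "(1/2::real) ^ J \<le> (1/2) ^ J0" using that by (intro power_decreasing) auto
    then have "(1/2) ^ J < \<delta>" using J0 by (rule le_less_trans)
    from stieltjes_dyadic_sum_le[OF mono right h_mono this]
    have "(\<Sum>l. ennreal (- \<eta> ((1/2) ^ (l + J)) - - \<eta> ((1/2) ^ Suc (l + J))) * ennreal (h ((1/2) ^ Suc (l + J))))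
      \<le> (\<integral>\<^sup>+s\<in>{0<..<\<delta>}. ennreal (h s) \<partial>stieltjes_pos (\<lambda>s. - \<eta> s))" by simp
    moreover have "- \<eta> a - - \<eta> b = \<eta> b - \<eta> a" for a b by simp
    ultimately show ?thesis using \<delta>(2) by (simp only: le_less_trans)
  qed
  have div: "(\<integral>\<^sup>+r. young_conjugate (young_pre CARD('n) A) (c / r) *
      ennreal (r ^ (CARD('n) - 1) * \<eta> r) * indicator {0<..<R} r \<partial>lborel) = \<infinity>" if c: "0 < c" and R: "0 < R" for c R
  proof -
    \<comment> \<open>The integrand of the divergence condition. With t = 1/r it becomes
      A_{n-1}(c/r) r^(n - 1) \<eta>(r), because r^(n - 1) \<eta>(r) = 1 / (r \<Psi>(1/r)).\<close>
    define F where "F = (\<lambda>t. D (c * t) / (t * \<Psi> t))"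
    \<comment> \<open>Taking T beyond 1/R places the substituted range inside (0, R); the divergence
      holds from arbitrarily large T on.\<close>
    have "\<forall>\<^sub>F T in at_top. T > max 1 (1 / R) \<and> (\<integral>\<^sup>+t\<in>{T..}. young_sub CARD('n) A (c * t) /
          (ennreal t * ennreal (\<sigma> t) * young_sub CARD('n) A t) \<partial>lborel) = \<infinity>"
      using \<sigma>_div c by (intro eventually_conj eventually_gt_at_top) auto
    then obtain T where T: "T > max 1 (1 / R)" and inf: "(\<integral>\<^sup>+t\<in>{T..}. young_sub CARD('n) A (c * t) /
          (ennreal t * ennreal (\<sigma> t) * young_sub CARD('n) A t) \<partial>lborel) = \<infinity>"
      by (auto dest!: eventually_happens)
    have T0: "0 < T" "1 / T < R" using T R by (auto simp: field_simps)
    have "(\<integral>\<^sup>+t\<in>{T..}. ennreal (F t) \<partial>lborel) = (\<integral>\<^sup>+t\<in>{T..}. young_sub CARD('n) A (c * t) /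
          (ennreal t * ennreal (\<sigma> t) * young_sub CARD('n) A t) \<partial>lborel)"
    proof (intro nn_integral_cong)
      fix t
      show "ennreal (F t) * indicator {T..} t = young_sub CARD('n) A (c * t) /
          (ennreal t * ennreal (\<sigma> t) * young_sub CARD('n) A t) * indicator {T..} t"
      proof (cases "T \<le> t")
        case True
        then have t: "0 < t" using T0 by simp
        have p: "0 < t * \<Psi> t" using t \<Psi>_pos by simp
        have "ennreal t * ennreal (\<sigma> t) * young_sub CARD('n) A t = ennreal (t * \<Psi> t)"
          using t \<sigma>_nonneg D0 by (simp add: sub_eq B_eq \<Psi>_eq ennreal_mult[symmetric] mult.assoc)
        moreover have "young_sub CARD('n) A (c * t) = ennreal (D (c * t))"
          using t c by (simp add: sub_eq B_eq)
        ultimately show ?thesis using True p D0 by (simp add: F_def divide_ennreal)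
      qed simp
    qed
    then have "(\<integral>\<^sup>+t\<in>{T..}. ennreal (F t) \<partial>lborel) = \<infinity>" using inf by simp
    moreover have "continuous_on {0<..} F"
      unfolding F_def
    proof (rule continuous_on_divide)
      show "continuous_on {0<..} (\<lambda>t. D (c * t))"
        by (rule continuous_on_compose2[OF D_cont]) (use c in \<open>auto intro!: continuous_intros\<close>)
      show "continuous_on {0<..} (\<lambda>t. t * \<Psi> t)" by (intro continuous_on_mult continuous_on_id \<Psi>_cont)
      show "\<forall>t\<in>{0<..}. t * \<Psi> t \<noteq> 0" using \<Psi>_pos by fastforce
    qed
    ultimately have "(\<integral>\<^sup>+r. ennreal (F (1 / r) * (1 / r\<^sup>2)) * indicator {0<..<R} r \<partial>lborel) = \<infinity>"
      using T0 by (intro nn_integral_inverse_substitution)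
    moreover have "(\<integral>\<^sup>+r. ennreal (F (1 / r) * (1 / r\<^sup>2)) * indicator {0<..<R} r \<partial>lborel)
       = (\<integral>\<^sup>+r. young_conjugate (young_pre CARD('n) A) (c / r) *
      ennreal (r ^ (CARD('n) - 1) * \<eta> r) * indicator {0<..<R} r \<partial>lborel)"
    proof (intro nn_integral_cong)
      fix r
      show "ennreal (F (1 / r) * (1 / r\<^sup>2)) * indicator {0<..<R} r = young_conjugate (young_pre CARD('n) A) (c / r) *
        ennreal (r ^ (CARD('n) - 1) * \<eta> r) * indicator {0<..<R} r"
      proof (cases "r \<in> {0<..<R}")
        case True
        then have r: "0 < r" by simp
        obtain m where m: "CARD('n) = Suc m" using n_ge_2 by (cases "CARD('n)") auto
        have "F (1 / r) * (1 / r\<^sup>2) = D (c / r) * (r ^ m * \<eta> r)"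
          using r \<Psi>_pos by (simp add: F_def \<eta>_def m power2_eq_square field_simps)
        moreover have "ennreal (D (c / r) * (r ^ m * \<eta> r)) = young_conjugate B (c / r) * ennreal (r ^ m * \<eta> r)"
          using r c D0 \<eta>_pos[OF r] by (simp add: B_eq ennreal_mult)
        ultimately show ?thesis by (simp add: m B_def)
      qed simp
    qed
    ultimately show ?thesis by simp
  qed
  have "\<exists>\<rho>>0. cball z (3 * \<rho>) \<subseteq> \<Omega>" if z: "z \<in> \<Omega>" for z
  proof -
    obtain e where "0 < e" "cball z e \<subseteq> \<Omega>" using open_\<Omega> z by (meson open_contains_cball)
    then show ?thesis by (intro exI[of _ "e / 3"]) simp
  qed
  then obtain \<rho> where \<rho>: "\<And>z. z \<in> \<Omega> \<Longrightarrow> 0 < \<rho> z" "\<And>z. z \<in> \<Omega> \<Longrightarrow> cball z (3 * \<rho> z) \<subseteq> \<Omega>"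
    by metis
  have "\<exists>N\<subseteq>ball z (\<rho> z). (\<forall>\<epsilon>>0. hausdorff_content h \<epsilon> N = 0) \<and> (\<forall>x\<in>ball z (\<rho> z) - N. essential_osc_vanishes u x)"
    if "z \<in> \<Omega>" for z
    using h_nonneg
    by (intro local_continuity[OF n_ge_2 young_A anti \<eta>_pos h_zero _ sum div u wm \<rho>(1)[OF that] \<rho>(2)[OF that]]) auto
  then obtain Nz where Nz: "\<And>z. z \<in> \<Omega> \<Longrightarrow> Nz z \<subseteq> ball z (\<rho> z)"
      "\<And>z \<epsilon>. z \<in> \<Omega> \<Longrightarrow> 0 < \<epsilon> \<Longrightarrow> hausdorff_content h \<epsilon> (Nz z) = 0"
      "\<And>z x. z \<in> \<Omega> \<Longrightarrow> x \<in> ball z (\<rho> z) - Nz z \<Longrightarrow> essential_osc_vanishes u x"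
    by metis
  \<comment> \<open>The local statement holds near each point of \<Omega> with its own exceptional
    set. A countable subcover keeps the union of these sets null at every scale.\<close>
  obtain \<F> where \<F>: "\<F> \<subseteq> (\<lambda>z. ball z (\<rho> z)) ` \<Omega>" "countable \<F>" "\<Union>\<F> = (\<Union>z\<in>\<Omega>. ball z (\<rho> z))"
    using Lindelof[of "(\<lambda>z. ball z (\<rho> z)) ` \<Omega>"] by auto
  obtain I where I: "I \<subseteq> \<Omega>" "countable I" "\<F> = (\<lambda>z. ball z (\<rho> z)) ` I"
    using countable_subset_image[of \<F> "\<lambda>z. ball z (\<rho> z)" \<Omega>] \<F> by metis
  have cover: "\<exists>z\<in>I. x \<in> ball z (\<rho> z)" if "x \<in> \<Omega>" for x
  proof -
    have "x \<in> ball x (\<rho> x)" using \<rho>(1)[OF that] by simp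
    then have "x \<in> \<Union>\<F>" unfolding \<F>(3) using that by blast
    then show ?thesis using I(3) by auto
  qed
  define N where "N = (\<Union>z\<in>I. Nz z)"
  have "N \<subseteq> \<Omega>"
  proof -
    have "ball z (\<rho> z) \<subseteq> \<Omega>" if "z \<in> \<Omega>" for z
    proof -
      have "ball z (\<rho> z) \<subseteq> cball z (3 * \<rho> z)" using \<rho>(1)[OF that] by (intro subsetI) simp
      then show ?thesis using \<rho>(2)[OF that] by blast
    qed
    then show ?thesis using Nz(1) I(1) unfolding N_def by blast
  qed
  moreover have "hausdorff_measure h N = 0"
    unfolding N_def using I(1,2) Nz(2) h_zero
    by (intro hausdorff_measure_eq_0I hausdorff_content_countable_UN_eq_0) auto
  moreover have "essential_osc_vanishes u x" if x: "x \<in> \<Omega> - N" for x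
  proof -
    obtain z where z: "z \<in> I" "x \<in> ball z (\<rho> z)" using cover x by blast
    then have "x \<in> ball z (\<rho> z) - Nz z" using x by (auto simp: N_def)
    then show ?thesis using Nz(3) z(1) I(1) by blast
  qed
  ultimately show "\<exists>v N. (AE x in lebesgue_on \<Omega>. v x = u x) \<and>
      N \<subseteq> \<Omega> \<and> hausdorff_measure h N = 0 \<and> continuous_on (\<Omega> - N) v"
    using continuous_representative[OF open_\<Omega>, of N u] by blast
qed

end
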